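(* Let $\lambda\in[0,\frac12)$ and let $\pi_\lambda$ be the product Bernoulli measure with density $\lambda$ on $\{0,1\}^{\mathbb Z}$ (which concentrates on $\mathcal X$). Let $\hat\pi_\lambda:=\mathrm{Palm}(\pi_\lambda)$ and let $\eta$ be distributed according to $\hat\pi_\lambda$. Define $\alpha=(\alpha_k)_{k\ge1}$ by $\alpha_k:=(\lambda(1-\lambda))^k$. Then $\alpha\in\mathcal A^+$; the random excursions $(\varepsilon^{(i)}[\eta])_{i\in\mathbb Z}$ are i.i.d. with distribution $\nu_\alpha$; the soliton components $(D_k\eta)_{k\ge1}$ are mutually independent; and for each $k\ge 1$ the $k$-soliton component $(D_k\eta(j))_{j\in\mathbb Z}$ is a sequence of i.i.d. Geometric$(1-q_k(\alpha))$ random variables. As a consequence, the measure $\pi_\lambda$ is $T$-invariant.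
   Context: Conventions: $0^0=1$. $Y$ is Geometric$(p)$, $p\in(0,1]$, if $P(Y=j)=p(1-p)^j$ for $j\ge0$. Excursions. An excursion is a finite integer sequence $\varepsilon=(\varepsilon(0),\dots,\varepsilon(2n))$, $n=n(\varepsilon)\ge0$, with $\varepsilon(0)=\varepsilon(2n)=0$, $\varepsilon(z)\ge0$ for $0\le z\le 2n$ and $|\varepsilon(z)-\varepsilon(z-1)|=1$ ($n=0$: empty excursion). $\mathcal E$ is the set of all excursions. The ball configuration of $\varepsilon$ has value $(\varepsilon(z)-\varepsilon(z-1)+1)/2$ at $z$ for $1\le z\le 2n$ and $0$ for all other $z\in\mathbb Z$. Solitons (Takahashi-Satsuma algorithm). A run of a configuration is a maximal (possibly infinite) interval of consecutive boxes on which the configuration is constant. Starting from the ball configuration of $\varepsilon$, as long as there are finite runs: let $k$ be the smallest size of a run, take the leftmost run of size $k$, and declare the $k$ boxes of this run together with the first $k$ boxes of the next run to be a $k$-soliton; then delete (ignore) these $2k$ boxes, recompute the runs, and repeat. A $k$-soliton $\gamma$ consists of $k$ occupied boxes $h_0(\gamma)<\dots<h_{k-1}(\gamma)$ and $k$ empty boxes $t_0(\gamma)<\dots<t_{k-1}(\gamma)$; its support is the set of these $2k$ boxes. $n_k(\varepsilon)$ is the number of $k$-solitons of $\varepsilon$. Box $z$ is a $k$-slot of $\varepsilon$ if $z=0$ or $z\in\{h_i(\gamma),t_i(\gamma)\}$ for some $i\ge k$ and some $m$-soliton $\gamma$ of $\varepsilon$ with $m>k$. Measures on excursions and parameters. For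 $\alpha=(\alpha_k)_{k\ge1}$ with $\alpha_k\in[0,1)$ let $Z_\alpha:=\sum_{\varepsilon\in\mathcal E}\prod_{k\ge1}\alpha_k^{n_k(\varepsilon)}$, $\mathcal A:=\{\alpha:Z_\alpha<\infty\}$. For $\alpha\in\mathcal A$ let $\nu_\alpha(\varepsilon):=Z_\alpha^{-1}\prod_{k\ge1}\alpha_k^{n_k(\varepsilon)}$, $\rho_k(\alpha):=\sum_\varepsilon n_k(\varepsilon)\nu_\alpha(\varepsilon)$, and $\mathcal A^+:=\{\alpha\in\mathcal A:\sum_k2k\rho_k(\alpha)<\infty\}$. For $\alpha\in\mathcal A$, $q(\alpha)$ is given by $q_1=\alpha_1$, $q_k=\alpha_k/\prod_{j=1}^{k-1}(1-q_j)^{2(k-j)}$ for $k\ge2$; one has $q_k(\alpha)\in[0,1)$. Configurations and records. For $\eta\in\{0,1\}^{\mathbb Z}$ let $\xi=W\eta$ be the walk with $\xi(0)=0$, $\xi(z)-\xi(z-1)=2\eta(z)-1$. $z$ is a record of $\eta$ if $\xi(z)<\xi(z')$ for all $z'<z$; $R\eta$ is the set of records and $r(\eta,i):=\min\{z:\xi(z)=-i\}$. $\mathcal X_\lambda$ is the set of $\eta$ with $\lim_{y\to\infty}\frac1y\sum_{z=-y}^0\eta(z)=\lim_{y\to\infty}\frac1y\sum_{z=0}^y\eta(z)=\lambda$; $\mathcal X:=\bigcup_{0\le\lambda<1/2}\mathcal X_\lambda$; $\hat{\mathcal X}:=\{\eta\in\mathcal X:0\in R\eta\}$. For $\eta\in\hat{\mathcal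 X}$ all $r(\eta,i)$, $i\in\mathbb Z$, are finite, $r(\eta,0)=0$, and excursion $i$ is $\varepsilon^{(i)}[\eta]$, with $n=(r(\eta,i+1)-r(\eta,i)-1)/2$ and $\varepsilon^{(i)}(z)=\xi(r(\eta,i)+z)-\xi(r(\eta,i))$, $0\le z\le 2n$. Soliton components. For $\eta\in\hat{\mathcal X}$, the $k$-solitons and $k$-slots of $\eta$ are those of the excursions $\varepsilon^{(i)}[\eta]$ translated by $r(\eta,i)$, $i\in\mathbb Z$. Enumerate the $k$-slots increasingly by $j\in\mathbb Z$, $\mathtt s_k(\eta,j)$, with $\mathtt s_k(\eta,0)=0$. A $k$-soliton is appended to $k$-slot $j$ if its support is contained in the open interval $(\mathtt s_k(\eta,j),\mathtt s_k(\eta,j+1))$. $D_k\eta(j)$ is the number of $k$-solitons of $\eta$ appended to $k$-slot $j$; $D_k\eta=(D_k\eta(j))_{j\in\mathbb Z}$ is the $k$-component. Palm measure. For a translation invariant probability $\mu$ on $\mathcal X$ with $\lambda=\int\eta(0)\mu(d\eta)$ (the density of records is $1-2\lambda$), $\mathrm{Palm}(\mu)$ is the measure $\mu$ conditioned to have a record at $0$: $\int f\,d\,\mathrm{Palm}(\mu)=\frac1{1-2\lambda}\int\mathbf 1\{0\in R\eta\}f(\eta)\mu(d\eta)$. Dynamics (Box-Ball System). $T:\mathcal X\to\mathcal X$, $T\eta(z):=(1-\eta(z))\mathbf 1\{z\notin R\eta\}$. $\mu$ is $T$-invariant if $\mu\circ T^{-1}=\mu$. *)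

theory Defs
  imports "HOL-Probability.Probability"
begin

text \<open>\<open>\<eta> z\<close> means that box \<open>z\<close> is occupied, i.e. the value 1 in \<open>{0,1}\<close>.\<close>

type_synonym config = "int \<Rightarrow> bool"

text \<open>One of the two sums is always empty; the two lemmas below are the defining recursion.\<close>

definition walk :: "config \<Rightarrow> int \<Rightarrow> int" where
  "walk \<eta> z = (\<Sum>y\<in>{0<..z}. 2 * of_bool (\<eta> y) - 1) - (\<Sum>y\<in>{z<..0}. 2 * of_bool (\<eta> y) - 1)"

lemma walk_0: "walk \<eta> 0 = 0"
  by (simp add: walk_def)

lemma walk_step: "walk \<eta> z - walk \<eta> (z - 1) = 2 * of_bool (\<eta> z) - 1"
proof (cases "z \<ge> 1")
  case True
  then have "{0<..z} = insert z {0<..z - 1}" "{z<..0} = {}" "{z - 1<..0} = {}" by auto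
  then show ?thesis by (simp add: walk_def)
next
  case False
  then have "{z - 1<..0} = insert z {z<..0}" "{0<..z} = {}" "{0<..z - 1} = {}" by auto
  then show ?thesis by (simp add: walk_def)
qed

definition records :: "config \<Rightarrow> int set" where
  "records \<eta> = {z. \<forall>z'<z. walk \<eta> z < walk \<eta> z'}"

definition rec_pos :: "config \<Rightarrow> int \<Rightarrow> int" where
  "rec_pos \<eta> i = (LEAST z. walk \<eta> z = - i)"

definition density_configs :: "real \<Rightarrow> config set" where
  "density_configs lam = {\<eta>.
     (\<lambda>y::nat. (\<Sum>z\<in>{- int y..0}. of_bool (\<eta> z)) / real y) \<longlonglongrightarrow> lam \<and>
     (\<lambda>y::nat. (\<Sum>z\<in>{0..int y}. of_bool (\<eta> z)) / real y) \<longlonglongrightarrow> lam}"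

definition good_configs :: "config set" where
  "good_configs = (\<Union>lam\<in>{0..<1/2}. density_configs lam)"

definition bbs :: "config \<Rightarrow> config" where
  "bbs \<eta> z \<longleftrightarrow> \<not> \<eta> z \<and> z \<notin> records \<eta>"

text \<open>The excursion \<open>(\<epsilon>(0), \<dots>, \<epsilon>(2n))\<close> is the list with these \<open>2n + 1\<close> entries.\<close>

definition excursions :: "int list set" where
  "excursions = {e. \<exists>n. length e = 2 * n + 1 \<and> e ! 0 = 0 \<and> e ! (2 * n) = 0 \<and>
      (\<forall>z\<le>2 * n. 0 \<le> e ! z) \<and> (\<forall>z\<in>{1..2 * n}. \<bar>e ! z - e ! (z - 1)\<bar> = 1)}"

definition ball_config :: "int list \<Rightarrow> config" where
  "ball_config e z \<longleftrightarrow>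
     1 \<le> z \<and> z < int (length e) \<and> (e ! nat z - e ! nat (z - 1) + 1) div 2 = 1"

text \<open>Excursion \<open>i\<close> of \<open>\<eta>\<close>. When some \<open>rec_pos\<close> does not exist the value is a meaningless
  list, possibly outside \<^const>\<open>excursions\<close>; this does not happen for \<open>\<eta>\<close> in
  \<^const>\<open>good_configs\<close> with a record at 0.\<close>

definition excursion :: "config \<Rightarrow> int \<Rightarrow> int list" where
  "excursion \<eta> i =
     (let a = rec_pos \<eta> i; n = (rec_pos \<eta> (i + 1) - a - 1) div 2
      in map (\<lambda>z. walk \<eta> (a + z) - walk \<eta> a) [0..2 * n])"

text \<open>In what follows \<open>A\<close> is the set of boxes that have not been deleted yet; boxes are
  consecutive if no box of \<open>A\<close> lies between them.\<close>

definition consecutive_in :: "int set \<Rightarrow> int set \<Rightarrow> bool" where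
  "consecutive_in A I \<longleftrightarrow> I \<subseteq> A \<and> (\<forall>x\<in>I. \<forall>y\<in>I. \<forall>z\<in>A. x \<le> z \<and> z \<le> y \<longrightarrow> z \<in> I)"

definition runs :: "config \<Rightarrow> int set \<Rightarrow> int set set" where
  "runs \<eta> A = {I. I \<noteq> {} \<and> consecutive_in A I \<and> \<eta> constant_on I \<and>
      (\<forall>J. I \<subseteq> J \<and> consecutive_in A J \<and> \<eta> constant_on J \<longrightarrow> J = I)}"

definition next_run :: "config \<Rightarrow> int set \<Rightarrow> int set \<Rightarrow> int set \<Rightarrow> bool" where
  "next_run \<eta> A I J \<longleftrightarrow> I \<in> runs \<eta> A \<and> J \<in> runs \<eta> A \<and>
     (\<forall>x\<in>I. \<forall>y\<in>J. x < y) \<and> consecutive_in A (I \<union> J)"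

text \<open>\<open>ts_picks \<eta> A k \<gamma>\<close>: with boxes \<open>A\<close> remaining, the algorithm declares \<open>\<gamma>\<close> to be a
  \<open>k\<close>-soliton. It holds for no \<open>k\<close>, \<open>\<gamma>\<close> if there is no finite run.\<close>

definition ts_picks :: "config \<Rightarrow> int set \<Rightarrow> nat \<Rightarrow> int set \<Rightarrow> bool" where
  "ts_picks \<eta> A k \<gamma> \<longleftrightarrow> (\<exists>I J. I \<in> runs \<eta> A \<and> finite I \<and> card I = k \<and>
     (\<forall>I'\<in>runs \<eta> A. finite I' \<longrightarrow> k \<le> card I') \<and>
     (\<forall>I'\<in>runs \<eta> A. finite I' \<and> card I' = k \<longrightarrow> Min I \<le> Min I') \<and>
     next_run \<eta> A I J \<and>
     \<gamma> = I \<union> {y \<in> J. card {x \<in> J. x < y} < k})"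

inductive ts_reach :: "config \<Rightarrow> int set \<Rightarrow> bool" for \<eta> :: config where
  start: "ts_reach \<eta> UNIV"
| step: "ts_reach \<eta> A \<Longrightarrow> ts_picks \<eta> A k \<gamma> \<Longrightarrow> ts_reach \<eta> (A - \<gamma>)"

text \<open>A soliton is represented by its support.\<close>

definition exc_solitons :: "int list \<Rightarrow> nat \<Rightarrow> int set set" where
  "exc_solitons e k =
     {\<gamma>. \<exists>A. ts_reach (ball_config e) A \<and> ts_picks (ball_config e) A k \<gamma>}"

definition num_solitons :: "nat \<Rightarrow> int list \<Rightarrow> nat" where
  "num_solitons k e = card (exc_solitons e k)"

definition head :: "config \<Rightarrow> int set \<Rightarrow> nat \<Rightarrow> int" where
  "head \<eta> \<gamma> i = sorted_list_of_set {z \<in> \<gamma>. \<eta> z} ! i"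

definition tail :: "config \<Rightarrow> int set \<Rightarrow> nat \<Rightarrow> int" where
  "tail \<eta> \<gamma> i = sorted_list_of_set {z \<in> \<gamma>. \<not> \<eta> z} ! i"

definition exc_slots :: "int list \<Rightarrow> nat \<Rightarrow> int set" where
  "exc_slots e k = insert 0
     {z. \<exists>m \<gamma> i. k < m \<and> \<gamma> \<in> exc_solitons e m \<and> k \<le> i \<and> i < m \<and>
        (z = head (ball_config e) \<gamma> i \<or> z = tail (ball_config e) \<gamma> i)}"

definition solitons :: "config \<Rightarrow> nat \<Rightarrow> int set set" where
  "solitons \<eta> k = (\<Union>i. (\<lambda>\<gamma>. (+) (rec_pos \<eta> i) ` \<gamma>) ` exc_solitons (excursion \<eta> i) k)"

definition slots :: "config \<Rightarrow> nat \<Rightarrow> int set" where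
  "slots \<eta> k = (\<Union>i. (+) (rec_pos \<eta> i) ` exc_slots (excursion \<eta> i) k)"

definition slot_pos :: "config \<Rightarrow> nat \<Rightarrow> int \<Rightarrow> int" where
  "slot_pos \<eta> k = (THE s. strict_mono s \<and> range s = slots \<eta> k \<and> s 0 = 0)"

definition component :: "nat \<Rightarrow> config \<Rightarrow> int \<Rightarrow> nat" where
  "component k \<eta> j =
     card {\<gamma> \<in> solitons \<eta> k. \<gamma> \<subseteq> {slot_pos \<eta> k j<..<slot_pos \<eta> k (j + 1)}}"

text \<open>Parameters are sequences \<open>\<alpha> k\<close>, \<open>k \<ge> 1\<close>; the value at index 0 is never used.\<close>

definition weight :: "(nat \<Rightarrow> real) \<Rightarrow> int list \<Rightarrow> real" where
  "weight \<alpha> e = (\<Prod>k. \<alpha> (Suc k) ^ num_solitons (Suc k) e)"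

definition Z :: "(nat \<Rightarrow> real) \<Rightarrow> ennreal" where
  "Z \<alpha> = (\<Sum>\<^sub>\<infinity>e\<in>excursions. ennreal (weight \<alpha> e))"

definition params :: "(nat \<Rightarrow> real) set" where
  "params = {\<alpha>. (\<forall>k\<ge>1. 0 \<le> \<alpha> k \<and> \<alpha> k < 1) \<and> Z \<alpha> < \<infinity>}"

definition nu :: "(nat \<Rightarrow> real) \<Rightarrow> int list \<Rightarrow> ennreal" where
  "nu \<alpha> e = (if e \<in> excursions then ennreal (weight \<alpha> e) / Z \<alpha> else 0)"

definition exc_law :: "(nat \<Rightarrow> real) \<Rightarrow> int list measure" where
  "exc_law \<alpha> = point_measure UNIV (nu \<alpha>)"

definition rho :: "nat \<Rightarrow> (nat \<Rightarrow> real) \<Rightarrow> ennreal" where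
  "rho k \<alpha> = (\<Sum>\<^sub>\<infinity>e\<in>excursions. of_nat (num_solitons k e) * nu \<alpha> e)"

definition params_plus :: "(nat \<Rightarrow> real) set" where
  "params_plus = {\<alpha> \<in> params. (\<Sum>k. of_nat (2 * Suc k) * rho (Suc k) \<alpha>) < \<infinity>}"

fun q :: "(nat \<Rightarrow> real) \<Rightarrow> nat \<Rightarrow> real" where
  "q \<alpha> k = \<alpha> k / (\<Prod>j\<in>{1..<k}. (1 - q \<alpha> j) ^ (2 * (k - j)))"

declare q.simps [simp del]

definition bernoulli_config :: "real \<Rightarrow> config measure" where
  "bernoulli_config lam = Pi\<^sub>M UNIV (\<lambda>_. measure_pmf (bernoulli_pmf lam))"

text \<open>For translation invariant \<open>\<mu>\<close> with ball density below 1/2, the density of records is 1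
  minus twice the ball density, so this is \<open>\<mu>\<close> conditioned on a record at 0.\<close>

definition palm :: "config measure \<Rightarrow> config measure" where
  "palm \<mu> = density \<mu> (\<lambda>\<eta>. ennreal
     (indicator {\<eta>. 0 \<in> records \<eta>} \<eta> / (1 - 2 * (\<integral>\<eta>. of_bool (\<eta> 0) \<partial>\<mu>))))"

definition bbs_invariant :: "config measure \<Rightarrow> bool" where
  "bbs_invariant \<mu> \<longleftrightarrow> bbs \<in> measurable \<mu> \<mu> \<and> distr \<mu> \<mu> bbs = \<mu>"

end

theory Submission
  imports Defs
begin

text \<open>Deleting the 1-solitons of an excursion and then the first box of every remaining run yields
  a shorter excursion whose \<open>k\<close>-solitons and \<open>k\<close>-slots come from the \<open>(k + 1)\<close>-solitons and
  \<open>(k + 1)\<close>-slots of the given one, and whose boxes are the nonzero 1-slots of the given one. Read on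
  words of balls and holes this is a finite automaton: a word corresponds bijectively to a shorter word
  \<open>u\<close> together with \<open>length u + 1\<close> numbers, the 1-solitons appended to each 1-slot.
  Solitons lose size 1 and the number of 1-slots is 1 plus the length of \<open>u\<close>, so the weight of a word
  is the weight of \<open>u\<close> with changed parameters times a product of geometric weights. Hence an i.i.d.
  sequence of random words splits into an i.i.d. sequence of shorter words of the same kind and an
  independent i.i.d. geometric sequence, the 1-component; iterating this gives all components.

  Under the Palm measure, a word of length \<open>2n\<close> followed by its record has probability
  \<open>(1 - \<lambda>) (\<lambda> (1 - \<lambda>)) ^ n\<close>, independently for disjoint windows, and \<open>n\<close> is the sum of the sizes of the
  solitons.

  For the invariance, read the dynamics as a carrier that travels to the right, picks up balls and
  drops one in every empty box as long as it can. Its load is a stationary reversible Markov chain,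
  so, as in Burke's theorem for queues, the output up to a site is independent of the load there.\<close>

text \<open>The algorithm picks the leftmost smallest run of what is left, whereas the automaton
  reads a word once from left to right. They agree because runs of size 1 are the smallest, so all
  1-solitons are picked before the others and in reading order. Once none is left, removing the
  first box of every run except the unbounded leftmost one lowers all finite sizes by 1 and
  preserves the leftmost minimal run. A pick removes the first boxes of two runs and merges the
  remainder into a run whose first box stays, so shrinking commutes with picking. Solitons and slots
  have to be traced as boxes through all rounds; this is why the algorithm is carried out on blocks
  of positions and not on words.

  On the probabilistic side, the lengths of the shorter words decide where the sequence of counts is
  cut into excursions. Independence survives because the counts are i.i.d. and independent of these
  lengths. The splitting map would lead to events with random cutting points; the inverse map turns
  a window of words into a product of two windows, so the laws are compared there.\<close>

section \<open>Words of balls and holes\<close>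

text \<open>\<open>c\<close> is the content of the last box that was kept (initially a hole, the record
  at the left end); \<open>x\<close> with \<open>f x \<noteq> c\<close> starts a new run, and if this run has length 1 then \<open>x\<close> and \<open>y\<close>
  form a 1-soliton.\<close>

fun core :: "('a \<Rightarrow> bool) \<Rightarrow> bool \<Rightarrow> 'a list \<Rightarrow> 'a list" where
  "core f c [] = []"
| "core f c [x] = (if f x = c then [x] else [])"
| "core f c (x # y # zs) = (if f x = c then x # core f c (y # zs)
     else if f y = f x then y # core f (f y) zs else core f c zs)"

text \<open>A 1-soliton found before the next kept box belongs to the gap that is still open, the
  head of the list.\<close>

fun bump :: "nat list \<Rightarrow> nat list" where
  "bump [] = []"
| "bump (n # ns) = Suc n # ns"

text \<open>Entry \<open>t\<close> is the number of 1-solitons between the kept boxes \<open>t - 1\<close> and \<open>t\<close>.\<close>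

fun gaps :: "('a \<Rightarrow> bool) \<Rightarrow> bool \<Rightarrow> 'a list \<Rightarrow> nat list" where
  "gaps f c [] = [0]"
| "gaps f c [x] = (if f x = c then [0, 0] else [0])"
| "gaps f c (x # y # zs) = (if f x = c then 0 # gaps f c (y # zs)
     else if f y = f x then 0 # gaps f (f y) zs else bump (gaps f c zs))"

text \<open>A row of \<open>n\<close> 1-solitons behind a kept box of content \<open>c\<close>. Each
  starts with the opposite content, so its order is ball-hole or hole-ball according to
  \<open>c\<close>.\<close>

definition alternations :: "bool \<Rightarrow> nat \<Rightarrow> bool list" where
  "alternations c n = concat (replicate n [\<not> c, c])"

text \<open>The inverse of the automaton. A change of content in the short word means a run whose
  first box was removed, so its first letter is doubled.\<close>

fun expand :: "bool \<Rightarrow> bool list \<Rightarrow> nat list \<Rightarrow> bool list" where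
  "expand c [] ns = alternations c (hd ns)"
| "expand c (d # ws) ns =
     alternations c (hd ns) @ (if d = c then [d] else [d, d]) @ expand d ws (tl ns)"

fun dyck :: "nat \<Rightarrow> bool list \<Rightarrow> bool" where
  "dyck h [] = (h = 0)"
| "dyck h (True # w) = dyck (Suc h) w"
| "dyck h (False # w) = (h \<noteq> 0 \<and> dyck (h - 1) w)"

text \<open>Counts the runs that start inside the word; for a short word this is the number of boxes
  that shrinking removed.\<close>

fun changes :: "bool \<Rightarrow> bool list \<Rightarrow> nat" where
  "changes c [] = 0"
| "changes c (x # xs) = of_bool (x \<noteq> c) + changes x xs"

abbreviation wcore :: "bool list \<Rightarrow> bool list" where
  "wcore \<equiv> core (\<lambda>b. b) False"

abbreviation wgaps :: "bool list \<Rightarrow> nat list" where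
  "wgaps \<equiv> gaps (\<lambda>b. b) False"

text \<open>Each round lowers the sizes by 1, so \<open>m\<close>-solitons become 1-solitons after
  \<open>m - 1\<close> rounds. That this agrees with the algorithm is shown in
  \<open>exc_path\<close>.\<close>

definition word_solitons :: "nat \<Rightarrow> bool list \<Rightarrow> nat" where
  "word_solitons m w = sum_list (wgaps ((wcore ^^ (m - 1)) w))"

lemma length_bump [simp]: "length (bump ns) = length ns"
  by (cases ns) auto

lemma sum_list_bump: "ns \<noteq> [] \<Longrightarrow> sum_list (bump ns) = Suc (sum_list ns)"
  by (cases ns) auto

lemma length_gaps: "length (gaps f c xs) = Suc (length (core f c xs))"
  by (induction f c xs rule: gaps.induct) auto

lemma gaps_nonempty [simp]: "gaps f c xs \<noteq> []"
  using length_gaps[of f c xs] by auto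

lemma core_map: "core f c (map h xs) = map h (core (\<lambda>x. f (h x)) c xs)"
  by (induction "\<lambda>x. f (h x)" c xs rule: core.induct) auto

lemma gaps_map: "gaps f c (map h xs) = gaps (\<lambda>x. f (h x)) c xs"
  by (induction "\<lambda>x. f (h x)" c xs rule: gaps.induct) auto

lemma map_core: "map f (core f c xs) = core (\<lambda>b. b) c (map f xs)"
  by (simp add: core_map)

lemma gaps_word: "gaps f c xs = gaps (\<lambda>b. b) c (map f xs)"
  by (simp add: gaps_map)

lemma core_same: "f x = c \<Longrightarrow> core f c (x # xs) = x # core f c xs"
  by (cases xs) auto

lemma gaps_same: "f x = c \<Longrightarrow> gaps f c (x # xs) = 0 # gaps f c xs"
  by (cases xs) auto

lemma set_core: "set (core f c xs) \<subseteq> set xs"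
  by (induction f c xs rule: core.induct) auto

lemma sorted_core: "sorted_wrt P xs \<Longrightarrow> sorted_wrt P (core f c xs)"
proof (induction f c xs rule: core.induct)
  case (3 f c x y zs)
  have "\<forall>z\<in>set (core f c (y # zs)). z \<in> set (y # zs)" "\<forall>z\<in>set (core f (f y) zs). z \<in> set zs"
    using set_core[of f c "y # zs"] set_core[of f "f y" zs] by auto
  with 3 show ?case by auto
qed auto

lemma alternations_0 [simp]: "alternations c 0 = []"
  and alternations_Suc [simp]: "alternations c (Suc n) = (\<not> c) # c # alternations c n"
  by (simp_all add: alternations_def)

lemma core_alternations: "core (\<lambda>b. b) c (alternations c n @ v) = core (\<lambda>b. b) c v"
  by (induction n) auto

lemma gaps_alternations:
  "gaps (\<lambda>b. b) c (alternations c n @ v) = (hd (gaps (\<lambda>b. b) c v) + n) # tl (gaps (\<lambda>b. b) c v)"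
  by (induction n) (auto simp: )

text \<open>A row of alternating pairs returns the automaton to its state \<open>c\<close>, and the
  letter behind it is either equal to \<open>c\<close> or doubled; so every letter and every count
  is recovered.\<close>

lemma decode_expand:
  "length ns = Suc (length ws) \<Longrightarrow>
    core (\<lambda>b. b) c (expand c ws ns) = ws \<and> gaps (\<lambda>b. b) c (expand c ws ns) = ns"
proof (induction ws arbitrary: c ns)
  case Nil
  then show ?case
    using core_alternations[of c "hd ns" "[]"] gaps_alternations[of c "hd ns" "[]"]
    by (cases ns) auto
next
  case (Cons d ws)
  then obtain n ns' where ns: "ns = n # ns'" "length ns' = Suc (length ws)" by (cases ns) auto
  show ?case
    using Cons.IH[OF ns(2), of d]
    by (cases "d = c") (auto simp: ns core_alternations gaps_alternations core_same gaps_same)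
qed

lemma expand_bump:
  "ns \<noteq> [] \<Longrightarrow> expand c ws (bump ns) = (\<not> c) # c # expand c ws ns"
  by (cases ns; cases ws) auto

text \<open>In state True one ball of the current run is missing from the short word, so the short
  path is one lower; in state False both paths have the same height. State True is entered with two
  balls, so the height is at least 2, the origin of \<open>Suc (Suc h)\<close>: a single hole cannot
  end the word there, and no run of size 1 is left without a partner.\<close>

lemma expand_decode:
  "dyck (if c then Suc (Suc h) else h) w \<Longrightarrow>
    expand c (core (\<lambda>b. b) c w) (gaps (\<lambda>b. b) c w) = w \<and>
    dyck (if c then Suc h else h) (core (\<lambda>b. b) c w) \<and>
    changes c w = changes c (core (\<lambda>b. b) c w) + 2 * sum_list (gaps (\<lambda>b. b) c w) \<and>
    length w = length (core (\<lambda>b. b) c w) + changes c (core (\<lambda>b. b) c w) + 2 * sum_list (gaps (\<lambda>b. b) c w)"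
proof (induction "\<lambda>b::bool. b" c w arbitrary: h rule: core.induct)
  case (1 c)
  then show ?case by auto
next
  case (2 c x)
  then show ?case by (cases c; cases x) auto
next
  case (3 c x y zs)
  show ?case
  proof (cases "x = c")
    case True
    show ?thesis
    proof (cases c)
      case True
      then show ?thesis using 3(1)[of "Suc h"] 3(4) \<open>x = c\<close> by auto
    next
      case False
      then obtain h' where "h = Suc h'" using 3(4) \<open>x = c\<close> by (cases h) auto
      then show ?thesis using 3(1)[of h'] 3(4) \<open>x = c\<close> False by auto
    qed
  next
    case False
    show ?thesis
    proof (cases "y = x")
      case True
      then show ?thesis
        using 3(2)[of h] 3(4) False by (cases c) auto
    next
      case yx: False
      then have "y = c" using False by auto
      then show ?thesis
        using 3(3)[of h] 3(4) False
        by (cases c) (auto simp: expand_bump sum_list_bump)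
    qed
  qed
qed

lemma dyck_alternations:
  "dyck (if c then Suc h else h) (alternations c n @ v) = dyck (if c then Suc h else h) v"
  by (induction n) auto

lemma dyck_expand:
  "length ns = Suc (length ws) \<Longrightarrow> dyck (if c then Suc h else h) ws \<Longrightarrow>
    dyck (if c then Suc (Suc h) else h) (expand c ws ns)"
proof (induction ws arbitrary: c h ns)
  case Nil
  then show ?case
    using dyck_alternations[of c "Suc h" "hd ns" "[]"] dyck_alternations[of c h "hd ns" "[]"]
    by (cases c) auto
next
  case (Cons d ws)
  then obtain n ns' where ns: "ns = n # ns'" "length ns' = Suc (length ws)" by (cases ns) auto
  note alt = dyck_alternations[of c "Suc h" n] dyck_alternations[of c h n]
  show ?case
  proof (cases c; cases d)
    assume "c" "d"
    then show ?thesis using alt Cons.IH[OF ns(2), of d "Suc h"] Cons.prems by (auto simp: ns)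
  next
    assume "\<not> c" "d"
    then show ?thesis using alt Cons.IH[OF ns(2), of d h] Cons.prems by (auto simp: ns)
  next
    assume "c" "\<not> d"
    then show ?thesis using alt Cons.IH[OF ns(2), of d h] Cons.prems by (auto simp: ns)
  next
    assume "\<not> c" "\<not> d"
    then show ?thesis using alt Cons.IH[OF ns(2), of d "h - 1"] Cons.prems by (cases h) (auto simp: ns)
  qed
qed

lemma dyck_wcore: "dyck 0 w \<Longrightarrow> dyck 0 (wcore w)"
  using expand_decode[of False 0 w] by simp

lemma changes_pos: "dyck 0 w \<Longrightarrow> w \<noteq> [] \<Longrightarrow> 0 < changes False w"
proof (cases w)
  case (Cons x xs)
  assume "dyck 0 w"
  with Cons show ?thesis by (cases x) auto
qed simp

text \<open>By \<open>expand_decode\<close> the loss of length equals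
  \<open>changes False w\<close>, and a nonempty Dyck word starts with a ball.\<close>

lemma length_wcore_less: "dyck 0 w \<Longrightarrow> w \<noteq> [] \<Longrightarrow> length (wcore w) < length w"
  using expand_decode[of False 0 w] changes_pos[of w] by simp

lemma word_solitons_Suc_Suc: "word_solitons (Suc (Suc m)) w = word_solitons (Suc m) (wcore w)"
  by (simp add: word_solitons_def funpow_swap1)

lemma word_solitons_1: "word_solitons (Suc 0) w = sum_list (wgaps w)"
  by (simp add: word_solitons_def)

text \<open>One round loses as many letters as the word has changes, so the length can be followed
  only together with the changes. A soliton of size \<open>m\<close> accounts for
  \<open>2 * m\<close> letters and two changes. The slack between \<open>M\<close> and the length
  lets the induction pass to the core.\<close>

lemma length_and_changes_word_solitons:
  "dyck 0 w \<Longrightarrow> length w \<le> M \<Longrightarrow> length w = (\<Sum>m<M. 2 * Suc m * word_solitons (Suc m) w) \<and>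
     changes False w = (\<Sum>m<M. 2 * word_solitons (Suc m) w)"
proof (induction M arbitrary: w)
  case 0
  then show ?case by simp
next
  case (Suc M)
  have "length (wcore w) \<le> M"
    using length_wcore_less[OF Suc.prems(1)] Suc.prems(2) by (cases "w = []") auto
  note IH = Suc.IH[OF dyck_wcore[OF Suc.prems(1)] this]
  note E = expand_decode[of False 0 w, simplified, OF Suc.prems(1)]
  have "(\<Sum>m<Suc M. 2 * word_solitons (Suc m) w) = 2 * sum_list (wgaps w) + (\<Sum>m<M. 2 * word_solitons (Suc m) (wcore w))"
    by (subst sum.lessThan_Suc_shift) (simp add: word_solitons_1 word_solitons_Suc_Suc)
  moreover have "(\<Sum>m<Suc M. 2 * Suc m * word_solitons (Suc m) w)
      = 2 * sum_list (wgaps w) + (\<Sum>m<M. 2 * Suc m * word_solitons (Suc m) (wcore w) + 2 * word_solitons (Suc m) (wcore w))"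
    by (subst sum.lessThan_Suc_shift) (simp add: word_solitons_1 word_solitons_Suc_Suc algebra_simps)
  then have "(\<Sum>m<Suc M. 2 * Suc m * word_solitons (Suc m) w) = 2 * sum_list (wgaps w) +
      ((\<Sum>m<M. 2 * Suc m * word_solitons (Suc m) (wcore w)) + (\<Sum>m<M. 2 * word_solitons (Suc m) (wcore w)))"
    by (simp only: sum.distrib)
  ultimately show ?case using E IH by linarith
qed

lemma length_word_solitons: "dyck 0 w \<Longrightarrow> length w \<le> M \<Longrightarrow> length w = (\<Sum>m<M. 2 * Suc m * word_solitons (Suc m) w)"
  using length_and_changes_word_solitons by blast

text \<open>The sums of \<open>length_word_solitons\<close> with \<open>m\<close> and with
  \<open>Suc m\<close> terms have the same value.\<close>

lemma word_solitons_eq_0: "dyck 0 w \<Longrightarrow> length w \<le> m \<Longrightarrow> word_solitons (Suc m) w = 0"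
  using length_word_solitons[of w m] length_word_solitons[of w "Suc m"] by simp

section \<open>The Takahashi-Satsuma algorithm on lists of runs\<close>

lemma consecutive_in_Un:
  assumes "consecutive_in A I" "consecutive_in A J" "p \<in> I" "p \<in> J"
  shows "consecutive_in A (I \<union> J)"
  unfolding consecutive_in_def
proof (intro conjI ballI impI)
  show "I \<union> J \<subseteq> A" using assms(1,2) unfolding consecutive_in_def by blast
next
  fix x y z assume xy: "x \<in> I \<union> J" "y \<in> I \<union> J" "z \<in> A" "x \<le> z \<and> z \<le> y"
  have I: "\<And>x y. x \<in> I \<Longrightarrow> y \<in> I \<Longrightarrow> x \<le> z \<Longrightarrow> z \<le> y \<Longrightarrow> z \<in> I"
    using assms(1) \<open>z \<in> A\<close> unfolding consecutive_in_def by blast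
  have J: "\<And>x y. x \<in> J \<Longrightarrow> y \<in> J \<Longrightarrow> x \<le> z \<Longrightarrow> z \<le> y \<Longrightarrow> z \<in> J"
    using assms(2) \<open>z \<in> A\<close> unfolding consecutive_in_def by blast
  have "z \<le> p \<or> p \<le> z" by linarith
  then show "z \<in> I \<union> J"
    using I[of x p] I[of p y] J[of x p] J[of p y] xy assms(3,4) by blast
qed

lemma runsD:
  assumes "I \<in> runs \<eta> A"
  shows "I \<noteq> {}" "consecutive_in A I" "\<eta> constant_on I" "I \<subseteq> A"
    "\<And>J. I \<subseteq> J \<Longrightarrow> consecutive_in A J \<Longrightarrow> \<eta> constant_on J \<Longrightarrow> J = I"
  using assms unfolding runs_def consecutive_in_def by blast+

lemma runs_eqI:
  assumes "I \<in> runs \<eta> A" "J \<in> runs \<eta> A" "p \<in> I" "p \<in> J"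
  shows "I = J"
proof -
  have "consecutive_in A (I \<union> J)"
    using consecutive_in_Un runsD(2) assms by blast
  moreover obtain c d where "\<forall>x\<in>I. \<eta> x = c" "\<forall>x\<in>J. \<eta> x = d"
    using runsD(3)[OF assms(1)] runsD(3)[OF assms(2)] unfolding constant_on_def by blast
  then have "\<forall>x\<in>I \<union> J. \<eta> x = c" using assms(3,4) by auto
  then have "\<eta> constant_on (I \<union> J)" unfolding constant_on_def by blast
  ultimately have "I \<union> J = I" "I \<union> J = J"
    using runsD(5)[OF assms(1), of "I \<union> J"] runsD(5)[OF assms(2), of "I \<union> J"] by auto
  then show ?thesis by simp
qed

lemma next_run_unique:
  assumes "next_run \<eta> A I J" "next_run \<eta> A I J'"
  shows "J = J'"
proof -
  have *: "K = K'" if "next_run \<eta> A I K" "next_run \<eta> A I K'" "j \<in> K" "j' \<in> K'" "j \<le> j'" for K K' j j'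
  proof -
    have K: "K \<in> runs \<eta> A" "K' \<in> runs \<eta> A" "I \<in> runs \<eta> A" "\<forall>x\<in>I. \<forall>y\<in>K. x < y"
      "consecutive_in A (I \<union> K')"
      using that(1,2) unfolding next_run_def by blast+
    obtain i where i: "i \<in> I" using runsD(1)[OF K(3)] by blast
    have "j \<in> A" "i < j" using runsD(4)[OF K(1)] K(4) that(3) i by auto
    moreover have "i \<in> I \<union> K'" "j' \<in> I \<union> K'" using i that(4) by auto
    ultimately have "j \<in> I \<union> K'" using that(5) K(5) unfolding consecutive_in_def
      by (metis less_imp_le)
    moreover have "j \<notin> I" using K(4) that(3) by blast
    ultimately show ?thesis using that(3) runs_eqI[OF K(1,2), of j] by blast
  qed
  have "J \<in> runs \<eta> A" "J' \<in> runs \<eta> A" using assms unfolding next_run_def by blast+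
  then obtain j j' where "j \<in> J" "j' \<in> J'" using runsD(1) by blast
  then show ?thesis using *[OF assms, of j j'] *[OF assms(2,1), of j' j] by (cases "j \<le> j'") auto
qed

text \<open>\<open>ts_reach\<close> and \<open>ts_picks\<close> are relations. Determinism is what
  allows all solitons to be read off from a single execution.\<close>

lemma ts_picks_unique:
  assumes "ts_picks \<eta> A k \<gamma>" "ts_picks \<eta> A k' \<gamma>'"
  shows "k = k' \<and> \<gamma> = \<gamma>'"
proof -
  obtain I J where I: "I \<in> runs \<eta> A" "finite I" "card I = k"
     "\<forall>I'\<in>runs \<eta> A. finite I' \<longrightarrow> k \<le> card I'"
     "\<forall>I'\<in>runs \<eta> A. finite I' \<and> card I' = k \<longrightarrow> Min I \<le> Min I'"
     "next_run \<eta> A I J" "\<gamma> = I \<union> {y \<in> J. card {x \<in> J. x < y} < k}"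
    using assms(1) unfolding ts_picks_def by blast
  obtain I' J' where I': "I' \<in> runs \<eta> A" "finite I'" "card I' = k'"
     "\<forall>I\<in>runs \<eta> A. finite I \<longrightarrow> k' \<le> card I"
     "\<forall>I\<in>runs \<eta> A. finite I \<and> card I = k' \<longrightarrow> Min I' \<le> Min I"
     "next_run \<eta> A I' J'" "\<gamma>' = I' \<union> {y \<in> J'. card {x \<in> J'. x < y} < k'}"
    using assms(2) unfolding ts_picks_def by blast
  have k: "k = k'" using I(1-4) I'(1-4) by (meson le_antisym)
  have "Min I \<le> Min I'" "Min I' \<le> Min I" using I(1-5) I'(1-5) k by auto
  then have "Min I = Min I'" by simp
  moreover have "I \<noteq> {}" "I' \<noteq> {}" using runsD(1) I(1) I'(1) by auto
  ultimately have "I = I'"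
    using I(1,2) I'(1,2) runs_eqI[of I \<eta> A I' "Min I"] Min_in[of I] Min_in[of I'] by auto
  then have "J = J'" using next_run_unique[of \<eta> A I J J'] I(6) I'(6) by simp
  then show ?thesis using I(7) I'(7) k \<open>I = I'\<close> by simp
qed

section \<open>Finite lists of runs and executions of the algorithm on them\<close>

definition below :: "int set \<Rightarrow> int set \<Rightarrow> bool" where
  "below I J \<longleftrightarrow> (\<forall>x\<in>I. \<forall>y\<in>J. x < y)"

definition opposite :: "config \<Rightarrow> int set \<Rightarrow> int set \<Rightarrow> bool" where
  "opposite \<eta> I J \<longleftrightarrow> (\<forall>x\<in>I. \<forall>y\<in>J. \<eta> x \<noteq> \<eta> y)"

definition blocks :: "config \<Rightarrow> int set list \<Rightarrow> bool" where
  "blocks \<eta> Rs \<longleftrightarrow> sorted_wrt below Rs \<and> (\<forall>R\<in>set Rs. R \<noteq> {} \<and> \<eta> constant_on R) \<and>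
     successively (opposite \<eta>) Rs"

lemma blocks_consecutive:
  assumes "blocks \<eta> (ps @ qs @ ss)"
  shows "consecutive_in (\<Union>(set (ps @ qs @ ss))) (\<Union>(set qs))"
  unfolding consecutive_in_def
proof (intro conjI ballI impI)
  fix x y z
  assume xy: "x \<in> \<Union>(set qs)" "y \<in> \<Union>(set qs)" "z \<in> \<Union>(set (ps @ qs @ ss))" "x \<le> z \<and> z \<le> y"
  show "z \<in> \<Union>(set qs)"
  proof (rule ccontr)
    assume "z \<notin> \<Union>(set qs)"
    then obtain R where R: "z \<in> R" "R \<in> set ps \<or> R \<in> set ss" using xy by auto
    moreover obtain X Y where "x \<in> X" "X \<in> set qs" "y \<in> Y" "Y \<in> set qs" using xy by auto
    moreover have "\<forall>A\<in>set ps. \<forall>B\<in>set qs. below A B" "\<forall>A\<in>set qs. \<forall>B\<in>set ss. below A B"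
      using assms by (auto simp: blocks_def sorted_wrt_append)
    ultimately have "z < x \<or> y < z" unfolding below_def by blast
    then show False using xy(4) by auto
  qed
qed auto

text \<open>A larger interval would contain a box of a neighbouring block, whose content is
  opposite.\<close>

lemma blocks_in_runs:
  assumes "blocks \<eta> (ps @ I # ss)"
  shows "I \<in> runs \<eta> (\<Union>(set (ps @ I # ss)))"
proof -
  let ?A = "\<Union>(set (ps @ I # ss))"
  have cons: "consecutive_in ?A I" using blocks_consecutive[of \<eta> ps "[I]" ss] assms by simp
  have ne: "\<And>R. R \<in> set (ps @ I # ss) \<Longrightarrow> R \<noteq> {}" and const: "\<eta> constant_on I"
    using assms by (auto simp: blocks_def)
  have "J = I" if J: "I \<subseteq> J" "consecutive_in ?A J" "\<eta> constant_on J" for J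
  proof (rule ccontr)
    assume "J \<noteq> I"
    then obtain j where j: "j \<in> J" "j \<notin> I" using J(1) by auto
    obtain i where i: "i \<in> I" using ne[of I] by auto
    obtain R where R: "j \<in> R" "R \<in> set ps \<or> R \<in> set ss" using j J(2) by (auto simp: consecutive_in_def)
    \<comment> \<open>\<open>N\<close> stands for the neighbour of \<open>I\<close> on the side of
      the foreign block \<open>R\<close>, possibly \<open>R\<close> itself. An interval that reaches
      from \<open>I\<close> to \<open>R\<close> meets \<open>N\<close>.\<close>
    have False if N: "N \<in> set (ps @ I # ss)" "opposite \<eta> I N \<or> opposite \<eta> N I"
      "R = N \<or> below I N \<and> below N R \<or> below R N \<and> below N I" for N
    proof -
      obtain n where n: "n \<in> N" "R = N \<longrightarrow> n = j" using ne[OF N(1)] R(1) by blast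
      have "n \<in> ?A" using n N by auto
      then have "n \<in> J" using N(3) n R(1) i j J unfolding below_def consecutive_in_def
        by (metis less_imp_le subsetD)
      moreover have "\<eta> n \<noteq> \<eta> i" using N(2) n i by (auto simp: opposite_def)
      moreover have "i \<in> J" using i J by auto
      ultimately show False using J(3) unfolding constant_on_def by blast
    qed
    note * = this
    from R(2) show False
    proof
      assume "R \<in> set ss"
      then obtain N ss' where "ss = N # ss'" by (cases ss) auto
      then show False using *[of N] \<open>R \<in> set ss\<close> assms
        by (auto simp: blocks_def sorted_wrt_append successively_append_iff)
    next
      assume "R \<in> set ps"
      then obtain N ps' where "ps = ps' @ [N]" by (cases ps rule: rev_cases) auto
      then show False using *[of N] \<open>R \<in> set ps\<close> assms
        by (auto simp: blocks_def sorted_wrt_append successively_append_iff)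
    qed
  qed
  then show ?thesis using cons ne const by (auto simp: runs_def)
qed

lemma runs_blocks:
  assumes "blocks \<eta> Rs"
  shows "runs \<eta> (\<Union>(set Rs)) = set Rs"
proof
  show sub: "set Rs \<subseteq> runs \<eta> (\<Union>(set Rs))"
    using blocks_in_runs assms by (metis split_list subsetI)
  show "runs \<eta> (\<Union>(set Rs)) \<subseteq> set Rs"
  proof
    fix R assume R: "R \<in> runs \<eta> (\<Union>(set Rs))"
    obtain x where x: "x \<in> R" using runsD(1)[OF R] by auto
    then obtain I where "x \<in> I" "I \<in> set Rs" using runsD(4)[OF R] by auto
    note this x
    then show "R \<in> set Rs" using runs_eqI[OF R, of I x] sub by (metis subsetD)
  qed
qed

definition initial :: "nat \<Rightarrow> int set \<Rightarrow> int set" where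
  "initial k J = {y \<in> J. card {x \<in> J. x < y} < k}"

definition drop_least :: "int set \<Rightarrow> int set" where
  "drop_least J = {y \<in> J. \<exists>x\<in>J. x < y}"

text \<open>A relation in place of \<open>Min\<close>, because the last run is infinite.\<close>

definition least_in :: "int set \<Rightarrow> int \<Rightarrow> bool" where
  "least_in J f \<longleftrightarrow> f \<in> J \<and> (\<forall>x\<in>J. f \<le> x)"

lemma ex_least_in: "J \<noteq> {} \<Longrightarrow> bdd_below J \<Longrightarrow> \<exists>f. least_in J f"
proof -
  assume "J \<noteq> {}" "bdd_below J"
  then obtain x b where "x \<in> J" "\<forall>y\<in>J. b \<le> y" by (auto simp: bdd_below_def)
  then show ?thesis
    using ex_has_least_nat[of "\<lambda>y. y \<in> J" x "\<lambda>y. nat (y - b)"] by (fastforce simp: least_in_def)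
qed

lemma drop_least_insert: "least_in J f \<Longrightarrow> J = insert f (drop_least J) \<and> f \<notin> drop_least J"
  by (force simp: least_in_def drop_least_def)

lemma drop_least_subset: "drop_least J \<subseteq> J"
  by (auto simp: drop_least_def)

lemma initial_subset: "initial k J \<subseteq> J"
  by (auto simp: initial_def)

lemma initial_Suc:
  assumes "least_in J f"
  shows "initial (Suc k) J = insert f (initial k (drop_least J))"
proof -
  have "card {x \<in> J. x < y} = Suc (card {x \<in> drop_least J. x < y})" if "y \<in> drop_least J" for y
  proof -
    have "{x \<in> J. x < y} = insert f {x \<in> drop_least J. x < y}"
      using assms that by (force simp: least_in_def drop_least_def)
    moreover have "f \<notin> drop_least J" "finite {x \<in> drop_least J. x < y}"
      using drop_least_insert[OF assms] assms
      by (auto simp: least_in_def drop_least_def intro: finite_subset[of _ "{f..y}"])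
    ultimately show ?thesis by simp
  qed
  moreover have emp: "{x \<in> J. x < f} = {}" using assms by (auto simp: least_in_def)
  moreover have "x \<in> J \<longleftrightarrow> x = f \<or> x \<in> drop_least J" for x using drop_least_insert[OF assms] by auto
  moreover have "card {x \<in> J. x < f} = 0" unfolding emp by simp
  ultimately show ?thesis unfolding initial_def by (auto simp del: card_0_eq)
qed

lemma finite_card_initial:
  "bdd_below J \<Longrightarrow> (finite J \<longrightarrow> k \<le> card J) \<Longrightarrow> finite (initial k J) \<and> card (initial k J) = k"
proof (induction k arbitrary: J)
  case 0
  then show ?case by (simp add: initial_def)
next
  case (Suc k)
  then have "J \<noteq> {}" by auto
  then obtain f where f: "least_in J f" using ex_least_in Suc.prems by auto
  then have J: "J = insert f (drop_least J)" "f \<notin> drop_least J" using drop_least_insert by auto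
  have "finite (drop_least J) \<longrightarrow> k \<le> card (drop_least J)"
  proof
    assume thin_blocks: "finite (drop_least J)"
    then have "card J = Suc (card (drop_least J))" "finite J"
      using J by (metis card_insert_disjoint, metis finite.insertI)
    then show "k \<le> card (drop_least J)" using Suc.prems(2) by auto
  qed
  then have IH: "finite (initial k (drop_least J)) \<and> card (initial k (drop_least J)) = k"
    by (intro Suc.IH bdd_below_mono[OF Suc.prems(1) drop_least_subset])
  moreover have "f \<notin> initial k (drop_least J)" using J(2) initial_subset by blast
  ultimately show ?case unfolding initial_Suc[OF f] by simp
qed

text \<open>The deleted run \<open>I\<close> is never the first one, because the first run is infinite; deleting a soliton merges
  the rest of \<open>J\<close> with the run \<open>P\<close> before \<open>I\<close>.\<close>

inductive block_pick :: "int set list \<Rightarrow> nat \<Rightarrow> int set \<Rightarrow> int set list \<Rightarrow> bool" where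
  "finite I \<Longrightarrow> card I = k \<Longrightarrow>
   (\<forall>R\<in>set (ps @ P # I # J # ss). finite R \<longrightarrow> k \<le> card R) \<Longrightarrow>
   (\<forall>R\<in>set (ps @ [P]). finite R \<longrightarrow> k < card R) \<Longrightarrow>
   block_pick (ps @ P # I # J # ss) k (I \<union> initial k J) (ps @ (P \<union> (J - initial k J)) # ss)"

text \<open>The list keeps the order of the deletions; later arguments compare solitons by their
  place in it.\<close>

inductive block_exec :: "int set list \<Rightarrow> (nat \<times> int set) list \<Rightarrow> bool" where
  stop: "block_exec [R] []"
| pick: "block_pick Rs k \<gamma> Rs' \<Longrightarrow> block_exec Rs' L \<Longrightarrow> block_exec Rs ((k, \<gamma>) # L)"

lemma blocks_split:
  assumes "blocks \<eta> (ps @ P # I # J # ss)"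
  shows "P \<noteq> {}" "I \<noteq> {}" "J \<noteq> {}" "\<eta> constant_on P" "\<eta> constant_on J" "opposite \<eta> P I" "opposite \<eta> I J"
    "below P I" "below P J" "below I J"
    "\<And>R. R \<in> set ps \<Longrightarrow> R \<noteq> {} \<and> \<eta> constant_on R \<and> below R P \<and> below R I \<and> below R J"
    "\<And>R. R \<in> set ss \<Longrightarrow> R \<noteq> {} \<and> \<eta> constant_on R \<and> below P R \<and> below I R \<and> below J R"
    "sorted_wrt below ps" "sorted_wrt below ss" "\<And>R S. R \<in> set ps \<Longrightarrow> S \<in> set ss \<Longrightarrow> below R S"
    "successively (opposite \<eta>) ps" "successively (opposite \<eta>) ss"
    "ps \<noteq> [] \<Longrightarrow> opposite \<eta> (last ps) P" "ss \<noteq> [] \<Longrightarrow> opposite \<eta> J (hd ss)"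
  using assms
  by (auto simp: blocks_def sorted_wrt_append successively_append_iff successively_Cons)

text \<open>All finite runs up to and including \<open>P\<close> are strictly larger than
  \<open>k\<close>, so \<open>I\<close> is the leftmost run of minimal size.\<close>

lemma block_pick_ts_picks:
  assumes "block_pick Rs k \<gamma> Rs'" "blocks \<eta> Rs"
  shows "ts_picks \<eta> (\<Union>(set Rs)) k \<gamma>"
  using assms(1)
proof (cases rule: block_pick.cases)
  case (1 I ps P J ss)
  let ?A = "\<Union>(set Rs)"
  have B: "blocks \<eta> (ps @ P # I # J # ss)" using assms(2) unfolding 1(1) .
  note sp = blocks_split[OF B]
  have runs: "runs \<eta> ?A = set Rs" using runs_blocks assms(2) by blast
  have "consecutive_in ?A (I \<union> J)"
    using blocks_consecutive[of \<eta> "ps @ [P]" "[I, J]" ss] B unfolding 1(1) by simp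
  then have "next_run \<eta> ?A I J"
    using sp(10) unfolding next_run_def runs below_def by (simp add: 1(1))
  moreover have "Min I \<le> Min I'" if "I' \<in> set Rs" "finite I'" "card I' = k" for I'
  proof -
    have "I' \<notin> set (ps @ [P])" using 1(7) that by auto
    then have "I' = I \<or> below I I'" "I' \<noteq> {}"
      using that(1) sp(3,10,12) unfolding 1(1) by (auto simp: sp(2))
    then show ?thesis using Min_in[OF that(2)] Min_in[OF 1(4) sp(2)]
      unfolding below_def by (auto simp: less_imp_le)
  qed
  moreover have "I \<in> set Rs" unfolding 1(1) by simp
  moreover have "\<forall>I'\<in>set Rs. finite I' \<longrightarrow> k \<le> card I'" using 1(6) unfolding 1(1) .
  ultimately show ?thesis unfolding ts_picks_def runs initial_def[symmetric] using 1(2,4,5) by blast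
qed

text \<open>\<open>P\<close> and \<open>J\<close> are both opposite to \<open>I\<close>, so what is
  left of \<open>J\<close> has the content of \<open>P\<close> and forms one run with it.\<close>

lemma blocks_block_pick:
  assumes "block_pick Rs k \<gamma> Rs'" "blocks \<eta> Rs"
  shows "blocks \<eta> Rs' \<and> \<Union>(set Rs') = \<Union>(set Rs) - \<gamma>"
  using assms(1)
proof (cases rule: block_pick.cases)
  case (1 I ps P J ss)
  have B: "blocks \<eta> (ps @ P # I # J # ss)" using assms(2) unfolding 1(1) .
  note sp = blocks_split[OF B]
  define Q where "Q = P \<union> (J - initial k J)"
  have Q: "Q \<subseteq> P \<union> J" "Q \<noteq> {}" using sp(1) by (auto simp: Q_def)
  have same: "\<eta> x = \<eta> y" if "x \<in> P \<union> J" "y \<in> P \<union> J" for x y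
  proof -
    obtain i where "i \<in> I" using sp(2) by blast
    then have "\<forall>z\<in>P \<union> J. \<eta> z \<noteq> \<eta> i" using sp(6,7) unfolding opposite_def by blast
    then show ?thesis using that by blast
  qed
  have "\<eta> constant_on Q" using same Q unfolding constant_on_def by blast
  moreover have bQ: "\<And>R. R \<in> set ps \<Longrightarrow> below R Q" "\<And>R. R \<in> set ss \<Longrightarrow> below Q R"
    using sp(11,12) Q(1) unfolding below_def by blast+
  then have "sorted_wrt below (ps @ Q # ss)" using sp(13-15) by (auto simp: sorted_wrt_append)
  moreover have "opposite \<eta> Q (hd ss)" if "ss \<noteq> []"
    unfolding opposite_def
  proof (intro ballI)
    fix x y assume "x \<in> Q" "y \<in> hd ss"
    moreover obtain j where "j \<in> J" using sp(3) by blast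
    ultimately show "\<eta> x \<noteq> \<eta> y" using sp(19)[OF that] same[of x j] Q(1) unfolding opposite_def by blast
  qed
  moreover have "opposite \<eta> (last ps) Q" if "ps \<noteq> []"
    unfolding opposite_def
  proof (intro ballI)
    fix x y assume "y \<in> Q" "x \<in> last ps"
    moreover obtain p where "p \<in> P" using sp(1) by blast
    ultimately show "\<eta> x \<noteq> \<eta> y" using sp(18)[OF that] same[of p y] Q(1) unfolding opposite_def by blast
  qed
  moreover have "\<Union>(set (ps @ Q # ss)) = \<Union>(set Rs) - \<gamma>"
  proof -
    have d: "A \<inter> C = {}" if "below A C" for A C using that unfolding below_def by fastforce
    have "R \<inter> \<gamma> = {}" if "R \<in> set ps" for R
      using sp(11)[OF that] d initial_subset[of k J] unfolding 1(2) by blast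
    moreover have "R \<inter> \<gamma> = {}" if "R \<in> set ss" for R
      using sp(12)[OF that] d initial_subset[of k J] unfolding 1(2) by blast
    moreover have "P \<inter> \<gamma> = {}" using sp(8,9) d initial_subset[of k J] unfolding 1(2) by blast
    moreover have "J - \<gamma> = J - initial k J" "I - \<gamma> = {}" using d[OF sp(10)] unfolding 1(2) by blast+
    moreover have "\<Union>(set Rs) - \<gamma> = (\<Union>R\<in>set ps. R - \<gamma>) \<union> (P - \<gamma>) \<union> (I - \<gamma>) \<union> (J - \<gamma>) \<union> (\<Union>R\<in>set ss. R - \<gamma>)"
      unfolding 1(1) by auto
    moreover have "R - \<gamma> = R" if "R \<inter> \<gamma> = {}" for R using that by blast
    ultimately have "\<Union>(set Rs) - \<gamma> = (\<Union>R\<in>set ps. R) \<union> P \<union> (I - \<gamma>) \<union> (J - initial k J) \<union> (\<Union>R\<in>set ss. R)"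
      by simp
    then show ?thesis unfolding Q_def \<open>I - \<gamma> = {}\<close> by auto
  qed
  ultimately show ?thesis unfolding 1(3) Q_def[symmetric] blocks_def
    using sp(11,12,16,17) Q(2) by (auto simp: successively_append_iff successively_Cons)
qed

text \<open>In the application both outer runs are empty, so an odd number of finite runs lies
  between them. The parity excludes a list of two infinite runs, to which no rule of
  \<open>block_exec\<close> applies, and it survives a pick, which shortens the list by 2.\<close>

definition framed :: "int set list \<Rightarrow> bool" where
  "framed Rs \<longleftrightarrow> (\<exists>R. Rs = [R] \<and> infinite R) \<or>
     (\<exists>R0 mid Rl. Rs = R0 # mid @ [Rl] \<and> infinite R0 \<and> infinite Rl \<and> odd (length mid) \<and>
        (\<forall>R\<in>set mid. finite R))"

lemma block_pick_bdd_below: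
  assumes "blocks \<eta> (ps @ P # I # J # ss)"
  shows "bdd_below J" "bdd_below I"
proof -
  obtain p where "p \<in> P" using blocks_split(1)[OF assms] by blast
  then have "\<forall>x\<in>I. p \<le> x" "\<forall>x\<in>J. p \<le> x"
    using blocks_split(8,9)[OF assms] by (auto simp: below_def less_imp_le)
  then show "bdd_below J" "bdd_below I" by (auto simp: bdd_below_def)
qed

lemma framed_block_pick:
  assumes "block_pick Rs k \<gamma> Rs'" "blocks \<eta> Rs" "framed Rs"
  shows "framed Rs'"
  using assms(1)
proof (cases rule: block_pick.cases)
  case (1 I ps P J ss)
  then have bJ: "bdd_below J" using block_pick_bdd_below(1)[of \<eta> ps P I J ss] assms(2) by simp
  have fJ: "finite (initial k J)" using finite_card_initial[OF bJ] 1 by auto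
  obtain R0 mid Rl where R: "Rs = R0 # mid @ [Rl]" "infinite R0" "infinite Rl" "odd (length mid)"
      "\<forall>R\<in>set mid. finite R"
    using assms(3) 1 by (auto simp: framed_def)
  \<comment> \<open>\<open>P\<close> may be the first run and \<open>J\<close> the last one. A
    merged run that involves one of them stays infinite, since only finitely many boxes are
    deleted.\<close>
  consider "ps = []" "ss = []" | ss' where "ps = []" "ss = ss' @ [Rl]"
    | ps' where "ps = R0 # ps'" "ss = []" | ps' ss' where "ps = R0 # ps'" "ss = ss' @ [Rl]"
    using R(1) 1(1) by (cases ps; cases ss rule: rev_cases) auto
  then show ?thesis
  proof cases
    case a: 1
    then show ?thesis using R 1 by (auto simp: framed_def)
  next
    case a: (2 ss')
    then have "mid = I # J # ss'" "P = R0" using R 1 by auto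
    then show ?thesis using R 1 a by (auto simp: framed_def)
  next
    case a: (3 ps')
    then have m: "mid = ps' @ [P, I]" "J = Rl" using R(1) 1(1) by auto
    have "Rs' = R0 # ps' @ [P \<union> (J - initial k J)]" using 1 a by simp
    moreover have "infinite (P \<union> (J - initial k J))" using R m fJ by simp
    ultimately show ?thesis using R m unfolding framed_def by auto
  next
    case a: (4 ps' ss')
    then have m: "mid = ps' @ P # I # J # ss'" using R(1) 1(1) by auto
    have "Rs' = R0 # (ps' @ (P \<union> (J - initial k J)) # ss') @ [Rl]" using 1 a by simp
    moreover have "\<forall>R\<in>set (ps' @ (P \<union> (J - initial k J)) # ss'). finite R" using R m by auto
    ultimately show ?thesis using R m unfolding framed_def by auto
  qed
qed

lemma length_block_pick: "block_pick Rs k \<gamma> Rs' \<Longrightarrow> length Rs = length Rs' + 2"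
  by (cases rule: block_pick.cases, assumption) simp

lemma ex_block_pick:
  assumes "framed Rs" "length Rs \<noteq> 1"
  shows "\<exists>k \<gamma> Rs'. block_pick Rs k \<gamma> Rs'"
proof -
  obtain R0 mid Rl where R: "Rs = R0 # mid @ [Rl]" "infinite R0" "infinite Rl" "odd (length mid)"
      "\<forall>R\<in>set mid. finite R"
    using assms by (auto simp: framed_def)
  define k where "k = Min (card ` set mid)"
  have "mid \<noteq> []" using R(4) by auto
  then have "k \<in> card ` set mid" and min: "\<forall>R\<in>set mid. k \<le> card R"
    unfolding k_def by (auto intro: Min_in)
  then have "\<exists>x\<in>set mid. card x = k" by auto
  then obtain xs I ys where I: "mid = xs @ I # ys" "card I = k" "\<forall>x\<in>set xs. card x \<noteq> k"
    by (rule split_list_first_propE)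
  have lt: "\<forall>x\<in>set xs. k < card x" using I min by (metis Un_iff le_neq_implies_less set_append)
  obtain ps P where P: "R0 # xs = ps @ [P]" by (metis append_butlast_last_id list.distinct(1))
  obtain J ss where J: "ys @ [Rl] = J # ss" by (cases "ys @ [Rl]") auto
  have e: "Rs = ps @ P # I # J # ss" using P J R(1) I(1)
    by (metis append.assoc append_Cons append_Nil)
  have "set (ps @ [P]) = insert R0 (set xs)" using P by (metis list.simps(15))
  then have "\<forall>R\<in>set (ps @ [P]). finite R \<longrightarrow> k < card R" using lt R by auto
  moreover have "\<forall>R\<in>set (ps @ P # I # J # ss). finite R \<longrightarrow> k \<le> card R"
    unfolding e[symmetric] using R min by auto
  moreover have "finite I" using I R by auto
  ultimately show ?thesis using block_pick.intros[of I k ps P J ss] I(2) e by blast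
qed

lemma ex_block_exec: "blocks \<eta> Rs \<Longrightarrow> framed Rs \<Longrightarrow> \<exists>L. block_exec Rs L"
proof (induction "length Rs" arbitrary: Rs rule: less_induct)
  case less
  show ?case
  proof (cases "length Rs = 1")
    case True
    then show ?thesis by (cases Rs) (auto intro: block_exec.intros)
  next
    case False
    then obtain k \<gamma> Rs' where p: "block_pick Rs k \<gamma> Rs'" using ex_block_pick less by blast
    then obtain L where "block_exec Rs' L"
      using less.hyps[of Rs'] length_block_pick[OF p] blocks_block_pick[OF p] framed_block_pick[OF p] less.prems by auto
    then show ?thesis using p block_exec.intros by blast
  qed
qed

lemma block_exec_imp_reach:
  "block_exec Rs L \<Longrightarrow> blocks \<eta> Rs \<Longrightarrow> ts_reach \<eta> (\<Union>(set Rs)) \<Longrightarrow> (k, \<gamma>) \<in> set L \<Longrightarrow>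
    \<exists>A. ts_reach \<eta> A \<and> ts_picks \<eta> A k \<gamma>"
proof (induction rule: block_exec.induct)
  case (pick Rs k' \<gamma>' Rs' L)
  note p = block_pick_ts_picks[OF pick.hyps(1) pick.prems(1)]
  show ?case
  proof (cases "(k, \<gamma>) = (k', \<gamma>')")
    case True
    then show ?thesis using p pick.prems by blast
  next
    case False
    then show ?thesis
      using pick.IH blocks_block_pick[OF pick.hyps(1) pick.prems(1)] ts_reach.step[OF pick.prems(2) p] pick.prems(3)
      by auto
  qed
qed simp

lemma no_picks_single: "infinite R \<Longrightarrow> blocks \<eta> [R] \<Longrightarrow> \<not> ts_picks \<eta> R k \<gamma>"
  using runs_blocks[of \<eta> "[R]"] by (auto simp: ts_picks_def)

lemma reach_imp_block_exec:
  assumes "ts_reach \<eta> A" "block_exec Rs L" "blocks \<eta> Rs" "framed Rs" "\<Union>(set Rs) = UNIV"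
  shows "\<exists>Rs' L1 L2. blocks \<eta> Rs' \<and> framed Rs' \<and> \<Union>(set Rs') = A \<and> block_exec Rs' L2 \<and> L = L1 @ L2"
  using assms(1)
proof (induction rule: ts_reach.induct)
  case start
  then show ?case using assms by blast
next
  case (step A k \<gamma>)
  then obtain Rs' L1 L2 where R: "blocks \<eta> Rs'" "framed Rs'" "\<Union>(set Rs') = A" "block_exec Rs' L2" "L = L1 @ L2"
    by blast
  from R(4) show ?case
  proof (cases rule: block_exec.cases)
    case (stop R)
    then show ?thesis using no_picks_single[of R] R step by (auto simp: framed_def)
  next
    case (pick k' \<gamma>' Rs'' L')
    then have "k = k' \<and> \<gamma> = \<gamma>'"
      using block_pick_ts_picks[OF pick(2) R(1)] R(3) step ts_picks_unique by blast
    then show ?thesis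
      using blocks_block_pick[OF pick(2) R(1)] framed_block_pick[OF pick(2) R(1,2)] R pick
      by (intro exI[of _ Rs''] exI[of _ "L1 @ [(k, \<gamma>)]"] exI[of _ L']) auto
  qed
qed

text \<open>By determinism every reachable set occurs along the given execution, so its list
  contains all solitons that are ever declared.\<close>

lemma block_exec_iff_picks:
  assumes "block_exec Rs L" "blocks \<eta> Rs" "framed Rs" "\<Union>(set Rs) = UNIV"
  shows "(\<exists>A. ts_reach \<eta> A \<and> ts_picks \<eta> A k \<gamma>) \<longleftrightarrow> (k, \<gamma>) \<in> set L"
proof
  assume "(k, \<gamma>) \<in> set L"
  then show "\<exists>A. ts_reach \<eta> A \<and> ts_picks \<eta> A k \<gamma>"
    using block_exec_imp_reach[OF assms(1,2)] assms(4) ts_reach.start by auto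
next
  assume "\<exists>A. ts_reach \<eta> A \<and> ts_picks \<eta> A k \<gamma>"
  then obtain A where A: "ts_reach \<eta> A" "ts_picks \<eta> A k \<gamma>" by blast
  obtain Rs' L1 L2 where R: "blocks \<eta> Rs'" "framed Rs'" "\<Union>(set Rs') = A" "block_exec Rs' L2" "L = L1 @ L2"
    using reach_imp_block_exec[OF A(1) assms] by blast
  from R(4) show "(k, \<gamma>) \<in> set L"
  proof (cases rule: block_exec.cases)
    case (stop R)
    then show ?thesis using no_picks_single[of R] R A by (auto simp: framed_def)
  next
    case (pick k' \<gamma>' Rs'' L')
    then have "k = k' \<and> \<gamma> = \<gamma>'"
      using block_pick_ts_picks[OF pick(2) R(1)] R(3) A ts_picks_unique by blast
    then show ?thesis using R pick by auto
  qed
qed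

section \<open>Deleting the 1-solitons and shrinking the runs\<close>

text \<open>Removes \<open>h\<^sub>0\<close> and \<open>t\<^sub>0\<close> from a soliton.\<close>

definition drop_firsts :: "config \<Rightarrow> int set \<Rightarrow> int set" where
  "drop_firsts \<eta> \<gamma> = {z \<in> \<gamma>. \<exists>y\<in>\<gamma>. y < z \<and> \<eta> y = \<eta> z}"

text \<open>The first run is exempt: in the application it extends to minus infinity and has no
  first box.\<close>

definition shrink :: "int set list \<Rightarrow> int set list" where
  "shrink Rs = hd Rs # map drop_least (tl Rs)"

definition thick :: "int set \<Rightarrow> bool" where
  "thick R \<longleftrightarrow> (finite R \<longrightarrow> 2 \<le> card R)"

definition first_set :: "int set list \<Rightarrow> int set" where
  "first_set Rs = {f. \<exists>R\<in>set (tl Rs). least_in R f}"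

lemma card_drop_least: "least_in R f \<Longrightarrow> (finite (drop_least R) \<longleftrightarrow> finite R) \<and> (finite R \<longrightarrow> card R = Suc (card (drop_least R)))"
  using drop_least_insert[of R f] by (metis card_insert_disjoint finite.insertI finite_insert)

lemma least_in_bdd: "R \<noteq> {} \<Longrightarrow> below P R \<Longrightarrow> P \<noteq> {} \<Longrightarrow> \<exists>f. least_in R f"
proof -
  assume R: "R \<noteq> {}" "below P R" "P \<noteq> {}"
  then obtain p where "p \<in> P" by blast
  then have "bdd_below R" using R(2) by (auto simp: below_def bdd_below_def intro: less_imp_le)
  then show ?thesis using ex_least_in R(1) by blast
qed

lemma drop_firsts_pick:
  assumes "opposite \<eta> I J" "\<eta> constant_on I" "\<eta> constant_on J" "I \<noteq> {}" "least_in J f"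
  shows "drop_firsts \<eta> (I \<union> initial (Suc k) J) = drop_least I \<union> initial k (drop_least J)"
proof -
  note pS = initial_Suc[OF assms(5), of k]
  have sub: "initial (Suc k) J \<subseteq> J" by (rule initial_subset)
  obtain c where c: "\<forall>x\<in>I. \<eta> x = c" using assms(2) unfolding constant_on_def by blast
  then have d: "\<forall>x\<in>J. \<eta> x = (\<not> c)" using assms(1,4) unfolding opposite_def by blast
  have f: "f \<in> J" "\<forall>x\<in>J. f \<le> x" using assms(5) by (auto simp: least_in_def)
  show ?thesis
  proof (intro set_eqI iffI)
    fix z assume "z \<in> drop_firsts \<eta> (I \<union> initial (Suc k) J)"
    then obtain y where y: "z \<in> I \<union> initial (Suc k) J" "y \<in> I \<union> initial (Suc k) J" "y < z" "\<eta> y = \<eta> z"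
      unfolding drop_firsts_def by blast
    show "z \<in> drop_least I \<union> initial k (drop_least J)"
    proof (cases "z \<in> I")
      case True
      then have "y \<in> I" using y c d sub by blast
      then show ?thesis using True y(3) unfolding drop_least_def by blast
    next
      case False
      then have z: "z \<in> initial (Suc k) J" using y by blast
      then have "y \<in> J" using y c d sub by blast
      then have "f < z" using f y(3) by force
      then show ?thesis using z unfolding pS by auto
    qed
  next
    fix z assume "z \<in> drop_least I \<union> initial k (drop_least J)"
    then show "z \<in> drop_firsts \<eta> (I \<union> initial (Suc k) J)"
    proof
      assume "z \<in> drop_least I"
      then show ?thesis using c unfolding drop_least_def drop_firsts_def by blast
    next
      assume z: "z \<in> initial k (drop_least J)"
      then have "z \<in> drop_least J" using initial_subset by blast
      then have "z \<in> J" "f < z" using f drop_least_insert[OF assms(5)] by (auto simp: less_le)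
      then show ?thesis using z d f unfolding drop_firsts_def pS by blast
    qed
  qed
qed

lemma thick_Un: "thick P \<Longrightarrow> thick (P \<union> Q)"
  unfolding thick_def by (meson card_mono finite_Un order_trans sup_ge1)

lemma blocks_tl_least:
  assumes "blocks \<eta> Rs" "R \<in> set (tl Rs)"
  shows "\<exists>f. least_in R f"
proof (cases Rs)
  case (Cons P Rs')
  then show ?thesis using assms least_in_bdd[of R P] by (auto simp: blocks_def)
qed (use assms in auto)

text \<open>Every finite run behind the first loses exactly one box, so \<open>I\<close> remains the
  leftmost run of minimal size. The merged run starts with the first box of \<open>P\<close>, and
  the first box of \<open>J\<close> lies in the soliton; hence merging commutes with shrinking. The
  merged run contains \<open>P\<close> and is therefore thick.\<close>

lemma block_pick_shrink:
  assumes "block_pick Rs (Suc k) \<gamma> Rs'" "blocks \<eta> Rs" "framed Rs" "\<forall>R\<in>set Rs. thick R"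
  shows "block_pick (shrink Rs) k (drop_firsts \<eta> \<gamma>) (shrink Rs') \<and> (\<forall>R\<in>set Rs'. thick R)"
  using assms(1)
proof (cases rule: block_pick.cases)
  case (1 I ps P J ss)
  have B: "blocks \<eta> (ps @ P # I # J # ss)" using assms(2) unfolding 1(1) .
  note sp = blocks_split[OF B]
  have lst: "\<exists>f. least_in R f" if "R \<in> set (tl Rs)" for R using blocks_tl_least[OF assms(2) that] .
  have hd: "infinite (hd Rs)" using assms(3) by (auto simp: framed_def)
  have sh: "finite (drop_least R) \<longleftrightarrow> finite R" "finite R \<Longrightarrow> card (drop_least R) = card R - 1" if "R \<in> set (tl Rs)" for R
    using lst[OF that] card_drop_least by fastforce+
  obtain f where f: "least_in J f" using least_in_bdd sp(1,3,9) by blast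
  obtain g where g: "least_in I g" using least_in_bdd sp(1,2,8) by blast
  have "\<eta> constant_on I" using B by (auto simp: blocks_def)
  then have r: "drop_firsts \<eta> \<gamma> = drop_least I \<union> initial k (drop_least J)"
    unfolding 1(2) using drop_firsts_pick[OF sp(7) _ sp(5) sp(2) f] by simp
  have J: "J - initial (Suc k) J = drop_least J - initial k (drop_least J)"
    unfolding initial_Suc[OF f] using drop_least_insert[OF f] by blast
  have cI: "finite (drop_least I)" "card (drop_least I) = k" using card_drop_least[OF g] 1(4,5) by auto
  have size: "finite (drop_least R) \<longrightarrow> k \<le> card (drop_least R)" if "R \<in> set (tl Rs)" for R
  proof
    assume "finite (drop_least R)"
    then have "finite R" using sh(1)[OF that] by simp
    moreover have "R \<in> set Rs" using that by (cases Rs) auto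
    ultimately have "Suc k \<le> card R" using 1(6) unfolding 1(1) by blast
    then show "k \<le> card (drop_least R)" using sh(2)[OF that \<open>finite R\<close>] by simp
  qed
  have "block_pick (shrink Rs) k (drop_firsts \<eta> \<gamma>) (shrink Rs')"
  \<comment> \<open>Either \<open>P\<close> is the first run, which is not shrunk, or it is a later
    one, which loses its least box.\<close>
  proof (cases ps)
    case Nil
    have e: "shrink Rs = [] @ P # drop_least I # drop_least J # map drop_least ss"
      "shrink Rs' = [] @ (P \<union> (drop_least J - initial k (drop_least J))) # map drop_least ss"
      unfolding shrink_def 1(1,3) Nil J by simp_all
    have inf: "infinite P" using hd unfolding 1(1) Nil by simp
    have "\<forall>R\<in>set ([] @ P # drop_least I # drop_least J # map drop_least ss). finite R \<longrightarrow> k \<le> card R"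
      using size inf unfolding 1(1) Nil by auto
    then show ?thesis unfolding e r by (intro block_pick.intros cI) (use inf in auto)
  next
    case (Cons p ps')
    have e: "shrink Rs = (p # map drop_least ps') @ drop_least P # drop_least I # drop_least J # map drop_least ss"
      unfolding shrink_def 1(1) Cons by simp
    have inf: "infinite p" using hd unfolding 1(1) Cons by simp
    have P: "P \<in> set (tl Rs)" unfolding 1(1) Cons by simp
    have "drop_least (P \<union> K) = drop_least P \<union> K" if "K \<subseteq> J" for K
    proof -
      obtain a where "a \<in> P" using sp(1) by blast
      then have "\<forall>z\<in>K. a < z" using that sp(9) unfolding below_def by blast
      moreover have "\<forall>z\<in>K. \<forall>p\<in>P. p < z" using that sp(9) unfolding below_def by blast
      ultimately show ?thesis using \<open>a \<in> P\<close> unfolding drop_least_def by (auto dest: order.asym)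
    qed
    then have e': "shrink Rs' = (p # map drop_least ps') @ (drop_least P \<union> (drop_least J - initial k (drop_least J))) # map drop_least ss"
      unfolding shrink_def 1(3) Cons J[symmetric] by simp
    have "\<forall>R\<in>set ((p # map drop_least ps') @ drop_least P # drop_least I # drop_least J # map drop_least ss). finite R \<longrightarrow> k \<le> card R"
      using size inf unfolding 1(1) Cons by auto
    moreover have "\<forall>R\<in>set ((p # map drop_least ps') @ [drop_least P]). finite R \<longrightarrow> k < card R"
    proof
      fix R assume R: "R \<in> set ((p # map drop_least ps') @ [drop_least P])"
      show "finite R \<longrightarrow> k < card R"
      proof (cases "R = p")
        case False
        then obtain Q where Q: "R = drop_least Q" "Q \<in> set (ps' @ [P])" using R by auto
        then have "Q \<in> set (tl Rs)" unfolding 1(1) Cons by auto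
        moreover have "finite Q \<longrightarrow> Suc k < card Q" using 1(7) Q(2) unfolding Cons by auto
        ultimately show ?thesis using sh[of Q] Q(1) by auto
      qed (use inf in simp)
    qed
    ultimately show ?thesis unfolding e e' r by (intro block_pick.intros cI)
  qed
  moreover have "\<forall>R\<in>set Rs'. thick R"
    using assms(4) thick_Un unfolding 1(1,3) by auto
  ultimately show ?thesis by blast
qed

lemma block_pick_pos: "block_pick Rs k \<gamma> Rs' \<Longrightarrow> blocks \<eta> Rs \<Longrightarrow> 1 \<le> k"
  by (cases rule: block_pick.cases, assumption) (use blocks_split(2) card_0_eq in \<open>fastforce simp: Suc_le_eq\<close>)

lemma block_exec_shrink:
  "block_exec Rs L \<Longrightarrow> blocks \<eta> Rs \<Longrightarrow> framed Rs \<Longrightarrow> \<forall>R\<in>set Rs. thick R \<Longrightarrow>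
    block_exec (shrink Rs) (map (\<lambda>(k, \<gamma>). (k - 1, drop_firsts \<eta> \<gamma>)) L) \<and> (\<forall>(k, \<gamma>)\<in>set L. 2 \<le> k)"
proof (induction rule: block_exec.induct)
  case (stop R)
  then show ?case by (auto simp: shrink_def intro: block_exec.stop)
next
  case (pick Rs k \<gamma> Rs' L)
  have "2 \<le> k" using pick.hyps(1)
    by (cases rule: block_pick.cases) (use pick.prems(3) in \<open>auto simp: thick_def\<close>)
  then obtain k' where k: "k = Suc k'" by (cases k) auto
  note p = block_pick_shrink[OF pick.hyps(1)[unfolded k] pick.prems]
  show ?case using pick.IH[OF _ framed_block_pick[OF pick.hyps(1) pick.prems(1,2)]] p
      blocks_block_pick[OF pick.hyps(1) pick.prems(1)] \<open>2 \<le> k\<close> k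
    by (auto intro: block_exec.pick)
qed

text \<open>An execution is determined by the set of remaining boxes, through
  \<open>ts_picks\<close>; so only the unions of the two lists have to be compared.\<close>

lemma block_exec_unique:
  "block_exec Rs L \<Longrightarrow> blocks \<eta> Rs \<Longrightarrow> framed Rs \<Longrightarrow> block_exec Rs2 L2 \<Longrightarrow> blocks \<eta> Rs2 \<Longrightarrow> framed Rs2 \<Longrightarrow>
    \<Union>(set Rs) = \<Union>(set Rs2) \<Longrightarrow> L = L2"
proof (induction arbitrary: Rs2 L2 rule: block_exec.induct)
  case (stop R)
  have "\<not> ts_picks \<eta> R k \<gamma>" for k \<gamma> using no_picks_single stop(1,2) by (auto simp: framed_def)
  note none = this
  from stop(3) show ?case
  proof (cases rule: block_exec.cases)
    case (pick k \<gamma> Rs' L')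
    then show ?thesis using none[of k \<gamma>] block_pick_ts_picks[OF pick(2) stop(4)] stop(6) by simp
  qed simp
next
  case (pick Rs k \<gamma> Rs' L)
  note p = block_pick_ts_picks[OF pick.hyps(1) pick.prems(1)]
  from pick.prems(3) show ?case
  proof (cases rule: block_exec.cases)
    case (stop R)
    then show ?thesis using no_picks_single[of R \<eta> k \<gamma>] p pick.prems by (auto simp: framed_def)
  next
    case (pick k' \<gamma>' Rs'' L')
    have e: "k = k' \<and> \<gamma> = \<gamma>'"
      using ts_picks_unique[OF p] block_pick_ts_picks[OF pick(2) pick.prems(4)] pick.prems(6) by simp
    moreover have "L = L'"
      using pick.IH[OF _ _ pick(3)] blocks_block_pick[OF pick.hyps(1) pick.prems(1)]
        framed_block_pick[OF pick.hyps(1) pick.prems(1,2)] blocks_block_pick[OF pick(2) pick.prems(4)]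
        framed_block_pick[OF pick(2) pick.prems(4,5)] pick.prems(6) e by auto
    ultimately show ?thesis using pick by simp
  qed
qed

lemma block_pick_soliton:
  assumes "block_pick Rs k \<gamma> Rs'" "blocks \<eta> Rs"
  shows "\<gamma> \<subseteq> \<Union>(set Rs)" "finite \<gamma>" "card {z \<in> \<gamma>. \<eta> z} = k" "card {z \<in> \<gamma>. \<not> \<eta> z} = k"
    "consecutive_in (\<Union>(set Rs)) \<gamma>"
proof -
  have "\<gamma> \<subseteq> \<Union>(set Rs) \<and> finite \<gamma> \<and> card {z \<in> \<gamma>. \<eta> z} = k \<and> card {z \<in> \<gamma>. \<not> \<eta> z} = k \<and>
    consecutive_in (\<Union>(set Rs)) \<gamma>"
    using assms(1)
  proof (cases rule: block_pick.cases)
    case (1 I ps P J ss)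
    have B: "blocks \<eta> (ps @ P # I # J # ss)" using assms(2) unfolding 1(1) .
    note sp = blocks_split[OF B]
    have fJ: "finite (initial k J)" "card (initial k J) = k"
      using finite_card_initial[of J k] block_pick_bdd_below(1)[OF B] 1(6) by auto
    have sub: "initial k J \<subseteq> J" by (rule initial_subset)
    obtain d where d: "\<forall>x\<in>J. \<eta> x = d" using sp(5) unfolding constant_on_def by blast
    then have c: "\<forall>x\<in>I. \<eta> x = (\<not> d)" using sp(3,7) unfolding opposite_def by blast
    have "(if d then {z \<in> \<gamma>. \<eta> z} else {z \<in> \<gamma>. \<not> \<eta> z}) = initial k J"
      "(if d then {z \<in> \<gamma>. \<not> \<eta> z} else {z \<in> \<gamma>. \<eta> z}) = I"
      using c d sub unfolding 1(2) by auto
    then have "card {z \<in> \<gamma>. \<eta> z} = k" "card {z \<in> \<gamma>. \<not> \<eta> z} = k" using fJ 1(5) by (auto split: if_splits)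
    moreover have "\<gamma> \<subseteq> \<Union>(set Rs)" using sub unfolding 1(1,2) by auto
    moreover have "consecutive_in (\<Union>(set Rs)) \<gamma>"
      unfolding consecutive_in_def
    proof (intro conjI ballI impI)
      show "\<gamma> \<subseteq> \<Union>(set Rs)" by fact
      fix x y z assume z: "x \<in> \<gamma>" "y \<in> \<gamma>" "z \<in> \<Union>(set Rs)" "x \<le> z \<and> z \<le> y"
      have "consecutive_in (\<Union>(set Rs)) (I \<union> J)"
        using blocks_consecutive[of \<eta> "ps @ [P]" "[I, J]" ss] B unfolding 1(1) by simp
      then have "z \<in> I \<union> J" using z sub unfolding 1(2) consecutive_in_def by blast
      moreover have "z \<in> initial k J" if "z \<in> J"
      proof -
        have "y \<notin> I" using that z(4) sp(10) unfolding below_def by force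
        then have y: "y \<in> initial k J" using z(2) unfolding 1(2) by blast
        have "finite {x \<in> J. x < y}"
        proof -
          obtain b where "\<forall>x\<in>J. b \<le> x" using block_pick_bdd_below(1)[OF B] by (auto simp: bdd_below_def)
          then have "{x \<in> J. x < y} \<subseteq> {b..y}" by auto
          then show ?thesis by (rule finite_subset) simp
        qed
        then have "card {x \<in> J. x < z} \<le> card {x \<in> J. x < y}" using z(4) by (intro card_mono) auto
        then show ?thesis using that y by (auto simp: initial_def)
      qed
      ultimately show "z \<in> \<gamma>" unfolding 1(2) by blast
    qed
    ultimately show ?thesis using fJ 1 by auto
  qed
  then show "\<gamma> \<subseteq> \<Union>(set Rs)" "finite \<gamma>" "card {z \<in> \<gamma>. \<eta> z} = k" "card {z \<in> \<gamma>. \<not> \<eta> z} = k"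
    "consecutive_in (\<Union>(set Rs)) \<gamma>" by blast+
qed

lemma block_exec_solitons:
  "block_exec Rs L \<Longrightarrow> blocks \<eta> Rs \<Longrightarrow> (k, \<gamma>) \<in> set L \<Longrightarrow>
    \<gamma> \<subseteq> \<Union>(set Rs) \<and> finite \<gamma> \<and> card {z \<in> \<gamma>. \<eta> z} = k \<and> card {z \<in> \<gamma>. \<not> \<eta> z} = k \<and> 1 \<le> k"
proof (induction rule: block_exec.induct)
  case (pick Rs k' \<gamma>' Rs' L)
  show ?case
  proof (cases "(k, \<gamma>) = (k', \<gamma>')")
    case True
    then show ?thesis using block_pick_soliton[OF pick.hyps(1) pick.prems(1)] block_pick_pos[OF pick.hyps(1) pick.prems(1)]
      by simp
  next
    case False
    then show ?thesis
      using pick.IH blocks_block_pick[OF pick.hyps(1) pick.prems(1)] pick.prems(2) by auto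
  qed
qed simp

text \<open>A picked soliton is an interval among the boxes still present, and these include the
  boxes of all solitons picked later.\<close>

lemma block_exec_later:
  "block_exec Rs L \<Longrightarrow> blocks \<eta> Rs \<Longrightarrow> L = L1 @ (k, \<gamma>) # L2 \<Longrightarrow> (m, \<gamma>2) \<in> set L2 \<Longrightarrow>
    z \<in> \<gamma>2 \<Longrightarrow> x \<in> \<gamma> \<Longrightarrow> y \<in> \<gamma> \<Longrightarrow> x \<le> z \<Longrightarrow> z \<le> y \<Longrightarrow> False"
proof (induction arbitrary: L1 rule: block_exec.induct)
  case (pick Rs k' \<gamma>' Rs' L)
  note b = blocks_block_pick[OF pick.hyps(1) pick.prems(1)]
  show ?case
  proof (cases L1)
    case Nil
    then have e: "k' = k" "\<gamma>' = \<gamma>" "L = L2" using pick.prems(2) by auto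
    have "z \<in> \<Union>(set Rs) - \<gamma>" using block_exec_solitons[OF pick.hyps(2), of \<eta> m \<gamma>2] b pick.prems(3,4) e by auto
    then show ?thesis using block_pick_soliton(5)[OF pick.hyps(1) pick.prems(1)] pick.prems(5-8) e(2)
      unfolding consecutive_in_def by blast
  next
    case (Cons a L1')
    then show ?thesis using pick.IH[of L1'] b pick.prems by auto
  qed
qed simp

lemma block_exec_disjoint:
  assumes "block_exec Rs L" "blocks \<eta> Rs" "(k, \<gamma>) \<in> set L" "(m, \<gamma>2) \<in> set L" "z \<in> \<gamma>" "z \<in> \<gamma>2"
  shows "\<gamma> = \<gamma>2 \<and> k = m"
proof (rule ccontr)
  assume ne: "\<not> (\<gamma> = \<gamma>2 \<and> k = m)"
  obtain L1 L2 where L: "L = L1 @ (k, \<gamma>) # L2" using assms(3) by (auto dest: split_list)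
  then consider "(m, \<gamma>2) \<in> set L2" | "(m, \<gamma>2) \<in> set L1" using assms(4) ne by auto
  then show False
  proof cases
    case 1
    then show ?thesis using block_exec_later[OF assms(1,2) L 1 assms(6,5,5)] by simp
  next
    case 2
    then obtain M1 M2 where "L1 = M1 @ (m, \<gamma>2) # M2" by (auto dest: split_list)
    then have "L = M1 @ (m, \<gamma>2) # (M2 @ (k, \<gamma>) # L2)" using L by simp
    then show ?thesis using block_exec_later[OF assms(1,2) _ _ assms(5,6,6), of M1 m "M2 @ (k, \<gamma>) # L2" k] by simp
  qed
qed

text \<open>A pick consumes the first boxes of \<open>I\<close> and \<open>J\<close>, and the merged
  run inherits the first box of \<open>P\<close>. So the stock of first boxes loses only boxes of
  the soliton.\<close>

lemma first_set_block_pick: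
  assumes "block_pick Rs k \<gamma> Rs'" "blocks \<eta> Rs"
  shows "first_set Rs \<subseteq> \<gamma> \<union> first_set Rs'" "first_set Rs' \<subseteq> first_set Rs" "\<gamma> - drop_firsts \<eta> \<gamma> \<subseteq> first_set Rs"
proof -
  have "first_set Rs \<subseteq> \<gamma> \<union> first_set Rs' \<and> first_set Rs' \<subseteq> first_set Rs \<and> \<gamma> - drop_firsts \<eta> \<gamma> \<subseteq> first_set Rs"
    using assms(1)
  proof (cases rule: block_pick.cases)
    case (1 I ps P J ss)
    have B: "blocks \<eta> (ps @ P # I # J # ss)" using assms(2) unfolding 1(1) .
    note sp = blocks_split[OF B]
    obtain k' where k: "k = Suc k'" using block_pick_pos[OF assms] by (cases k) auto
    obtain f where f: "least_in J f" using least_in_bdd sp(1,3,9) by blast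
    obtain g where g: "least_in I g" using least_in_bdd sp(1,2,8) by blast
    have "\<eta> constant_on I" using B by (auto simp: blocks_def)
    then have r: "drop_firsts \<eta> \<gamma> = drop_least I \<union> initial k' (drop_least J)"
      unfolding 1(2) k using drop_firsts_pick[OF sp(7) _ sp(5) sp(2) f] by simp
    have "\<gamma> - drop_firsts \<eta> \<gamma> \<subseteq> {g, f}"
      unfolding r unfolding 1(2) k initial_Suc[OF f] using drop_least_insert[OF g] by blast
    moreover have "{g, f} \<subseteq> first_set Rs"
      using f g unfolding first_set_def 1(1) by (cases ps) auto
    moreover have uniq: "x = y" if "least_in X x" "least_in X y" for X x y
      using that unfolding least_in_def by (meson antisym)
    have Q: "least_in (P \<union> (J - initial k J)) x \<longleftrightarrow> least_in P x" for x
    proof -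
      obtain a where "a \<in> P" using sp(1) by blast
      then show ?thesis using sp(9) unfolding least_in_def below_def by (auto simp: less_imp_le) force+
    qed
    have gf: "g \<in> \<gamma>" "f \<in> \<gamma>" using g f unfolding 1(2) k initial_Suc[OF f] by (auto simp: least_in_def)
    have "x \<in> \<gamma>" if "least_in I x \<or> least_in J x" for x using that gf uniq f g by metis
    then have "first_set Rs \<subseteq> \<gamma> \<union> first_set Rs' \<and> first_set Rs' \<subseteq> first_set Rs"
      unfolding first_set_def 1(1,3) by (cases ps) (auto simp: Q)
    ultimately show ?thesis by blast
  qed
  then show "first_set Rs \<subseteq> \<gamma> \<union> first_set Rs'" "first_set Rs' \<subseteq> first_set Rs" "\<gamma> - drop_firsts \<eta> \<gamma> \<subseteq> first_set Rs"
    by blast+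
qed

text \<open>The balance of boxes for one round: what shrinking removes lies in the solitons, and
  what the solitons lose under \<open>drop_firsts\<close> is removed by shrinking.\<close>

lemma first_set_block_exec:
  "block_exec Rs L \<Longrightarrow> blocks \<eta> Rs \<Longrightarrow>
    first_set Rs \<subseteq> \<Union>(snd ` set L) \<and> (\<forall>(k, \<gamma>)\<in>set L. \<gamma> - drop_firsts \<eta> \<gamma> \<subseteq> first_set Rs)"
proof (induction rule: block_exec.induct)
  case (stop R)
  then show ?case by (simp add: first_set_def)
next
  case (pick Rs k \<gamma> Rs' L)
  have b: "blocks \<eta> Rs'" using blocks_block_pick[OF pick.hyps(1) pick.prems] by blast
  note f = first_set_block_pick[OF pick.hyps(1) pick.prems]
  have "first_set Rs \<subseteq> \<Union>(snd ` set ((k, \<gamma>) # L))" using f(1) pick.IH[OF b] by auto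
  moreover have "\<gamma>' - drop_firsts \<eta> \<gamma>' \<subseteq> first_set Rs" if "(k', \<gamma>') \<in> set ((k, \<gamma>) # L)" for k' \<gamma>'
  proof (cases "(k', \<gamma>') \<in> set L")
    case True
    then have "\<gamma>' - drop_firsts \<eta> \<gamma>' \<subseteq> first_set Rs'" using pick.IH[OF b] by blast
    then show ?thesis using f(2) by blast
  next
    case False
    then have "\<gamma>' = \<gamma>" using that by simp
    then show ?thesis using f(3) by simp
  qed
  ultimately show ?case by blast
qed

text \<open>\<open>C\<close> is the part of the current run read so far, of content \<open>c\<close>, and \<open>xs\<close> lists the remaining boxes to
  the right of it; the last run always contains all boxes beyond \<open>N\<close>.\<close>

fun run_blocks :: "config \<Rightarrow> int \<Rightarrow> int set \<Rightarrow> bool \<Rightarrow> int list \<Rightarrow> int set list" where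
  "run_blocks \<eta> N C c [] = (if c then [C, {N<..}] else [C \<union> {N<..}])"
| "run_blocks \<eta> N C c (x # xs) = (if \<eta> x = c then run_blocks \<eta> N (C \<union> {x}) c xs else C # run_blocks \<eta> N {x} (\<eta> x) xs)"

text \<open>The runs that are left once all 1-solitons are deleted.\<close>

fun thin_blocks :: "config \<Rightarrow> int \<Rightarrow> int set \<Rightarrow> bool \<Rightarrow> int list \<Rightarrow> int set list" where
  "thin_blocks \<eta> N C c [] = run_blocks \<eta> N C c []"
| "thin_blocks \<eta> N C c [x] = run_blocks \<eta> N C c [x]"
| "thin_blocks \<eta> N C c (x # y # zs) = (if \<eta> x = c then thin_blocks \<eta> N (C \<union> {x}) c (y # zs)
     else if \<eta> y = \<eta> x then C # thin_blocks \<eta> N {x, y} (\<eta> y) zs else thin_blocks \<eta> N C c zs)"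

fun one_pairs :: "config \<Rightarrow> bool \<Rightarrow> int list \<Rightarrow> (int \<times> int) list" where
  "one_pairs \<eta> c [] = []"
| "one_pairs \<eta> c [x] = []"
| "one_pairs \<eta> c (x # y # zs) = (if \<eta> x = c then one_pairs \<eta> c (y # zs)
     else if \<eta> y = \<eta> x then one_pairs \<eta> (\<eta> y) zs else (x, y) # one_pairs \<eta> c zs)"

text \<open>The boxes that \<open>core\<close> drops without a partner: the first boxes of the
  surviving runs.\<close>

fun run_firsts :: "config \<Rightarrow> bool \<Rightarrow> int list \<Rightarrow> int list" where
  "run_firsts \<eta> c [] = []"
| "run_firsts \<eta> c [x] = []"
| "run_firsts \<eta> c (x # y # zs) = (if \<eta> x = c then run_firsts \<eta> c (y # zs)
     else if \<eta> y = \<eta> x then x # run_firsts \<eta> (\<eta> y) zs else run_firsts \<eta> c zs)"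

abbreviation one_picks :: "config \<Rightarrow> bool \<Rightarrow> int list \<Rightarrow> (nat \<times> int set) list" where
  "one_picks \<eta> c xs \<equiv> map (\<lambda>(x, y). (1, {x, y})) (one_pairs \<eta> c xs)"

text \<open>\<open>Y\<close> and \<open>T\<close> do not depend on the part \<open>C\<close> already
  read. So a merge to the left affects only the first block.\<close>

lemma run_blocks_head:
  "\<exists>Y T. (\<forall>C. run_blocks \<eta> N C c xs = (C \<union> Y) # T) \<and> Y \<subseteq> set xs \<union> {N<..}"
proof (induction xs)
  case Nil
  show ?case by (rule exI[of _ "if c then {} else {N<..}"], rule exI[of _ "if c then [{N<..}] else []"]) auto
next
  case (Cons x xs)
  then obtain Y T where Y: "\<forall>C. run_blocks \<eta> N C c xs = (C \<union> Y) # T" "Y \<subseteq> set xs \<union> {N<..}" by blast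
  show ?case
  proof (cases "\<eta> x = c")
    case True
    then show ?thesis using Y by (intro exI[of _ "{x} \<union> Y"] exI[of _ T]) auto
  next
    case False
    then show ?thesis by (intro exI[of _ "{}"] exI[of _ "run_blocks \<eta> N {x} (\<eta> x) xs"]) auto
  qed
qed

lemma run_blocks_hd_const:
  "\<forall>z>N. \<not> \<eta> z \<Longrightarrow> \<forall>z\<in>C. \<eta> z = c \<Longrightarrow> \<forall>z\<in>hd (run_blocks \<eta> N C c xs). \<eta> z = c"
proof (induction xs arbitrary: C)
  case (Cons x xs)
  show ?case
  proof (cases "\<eta> x = c")
    case True
    have "\<forall>z\<in>C \<union> {x}. \<eta> z = c" using Cons.prems(2) True by blast
    note IH = Cons.IH[OF Cons.prems(1) this]
    have e: "run_blocks \<eta> N C c (x # xs) = run_blocks \<eta> N (C \<union> {x}) c xs" using True by simp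
    show ?thesis unfolding e by (rule IH)
  qed (use Cons.prems in simp)
qed auto

lemma blocks_Cons:
  assumes "blocks \<eta> Rs" "Rs \<noteq> []" "C \<noteq> {}" "\<eta> constant_on C" "below C (\<Union>(set Rs))" "opposite \<eta> C (hd Rs)"
  shows "blocks \<eta> (C # Rs)"
proof -
  have "\<forall>R\<in>set Rs. below C R" using assms(5) unfolding below_def by blast
  then show ?thesis using assms by (auto simp: blocks_def successively_Cons)
qed

lemma run_blocks_props:
  assumes "\<forall>z>N. \<not> \<eta> z"
  shows "sorted_wrt (<) xs \<Longrightarrow> C \<noteq> {} \<Longrightarrow> \<forall>z\<in>C. \<eta> z = c \<Longrightarrow> \<forall>z\<in>C. z \<le> N \<Longrightarrow> \<forall>x\<in>set xs. x \<le> N \<Longrightarrow>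
     \<forall>z\<in>C. \<forall>x\<in>set xs. z < x \<Longrightarrow>
     blocks \<eta> (run_blocks \<eta> N C c xs) \<and> \<Union>(set (run_blocks \<eta> N C c xs)) = C \<union> set xs \<union> {N<..}"
proof (induction xs arbitrary: C c)
  case Nil
  have ne: "{N<..} \<noteq> {}" by (metis greaterThan_iff gt_ex equals0D)
  have "\<eta> constant_on C" "\<eta> constant_on {N<..}" "\<not> c \<Longrightarrow> \<eta> constant_on (C \<union> {N<..})"
    using Nil(3) assms by (auto simp: constant_on_def)
  moreover have "below C {N<..}" using Nil(4) by (auto simp: below_def)
  moreover have "c \<Longrightarrow> opposite \<eta> C {N<..}" using Nil(3) assms by (auto simp: opposite_def)
  ultimately show ?case using Nil(2) ne by (auto simp: blocks_def)
next
  case (Cons x xs)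
  show ?case
  proof (cases "\<eta> x = c")
    case True
    then show ?thesis using Cons.IH[of "C \<union> {x}" c] Cons.prems by auto
  next
    case False
    have IH: "blocks \<eta> (run_blocks \<eta> N {x} (\<eta> x) xs)" "\<Union>(set (run_blocks \<eta> N {x} (\<eta> x) xs)) = {x} \<union> set xs \<union> {N<..}"
      using Cons.IH[of "{x}" "\<eta> x"] Cons.prems by auto
    obtain Y T where "run_blocks \<eta> N {x} (\<eta> x) xs = ({x} \<union> Y) # T" using run_blocks_head by blast
    then have "run_blocks \<eta> N {x} (\<eta> x) xs \<noteq> []" by simp
    moreover have "below C (\<Union>(set (run_blocks \<eta> N {x} (\<eta> x) xs)))"
      unfolding IH(2) using Cons.prems by (auto simp: below_def)
    moreover have "opposite \<eta> C (hd (run_blocks \<eta> N {x} (\<eta> x) xs))"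
      using run_blocks_hd_const[OF assms, of "{x}" "\<eta> x" xs] Cons.prems(3) False unfolding opposite_def by auto
    moreover have "\<eta> constant_on C" using Cons.prems(3) by (auto simp: constant_on_def)
    ultimately show ?thesis using blocks_Cons[OF IH(1)] Cons.prems(2) IH(2) False by auto
  qed
qed

text \<open>Contents alternate from \<open>d\<close> down to the empty last block, which fixes the
  parity.\<close>

lemma run_blocks_mid:
  "finite D \<Longrightarrow> \<exists>mid Rl. run_blocks \<eta> N D d ys = mid @ [Rl] \<and> infinite Rl \<and> (\<forall>R\<in>set mid. finite R) \<and>
     (odd (length mid) \<longleftrightarrow> d)"
proof (induction ys arbitrary: D d)
  case Nil
  show ?case
    by (rule exI[of _ "if d then [D] else []"], rule exI[of _ "if d then {N<..} else D \<union> {N<..}"])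
      (use Nil infinite_Ioi in auto)
next
  case (Cons x xs)
  show ?case
  proof (cases "\<eta> x = d")
    case True
    then show ?thesis using Cons.IH[of "D \<union> {x}" d] Cons.prems by auto
  next
    case False
    obtain mid Rl where "run_blocks \<eta> N {x} (\<eta> x) xs = mid @ [Rl]" "infinite Rl" "\<forall>R\<in>set mid. finite R"
      "odd (length mid) \<longleftrightarrow> \<eta> x" using Cons.IH[of "{x}" "\<eta> x"] by auto
    then show ?thesis using False Cons.prems by (intro exI[of _ "D # mid"] exI[of _ Rl]) auto
  qed
qed

lemma run_blocks_framed: "infinite C \<Longrightarrow> framed (run_blocks \<eta> N C False xs)"
proof (induction xs arbitrary: C)
  case Nil
  then show ?case by (auto simp: framed_def)
next
  case (Cons x xs)
  show ?case
  proof (cases "\<eta> x")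
    case True
    obtain mid Rl where "run_blocks \<eta> N {x} True xs = mid @ [Rl]" "infinite Rl" "\<forall>R\<in>set mid. finite R"
      "odd (length mid)" using run_blocks_mid[of "{x}" \<eta> N True xs] by auto
    then show ?thesis using True Cons.prems unfolding framed_def by auto
  next
    case False
    then show ?thesis using Cons by auto
  qed
qed

lemma run_blocks_nonempty: "C \<noteq> {} \<Longrightarrow> R \<in> set (run_blocks \<eta> N C c xs) \<Longrightarrow> R \<noteq> {}"
proof (induction xs arbitrary: C c)
  case Nil
  have "N + 1 \<in> {N<..}" by simp
  then have "{N<..} \<noteq> {}" "{} \<noteq> {N<..}" by blast+
  then show ?case using Nil by (cases c) auto
next
  case (Cons x xs)
  then show ?case using Cons.IH[of "C \<union> {x}" c] Cons.IH[of "{x}" "\<eta> x"] by (cases "\<eta> x = c") auto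
qed

lemma thick_pair: "x < y \<Longrightarrow> thick {x, y :: int}"
  by (simp add: thick_def)

text \<open>All runs to the left are thick, so \<open>{x}\<close> is the leftmost run of size 1.
  Deleting it with \<open>y\<close> merges \<open>C\<close> with the rest of the run of
  \<open>y\<close>, and this is the block obtained by reading \<open>zs\<close> directly behind
  \<open>C\<close>.\<close>

lemma pair_block_pick:
  assumes "\<forall>R\<in>set ps. thick R" "thick C" "C \<noteq> {}" "\<eta> x \<noteq> c" "\<eta> y = c" "y \<le> N" "\<forall>z\<in>set zs. y < z"
  shows "block_pick (ps @ run_blocks \<eta> N C c (x # y # zs)) 1 {x, y} (ps @ run_blocks \<eta> N C c zs)"
proof -
  obtain Y T where Y: "\<And>C. run_blocks \<eta> N C c zs = (C \<union> Y) # T" "Y \<subseteq> set zs \<union> {N<..}" using run_blocks_head by blast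
  have yY: "\<forall>z\<in>Y. y < z" using Y(2) assms(6,7) by auto
  then have l: "least_in ({y} \<union> Y) y" by (auto simp: least_in_def less_imp_le)
  have p: "initial 1 ({y} \<union> Y) = {y}" using initial_Suc[OF l, of 0] by (simp add: initial_def)
  have d: "({y} \<union> Y) - {y} = Y" using yY by auto
  have e: "run_blocks \<eta> N C c (x # y # zs) = C # {x} # ({y} \<union> Y) # T" using assms(4,5) Y(1)[of "{y}"] by simp
  have ne: "R \<noteq> {}" if "R \<in> set (C # {x} # ({y} \<union> Y) # T)" for R
    using run_blocks_nonempty[OF assms(3)] that e[symmetric] by metis
  have c1: "\<forall>R\<in>set (ps @ C # {x} # ({y} \<union> Y) # T). finite R \<longrightarrow> 1 \<le> card R"
  proof (intro ballI impI)
    fix R assume R: "R \<in> set (ps @ C # {x} # ({y} \<union> Y) # T)" "finite R"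
    show "1 \<le> card R"
    proof (cases "R \<in> set ps")
      case True
      then have "2 \<le> card R" using assms(1) R(2) by (simp add: thick_def)
      then show ?thesis by simp
    next
      case False
      then have "R \<noteq> {}" using R(1) ne by auto
      then show ?thesis using R(2) by (simp add: Suc_le_eq card_gt_0_iff)
    qed
  qed
  have c2: "\<forall>R\<in>set (ps @ [C]). finite R \<longrightarrow> 1 < card R"
  proof
    fix R assume "R \<in> set (ps @ [C])"
    then have "thick R" using assms(1,2) by auto
    then show "finite R \<longrightarrow> 1 < card R" unfolding thick_def by linarith
  qed
  have c0: "finite {x}" "card {x} = 1" by simp_all
  note pk = block_pick.intros[OF c0 c1 c2]
  have "{x} \<union> {y} = {x, y}" by blast
  then have "block_pick (ps @ C # {x} # ({y} \<union> Y) # T) 1 {x, y} (ps @ (C \<union> Y) # T)"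
    using pk by (simp only: p d)
  then show ?thesis by (simp only: e Y(1)[of C])
qed

text \<open>\<open>ps\<close> holds the completed runs. They are thick, so the next run of size 1
  that the automaton meets is the one that the algorithm picks.\<close>

lemma block_exec_one_picks:
  assumes "sorted_wrt (<) xs" "\<forall>x\<in>set xs. x \<le> N"
  shows "\<forall>R\<in>set ps. thick R \<Longrightarrow> thick C \<Longrightarrow> C \<noteq> {} \<Longrightarrow>
    (block_exec (ps @ thin_blocks \<eta> N C c xs) L \<longrightarrow> block_exec (ps @ run_blocks \<eta> N C c xs) (one_picks \<eta> c xs @ L)) \<and>
    (blocks \<eta> (ps @ run_blocks \<eta> N C c xs) \<longrightarrow> framed (ps @ run_blocks \<eta> N C c xs) \<longrightarrow>
      blocks \<eta> (ps @ thin_blocks \<eta> N C c xs) \<and> framed (ps @ thin_blocks \<eta> N C c xs))"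
  using assms
proof (induction \<eta> N C c xs arbitrary: ps rule: thin_blocks.induct)
  case (1 \<eta> N C c)
  then show ?case by simp
next
  case (2 \<eta> N C c x)
  then show ?case by simp
next
  case (3 \<eta> N C c x y zs)
  show ?case
  proof (cases "\<eta> x = c")
    case True
    then show ?thesis using 3(1)[OF True 3(4)] 3(5-) thick_Un[of C "{x}"] by simp
  next
    case False
    show ?thesis
    proof (cases "\<eta> y = \<eta> x")
      case True
      have "thick {x, y}" using thick_pair 3(7) by simp
      then show ?thesis using 3(2)[OF False True, of "ps @ [C]"] 3(4-) False True
        by (simp add: insert_commute)
    next
      case yx: False
      then have yc: "\<eta> y = c" using False by auto
      have "block_pick (ps @ run_blocks \<eta> N C c (x # y # zs)) 1 {x, y} (ps @ run_blocks \<eta> N C c zs)"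
        using 3(4-) False yc by (intro pair_block_pick) auto
      note p = this
      note IH = 3(3)[OF False yx 3(4-6)]
      have fe: "thin_blocks \<eta> N C c (x # y # zs) = thin_blocks \<eta> N C c zs"
        "one_picks \<eta> c (x # y # zs) = (1, {x, y}) # one_picks \<eta> c zs" using False yx by simp_all
      show ?thesis unfolding fe using IH block_exec.pick[OF p] blocks_block_pick[OF p] framed_block_pick[OF p] 3(7,8)
        by auto
    qed
  qed
qed

text \<open>The height condition is that of \<open>expand_decode\<close>. It rules out a lone box at
  the end of the word, which would leave a run of size 1, so that all later blocks are
  thick.\<close>

lemma thin_blocks_structure:
  assumes "sorted_wrt (<) xs" "\<forall>x\<in>set xs. x \<le> N"
  shows "dyck (if c then Suc (Suc h) else h) (map \<eta> xs) \<Longrightarrow>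
    (\<exists>Y T. (\<forall>C. thin_blocks \<eta> N C c xs = (C \<union> Y) # T) \<and>
       (\<forall>C. run_blocks \<eta> N C c (core \<eta> c xs) = (C \<union> Y) # map drop_least T) \<and>
       (\<forall>R\<in>set T. thick R) \<and> Y \<subseteq> set xs \<union> {N<..} \<and>
       {f. \<exists>R\<in>set T. least_in R f} = set (run_firsts \<eta> c xs)) \<and>
    set xs = set (core \<eta> c xs) \<union> set (run_firsts \<eta> c xs) \<union> (\<Union>(x, y)\<in>set (one_pairs \<eta> c xs). {x, y})"
  using assms
proof (induction \<eta> c xs arbitrary: h rule: core.induct)
  case (1 \<eta> c)
  then show ?case by (cases c) auto
next
  case (2 \<eta> c x)
  \<comment> \<open>A last box must be a hole at height 1, whereas in state True the height is at
    least 2.\<close>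
  then have "\<eta> x = c" "\<not> c" by (cases c; cases "\<eta> x"; simp)+
  then show ?case by (auto intro!: exI[of _ "{x} \<union> {N<..}"])
next
  case (3 \<eta> c x y zs)
  show ?case
  proof (cases "\<eta> x = c")
    case True
    define h' where "h' = (if c then Suc h else h - 1)"
    have "dyck (if c then Suc (Suc h') else h') (map \<eta> (y # zs))"
      using 3(4) True by (cases c) (auto simp: h'_def)
    note IH = 3(1)[OF True this]
    have a: "sorted_wrt (<) (y # zs)" "\<forall>x\<in>set (y # zs). x \<le> N" using 3(5,6) by auto
    note S = conjunct2[OF IH[OF a]]
    from conjunct1[OF IH[OF a]] obtain Y T where Y: "\<forall>C. thin_blocks \<eta> N C c (y # zs) = (C \<union> Y) # T"
       "\<forall>C. run_blocks \<eta> N C c (core \<eta> c (y # zs)) = (C \<union> Y) # map drop_least T"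
       "\<forall>R\<in>set T. thick R" "Y \<subseteq> set (y # zs) \<union> {N<..}"
       "{f. \<exists>R\<in>set T. least_in R f} = set (run_firsts \<eta> c (y # zs))"
      by (elim exE conjE)
    have e: "core \<eta> c (x # y # zs) = x # core \<eta> c (y # zs)" "run_firsts \<eta> c (x # y # zs) = run_firsts \<eta> c (y # zs)"
      "one_pairs \<eta> c (x # y # zs) = one_pairs \<eta> c (y # zs)" using True by simp_all
    show ?thesis unfolding e
    proof (intro conjI exI)
      show "\<forall>C. thin_blocks \<eta> N C c (x # y # zs) = (C \<union> ({x} \<union> Y)) # T"
        using True Y(1) by (simp add: Un_assoc del: Un_insert_right Un_insert_left)
      show "\<forall>C. run_blocks \<eta> N C c (x # core \<eta> c (y # zs)) = (C \<union> ({x} \<union> Y)) # map drop_least T"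
        using True Y(2) by (simp add: Un_assoc del: Un_insert_right Un_insert_left)
      show "{x} \<union> Y \<subseteq> set (x # y # zs) \<union> {N<..}" using Y(4) by auto
      show "set (x # y # zs) = set (x # core \<eta> c (y # zs)) \<union> set (run_firsts \<eta> c (y # zs)) \<union>
        (\<Union>(x, y)\<in>set (one_pairs \<eta> c (y # zs)). {x, y})" using S by auto
    qed (use Y in auto)
  next
    case False
    show ?thesis
    proof (cases "\<eta> y = \<eta> x")
      case True
      define h' where "h' = (if c then h else h)"
      have "dyck (if \<eta> y then Suc (Suc h') else h') (map \<eta> zs)"
        using 3(4) True False by (cases c) (auto simp: h'_def)
      note IH = 3(2)[OF False True this]
      have a: "sorted_wrt (<) zs" "\<forall>x\<in>set zs. x \<le> N" using 3(5,6) by auto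
      note S = conjunct2[OF IH[OF a]]
      from conjunct1[OF IH[OF a]] obtain Y T where Y: "\<forall>C. thin_blocks \<eta> N C (\<eta> y) zs = (C \<union> Y) # T"
         "\<forall>C. run_blocks \<eta> N C (\<eta> y) (core \<eta> (\<eta> y) zs) = (C \<union> Y) # map drop_least T"
         "\<forall>R\<in>set T. thick R" "Y \<subseteq> set zs \<union> {N<..}"
         "{f. \<exists>R\<in>set T. least_in R f} = set (run_firsts \<eta> (\<eta> y) zs)"
        by (elim exE conjE)
      have e: "core \<eta> c (x # y # zs) = y # core \<eta> (\<eta> y) zs" "run_firsts \<eta> c (x # y # zs) = x # run_firsts \<eta> (\<eta> y) zs"
        "one_pairs \<eta> c (x # y # zs) = one_pairs \<eta> (\<eta> y) zs" using True False by simp_all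
      have yY: "\<forall>z\<in>{y} \<union> Y. x < z" "\<forall>z\<in>Y. y < z" using Y(4) 3(5,6) by force+
      then have sh: "drop_least ({x, y} \<union> Y) = {y} \<union> Y" by (force simp: drop_least_def)
      have l: "least_in ({x, y} \<union> Y) f \<longleftrightarrow> f = x" for f using yY by (force simp: least_in_def)
      show ?thesis unfolding e
      proof (intro conjI exI)
        show "\<forall>C. thin_blocks \<eta> N C c (x # y # zs) = (C \<union> {}) # (({x, y} \<union> Y) # T)"
          using True False Y(1) by simp
        show "\<forall>C. run_blocks \<eta> N C c (y # core \<eta> (\<eta> y) zs) = (C \<union> {}) # map drop_least (({x, y} \<union> Y) # T)"
          using True False Y(2) sh by simp
        have "thick {x, y}" using thick_pair 3(5) by simp
        then show "\<forall>R\<in>set (({x, y} \<union> Y) # T). thick R" using Y(3) thick_Un[of "{x, y}" Y] by simp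
        show "{f. \<exists>R\<in>set (({x, y} \<union> Y) # T). least_in R f} = set (x # run_firsts \<eta> (\<eta> y) zs)"
          using Y(5) l by auto
        show "set (x # y # zs) = set (y # core \<eta> (\<eta> y) zs) \<union> set (x # run_firsts \<eta> (\<eta> y) zs) \<union>
          (\<Union>(x, y)\<in>set (one_pairs \<eta> (\<eta> y) zs). {x, y})" using S by auto
      qed simp
    next
      case yx: False
      have "dyck (if c then Suc (Suc h) else h) (map \<eta> zs)"
        using 3(4) yx False by (cases c) auto
      note IH = 3(3)[OF False yx this]
      have e: "core \<eta> c (x # y # zs) = core \<eta> c zs" "run_firsts \<eta> c (x # y # zs) = run_firsts \<eta> c zs"
        "one_pairs \<eta> c (x # y # zs) = (x, y) # one_pairs \<eta> c zs"
        "\<And>C. thin_blocks \<eta> N C c (x # y # zs) = thin_blocks \<eta> N C c zs" using yx False by simp_all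
      have a: "sorted_wrt (<) zs" "\<forall>x\<in>set zs. x \<le> N" using 3(5,6) by auto
      from conjunct1[OF IH[OF a]] obtain Y T where Y: "\<forall>C. thin_blocks \<eta> N C c zs = (C \<union> Y) # T"
         "\<forall>C. run_blocks \<eta> N C c (core \<eta> c zs) = (C \<union> Y) # map drop_least T"
         "\<forall>R\<in>set T. thick R" "Y \<subseteq> set zs \<union> {N<..}"
         "{f. \<exists>R\<in>set T. least_in R f} = set (run_firsts \<eta> c zs)"
        by (elim exE conjE)
      show ?thesis unfolding e
      proof (intro conjI exI)
        show "Y \<subseteq> set (x # y # zs) \<union> {N<..}" using Y(4) by auto
        show "set (x # y # zs) = set (core \<eta> c zs) \<union> set (run_firsts \<eta> c zs) \<union>
          (\<Union>(x, y)\<in>set ((x, y) # one_pairs \<eta> c zs). {x, y})" using conjunct2[OF IH[OF a]] by auto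
      qed (use Y in auto)
    qed
  qed
qed

lemma one_pairs_subset: "(x, y) \<in> set (one_pairs \<eta> c xs) \<Longrightarrow> x \<in> set xs \<and> y \<in> set xs"
  by (induction \<eta> c xs rule: one_pairs.induct) (auto split: if_splits)

text \<open>\<open>A\<close> is the last kept box and moves only when a box is kept. A pair is read
  while gap 0 is open, so it adds to the first entry.\<close>

lemma gaps_count:
  "sorted_wrt (<) xs \<Longrightarrow> \<forall>x\<in>set xs. A < x \<and> x < B \<Longrightarrow> t < length (gaps \<eta> c xs) \<Longrightarrow>
    card {\<gamma> \<in> (\<lambda>(x, y). {x, y}) ` set (one_pairs \<eta> c xs).
      \<gamma> \<subseteq> {(A # core \<eta> c xs @ [B]) ! t <..< (core \<eta> c xs @ [B]) ! t}} = gaps \<eta> c xs ! t"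
proof (induction \<eta> c xs arbitrary: A t rule: core.induct)
  case (1 \<eta> c)
  then show ?case by auto
next
  case (2 \<eta> c x)
  then show ?case by (auto split: if_splits simp: less_Suc_eq nth_Cons')
next
  case (3 \<eta> c x y zs)
  \<comment> \<open>Pairs read after the kept box \<open>u\<close> lie to its right and do not count
    for the gap that \<open>u\<close> closes.\<close>
  have empty: "card {\<gamma> \<in> (\<lambda>(x, y). {x, y}) ` set (one_pairs \<eta> d ws). \<gamma> \<subseteq> {A<..<u}} = 0"
    if "\<forall>z\<in>set ws. u < z" for d ws u
  proof -
    have "{\<gamma> \<in> (\<lambda>(x, y). {x, y}) ` set (one_pairs \<eta> d ws). \<gamma> \<subseteq> {A<..<u}} = {}"
      using that one_pairs_subset by fastforce
    then show ?thesis by (metis card.empty)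
  qed
  show ?case
  proof (cases "\<eta> x = c")
    case True
    show ?thesis
    proof (cases t)
      case 0
      then show ?thesis using True empty[of "y # zs" x c] 3(4,5) by simp
    next
      case (Suc t')
      then show ?thesis using True 3(1)[OF True, of x t'] 3(4-6) by simp
    qed
  next
    case False
    show ?thesis
    proof (cases "\<eta> y = \<eta> x")
      case True
      show ?thesis
      proof (cases t)
        case 0
        then show ?thesis using False True empty[of zs y "\<eta> y"] 3(4,5) by simp
      next
        case (Suc t')
        then show ?thesis using False True 3(2)[OF False True, of y t'] 3(4-6) by simp
      qed
    next
      case yx: False
      have zs: "sorted_wrt (<) zs" "\<forall>z\<in>set zs. A < z \<and> z < B" "\<forall>z\<in>set zs. y < z"
        using 3(4,5) by auto
      have len: "t < length (gaps \<eta> c zs)" using 3(6) False yx by simp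
      note IH = 3(3)[OF False yx zs(1,2) len]
      let ?P = "(\<lambda>(x, y). {x, y}) ` set (one_pairs \<eta> c zs)"
      let ?I = "{(A # core \<eta> c zs @ [B]) ! t <..< (core \<eta> c zs @ [B]) ! t}"
      obtain g gs where g: "gaps \<eta> c zs = g # gs" by (cases "gaps \<eta> c zs") auto
      have config_core: "\<forall>z\<in>set (core \<eta> c zs). y < z" using zs(3) set_core[of \<eta> c zs] by auto
      have e: "core \<eta> c (x # y # zs) = core \<eta> c zs" "one_pairs \<eta> c (x # y # zs) = (x, y) # one_pairs \<eta> c zs"
        "gaps \<eta> c (x # y # zs) = Suc g # gs" using yx False g by simp_all
      show ?thesis
      proof (cases t)
        case 0
        have xnot: "{x, y} \<notin> ?P"
        proof
          assume "{x, y} \<in> ?P"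
          then obtain u v where "{x, y} = {u, v}" "u \<in> set zs" "v \<in> set zs" using one_pairs_subset by auto
          then show False using zs(3) by (auto simp: doubleton_eq_iff)
        qed
        have "{x, y} \<subseteq> ?I"
          using 0 3(4,5) config_core by (cases "core \<eta> c zs") auto
        then have "{\<gamma> \<in> insert {x, y} ?P. \<gamma> \<subseteq> ?I} = insert {x, y} {\<gamma> \<in> ?P. \<gamma> \<subseteq> ?I}" by auto
        moreover have "card (insert {x, y} {\<gamma> \<in> ?P. \<gamma> \<subseteq> ?I}) = Suc (card {\<gamma> \<in> ?P. \<gamma> \<subseteq> ?I})"
          using xnot by (subst card_insert_disjoint) auto
        ultimately show ?thesis using IH 0 g unfolding e by simp
      next
        case (Suc t')
        have "(A # core \<eta> c zs @ [B]) ! t \<in> set (core \<eta> c zs)"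
          using Suc len length_gaps[of \<eta> c zs] by (simp add: nth_append)
        then have "\<not> {x, y} \<subseteq> ?I" using config_core by fastforce
        then have "{\<gamma> \<in> insert {x, y} ?P. \<gamma> \<subseteq> ?I} = {\<gamma> \<in> ?P. \<gamma> \<subseteq> ?I}" by auto
        then show ?thesis using IH Suc g unfolding e by simp
      qed
    qed
  qed
qed

lemma sorted_list_drop_least:
  assumes "finite S" "S \<noteq> {}"
  shows "sorted_list_of_set S = Min S # sorted_list_of_set (drop_least S)"
proof -
  have "drop_least S = S - {Min S}"
  proof
    show "drop_least S \<subseteq> S - {Min S}"
    proof
      fix z assume "z \<in> drop_least S"
      then obtain x where "z \<in> S" "x \<in> S" "x < z" by (auto simp: drop_least_def)
      then show "z \<in> S - {Min S}" using Min_le[OF assms(1) \<open>x \<in> S\<close>] by auto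
    qed
    show "S - {Min S} \<subseteq> drop_least S"
    proof
      fix z assume "z \<in> S - {Min S}"
      moreover have "Min S \<in> S" "Min S \<le> z" using calculation assms by auto
      ultimately have "Min S < z" by auto
      then show "z \<in> drop_least S" using \<open>Min S \<in> S\<close> \<open>z \<in> S - {Min S}\<close> by (auto simp: drop_least_def)
    qed
  qed
  then show ?thesis using sorted_list_of_set_nonempty[OF assms] by simp
qed

text \<open>With \<open>tail_drop_firsts\<close>, this shift of the index turns slots of level
  \<open>Suc k\<close> into slots of level \<open>k\<close> of the shrunk solitons.\<close>

lemma head_drop_firsts:
  assumes "finite \<gamma>" "{z \<in> \<gamma>. \<eta> z} \<noteq> {}"
  shows "head \<eta> \<gamma> (Suc i) = head \<eta> (drop_firsts \<eta> \<gamma>) i"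
proof -
  have "{z \<in> drop_firsts \<eta> \<gamma>. \<eta> z} = drop_least {z \<in> \<gamma>. \<eta> z}" by (auto simp: drop_firsts_def drop_least_def)
  then show ?thesis using sorted_list_drop_least[of "{z \<in> \<gamma>. \<eta> z}"] assms by (simp add: head_def)
qed

lemma tail_drop_firsts:
  assumes "finite \<gamma>" "{z \<in> \<gamma>. \<not> \<eta> z} \<noteq> {}"
  shows "tail \<eta> \<gamma> (Suc i) = tail \<eta> (drop_firsts \<eta> \<gamma>) i"
proof -
  have "{z \<in> drop_firsts \<eta> \<gamma>. \<not> \<eta> z} = drop_least {z \<in> \<gamma>. \<not> \<eta> z}" by (auto simp: drop_firsts_def drop_least_def)
  then show ?thesis using sorted_list_drop_least[of "{z \<in> \<gamma>. \<not> \<eta> z}"] assms by (simp add: tail_def)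
qed

lemma nth_sorted_list_image:
  assumes "finite S" "card S = m"
  shows "{sorted_list_of_set S ! i |i. i < m} = S"
  using assms set_conv_nth[of "sorted_list_of_set S"] by simp

lemma soliton_heads_tails:
  assumes "finite \<gamma>" "card {z \<in> \<gamma>. \<eta> z} = m" "card {z \<in> \<gamma>. \<not> \<eta> z} = m"
  shows "{z. \<exists>i<m. z = head \<eta> \<gamma> i \<or> z = tail \<eta> \<gamma> i} = \<gamma>"
proof -
  have "{head \<eta> \<gamma> i |i. i < m} = {z \<in> \<gamma>. \<eta> z}" "{tail \<eta> \<gamma> i |i. i < m} = {z \<in> \<gamma>. \<not> \<eta> z}"
    unfolding head_def tail_def using assms by (intro nth_sorted_list_image; simp)+
  then show ?thesis by blast
qed

section \<open>Solitons and slots of one excursion\<close>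

definition slot_set :: "config \<Rightarrow> (nat \<times> int set) list \<Rightarrow> nat \<Rightarrow> int set" where
  "slot_set \<eta> L k = {z. \<exists>m \<gamma> i. k < m \<and> (m, \<gamma>) \<in> set L \<and> k \<le> i \<and> i < m \<and>
     (z = head \<eta> \<gamma> i \<or> z = tail \<eta> \<gamma> i)}"

text \<open>The invariant of the induction over rounds. The positions 0 and \<open>N + 1\<close> are
  the records around the excursion; the boxes of the \<open>k\<close>-th core are the other
  \<open>k\<close>-slots, and its gaps count solitons of size \<open>Suc k\<close>. The order by
  size is part of it because locating a soliton between two slots uses that smaller solitons are
  deleted earlier.\<close>

definition solved :: "config \<Rightarrow> int \<Rightarrow> int list \<Rightarrow> (nat \<times> int set) list \<Rightarrow> bool" where
  "solved \<eta> N xs L \<longleftrightarrow>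
     sorted (map fst L) \<and> \<Union>(snd ` set L) = set xs \<and>
     (\<forall>k. slot_set \<eta> L k = set ((core \<eta> False ^^ k) xs)) \<and>
     (\<forall>k. card {\<gamma>. (Suc k, \<gamma>) \<in> set L} = sum_list (gaps \<eta> False ((core \<eta> False ^^ k) xs))) \<and>
     (\<forall>k t. t < length (gaps \<eta> False ((core \<eta> False ^^ k) xs)) \<longrightarrow>
        card {\<gamma>. (Suc k, \<gamma>) \<in> set L \<and>
          \<gamma> \<subseteq> {(0 # (core \<eta> False ^^ Suc k) xs @ [N + 1]) ! t <..<
              ((core \<eta> False ^^ Suc k) xs @ [N + 1]) ! t}}
        = gaps \<eta> False ((core \<eta> False ^^ k) xs) ! t)"

lemma one_pairs_distinct:
  "sorted_wrt (<) xs \<Longrightarrow> card ((\<lambda>(x, y). {x, y}) ` set (one_pairs \<eta> c xs)) = sum_list (gaps \<eta> c xs)"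
proof (induction \<eta> c xs rule: core.induct)
  case (3 \<eta> c x y zs)
  show ?case
  proof (cases "\<eta> x = c")
    case True
    then show ?thesis using 3(1)[OF True] 3(4) by simp
  next
    case False
    show ?thesis
    proof (cases "\<eta> y = \<eta> x")
      case True
      then show ?thesis using 3(2)[OF False True] 3(4) False by simp
    next
      case yx: False
      have "{x, y} \<notin> (\<lambda>(x, y). {x, y}) ` set (one_pairs \<eta> c zs)"
      proof
        assume "{x, y} \<in> (\<lambda>(x, y). {x, y}) ` set (one_pairs \<eta> c zs)"
        then obtain u v where "{x, y} = {u, v}" "u \<in> set zs" "v \<in> set zs" using one_pairs_subset by auto
        then show False using 3(4) by (auto simp: doubleton_eq_iff)
      qed
      then show ?thesis using 3(3)[OF False yx] 3(4) False yx by (simp add: sum_list_bump)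
    qed
  qed
qed auto

locale bounded_config =
  fixes \<eta> :: config and N :: int
  assumes balls: "\<eta> z \<Longrightarrow> 1 \<le> z \<and> z \<le> N" and N: "0 \<le> N"
begin

abbreviation start_blocks :: "int list \<Rightarrow> int set list" where
  "start_blocks xs \<equiv> run_blocks \<eta> N {..0} False xs"

abbreviation config_core :: "int list \<Rightarrow> int list" where
  "config_core \<equiv> core \<eta> False"

text \<open>Boxes of \<open>{1..N}\<close> outside \<open>xs\<close> count as deleted, so the runs
  of \<open>xs\<close> need not be intervals of integers.\<close>

definition good_list :: "int list \<Rightarrow> bool" where
  "good_list xs \<longleftrightarrow> sorted_wrt (<) xs \<and> set xs \<subseteq> {1..N} \<and> dyck 0 (map \<eta> xs)"

lemma start_blocks_blocks:
  assumes "good_list xs"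
  shows "blocks \<eta> (start_blocks xs)" "framed (start_blocks xs)" "\<Union>(set (start_blocks xs)) = {..0} \<union> set xs \<union> {N<..}"
proof -
  have "\<forall>z>N. \<not> \<eta> z" using balls by force
  moreover have "\<forall>z\<in>{..0}. \<eta> z = False" using balls by force
  moreover have "{..0 :: int} \<noteq> {}" by auto
  ultimately have "blocks \<eta> (start_blocks xs) \<and> \<Union>(set (start_blocks xs)) = {..0} \<union> set xs \<union> {N<..}"
    using assms N unfolding good_list_def by (intro run_blocks_props) force+
  then show "blocks \<eta> (start_blocks xs)" "\<Union>(set (start_blocks xs)) = {..0} \<union> set xs \<union> {N<..}" by blast+
  show "framed (start_blocks xs)" by (rule run_blocks_framed) (rule infinite_Iic)
qed

lemma good_config_core: "good_list xs \<Longrightarrow> good_list (config_core xs)"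
  unfolding good_list_def using sorted_core[of "(<)" xs \<eta> False] set_core[of \<eta> False xs]
  by (auto simp: map_core intro: dyck_wcore)

lemma good_config_core_pow: "good_list xs \<Longrightarrow> good_list ((config_core ^^ k) xs)"
  by (induction k) (auto intro: good_config_core)

lemma decompose:
  assumes "good_list xs"
  shows "\<exists>L1. block_exec (start_blocks xs) (one_picks \<eta> False xs @ L1) \<and>
     block_exec (start_blocks (config_core xs)) (map (\<lambda>(k, \<gamma>). (k - 1, drop_firsts \<eta> \<gamma>)) L1) \<and>
     (\<forall>(k, \<gamma>)\<in>set L1. 2 \<le> k) \<and>
     set (run_firsts \<eta> False xs) \<subseteq> \<Union>(snd ` set L1) \<and> (\<forall>(k, \<gamma>)\<in>set L1. \<gamma> - drop_firsts \<eta> \<gamma> \<subseteq> set (run_firsts \<eta> False xs)) \<and>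
     set xs = set (config_core xs) \<union> set (run_firsts \<eta> False xs) \<union> (\<Union>(x, y)\<in>set (one_pairs \<eta> False xs). {x, y})"
proof -
  have xs: "sorted_wrt (<) xs" "\<forall>x\<in>set xs. x \<le> N" "dyck 0 (map \<eta> xs)"
    using assms by (auto simp: good_list_def)
  note fs = thin_blocks_structure[OF xs(1,2), where h=0 and c=False and \<eta>=\<eta>, simplified, OF xs(3)]
  obtain Y T where Y: "\<forall>C. thin_blocks \<eta> N C False xs = (C \<union> Y) # T"
     "\<forall>C. run_blocks \<eta> N C False (config_core xs) = (C \<union> Y) # map drop_least T"
     "\<forall>R\<in>set T. thick R" "{f. \<exists>R\<in>set T. least_in R f} = set (run_firsts \<eta> False xs)"
    using conjunct1[OF fs] by (elim exE conjE)
  have th: "thick {..0 :: int}" by (simp add: thick_def infinite_Iic)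
  have ph: "\<And>L. (block_exec (thin_blocks \<eta> N {..0} False xs) L \<longrightarrow> block_exec (start_blocks xs) (one_picks \<eta> False xs @ L))"
    "blocks \<eta> (thin_blocks \<eta> N {..0} False xs) \<and> framed (thin_blocks \<eta> N {..0} False xs)"
    using block_exec_one_picks[OF xs(1,2), of "[]" "{..0}" \<eta> False] th start_blocks_blocks[OF assms] by auto
  obtain L1 where L1: "block_exec (thin_blocks \<eta> N {..0} False xs) L1" using ex_block_exec ph(2) by blast
  have "\<forall>R\<in>set (thin_blocks \<eta> N {..0} False xs). thick R"
    using Y(1,3) thick_Un[OF th, of Y] by simp
  note bs = block_exec_shrink[OF L1 conjunct1[OF ph(2)] conjunct2[OF ph(2)] this]
  have e: "shrink (thin_blocks \<eta> N {..0} False xs) = start_blocks (config_core xs)"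
    using Y(1,2) by (simp add: shrink_def)
  have "first_set (thin_blocks \<eta> N {..0} False xs) = set (run_firsts \<eta> False xs)"
    using Y(1,4) by (simp add: first_set_def)
  note fe = this
  show ?thesis
    using conjunct1[OF bs] conjunct2[OF bs] first_set_block_exec[OF L1 conjunct1[OF ph(2)]] ph(1)[rule_format, OF L1] conjunct2[OF fs]
    unfolding e fe by (intro exI[of _ L1] conjI) simp_all
qed

text \<open>Smaller solitons come first in the list, so the boxes of \<open>\<gamma>'\<close> are
  still present when \<open>\<gamma>\<close> is picked.\<close>

lemma not_straddling:
  assumes "block_exec (start_blocks xs) L" "good_list xs" "sorted (map fst L)"
    "(k, \<gamma>) \<in> set L" "(m, \<gamma>') \<in> set L" "k < m" "x \<in> \<gamma>" "y \<in> \<gamma>" "x \<le> z" "z \<le> y"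
  shows "z \<notin> \<gamma>'"
proof
  assume z: "z \<in> \<gamma>'"
  obtain L1 L2 where L: "L = L1 @ (k, \<gamma>) # L2" using assms(4) by (auto dest: split_list)
  have "(m, \<gamma>') \<notin> set L1" using assms(3,6) unfolding L by (force simp: sorted_append)
  then have "(m, \<gamma>') \<in> set L2" using assms(5,6) L by auto
  then show False
    using block_exec_later[OF assms(1) start_blocks_blocks(1)[OF assms(2)] L _ z assms(7,8,9,10)] by blast
qed

lemma slot_set_in_soliton:
  assumes "block_exec (start_blocks xs) L" "good_list xs" "z \<in> slot_set \<eta> L k"
  shows "\<exists>m \<gamma>. k < m \<and> (m, \<gamma>) \<in> set L \<and> z \<in> \<gamma>"
proof -
  obtain m \<gamma> i where m: "k < m" "(m, \<gamma>) \<in> set L" "i < m" "z = head \<eta> \<gamma> i \<or> z = tail \<eta> \<gamma> i"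
    using assms(3) unfolding slot_set_def by blast
  have "finite \<gamma> \<and> card {z \<in> \<gamma>. \<eta> z} = m \<and> card {z \<in> \<gamma>. \<not> \<eta> z} = m"
    using block_exec_solitons[OF assms(1) start_blocks_blocks(1)[OF assms(2)] m(2)] by blast
  then have "{z. \<exists>i<m. z = head \<eta> \<gamma> i \<or> z = tail \<eta> \<gamma> i} = \<gamma>"
    using soliton_heads_tails by blast
  then have "z \<in> \<gamma>" using m(3,4) by blast
  then show ?thesis using m by blast
qed

text \<open>The automaton accounts for the 1-solitons. Larger solitons correspond to the solitons of
  the core through \<open>drop_firsts\<close>, which lowers the size and the head and tail indices
  by 1; so the clauses for level \<open>Suc k\<close> reduce to those for level \<open>k\<close> of
  the core.\<close>

lemma solved_step:
  assumes xs: "good_list xs"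
    and L: "block_exec (start_blocks xs) L" "L = one_picks \<eta> False xs @ L1"
    and L': "L' = map (\<lambda>(k, \<gamma>). (k - 1, drop_firsts \<eta> \<gamma>)) L1" "block_exec (start_blocks (config_core xs)) L'"
    and two: "\<forall>(k, \<gamma>)\<in>set L1. 2 \<le> k"
    and fr: "set (run_firsts \<eta> False xs) \<subseteq> \<Union>(snd ` set L1)" "\<forall>(k, \<gamma>)\<in>set L1. \<gamma> - drop_firsts \<eta> \<gamma> \<subseteq> set (run_firsts \<eta> False xs)"
    and un: "set xs = set (config_core xs) \<union> set (run_firsts \<eta> False xs) \<union> (\<Union>(x, y)\<in>set (one_pairs \<eta> False xs). {x, y})"
    and IH: "solved \<eta> N (config_core xs) L'"
  shows "solved \<eta> N xs L"
proof -
  note B = start_blocks_blocks(1)[OF xs]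
  have L1L: "set L = set (one_picks \<eta> False xs) \<union> set L1" using L(2) by simp
  have one: "k = 1" if "(k, \<gamma>) \<in> set (one_picks \<eta> False xs)" for k \<gamma> using that by auto
  have in1: "(Suc (Suc k), \<gamma>) \<in> set L \<longleftrightarrow> (Suc (Suc k), \<gamma>) \<in> set L1" for k \<gamma>
    using one unfolding L1L by fastforce
  have in0: "(Suc 0, \<gamma>) \<in> set L \<longleftrightarrow> \<gamma> \<in> (\<lambda>(x, y). {x, y}) ` set (one_pairs \<eta> False xs)" for \<gamma>
    using two unfolding L1L by force
  have L'I: "(m, drop_firsts \<eta> \<gamma>) \<in> set L'" if "(Suc m, \<gamma>) \<in> set L1" for m \<gamma>
    using that unfolding L'(1) by force
  have L'D: "\<exists>\<gamma>. (Suc m, \<gamma>) \<in> set L1 \<and> \<gamma>' = drop_firsts \<eta> \<gamma>" if "(m, \<gamma>') \<in> set L'" for m \<gamma>'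
    using that two unfolding L'(1) by force
  have rsub: "drop_firsts \<eta> \<gamma> \<subseteq> \<gamma>" for \<gamma> by (auto simp: drop_firsts_def)
  have s: "sorted (map fst L)"
  proof -
    have "sorted (map fst L')" using IH unfolding solved_def by blast
    then have "sorted (map (\<lambda>k. k - 1) (map fst L1))" unfolding L'(1) by (simp add: case_prod_unfold comp_def)
    moreover have "map Suc (map (\<lambda>k. k - 1) (map fst L1)) = map fst L1"
      unfolding map_map by (rule map_cong[OF refl]) (use two in fastforce)
    moreover have "sorted (map Suc ks)" if "sorted ks" for ks :: "nat list"
      using that by (simp add: sorted_wrt_map)
    ultimately have "sorted (map fst L1)" by metis
    moreover have "\<forall>x\<in>set (map fst (one_picks \<eta> False xs)). x = 1" by auto
    moreover have "\<forall>y\<in>set (map fst L1). 2 \<le> y" using two by auto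
    moreover have "sorted (map fst (one_picks \<eta> False xs))" by (simp add: case_prod_unfold comp_def map_replicate_const)
    ultimately show ?thesis unfolding L(2) map_append sorted_append by fastforce
  qed
  have U: "\<Union>(snd ` set L) = set xs"
  proof -
    have "\<Union>(snd ` set L') = set (config_core xs)" using IH unfolding solved_def by blast
    then have r: "(\<Union>(k, \<gamma>)\<in>set L1. drop_firsts \<eta> \<gamma>) = set (config_core xs)" unfolding L'(1) by (force simp: case_prod_unfold)
    have "\<Union>(snd ` set L1) = set (config_core xs) \<union> set (run_firsts \<eta> False xs)"
    proof
      show "\<Union>(snd ` set L1) \<subseteq> set (config_core xs) \<union> set (run_firsts \<eta> False xs)"
      proof
        fix z assume "z \<in> \<Union>(snd ` set L1)"
        then obtain k \<gamma> where g: "(k, \<gamma>) \<in> set L1" "z \<in> \<gamma>" by force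
        then have "z \<in> drop_firsts \<eta> \<gamma> \<or> z \<in> set (run_firsts \<eta> False xs)" using fr(2) by blast
        then show "z \<in> set (config_core xs) \<union> set (run_firsts \<eta> False xs)" using g(1) unfolding r[symmetric] by blast
      qed
      show "set (config_core xs) \<union> set (run_firsts \<eta> False xs) \<subseteq> \<Union>(snd ` set L1)"
      proof -
        have "(\<Union>(k, \<gamma>)\<in>set L1. drop_firsts \<eta> \<gamma>) \<subseteq> (\<Union>(k, \<gamma>)\<in>set L1. \<gamma>)" using rsub by blast
        then show ?thesis using fr(1) unfolding r[symmetric] by (auto simp: case_prod_unfold)
      qed
    qed
    moreover have "\<Union>(snd ` set (one_picks \<eta> False xs)) = (\<Union>(x, y)\<in>set (one_pairs \<eta> False xs). {x, y})" by force
    ultimately show ?thesis unfolding L1L un by blast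
  qed
  have thin_blocks: "finite \<gamma> \<and> card {z \<in> \<gamma>. \<eta> z} = m \<and> card {z \<in> \<gamma>. \<not> \<eta> z} = m" if "(m, \<gamma>) \<in> set L" for m \<gamma>
    using block_exec_solitons[OF L(1) B that] by blast
  have slots: "slot_set \<eta> L k = set ((config_core ^^ k) xs)" for k
  proof (cases k)
    case 0
    have "slot_set \<eta> L 0 = \<Union>(snd ` set L)"
    proof
      show "slot_set \<eta> L 0 \<subseteq> \<Union>(snd ` set L)"
      proof
        fix z assume "z \<in> slot_set \<eta> L 0"
        then obtain m \<gamma> where "(m, \<gamma>) \<in> set L" "z \<in> \<gamma>" using slot_set_in_soliton[OF L(1) xs] by blast
        then show "z \<in> \<Union>(snd ` set L)" by force
      qed
      show "\<Union>(snd ` set L) \<subseteq> slot_set \<eta> L 0"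
      proof
        fix z assume "z \<in> \<Union>(snd ` set L)"
        then obtain m \<gamma> where g: "(m, \<gamma>) \<in> set L" "z \<in> \<gamma>" by force
        then obtain i where "i < m" "z = head \<eta> \<gamma> i \<or> z = tail \<eta> \<gamma> i"
          using soliton_heads_tails[of \<gamma> \<eta> m] thin_blocks[OF g(1)] by blast
        moreover have "0 < m" using \<open>i < m\<close> by simp
        ultimately show "z \<in> slot_set \<eta> L 0" using g(1) unfolding slot_set_def by blast
      qed
    qed
    then show ?thesis using U 0 by simp
  next
    case (Suc k')
    have ht: "head \<eta> \<gamma> (Suc i) = head \<eta> (drop_firsts \<eta> \<gamma>) i" "tail \<eta> \<gamma> (Suc i) = tail \<eta> (drop_firsts \<eta> \<gamma>) i"
      if "(Suc m, \<gamma>) \<in> set L1" for m \<gamma> i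
    proof -
      have f: "finite \<gamma>" "card {z \<in> \<gamma>. \<eta> z} = Suc m" "card {z \<in> \<gamma>. \<not> \<eta> z} = Suc m"
        using thin_blocks[of "Suc m" \<gamma>] that L1L by auto
      have ne: "S \<noteq> {}" if "card S = Suc m" for S :: "int set" using that by auto
      show "head \<eta> \<gamma> (Suc i) = head \<eta> (drop_firsts \<eta> \<gamma>) i" "tail \<eta> \<gamma> (Suc i) = tail \<eta> (drop_firsts \<eta> \<gamma>) i"
        by (rule head_drop_firsts[OF f(1) ne[OF f(2)]], rule tail_drop_firsts[OF f(1) ne[OF f(3)]])
    qed
    have "slot_set \<eta> L (Suc k') = slot_set \<eta> L' k'"
    proof
      show "slot_set \<eta> L (Suc k') \<subseteq> slot_set \<eta> L' k'"
      proof
        fix z assume "z \<in> slot_set \<eta> L (Suc k')"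
        then obtain m \<gamma> i where m: "Suc k' < m" "(m, \<gamma>) \<in> set L" "Suc k' \<le> i" "i < m"
          "z = head \<eta> \<gamma> i \<or> z = tail \<eta> \<gamma> i" unfolding slot_set_def by blast
        obtain m' i' where mi: "m = Suc m'" "i = Suc i'" using m by (cases m; cases i) auto
        have "(Suc m', \<gamma>) \<in> set L1" using m(1,2) in1 mi by (cases m') auto
        then show "z \<in> slot_set \<eta> L' k'"
          using m mi ht[of m' \<gamma> i'] L'I[of m' \<gamma>] unfolding slot_set_def
          by (intro CollectI exI[of _ m'] exI[of _ "drop_firsts \<eta> \<gamma>"] exI[of _ i']) auto
      qed
      show "slot_set \<eta> L' k' \<subseteq> slot_set \<eta> L (Suc k')"
      proof
        fix z assume "z \<in> slot_set \<eta> L' k'"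
        then obtain m \<gamma>' i where m: "k' < m" "(m, \<gamma>') \<in> set L'" "k' \<le> i" "i < m"
          "z = head \<eta> \<gamma>' i \<or> z = tail \<eta> \<gamma>' i" unfolding slot_set_def by blast
        obtain \<gamma> where "(Suc m, \<gamma>) \<in> set L1" "\<gamma>' = drop_firsts \<eta> \<gamma>" using L'D m(2) by blast
        then show "z \<in> slot_set \<eta> L (Suc k')"
          using m ht[of m \<gamma> i] L1L unfolding slot_set_def
          by (intro CollectI exI[of _ "Suc m"] exI[of _ \<gamma>] exI[of _ "Suc i"]) auto
      qed
    qed
    then show ?thesis using IH Suc unfolding solved_def by (simp add: funpow_swap1)
  qed
  \<comment> \<open>Solitons are disjoint, and a soliton of size at least 2 leaves a nonempty
    remainder, which identifies it.\<close>
  have inj: "inj_on (drop_firsts \<eta>) {\<gamma>. (Suc (Suc k), \<gamma>) \<in> set L}" for k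
  proof (rule inj_onI, clarify)
    fix \<gamma> \<gamma>2 assume g: "(Suc (Suc k), \<gamma>) \<in> set L" "(Suc (Suc k), \<gamma>2) \<in> set L" "drop_firsts \<eta> \<gamma> = drop_firsts \<eta> \<gamma>2"
    have "(Suc k, drop_firsts \<eta> \<gamma>) \<in> set L'" using L'I in1 g(1) by blast
    then have "card {z \<in> drop_firsts \<eta> \<gamma>. \<eta> z} = Suc k"
      using block_exec_solitons[OF L'(2) start_blocks_blocks(1)[OF good_config_core[OF xs]]] by blast
    then obtain z where "z \<in> drop_firsts \<eta> \<gamma>" by (metis (lifting) card.empty Collect_empty_eq Zero_not_Suc)
    then show "\<gamma> = \<gamma>2" using block_exec_disjoint[OF L(1) B g(1,2), of z] g(3) rsub by blast
  qed
  have img: "drop_firsts \<eta> ` {\<gamma>. (Suc (Suc k), \<gamma>) \<in> set L} = {\<gamma>'. (Suc k, \<gamma>') \<in> set L'}" for k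
    using L'I L'D in1 by fast
  have total: "card {\<gamma>. (Suc k, \<gamma>) \<in> set L} = sum_list (gaps \<eta> False ((config_core ^^ k) xs))" for k
  proof (cases k)
    case 0
    then show ?thesis using one_pairs_distinct[of xs \<eta> False] xs in0 by (simp add: good_list_def)
  next
    case (Suc k')
    have "card {\<gamma>. (Suc (Suc k'), \<gamma>) \<in> set L} = card {\<gamma>'. (Suc k', \<gamma>') \<in> set L'}"
      using card_image[OF inj[of k']] img[of k'] by simp
    then show ?thesis using IH Suc unfolding solved_def by (simp add: funpow_swap1)
  qed
  have count: "card {\<gamma>. (Suc k, \<gamma>) \<in> set L \<and>
          \<gamma> \<subseteq> {(0 # (config_core ^^ Suc k) xs @ [N + 1]) ! t <..< ((config_core ^^ Suc k) xs @ [N + 1]) ! t}}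
        = gaps \<eta> False ((config_core ^^ k) xs) ! t" if t: "t < length (gaps \<eta> False ((config_core ^^ k) xs))" for k t
  proof (cases k)
    case 0
    then show ?thesis using gaps_count[of xs 0 "N + 1" t \<eta> False] xs t
      by (force simp: good_list_def in0)
  next
    case (Suc k')
    define S where "S = (config_core ^^ Suc k) xs"
    define s s' where "s = (0 # S @ [N + 1]) ! t" and "s' = (S @ [N + 1]) ! t"
    have S': "S = (config_core ^^ Suc k') (config_core xs)" unfolding S_def Suc by (simp add: funpow_swap1)
    have g': "gaps \<eta> False ((config_core ^^ k) xs) = gaps \<eta> False ((config_core ^^ k') (config_core xs))"
      unfolding Suc by (simp add: funpow_swap1)
    have lenS: "length (gaps \<eta> False ((config_core ^^ k) xs)) = Suc (length S)"
      by (simp add: length_gaps S_def)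
    have ss: "s = 0 \<or> s \<in> set S" "s' = N + 1 \<or> s' \<in> set S"
      using t lenS unfolding s_def s'_def by (auto simp: nth_append nth_Cons split: nat.splits)
    \<comment> \<open>Each of \<open>s\<close> and \<open>s'\<close> is a record or a box of a
      soliton larger than \<open>Suc k\<close>. No such box lies in the span of
      \<open>\<gamma>\<close>, so all of \<open>\<gamma>\<close> is between them as soon as its
      remainder is.\<close>
    have key: "\<gamma> \<subseteq> {s<..<s'}" if g: "(Suc k, \<gamma>) \<in> set L" "drop_firsts \<eta> \<gamma> \<subseteq> {s<..<s'}" "drop_firsts \<eta> \<gamma> \<noteq> {}" for \<gamma>
    proof
      obtain z where z: "z \<in> \<gamma>" "s < z" "z < s'" using g(2,3) rsub by fastforce
      fix y assume y: "y \<in> \<gamma>"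
      have "\<gamma> \<subseteq> set xs" using U g(1) by force
      then have y1: "1 \<le> y" "y \<le> N" using y xs by (auto simp: good_list_def)
      have no: "u \<notin> set S" if "a \<in> \<gamma>" "b \<in> \<gamma>" "a \<le> u" "u \<le> b" for u a b
      proof
        assume "u \<in> set S"
        then have "u \<in> slot_set \<eta> L (Suc k)" using slots[of "Suc k"] S_def by simp
        then obtain m \<gamma>' where "Suc k < m" "(m, \<gamma>') \<in> set L" "u \<in> \<gamma>'"
          using slot_set_in_soliton[OF L(1) xs] by blast
        then show False using not_straddling[OF L(1) xs s g(1) _ _ that(1,2,3,4)] by blast
      qed
      have "s < y" using no[OF y z(1), of s] ss(1) y1 z(2) by linarith
      moreover have "y < s'" using no[OF z(1) y, of s'] ss(2) y1 z(3) by linarith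
      ultimately show "y \<in> {s<..<s'}" by simp
    qed
    have ne: "drop_firsts \<eta> \<gamma> \<noteq> {}" if "(Suc k, \<gamma>) \<in> set L" for \<gamma>
    proof -
      have "(Suc k', drop_firsts \<eta> \<gamma>) \<in> set L'" using L'I in1 that Suc by blast
      then have "card {z \<in> drop_firsts \<eta> \<gamma>. \<eta> z} = Suc k'"
        using block_exec_solitons[OF L'(2) start_blocks_blocks(1)[OF good_config_core[OF xs]]] by blast
      then show ?thesis by (metis (lifting) card.empty Collect_empty_eq Zero_not_Suc emptyE)
    qed
    let ?A = "{\<gamma>. (Suc k, \<gamma>) \<in> set L \<and> \<gamma> \<subseteq> {s<..<s'}}"
    have "drop_firsts \<eta> ` ?A = {\<gamma>'. (Suc k', \<gamma>') \<in> set L' \<and> \<gamma>' \<subseteq> {s<..<s'}}"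
    proof
      show "drop_firsts \<eta> ` ?A \<subseteq> {\<gamma>'. (Suc k', \<gamma>') \<in> set L' \<and> \<gamma>' \<subseteq> {s<..<s'}}"
        using L'I in1 Suc rsub by blast
      show "{\<gamma>'. (Suc k', \<gamma>') \<in> set L' \<and> \<gamma>' \<subseteq> {s<..<s'}} \<subseteq> drop_firsts \<eta> ` ?A"
      proof
        fix \<gamma>' assume a: "\<gamma>' \<in> {\<gamma>'. (Suc k', \<gamma>') \<in> set L' \<and> \<gamma>' \<subseteq> {s<..<s'}}"
        then obtain \<gamma> where g: "(Suc k, \<gamma>) \<in> set L" "\<gamma>' = drop_firsts \<eta> \<gamma>" using L'D in1 Suc by blast
        then have "\<gamma> \<in> ?A" using key ne a by blast
        then show "\<gamma>' \<in> drop_firsts \<eta> ` ?A" using g by blast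
      qed
    qed
    moreover have "inj_on (drop_firsts \<eta>) ?A" by (rule inj_on_subset[OF inj[of k']]) (use Suc in blast)
    ultimately have "card ?A = card {\<gamma>'. (Suc k', \<gamma>') \<in> set L' \<and> \<gamma>' \<subseteq> {s<..<s'}}"
      using card_image[of "drop_firsts \<eta>" ?A] by simp
    also have "\<dots> = gaps \<eta> False ((config_core ^^ k) xs) ! t"
      using IH t unfolding solved_def g' s_def s'_def S' by blast
    finally show ?thesis unfolding s_def s'_def S_def .
  qed
  show ?thesis unfolding solved_def using s U slots total count by blast
qed

lemma ex_solved: "good_list xs \<Longrightarrow> \<exists>L. block_exec (start_blocks xs) L \<and> solved \<eta> N xs L"
proof (induction "length xs" arbitrary: xs rule: less_induct)
  case less
  show ?case
  proof (cases "xs = []")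
    case True
    have "(config_core ^^ k) [] = []" for k by (induction k) auto
    then have "solved \<eta> N xs []" unfolding True solved_def slot_set_def by auto
    moreover have "block_exec (start_blocks xs) []" using True by (auto intro: block_exec.stop)
    ultimately show ?thesis by blast
  next
    case False
    obtain L1 where d: "block_exec (start_blocks xs) (one_picks \<eta> False xs @ L1)"
     "block_exec (start_blocks (config_core xs)) (map (\<lambda>(k, \<gamma>). (k - 1, drop_firsts \<eta> \<gamma>)) L1)"
     "\<forall>(k, \<gamma>)\<in>set L1. 2 \<le> k"
     "set (run_firsts \<eta> False xs) \<subseteq> \<Union>(snd ` set L1)" "\<forall>(k, \<gamma>)\<in>set L1. \<gamma> - drop_firsts \<eta> \<gamma> \<subseteq> set (run_firsts \<eta> False xs)"
     "set xs = set (config_core xs) \<union> set (run_firsts \<eta> False xs) \<union> (\<Union>(x, y)\<in>set (one_pairs \<eta> False xs). {x, y})"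
      using decompose[OF less.prems] by blast
    have "length (wcore (map \<eta> xs)) < length (map \<eta> xs)"
      using length_wcore_less[of "map \<eta> xs"] less.prems False unfolding good_list_def by blast
    then have "length (config_core xs) < length xs" by (simp add: map_core[symmetric])
    then obtain L' where L': "block_exec (start_blocks (config_core xs)) L'" "solved \<eta> N (config_core xs) L'"
      using less.hyps good_config_core[OF less.prems] by blast
    note g = good_config_core[OF less.prems]
    \<comment> \<open>The induction provides some execution on the core and \<open>decompose\<close>
      another one; uniqueness identifies them.\<close>
    have "L' = map (\<lambda>(k, \<gamma>). (k - 1, drop_firsts \<eta> \<gamma>)) L1"
      using block_exec_unique[OF L'(1) start_blocks_blocks(1,2)[OF g] d(2) start_blocks_blocks(1,2)[OF g]] by simp
    then show ?thesis using solved_step[OF less.prems d(1) refl _ L'(1) d(3-6) L'(2)] d(1) by blast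
  qed
qed

end

section \<open>Excursions as words\<close>

fun path :: "int \<Rightarrow> bool list \<Rightarrow> int list" where
  "path a [] = [a]"
| "path a (b # w) = a # path (if b then a + 1 else a - 1) w"

fun steps :: "int list \<Rightarrow> bool list" where
  "steps (a # b # e) = (a < b) # steps (b # e)"
| "steps e = []"

lemma length_path [simp]: "length (path a w) = Suc (length w)"
  by (induction w arbitrary: a) auto

lemma path_nth_0 [simp]: "path a w ! 0 = a"
  by (cases w) auto

lemma path_step: "i < length w \<Longrightarrow> path a w ! Suc i = path a w ! i + (if w ! i then 1 else -1)"
proof (induction w arbitrary: a i)
  case (Cons b w)
  then show ?case by (cases i) auto
qed simp

lemma steps_path: "steps (path a w) = w"
proof (induction w arbitrary: a)
  case (Cons b w)
  then show ?case by (cases w) auto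
qed simp

lemma path_steps:
  "e \<noteq> [] \<Longrightarrow> (\<And>i. Suc i < length e \<Longrightarrow> \<bar>e ! Suc i - e ! i\<bar> = 1) \<Longrightarrow> path (hd e) (steps e) = e"
proof (induction e rule: steps.induct)
  case (1 a b e)
  have "path (hd (b # e)) (steps (b # e)) = b # e"
  proof (rule 1(1))
    show "\<bar>(b # e) ! Suc i - (b # e) ! i\<bar> = 1" if "Suc i < length (b # e)" for i
      using 1(3)[of "Suc i"] that by simp
  qed simp
  moreover have "(if a < b then a + 1 else a - 1) = b" using 1(3)[of 0] by auto
  ultimately show ?case by simp
qed auto

lemma dyck_iff_path:
  "dyck h w \<longleftrightarrow> (\<forall>z\<le>length w. 0 \<le> path (int h) w ! z) \<and> path (int h) w ! length w = 0"
proof (induction w arbitrary: h)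
  case (Cons b w)
  show ?case
  proof (cases b)
    case True
    then have "dyck h (b # w) \<longleftrightarrow> dyck (Suc h) w" by simp
    then show ?thesis using Cons[of "Suc h"] True
      by (auto simp: add.commute nth_Cons split: nat.splits)
  next
    case False
    show ?thesis
    proof (cases h)
      case 0
      have "path (-1) w ! 0 = -1" by simp
      then show ?thesis using 0 False by (force intro!: exI[of _ "1 :: nat"])
    next
      case (Suc h')
      then show ?thesis using Cons[of h'] False
        by (auto simp: nth_Cons split: nat.splits)
    qed
  qed
qed auto

text \<open>The soliton count writes the length as a sum of even terms.\<close>

lemma even_length_dyck: "dyck 0 w \<Longrightarrow> even (length w)"
  by (subst length_word_solitons[of w "length w"]) (auto intro!: dvd_sum)

lemma excursions_eq: "excursions = path 0 ` {w. dyck 0 w}"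
proof
  show "path 0 ` {w. dyck 0 w} \<subseteq> excursions"
  proof
    fix e assume "e \<in> path 0 ` {w. dyck 0 w}"
    then obtain w where w: "e = path 0 w" "dyck 0 w" by auto
    obtain n where n: "length w = 2 * n" using even_length_dyck[OF w(2)] by (auto elim: evenE)
    have "\<bar>path 0 w ! z - path 0 w ! (z - 1)\<bar> = 1" if "z \<in> {1..2 * n}" for z
      using path_step[of "z - 1" w 0] that n by auto
    then show "e \<in> excursions" using w dyck_iff_path[of 0 w] n
      unfolding excursions_def by (intro CollectI exI[of _ n]) auto
  qed
  show "excursions \<subseteq> path 0 ` {w. dyck 0 w}"
  proof
    fix e assume "e \<in> excursions"
    then obtain n where n: "length e = 2 * n + 1" "e ! 0 = 0" "e ! (2 * n) = 0" "\<forall>z\<le>2 * n. 0 \<le> e ! z"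
      "\<forall>z\<in>{1..2 * n}. \<bar>e ! z - e ! (z - 1)\<bar> = 1" unfolding excursions_def by blast
    have ne: "e \<noteq> []" using n(1) by auto
    have "\<bar>e ! Suc i - e ! i\<bar> = 1" if "Suc i < length e" for i
      using n(5)[rule_format, of "Suc i"] that n(1) by simp
    then have p: "path 0 (steps e) = e" using path_steps[OF ne] n(2) ne by (simp add: hd_conv_nth)
    have "length (steps e) = 2 * n" using arg_cong[OF p, of length] n(1) by simp
    then have "dyck 0 (steps e)" using dyck_iff_path[of 0 "steps e"] p n by simp
    then show "e \<in> path 0 ` {w. dyck 0 w}" using p by (metis imageI mem_Collect_eq)
  qed
qed

lemma inj_path: "inj (path a)"
  by (metis injI steps_path)

lemma ball_config_path:
  "ball_config (path 0 w) z \<longleftrightarrow> 1 \<le> z \<and> z \<le> int (length w) \<and> w ! (nat z - 1)"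
proof (cases "1 \<le> z \<and> z \<le> int (length w)")
  case True
  then obtain i where i: "nat z = Suc i" "i < length w" by (cases "nat z") auto
  have "nat (z - 1) = i" using i by linarith
  then show ?thesis using True path_step[OF i(2), of 0] i(1) by (auto simp: ball_config_def)
qed (auto simp: ball_config_def)

text \<open>Here \<open>core\<close> runs on positions, with the contents as key, so the recursion
  for words also yields the places of the slots. The leading 0 is the record.\<close>

definition slot_list :: "nat \<Rightarrow> bool list \<Rightarrow> int list" where
  "slot_list k w = 0 # (core (ball_config (path 0 w)) False ^^ k) [1..int (length w)]"

lemma map_ball_config_path: "map (ball_config (path 0 w)) [1..int (length w)] = w"
proof (rule nth_equalityI)
  fix i assume "i < length (map (ball_config (path 0 w)) [1..int (length w)])"
  then show "map (ball_config (path 0 w)) [1..int (length w)] ! i = w ! i"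
    by (auto simp: ball_config_path nat_add_distrib)
qed simp

lemma map_core_pow: "map f ((core f False ^^ k) xs) = (wcore ^^ k) (map f xs)"
  by (induction k) (auto simp: map_core)

lemma length_slot_list: "length (slot_list k w) = Suc (length ((wcore ^^ k) w))"
  using arg_cong[OF map_core_pow[of "ball_config (path 0 w)" k "[1..int (length w)]"], of length]
  by (simp add: slot_list_def map_ball_config_path)

lemma bounded_config_path: "bounded_config (ball_config (path 0 w)) (int (length w))"
  by standard (auto simp: ball_config_path)

lemma good_list_path:
  assumes "dyck 0 w"
  shows "bounded_config.good_list (ball_config (path 0 w)) (int (length w)) [1..int (length w)]"
proof -
  interpret bounded_config "ball_config (path 0 w)" "int (length w)" by (rule bounded_config_path)
  show ?thesis unfolding good_list_def using assms by (simp add: map_ball_config_path)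
qed

lemma slot_list_props:
  assumes "dyck 0 w"
  shows "sorted_wrt (<) (slot_list k w)" "set (slot_list k w) \<subseteq> {0..int (length w)}"
proof -
  interpret bounded_config "ball_config (path 0 w)" "int (length w)" by (rule bounded_config_path)
  have "good_list ((config_core ^^ k) [1..int (length w)])"
    using good_config_core_pow good_list_path[OF assms] by blast
  then show "sorted_wrt (<) (slot_list k w)" "set (slot_list k w) \<subseteq> {0..int (length w)}"
    unfolding good_list_def slot_list_def by auto
qed

text \<open>The bridge from the algorithm to words. Behind the last slot of an excursion the next
  slot is the following record, at \<open>length w + 1\<close>.\<close>

lemma exc_path:
  assumes "dyck 0 w"
  shows "exc_slots (path 0 w) k = set (slot_list k w)"
    and "num_solitons (Suc k) (path 0 w) = word_solitons (Suc k) w"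
    and "t < length (slot_list (Suc k) w) \<Longrightarrow>
      card {\<gamma> \<in> exc_solitons (path 0 w) (Suc k).
        \<gamma> \<subseteq> {slot_list (Suc k) w ! t <..< (tl (slot_list (Suc k) w) @ [int (length w) + 1]) ! t}}
      = wgaps ((wcore ^^ k) w) ! t"
    and "\<gamma> \<in> exc_solitons (path 0 w) (Suc k) \<Longrightarrow> \<gamma> \<subseteq> {1..int (length w)} \<and> \<gamma> \<noteq> {}"
proof -
  define N where "N = int (length w)"
  define \<eta> where "\<eta> = ball_config (path 0 w)"
  interpret bounded_config \<eta> N unfolding \<eta>_def N_def by (rule bounded_config_path)
  have g: "good_list [1..N]" unfolding N_def \<eta>_def by (rule good_list_path[OF assms])
  obtain L where L: "block_exec (start_blocks [1..N]) L" "solved \<eta> N [1..N] L" using ex_solved[OF g] by blast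
  have U: "\<Union>(set (start_blocks [1..N])) = UNIV" using start_blocks_blocks(3)[OF g] by auto
  have sol: "exc_solitons (path 0 w) m = {\<gamma>. (m, \<gamma>) \<in> set L}" for m
    using block_exec_iff_picks[OF L(1) start_blocks_blocks(1,2)[OF g] U] by (simp add: exc_solitons_def \<eta>_def)
  have slot: "slot_list m w = 0 # (config_core ^^ m) [1..N]" for m by (simp add: slot_list_def \<eta>_def N_def)
  have "exc_slots (path 0 w) k = insert 0 (slot_set \<eta> L k)"
    unfolding exc_slots_def slot_set_def \<eta>_def[symmetric] sol by blast
  then show "exc_slots (path 0 w) k = set (slot_list k w)"
    using L(2) unfolding solved_def slot by simp
  have mw: "gaps \<eta> False ((config_core ^^ m) [1..N]) = wgaps ((wcore ^^ m) w)" for m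
    by (subst gaps_word) (simp add: map_core_pow, simp add: \<eta>_def N_def map_ball_config_path)
  show "num_solitons (Suc k) (path 0 w) = word_solitons (Suc k) w"
    using L(2) unfolding num_solitons_def sol solved_def word_solitons_def mw by simp
  show "card {\<gamma> \<in> exc_solitons (path 0 w) (Suc k).
        \<gamma> \<subseteq> {slot_list (Suc k) w ! t <..< (tl (slot_list (Suc k) w) @ [int (length w) + 1]) ! t}}
      = wgaps ((wcore ^^ k) w) ! t" if t: "t < length (slot_list (Suc k) w)" for t
  proof -
    have "t < length (gaps \<eta> False ((config_core ^^ k) [1..N]))" using t unfolding mw by (simp add: length_slot_list length_gaps)
    moreover have "(0 # (config_core ^^ Suc k) [1..N] @ [N + 1]) ! t = slot_list (Suc k) w ! t"
      using t unfolding slot by (metis append_Cons nth_append)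
    note tk = calculation(1) and eq = this
    have "card {\<gamma>. (Suc k, \<gamma>) \<in> set L \<and>
        \<gamma> \<subseteq> {slot_list (Suc k) w ! t <..< ((config_core ^^ Suc k) [1..N] @ [N + 1]) ! t}} =
        gaps \<eta> False ((config_core ^^ k) [1..N]) ! t"
      using L(2)[unfolded solved_def, THEN conjunct2, THEN conjunct2, THEN conjunct2, THEN conjunct2,
        rule_format, OF tk] unfolding eq .
    moreover have "tl (slot_list (Suc k) w) = (config_core ^^ Suc k) [1..N]" unfolding slot by simp
    ultimately show ?thesis unfolding sol mw by (simp only: N_def mem_Collect_eq)
  qed
  show "\<gamma> \<subseteq> {1..int (length w)} \<and> \<gamma> \<noteq> {}" if "\<gamma> \<in> exc_solitons (path 0 w) (Suc k)" for \<gamma>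
  proof -
    have m: "(Suc k, \<gamma>) \<in> set L" using that sol by blast
    have "\<Union>(snd ` set L) = {1..N}" using L(2) unfolding solved_def by simp
    then have "\<gamma> \<subseteq> {1..N}" using m by force
    moreover have "card {z \<in> \<gamma>. \<eta> z} = Suc k" using block_exec_solitons[OF L(1) start_blocks_blocks(1)[OF g] m] by blast
    then have "\<gamma> \<noteq> {}" by auto
    ultimately show ?thesis unfolding N_def by blast
  qed
qed

section \<open>Two-sided increasing sequences and concatenations of blocks\<close>

lemma strict_mono_intI:
  fixes s :: "int \<Rightarrow> int"
  assumes "\<And>i. s i < s (i + 1)"
  shows "strict_mono s"
proof (rule strict_monoI)
  fix i j :: int assume "i < j"
  then show "s i < s j"
  proof (induction j rule: int_gr_induct)
    case base
    then show ?case by (rule assms)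
  next
    case (step j)
    then show ?case using assms[of j] by simp
  qed
qed

lemma strict_mono_int_block:
  fixes s :: "int \<Rightarrow> int"
  assumes "strict_mono s"
  shows "\<exists>!i. s i \<le> j \<and> j < s (i + 1)"
proof -
  have up: "s 0 + i \<le> s i" if "0 \<le> i" for i
    using that
  proof (induction i rule: int_ge_induct)
    case (step i)
    then show ?case using strict_monoD[OF assms, of i "i + 1"] by simp
  qed simp
  have dn: "s i \<le> s 0 + i" if "i \<le> 0" for i
    using that
  proof (induction i rule: int_le_induct)
    case (step i)
    then show ?case using strict_monoD[OF assms, of "i - 1" i] by simp
  qed simp
  \<comment> \<open>\<open>s\<close> grows by at least 1 per step, so the index sought has distance
    at most \<open>\<bar>j - s 0\<bar>\<close> from 0.\<close>
  define A where "A = {i \<in> {- \<bar>j - s 0\<bar>..\<bar>j - s 0\<bar>}. s i \<le> j}"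
  have "- \<bar>j - s 0\<bar> \<in> A" using dn[of "- \<bar>j - s 0\<bar>"] by (auto simp: A_def)
  then have ne: "A \<noteq> {}" by blast
  have "A \<subseteq> {- \<bar>j - s 0\<bar>..\<bar>j - s 0\<bar>}" by (auto simp: A_def)
  then have fA: "finite A" by (rule finite_subset) simp
  define i where "i = Max A"
  have i: "i \<in> A" unfolding i_def using fA ne by (rule Max_in)
  have "j < s (i + 1)"
  proof (rule ccontr)
    assume "\<not> j < s (i + 1)"
    then have le: "s (i + 1) \<le> j" by simp
    have "i + 1 \<le> \<bar>j - s 0\<bar>"
    proof (rule ccontr)
      assume "\<not> i + 1 \<le> \<bar>j - s 0\<bar>"
      then have "0 \<le> i + 1" by linarith
      then show False using up[of "i + 1"] le \<open>\<not> i + 1 \<le> \<bar>j - s 0\<bar>\<close> by linarith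
    qed
    then have "i + 1 \<in> A" using i le by (auto simp: A_def)
    then have "i + 1 \<le> i" unfolding i_def using fA by (intro Max_ge)
    then show False by simp
  qed
  moreover have "i = i'" if "s i \<le> j" "j < s (i + 1)" "s i' \<le> j" "j < s (i' + 1)" for i i'
  proof -
    have "s i < s (i' + 1)" "s i' < s (i + 1)" using that by linarith+
    then have "i < i' + 1" "i' < i + 1" using strict_mono_less[OF assms] by blast+
    then show ?thesis by simp
  qed
  ultimately show ?thesis using i by (intro ex1I[of _ i]) (auto simp: A_def)
qed

text \<open>A two-sided enumeration is unique up to a shift, and the value at 0 fixes the shift.
  This resolves the description in \<open>slot_pos\<close>.\<close>

lemma strict_mono_same_range:
  fixes s s' :: "int \<Rightarrow> int"
  assumes "strict_mono s" "strict_mono s'" "range s = range s'" "s 0 = s' 0"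
  shows "s = s'"
proof -
  have nx: "u (i + 1) \<le> v (i + 1)" if h: "u i = v i" "strict_mono u" "strict_mono v" "range u = range v"
    for u v :: "int \<Rightarrow> int" and i
  proof -
    obtain a where a: "v (i + 1) = u a" using h(4) by (metis rangeE rangeI)
    have "u i < u a" using that a strict_monoD[OF h(3), of i "i + 1"] by simp
    then have "i + 1 \<le> a" using strict_mono_less[OF h(2)] by simp
    then show ?thesis using a strict_mono_less_eq[OF h(2)] by simp
  qed
  have pv: "v (i - 1) \<le> u (i - 1)" if h: "u i = v i" "strict_mono u" "strict_mono v" "range u = range v"
    for u v :: "int \<Rightarrow> int" and i
  proof -
    obtain a where a: "v (i - 1) = u a" using h(4) by (metis rangeE rangeI)
    have "u a < u i" using that a strict_monoD[OF h(3), of "i - 1" i] by simp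
    then have "a \<le> i - 1" using strict_mono_less[OF h(2)] by simp
    then show ?thesis using a strict_mono_less_eq[OF h(2)] by simp
  qed
  have "s i = s' i" for i
  proof (induction i rule: int_induct[where k=0])
    case (step1 i)
    then show ?case using nx[of s i s'] nx[of s' i s] assms by (metis antisym)
  next
    case (step2 i)
    then show ?case using pv[of s i s'] pv[of s' i s] assms by (metis antisym)
  qed (rule assms(4))
  then show ?thesis by blast
qed

text \<open>The words \<open>V i\<close>, of length \<open>l i\<close>, are concatenated to a two-sided sequence in which \<open>V i\<close> starts
  at index \<open>offset l i\<close> and \<open>V 0\<close> starts at 0.\<close>

definition offset :: "(int \<Rightarrow> nat) \<Rightarrow> int \<Rightarrow> int" where
  "offset l i = (\<Sum>y\<in>{0..<i}. int (l y)) - (\<Sum>y\<in>{i..<0}. int (l y))"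

lemma offset_0 [simp]: "offset l 0 = 0"
  by (simp add: offset_def)

lemma offset_step: "offset l (i + 1) = offset l i + int (l i)"
proof (cases "0 \<le> i")
  case True
  then have "{0..<i + 1} = insert i {0..<i}" "{i..<0} = {}" "{i + 1..<0} = {}" by auto
  then show ?thesis by (simp add: offset_def)
next
  case False
  then have "{i..<0} = insert i {i + 1..<0}" "{0..<i} = {}" "{0..<i + 1} = {}" by auto
  then show ?thesis by (simp add: offset_def)
qed

lemma offset_unique:
  assumes "f 0 = 0" "\<And>i. f (i + 1) = f i + int (l i)"
  shows "f i = offset l i"
proof (induction i rule: int_induct[where k=0])
  case (step1 i)
  then show ?case using assms(2)[of i] offset_step[of l i] by simp
next
  case (step2 i)
  then show ?case using assms(2)[of "i - 1"] offset_step[of l "i - 1"] by simp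
qed (simp add: assms)

lemma strict_mono_offset: "(\<And>i. 1 \<le> l i) \<Longrightarrow> strict_mono (offset l)"
  by (rule strict_mono_intI) (simp add: offset_step Suc_le_eq)

definition block_of :: "(int \<Rightarrow> nat) \<Rightarrow> int \<Rightarrow> int" where
  "block_of l j = (THE i. offset l i \<le> j \<and> j < offset l (i + 1))"

definition concat_words :: "(int \<Rightarrow> 'a list) \<Rightarrow> int \<Rightarrow> 'a" where
  "concat_words V j = (let l = (\<lambda>i. length (V i)); i = block_of l j in V i ! nat (j - offset l i))"

lemma block_of_eq:
  assumes "\<And>i. 1 \<le> l i" "offset l i \<le> j" "j < offset l (i + 1)"
  shows "block_of l j = i"
  unfolding block_of_def using strict_mono_int_block[OF strict_mono_offset[of l], of j] assms
  by (intro the1_equality) auto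

lemma ex_block:
  assumes "\<And>i. 1 \<le> l i"
  obtains i t where "t < l i" "j = offset l i + int t"
proof -
  obtain i where "offset l i \<le> j" "j < offset l (i + 1)"
    using strict_mono_int_block[OF strict_mono_offset[of l], of j] assms by blast
  then show ?thesis using that[of "nat (j - offset l i)" i] offset_step[of l i] by auto
qed

lemma ex_block_concat_words:
  assumes "\<And>i. V i \<noteq> []"
  obtains i t where "t < length (V i)" "j = offset (\<lambda>i. length (V i)) i + int t"
proof -
  have "1 \<le> length (V i)" for i using assms[of i] by (cases "V i") auto
  then show ?thesis using ex_block[of "\<lambda>i. length (V i)" j] that by blast
qed

lemma concat_words_eq:
  assumes "\<And>i. V i \<noteq> []" "t < length (V i)"
  shows "concat_words V (offset (\<lambda>i. length (V i)) i + int t) = V i ! t"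
proof -
  have "block_of (\<lambda>i. length (V i)) (offset (\<lambda>i. length (V i)) i + int t) = i"
    using assms by (intro block_of_eq) (auto simp: offset_step Suc_le_eq)
  then show ?thesis by (simp add: concat_words_def)
qed

lemma range_concat_words:
  assumes "\<And>i. V i \<noteq> []"
  shows "range (concat_words V) = (\<Union>i. set (V i))"
proof
  show "range (concat_words V) \<subseteq> (\<Union>i. set (V i))"
  proof
    fix x assume "x \<in> range (concat_words V)"
    then obtain j where x: "x = concat_words V j" by blast
    obtain i t where "t < length (V i)" "j = offset (\<lambda>i. length (V i)) i + int t"
      using ex_block_concat_words[of V j] assms by blast
    then have "x = V i ! t" using x concat_words_eq[of V t i] assms by simp
    then show "x \<in> (\<Union>i. set (V i))" using nth_mem[OF \<open>t < length (V i)\<close>] by blast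
  qed
  show "(\<Union>i. set (V i)) \<subseteq> range (concat_words V)"
  proof
    fix x assume "x \<in> (\<Union>i. set (V i))"
    then obtain i t where "t < length (V i)" "x = V i ! t" by (auto simp: in_set_conv_nth)
    then show "x \<in> range (concat_words V)" using concat_words_eq[of V t i] assms by (metis rangeI)
  qed
qed

lemma strict_mono_concat_words:
  fixes V :: "int \<Rightarrow> int list"
  assumes "\<And>i. V i \<noteq> []" "\<And>i. sorted_wrt (<) (V i)" "\<And>i x y. x \<in> set (V i) \<Longrightarrow> y \<in> set (V (i + 1)) \<Longrightarrow> x < y"
  shows "strict_mono (concat_words V)"
proof (rule strict_mono_intI)
  fix j :: int
  let ?l = "\<lambda>i. length (V i)"
  obtain i t where t: "t < length (V i)" "j = offset ?l i + int t"
    using ex_block_concat_words[of V j] assms(1) by blast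
  have j: "concat_words V j = V i ! t" using concat_words_eq[of V t i] assms(1) t by simp
  show "concat_words V j < concat_words V (j + 1)"
  proof (cases "Suc t < length (V i)")
    case True
    then have "concat_words V (j + 1) = V i ! Suc t" using concat_words_eq[of V "Suc t" i] assms(1) t by (simp add: ac_simps)
    then show ?thesis using j assms(2)[of i] True by (simp add: sorted_wrt_iff_nth_less)
  next
    case False
    then have "j + 1 = offset ?l (i + 1) + int 0" using t offset_step[of ?l i] by simp
    moreover have "0 < length (V (i + 1))" using assms(1) by simp
    ultimately have "concat_words V (j + 1) = V (i + 1) ! 0" using concat_words_eq[of V 0 "i + 1"] assms(1) by simp
    then show ?thesis using j assms(3)[of "V i ! t" i "V (i + 1) ! 0"] t(1) \<open>0 < length (V (i + 1))\<close> by simp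
  qed
qed

section \<open>Components of a configuration\<close>

lemma walk_Suc: "walk \<eta> (z + 1) = walk \<eta> z + (if \<eta> (z + 1) then 1 else -1)"
  using walk_step[of \<eta> "z + 1"] by auto

lemma upto_Suc_shift: "[0..int (Suc n)] = 0 # map (\<lambda>z. z + 1) [0..int n]"
proof (rule nth_equalityI)
  fix i assume "i < length [0..int (Suc n)]"
  then show "[0..int (Suc n)] ! i = (0 # map (\<lambda>z. z + 1) [0..int n]) ! i"
    by (cases i) auto
qed simp

lemma path_walk:
  "map (\<lambda>z. walk \<eta> (a + z) - walk \<eta> a + b) [0..int n] = path b (map \<eta> [a + 1..a + int n])"
proof (induction n arbitrary: a b)
  case (Suc n)
  let ?b = "if \<eta> (a + 1) then b + 1 else b - 1"
  have "map (\<lambda>z. walk \<eta> (a + z) - walk \<eta> a + b) [0..int (Suc n)] =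
     b # map (\<lambda>z. walk \<eta> (a + 1 + z) - walk \<eta> (a + 1) + ?b) [0..int n]"
    unfolding upto_Suc_shift using walk_Suc[of \<eta> a] by (auto simp: comp_def ac_simps)
  also have "\<dots> = b # path ?b (map \<eta> [a + 1 + 1..a + 1 + int n])" by (simp only: Suc)
  also have "\<dots> = path b (map \<eta> [a + 1..a + int (Suc n)])"
    by (subst (2) upto_rec1) (simp_all add: ac_simps)
  finally show ?case .
qed simp

text \<open>What the deterministic statements use of a configuration; almost sure under the Palm
  measure by \<open>AE_P_regular\<close>.\<close>

definition regular :: "config \<Rightarrow> bool" where
  "regular \<eta> \<longleftrightarrow> 0 \<in> records \<eta> \<and> (\<forall>i. \<exists>z\<in>records \<eta>. walk \<eta> z = - i)"

definition exc_word :: "config \<Rightarrow> int \<Rightarrow> bool list" where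
  "exc_word \<eta> i = map \<eta> [rec_pos \<eta> i + 1..rec_pos \<eta> (i + 1) - 1]"

lemma rec_pos_record:
  assumes "z \<in> records \<eta>" "walk \<eta> z = - i"
  shows "rec_pos \<eta> i = z"
  unfolding rec_pos_def
proof (rule Least_equality)
  fix y assume "walk \<eta> y = - i"
  then show "z \<le> y" using assms unfolding records_def by (cases "y < z") auto
qed (rule assms)

context
  fixes \<eta> :: config
  assumes reg: "regular \<eta>"
begin

lemma rec_pos_regular: "rec_pos \<eta> i \<in> records \<eta>" "walk \<eta> (rec_pos \<eta> i) = - i"
proof -
  obtain z where "z \<in> records \<eta>" "walk \<eta> z = - i" using reg unfolding regular_def by blast
  then show "rec_pos \<eta> i \<in> records \<eta>" "walk \<eta> (rec_pos \<eta> i) = - i" using rec_pos_record by auto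
qed

lemma rec_pos_0: "rec_pos \<eta> 0 = 0"
  using reg by (intro rec_pos_record) (auto simp: regular_def walk_0)

lemma rec_pos_less: "rec_pos \<eta> i < rec_pos \<eta> (i + 1)"
proof (rule ccontr)
  assume "\<not> rec_pos \<eta> i < rec_pos \<eta> (i + 1)"
  then have "rec_pos \<eta> (i + 1) < rec_pos \<eta> i \<or> rec_pos \<eta> (i + 1) = rec_pos \<eta> i" by linarith
  then show False using rec_pos_regular[of i] rec_pos_regular[of "i + 1"] unfolding records_def by force
qed

lemma walk_between: "z < rec_pos \<eta> (i + 1) \<Longrightarrow> - i \<le> walk \<eta> z"
  using rec_pos_regular[of "i + 1"] unfolding records_def by force

lemma length_exc_word: "int (length (exc_word \<eta> i)) = rec_pos \<eta> (i + 1) - rec_pos \<eta> i - 1"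
  using rec_pos_less[of i] by (simp add: exc_word_def)

lemma path_exc_word:
  "path 0 (exc_word \<eta> i) = map (\<lambda>z. walk \<eta> (rec_pos \<eta> i + z) - walk \<eta> (rec_pos \<eta> i)) [0..int (length (exc_word \<eta> i))]"
proof -
  have "exc_word \<eta> i = map \<eta> [rec_pos \<eta> i + 1..rec_pos \<eta> i + int (length (exc_word \<eta> i))]"
    using length_exc_word[of i] by (simp add: exc_word_def)
  then show ?thesis
    using path_walk[of \<eta> "rec_pos \<eta> i" 0 "length (exc_word \<eta> i)"] by simp
qed

lemma dyck_exc_word: "dyck 0 (exc_word \<eta> i)"
proof -
  let ?n = "length (exc_word \<eta> i)"
  let ?a = "rec_pos \<eta> i" and ?b = "rec_pos \<eta> (i + 1)"
  have nth: "path 0 (exc_word \<eta> i) ! z = walk \<eta> (?a + int z) + i" if "z \<le> ?n" for z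
  proof -
    have "[0..int ?n] ! z = int z" using nth_upto[of 0 z "int ?n"] that by simp
    then show ?thesis unfolding path_exc_word using that rec_pos_regular(2)[of i] by simp
  qed
  have "walk \<eta> (?b - 1) = - i"
  proof -
    have "walk \<eta> ?b < walk \<eta> (?b - 1)" using rec_pos_regular[of "i + 1"] unfolding records_def by simp
    then have "walk \<eta> (?b - 1) = walk \<eta> ?b + 1" using walk_step[of \<eta> ?b] by (cases "\<eta> ?b") auto
    then show ?thesis using rec_pos_regular(2)[of "i + 1"] by simp
  qed
  moreover have "?a + int ?n = ?b - 1" using length_exc_word[of i] by simp
  ultimately have "path 0 (exc_word \<eta> i) ! ?n = 0" using nth[of ?n] by simp
  moreover have "0 \<le> path 0 (exc_word \<eta> i) ! z" if "z \<le> ?n" for z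
    using nth[OF that] walk_between[of "?a + int z" i] length_exc_word[of i] that by simp
  ultimately show ?thesis by (simp add: dyck_iff_path)
qed

lemma excursion_regular: "excursion \<eta> i = path 0 (exc_word \<eta> i)"
proof -
  obtain n where "length (exc_word \<eta> i) = 2 * n" using even_length_dyck[OF dyck_exc_word[of i]] by (auto elim: evenE)
  then have "2 * ((rec_pos \<eta> (i + 1) - rec_pos \<eta> i - 1) div 2) = int (length (exc_word \<eta> i))"
    unfolding length_exc_word[of i, symmetric] by simp
  then show ?thesis unfolding path_exc_word excursion_def by (simp add: Let_def)
qed

lemma rec_pos_offset: "rec_pos \<eta> i = offset (\<lambda>i. Suc (length (exc_word \<eta> i))) i"
  by (rule offset_unique) (simp_all add: rec_pos_0 length_exc_word)

definition slot_blocks :: "nat \<Rightarrow> int \<Rightarrow> int list" where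
  "slot_blocks k i = map ((+) (rec_pos \<eta> i)) (slot_list k (exc_word \<eta> i))"

lemma slot_blocks_nonempty: "slot_blocks k i \<noteq> []"
  by (simp add: slot_blocks_def slot_list_def)

lemma set_slot_blocks: "x \<in> set (slot_blocks k i) \<Longrightarrow> rec_pos \<eta> i \<le> x \<and> x < rec_pos \<eta> (i + 1)"
  using slot_list_props(2)[OF dyck_exc_word[of i], of k] length_exc_word[of i]
  unfolding slot_blocks_def by force

lemma strict_mono_slot_blocks: "strict_mono (concat_words (slot_blocks k))"
proof (rule strict_mono_concat_words)
  show "sorted_wrt (<) (slot_blocks k i)" for i
    using slot_list_props(1)[OF dyck_exc_word[of i], of k] by (simp add: slot_blocks_def sorted_wrt_map)
  show "x < y" if "x \<in> set (slot_blocks k i)" "y \<in> set (slot_blocks k (i + 1))" for i x y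
    using set_slot_blocks[OF that(1)] set_slot_blocks[OF that(2)] by simp
qed (rule slot_blocks_nonempty)

lemma slots_regular: "slots \<eta> k = (\<Union>i. set (slot_blocks k i))"
  unfolding slots_def excursion_regular slot_blocks_def by (simp add: exc_path(1)[OF dyck_exc_word])

lemma slot_pos_regular: "slot_pos \<eta> k = concat_words (slot_blocks k)"
  unfolding slot_pos_def
proof (rule the_equality)
  have "concat_words (slot_blocks k) 0 = 0"
    using concat_words_eq[of "slot_blocks k" 0 0] slot_blocks_nonempty
    by (simp add: slot_blocks_def slot_list_def rec_pos_0)
  then show P: "strict_mono (concat_words (slot_blocks k)) \<and> range (concat_words (slot_blocks k)) = slots \<eta> k \<and>
      concat_words (slot_blocks k) 0 = 0"
    using strict_mono_slot_blocks range_concat_words[of "slot_blocks k"] slot_blocks_nonempty slots_regular by auto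
  fix s :: "int \<Rightarrow> int" assume "strict_mono s \<and> range s = slots \<eta> k \<and> s 0 = 0"
  then show "s = concat_words (slot_blocks k)" using P by (intro strict_mono_same_range) auto
qed

text \<open>In each excursion there are as many slots of level \<open>Suc k\<close> as entries in
  the list of gaps, so the numbering of the slots and the concatenation of the counts run in
  parallel.\<close>

lemma component_regular:
  "component (Suc k) \<eta> = concat_words (\<lambda>i. wgaps ((wcore ^^ k) (exc_word \<eta> i)))"
proof
  fix j
  let ?k = "Suc k"
  let ?G = "\<lambda>i. wgaps ((wcore ^^ k) (exc_word \<eta> i))"
  let ?S = "slot_blocks ?k"
  have len: "(\<lambda>i. length (?S i)) = (\<lambda>i. length (?G i))"
    by (simp add: slot_blocks_def length_slot_list length_gaps)
  obtain i t where t: "t < length (?S i)" "j = offset (\<lambda>i. length (?S i)) i + int t"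
    using ex_block_concat_words[of ?S j] slot_blocks_nonempty by blast
  define w where "w = exc_word \<eta> i"
  define r where "r = rec_pos \<eta> i"
  have w: "dyck 0 w" unfolding w_def by (rule dyck_exc_word)
  have r1: "rec_pos \<eta> (i + 1) = r + int (length w) + 1" using length_exc_word[of i] by (simp add: w_def r_def)
  have tl: "t < length (slot_list ?k w)" using t(1) by (simp add: slot_blocks_def w_def)
  have a: "slot_pos \<eta> ?k j = r + slot_list ?k w ! t"
    using concat_words_eq[of ?S t i] slot_blocks_nonempty t tl
    by (simp add: slot_pos_regular slot_blocks_def w_def r_def)
  have b: "slot_pos \<eta> ?k (j + 1) = r + (tl (slot_list ?k w) @ [int (length w) + 1]) ! t"
  proof (cases "Suc t < length (slot_list ?k w)")
    case True
    then have "concat_words ?S (offset (\<lambda>i. length (?S i)) i + int (Suc t)) = ?S i ! Suc t"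
      by (intro concat_words_eq slot_blocks_nonempty) (simp add: slot_blocks_def w_def)
    moreover have "j + 1 = offset (\<lambda>i. length (?S i)) i + int (Suc t)" using t by simp
    ultimately have "slot_pos \<eta> ?k (j + 1) = ?S i ! Suc t" unfolding slot_pos_regular by metis
    moreover have "t < length (tl (slot_list ?k w))" using True by simp
    ultimately show ?thesis using True by (simp add: slot_blocks_def w_def r_def nth_append nth_tl)
  next
    case False
    \<comment> \<open>Behind the last slot of excursion \<open>i\<close> comes the record that
      starts excursion \<open>i + 1\<close>.\<close>
    have "j + 1 = offset (\<lambda>i. length (?S i)) (i + 1) + int 0"
      using t tl False offset_step[of "\<lambda>i. length (?S i)" i] by (simp add: slot_blocks_def w_def)
    moreover have "concat_words ?S (offset (\<lambda>i. length (?S i)) (i + 1) + int 0) = ?S (i + 1) ! 0"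
      using slot_blocks_nonempty by (intro concat_words_eq) auto
    ultimately have "slot_pos \<eta> ?k (j + 1) = ?S (i + 1) ! 0" unfolding slot_pos_regular by metis
    then have "slot_pos \<eta> ?k (j + 1) = rec_pos \<eta> (i + 1)" by (simp add: slot_blocks_def slot_list_def)
    moreover have "t = length (tl (slot_list ?k w))" using False tl by simp
    ultimately show ?thesis using r1 by (simp add: nth_append)
  qed
  define A B where "A = slot_list ?k w ! t" and "B = (tl (slot_list ?k w) @ [int (length w) + 1]) ! t"
  have sub: "set (slot_list ?k w) \<subseteq> {0..int (length w)}" by (rule slot_list_props(2)[OF w])
  have A: "0 \<le> A" using sub nth_mem[OF tl] unfolding A_def by auto
  have B: "B \<le> int (length w) + 1"
  proof (cases "t < length (tl (slot_list ?k w))")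
    case True
    then have "B \<in> set (slot_list ?k w)" unfolding B_def
      by (metis list.set_sel(2) nth_append nth_mem list.sel(2) length_0_conv less_nat_zero_code)
    then show ?thesis using sub by auto
  qed (use tl in \<open>auto simp: B_def nth_append\<close>)
  have "{\<gamma> \<in> solitons \<eta> ?k. \<gamma> \<subseteq> {r + A<..<r + B}} =
    (\<lambda>\<gamma>. (+) r ` \<gamma>) ` {\<gamma> \<in> exc_solitons (path 0 w) ?k. \<gamma> \<subseteq> {A<..<B}}"
  proof
    show "(\<lambda>\<gamma>. (+) r ` \<gamma>) ` {\<gamma> \<in> exc_solitons (path 0 w) ?k. \<gamma> \<subseteq> {A<..<B}} \<subseteq>
        {\<gamma> \<in> solitons \<eta> ?k. \<gamma> \<subseteq> {r + A<..<r + B}}"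
      unfolding solitons_def excursion_regular r_def w_def by force
    show "{\<gamma> \<in> solitons \<eta> ?k. \<gamma> \<subseteq> {r + A<..<r + B}} \<subseteq>
      (\<lambda>\<gamma>. (+) r ` \<gamma>) ` {\<gamma> \<in> exc_solitons (path 0 w) ?k. \<gamma> \<subseteq> {A<..<B}}"
    proof
      fix \<gamma> assume g: "\<gamma> \<in> {\<gamma> \<in> solitons \<eta> ?k. \<gamma> \<subseteq> {r + A<..<r + B}}"
      \<comment> \<open>A soliton is nonempty and stays inside its own excursion, which therefore
        has to be excursion \<open>i\<close>.\<close>
      then obtain i' \<gamma>0 where i': "\<gamma> = (+) (rec_pos \<eta> i') ` \<gamma>0" "\<gamma>0 \<in> exc_solitons (path 0 (exc_word \<eta> i')) ?k"
        unfolding solitons_def excursion_regular by blast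
      have g0: "\<gamma>0 \<subseteq> {1..int (length (exc_word \<eta> i'))}" "\<gamma>0 \<noteq> {}"
        using exc_path(4)[OF dyck_exc_word i'(2)] by auto
      then obtain z where z: "z \<in> \<gamma>0" by blast
      have "rec_pos \<eta> i' \<le> rec_pos \<eta> i' + z" "rec_pos \<eta> i' + z < rec_pos \<eta> (i' + 1)"
        using g0(1) z length_exc_word[of i'] by auto
      moreover have "rec_pos \<eta> i \<le> rec_pos \<eta> i' + z" "rec_pos \<eta> i' + z < rec_pos \<eta> (i + 1)"
        using g z i'(1) A B r1 unfolding r_def by force+
      moreover have "strict_mono (rec_pos \<eta>)" by (rule strict_mono_intI) (rule rec_pos_less)
      ultimately have "i' = i" using strict_mono_int_block[of "rec_pos \<eta>" "rec_pos \<eta> i' + z"] by blast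
      then have "\<gamma> = (+) r ` \<gamma>0" "\<gamma>0 \<in> exc_solitons (path 0 w) ?k" using i' by (simp_all add: r_def w_def)
      moreover have "\<gamma>0 \<subseteq> {A<..<B}" using g \<open>\<gamma> = (+) r ` \<gamma>0\<close> by force
      ultimately show "\<gamma> \<in> (\<lambda>\<gamma>. (+) r ` \<gamma>) ` {\<gamma> \<in> exc_solitons (path 0 w) ?k. \<gamma> \<subseteq> {A<..<B}}" by blast
    qed
  qed
  moreover have "inj_on (\<lambda>\<gamma>. (+) r ` \<gamma>) X" for X :: "int set set"
    by (rule inj_onI) (simp add: inj_image_eq_iff)
  ultimately have "component ?k \<eta> j = card {\<gamma> \<in> exc_solitons (path 0 w) ?k. \<gamma> \<subseteq> {A<..<B}}"
    unfolding component_def a b A_def[symmetric] B_def[symmetric] by (simp add: card_image)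
  also have "\<dots> = wgaps ((wcore ^^ k) w) ! t" unfolding A_def B_def by (rule exc_path(3)[OF w tl])
  also have "\<dots> = concat_words ?G j"
  proof -
    have "t < length (?G i)" using t(1) fun_cong[OF len, of i] by metis
    then have "concat_words ?G (offset (\<lambda>i. length (?G i)) i + int t) = ?G i ! t" by (intro concat_words_eq) auto
    then show ?thesis unfolding t(2) len w_def by simp
  qed
  finally show "component ?k \<eta> j = concat_words ?G j" .
qed

end

section \<open>Records, prescribed excursions and good configurations\<close>

lemma offset_cong:
  assumes "\<And>i. i \<in> {-m..<n} \<Longrightarrow> l i = l' i" "0 \<le> m" "0 \<le> n" "i \<in> {-m..n}"
  shows "offset l i = offset l' i"
proof -
  have "(\<Sum>y\<in>{0..<i}. int (l y)) = (\<Sum>y\<in>{0..<i}. int (l' y))" "(\<Sum>y\<in>{i..<0}. int (l y)) = (\<Sum>y\<in>{i..<0}. int (l' y))"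
    using assms by (auto intro!: sum.cong)
  then show ?thesis by (simp add: offset_def)
qed

lemma record_not_ball: "z \<in> records \<eta> \<Longrightarrow> \<not> \<eta> z"
proof -
  assume "z \<in> records \<eta>"
  then have "walk \<eta> z < walk \<eta> (z - 1)" unfolding records_def by simp
  then show ?thesis using walk_step[of \<eta> z] by (cases "\<eta> z") auto
qed

lemma path_append_last: "path a (w @ [b]) = path a w @ [path a w ! length w + (if b then 1 else -1)]"
  by (induction w arbitrary: a) auto

text \<open>Along a Dyck word the walk does not go below its value at \<open>x\<close>, so the hole
  behind the word is the first visit to the next level.\<close>

lemma record_after_block:
  assumes "x \<in> records \<eta>" "dyck 0 w" "map \<eta> [x + 1..x + 1 + int (length w)] = w @ [False]"
  shows "x + 1 + int (length w) \<in> records \<eta>" "walk \<eta> (x + 1 + int (length w)) = walk \<eta> x - 1"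
proof -
  have p: "map (\<lambda>z. walk \<eta> (x + z) - walk \<eta> x + 0) [0..int (Suc (length w))] = path 0 (w @ [False])"
    unfolding path_walk using assms(3) by (simp add: ac_simps)
  have d: "0 \<le> path 0 w ! z" if "z \<le> length w" for z using assms(2) that by (simp add: dyck_iff_path)
  have e: "path 0 w ! length w = 0" using assms(2) by (simp add: dyck_iff_path)
  have val: "walk \<eta> (x + int z) - walk \<eta> x = path 0 (w @ [False]) ! z" if "z \<le> Suc (length w)" for z
  proof -
    have "[0..int (Suc (length w))] ! z = int z" using nth_upto[of 0 z "int (Suc (length w))"] that by simp
    then have "map (\<lambda>z. walk \<eta> (x + z) - walk \<eta> x + 0) [0..int (Suc (length w))] ! z = walk \<eta> (x + int z) - walk \<eta> x"
      using that by simp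
    then show ?thesis unfolding p by simp
  qed
  show last: "walk \<eta> (x + 1 + int (length w)) = walk \<eta> x - 1"
    using val[of "Suc (length w)"] e by (simp add: path_append_last nth_append ac_simps)
  show "x + 1 + int (length w) \<in> records \<eta>"
    unfolding records_def
  proof (intro CollectI allI impI)
    fix z assume z: "z < x + 1 + int (length w)"
    show "walk \<eta> (x + 1 + int (length w)) < walk \<eta> z"
    proof (cases "z < x")
      case True
      then show ?thesis using assms(1) last unfolding records_def by force
    next
      case False
      define t where "t = nat (z - x)"
      have t: "z = x + int t" "t \<le> length w" using False z by (auto simp: t_def)
      have "0 \<le> walk \<eta> z - walk \<eta> x"
        using val[of t] d[OF t(2)] t by (simp add: path_append_last nth_append)
      then show ?thesis using last by simp
    qed
  qed
qed

text \<open>The left side refers to the record at 0 and to excursions on both sides of it. The right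
  side starts from the leftmost record and prescribes the boxes to its right, so that its
  probability can be computed from left to right.\<close>

lemma window_iff_blocks:
  assumes w: "\<And>i. dyck 0 (w i)"
  defines "a \<equiv> offset (\<lambda>i. Suc (length (w i)))"
  assumes reg: "\<forall>i. \<exists>z\<in>records \<eta>. walk \<eta> z = - i"
  shows "0 \<in> records \<eta> \<and> (\<forall>i\<in>{-int m..<int n}. exc_word \<eta> i = w i) \<longleftrightarrow>
    a (- int m) \<in> records \<eta> \<and> (\<forall>i\<in>{-int m..<int n}. map \<eta> [a i + 1..a (i + 1)] = w i @ [False])"
proof
  assume h: "0 \<in> records \<eta> \<and> (\<forall>i\<in>{-int m..<int n}. exc_word \<eta> i = w i)"
  then have R: "regular \<eta>" using reg by (simp add: regular_def)
  have ra: "rec_pos \<eta> i = a i" if "i \<in> {-int m..int n}" for i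
    unfolding rec_pos_offset[OF R] a_def by (rule offset_cong[OF _ _ _ that]) (use h in auto)
  have "map \<eta> [a i + 1..a (i + 1)] = w i @ [False]" if i: "i \<in> {-int m..<int n}" for i
  proof -
    have e: "rec_pos \<eta> i = a i" "rec_pos \<eta> (i + 1) = a (i + 1)" using ra[of i] ra[of "i + 1"] i by auto
    have "[a i + 1..a (i + 1)] = [a i + 1..a (i + 1) - 1] @ [a (i + 1)]"
      using rec_pos_less[OF R, of i] e by (simp add: upto_rec2)
    moreover have "\<not> \<eta> (a (i + 1))" using record_not_ball rec_pos_regular(1)[OF R, of "i + 1"] e by metis
    moreover have "exc_word \<eta> i = w i" using h i by blast
    then have "map \<eta> [a i + 1..a (i + 1) - 1] = w i" unfolding exc_word_def e .
    ultimately show ?thesis by simp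
  qed
  moreover have "a (- int m) \<in> records \<eta>" using rec_pos_regular(1)[OF R, of "- int m"] ra[of "- int m"] by simp
  ultimately show "a (- int m) \<in> records \<eta> \<and> (\<forall>i\<in>{-int m..<int n}. map \<eta> [a i + 1..a (i + 1)] = w i @ [False])"
    by blast
next
  assume h: "a (- int m) \<in> records \<eta> \<and> (\<forall>i\<in>{-int m..<int n}. map \<eta> [a i + 1..a (i + 1)] = w i @ [False])"
  have st: "a (i + 1) = a i + 1 + int (length (w i))" for i unfolding a_def offset_step by simp
  have A: "a (- int m + int k) \<in> records \<eta> \<and> walk \<eta> (a (- int m + int k)) = walk \<eta> (a (- int m)) - int k"
    if "k \<le> m + n" for k
    using that
  proof (induction k)
    case 0
    then show ?case using h by simp
  next
    case (Suc k)
    define i where "i = - int m + int k"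
    have i: "i \<in> {-int m..<int n}" "- int m + int (Suc k) = i + 1" using Suc.prems by (auto simp: i_def)
    have IH: "a i \<in> records \<eta>" "walk \<eta> (a i) = walk \<eta> (a (- int m)) - int k" using Suc by (auto simp: i_def)
    have "map \<eta> [a i + 1..a i + 1 + int (length (w i))] = w i @ [False]"
      using h i(1) unfolding st by blast
    note rb = record_after_block[OF IH(1) w this]
    show ?case unfolding i(2) st using rb IH(2) by simp
  qed
  have a0: "a 0 = 0" by (simp add: a_def)
  have "0 \<in> records \<eta>" "walk \<eta> (a (- int m)) = int m" using A[of m] a0 walk_0[of \<eta>] by auto
  have B: "rec_pos \<eta> i = a i" if "i \<in> {-int m..int n}" for i
  proof (rule rec_pos_record)
    have "i = - int m + int (nat (i + int m))" "nat (i + int m) \<le> m + n" using that by auto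
    then show "a i \<in> records \<eta>" "walk \<eta> (a i) = - i"
      using A[of "nat (i + int m)"] \<open>walk \<eta> (a (- int m)) = int m\<close> by auto
  qed
  have "exc_word \<eta> i = w i" if i: "i \<in> {-int m..<int n}" for i
  proof -
    have e: "rec_pos \<eta> i = a i" "rec_pos \<eta> (i + 1) = a (i + 1)" using B[of i] B[of "i + 1"] i by auto
    have "[a i + 1..a (i + 1)] = [a i + 1..a (i + 1) - 1] @ [a (i + 1)]"
      using st[of i] by (simp add: upto_rec2)
    then have "map \<eta> [a i + 1..a (i + 1) - 1] @ [\<eta> (a (i + 1))] = w i @ [False]"
      using h i by (metis list.simps(8) list.simps(9) map_append)
    then show ?thesis unfolding exc_word_def e by simp
  qed
  then show "0 \<in> records \<eta> \<and> (\<forall>i\<in>{-int m..<int n}. exc_word \<eta> i = w i)" using \<open>0 \<in> records \<eta>\<close> by blast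
qed

text \<open>The bounds provide a first passage to the level \<open>- i\<close> or below, and the
  walk cannot jump over a level.\<close>

lemma ex_record:
  assumes "\<And>M. \<exists>Y. \<forall>y\<le>Y. M < walk \<eta> y" "\<And>M. \<exists>y. walk \<eta> y < M"
  shows "\<exists>z\<in>records \<eta>. walk \<eta> z = - i"
proof -
  obtain Y where Y: "\<forall>y\<le>Y. - i < walk \<eta> y" using assms(1) by blast
  obtain y0 where "walk \<eta> y0 < - i" using assms(2) by blast
  then have "y0 \<in> {z. walk \<eta> z \<le> - i}" by simp
  then have ne: "{z. walk \<eta> z \<le> - i} \<noteq> {}" by blast
  have bd: "bdd_below {z. walk \<eta> z \<le> - i}"
    unfolding bdd_below_def
  proof (intro exI ballI)
    fix y assume "y \<in> {z. walk \<eta> z \<le> - i}"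
    then have "\<not> - i < walk \<eta> y" by simp
    then have "\<not> y \<le> Y" using Y by blast
    then show "Y \<le> y" by simp
  qed
  obtain z where l: "least_in {z. walk \<eta> z \<le> - i} z" using ex_least_in[OF ne bd] by (elim exE)
  have z: "walk \<eta> z \<le> - i" "\<forall>z'<z. - i < walk \<eta> z'"
    using l unfolding least_in_def by (simp, metis linorder_not_le mem_Collect_eq)
  have "- i < walk \<eta> (z - 1)" using z(2) by simp
  then have "walk \<eta> z = - i" using z(1) walk_step[of \<eta> z] by (cases "\<eta> z") auto
  then show ?thesis using z(2) unfolding records_def by (intro bexI[of _ z]) auto
qed

lemma walk_right: "walk \<eta> (int y) = 2 * (\<Sum>z\<in>{1..int y}. of_bool (\<eta> z)) - int y"
proof (induction y)
  case 0
  show ?case by (simp add: walk_0)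
next
  case (Suc y)
  have "{1..int (Suc y)} = insert (int y + 1) {1..int y}" by auto
  then show ?case using Suc walk_Suc[of \<eta> "int y"] by (simp add: ac_simps)
qed

lemma walk_left: "walk \<eta> (- int y) = int y - 2 * (\<Sum>z\<in>{- int y + 1..0}. of_bool (\<eta> z))"
proof (induction y)
  case 0
  show ?case by (simp add: walk_0)
next
  case (Suc y)
  have "{- int (Suc y) + 1..0} = insert (- int y) {- int y + 1..0}" by auto
  then have "(\<Sum>z\<in>{- int (Suc y) + 1..0}. of_bool (\<eta> z)) = of_bool (\<eta> (- int y)) + (\<Sum>z\<in>{- int y + 1..0}. of_bool (\<eta> z) :: int)"
    by (simp del: sum_of_bool_eq)
  moreover have "walk \<eta> (- int (Suc y)) = walk \<eta> (- int y) - (2 * of_bool (\<eta> (- int y)) - 1)"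
  proof -
    have "- int (Suc y) = - int y - 1" by simp
    then show ?thesis using walk_step[of \<eta> "- int y"] by (simp only:)
  qed
  ultimately show ?case using Suc by linarith
qed

lemma good_configs_records:
  assumes "\<eta> \<in> good_configs"
  shows "\<forall>i. \<exists>z\<in>records \<eta>. walk \<eta> z = - i"
proof
  fix i
  obtain lam :: real where lam: "lam < 1 / 2"
    "(\<lambda>y::nat. (\<Sum>z\<in>{- int y..0}. of_bool (\<eta> z)) / real y) \<longlonglongrightarrow> lam"
    "(\<lambda>y::nat. (\<Sum>z\<in>{0..int y}. of_bool (\<eta> z)) / real y) \<longlonglongrightarrow> lam"
    using assms by (auto simp: good_configs_def density_configs_def)
  \<comment> \<open>Half of the distance from the density to \<open>1 / 2\<close>. In the long run
    the walk then descends by at least \<open>2 * d\<close> per step.\<close>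
  define d where "d = (1 / 2 - lam) / 2"
  have d: "0 < d" "lam < 1 / 2 - d" using lam(1) by (auto simp: d_def field_simps)
  have ev: "\<forall>\<^sub>F y in sequentially. (f y :: real) < (1 / 2 - d) * real y"
    if "(\<lambda>y. f y / real y) \<longlonglongrightarrow> lam" for f
    using order_tendstoD(2)[OF that d(2)] eventually_gt_at_top[of 0]
    by eventually_elim (simp add: field_simps)
  have large: "\<forall>\<^sub>F y in sequentially. M < 2 * d * real y" for M

  proof -
    have "filterlim (\<lambda>y. 2 * d * real y) at_top sequentially"
      using d(1) by (intro filterlim_tendsto_pos_mult_at_top[OF tendsto_const _ filterlim_real_sequentially]) auto
    then show ?thesis by (simp add: filterlim_at_top_dense)
  qed
  show "\<exists>z\<in>records \<eta>. walk \<eta> z = - i"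
  proof (rule ex_record)
    fix M
    obtain Y where Y: "\<And>y. y \<ge> Y \<Longrightarrow> (\<Sum>z\<in>{- int y..0}. of_bool (\<eta> z)) < (1 / 2 - d) * real y \<and> real_of_int M < 2 * d * real y"
      using eventually_conj[OF ev[OF lam(2)] large[of "real_of_int M"]] by (auto simp: eventually_sequentially)
    have "M < walk \<eta> y" if "y \<le> - int Y" for y
    proof -
      define t where "t = nat (- y)"
      have t: "y = - int t" "t \<ge> Y" using that by (auto simp: t_def)
      have "(\<Sum>z\<in>{- int t + 1..0}. of_bool (\<eta> z)) \<le> (\<Sum>z\<in>{- int t..0}. of_bool (\<eta> z) :: real)"
        by (rule sum_mono2) auto
      then have "real_of_int M < real t - 2 * (\<Sum>z\<in>{- int t + 1..0}. of_bool (\<eta> z))"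
        using Y[OF t(2)] by (simp add: algebra_simps)
      also have "\<dots> = real_of_int (walk \<eta> y)" unfolding t(1) walk_left by simp
      finally show ?thesis by simp
    qed
    then show "\<exists>Y. \<forall>y\<le>Y. M < walk \<eta> y" by blast
  next
    fix M
    obtain Y where Y: "\<And>y. y \<ge> Y \<Longrightarrow> (\<Sum>z\<in>{0..int y}. of_bool (\<eta> z)) < (1 / 2 - d) * real y \<and> real_of_int (- M) < 2 * d * real y"
      using eventually_conj[OF ev[OF lam(3)] large[of "real_of_int (- M)"]] by (auto simp: eventually_sequentially)
    have "(\<Sum>z\<in>{1..int Y}. of_bool (\<eta> z)) \<le> (\<Sum>z\<in>{0..int Y}. of_bool (\<eta> z) :: real)"
      by (rule sum_mono2) auto
    then have "2 * (\<Sum>z\<in>{1..int Y}. of_bool (\<eta> z)) - real Y < real_of_int M"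
      using Y[of Y] by (simp add: algebra_simps)
    moreover have "2 * (\<Sum>z\<in>{1..int Y}. of_bool (\<eta> z)) - real Y = real_of_int (walk \<eta> (int Y))"
      unfolding walk_right by simp
    ultimately show "\<exists>y. walk \<eta> y < M" by (metis of_int_less_iff)
  qed
qed

section \<open>Product measures on two-sided sequences\<close>

definition window_cyl :: "int \<Rightarrow> int \<Rightarrow> (int \<Rightarrow> 'a) \<Rightarrow> (int \<Rightarrow> 'a) set" where
  "window_cyl m n u = {\<omega>. \<forall>i\<in>{m..<n}. \<omega> i = u i}"

abbreviation seq_space :: "(int \<Rightarrow> 'a) measure" where
  "seq_space \<equiv> Pi\<^sub>M UNIV (\<lambda>_. count_space UNIV)"

lemma space_seq_space [simp]: "space seq_space = UNIV"
  by (simp add: space_PiM)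

lemma coord_in_sets: "{\<omega>. \<omega> i \<in> A} \<in> sets seq_space"
proof -
  have "(\<lambda>\<omega>. \<omega> i) -` A \<inter> space seq_space \<in> sets seq_space"
    by (rule measurable_sets[of _ _ "count_space UNIV"]) auto
  then show ?thesis by (simp add: vimage_def)
qed

lemma finite_cyl_in_sets:
  assumes "finite W"
  shows "{\<omega>. \<forall>i\<in>W. \<omega> i = u i} \<in> sets seq_space"
  using assms
proof (induction W)
  case empty
  then show ?case using sets.top[of seq_space] by simp
next
  case (insert i W)
  have "{\<omega>. \<forall>i\<in>insert i W. \<omega> i = u i} = {\<omega>. \<omega> i \<in> {u i}} \<inter> {\<omega>. \<forall>i\<in>W. \<omega> i = u i}" by auto
  then show ?case using coord_in_sets[of i "{u i}"] insert by auto
qed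

lemma window_cyl_in_sets: "window_cyl m n u \<in> sets seq_space"
  unfolding window_cyl_def by (rule finite_cyl_in_sets) simp

text \<open>Incompatible cylinders have empty intersection, so the empty set is added to make the
  family closed under intersections.\<close>

definition window_cyls :: "(int \<Rightarrow> 'a) set set" where
  "window_cyls = insert {} {window_cyl (- int n) (int n) u |n u. True}"

text \<open>The alphabet is countable, so an event of one coordinate is a countable union of
  cylinders over a window that contains it.\<close>

lemma sets_seq_space: "sets (seq_space :: (int \<Rightarrow> 'a::countable) measure) = sigma_sets UNIV window_cyls"
proof
  show "sigma_sets UNIV window_cyls \<subseteq> sets (seq_space :: (int \<Rightarrow> 'a) measure)"
    using sets.sigma_sets_subset[of window_cyls "seq_space :: (int \<Rightarrow> 'a) measure"] window_cyl_in_sets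
    by (auto simp: window_cyls_def)
  have gen: "sets (seq_space :: (int \<Rightarrow> 'a) measure) = sigma_sets UNIV {{f. f i \<in> A} |i A. True}"
    by (subst sets_PiM_single) (simp add: PiE_UNIV_domain)
  have "{f. f i \<in> A} \<in> sigma_sets UNIV window_cyls" for i and A :: "'a set"
  proof -
    define n where "n = Suc (nat \<bar>i\<bar>)"
    have i: "i \<in> {- int n..<int n}" by (auto simp: n_def)
    define C where "C ts = window_cyl (- int n) (int n) (\<lambda>j. ts ! nat (j + int n))" for ts :: "'a list"
    have "{f. f i \<in> A} = (\<Union>ts\<in>{ts. ts ! nat (i + int n) \<in> A}. C ts)"
    proof (intro equalityI subsetI)
      fix f assume f: "f \<in> {f. f i \<in> A}"
      define ts where "ts = map (\<lambda>j. f (int j - int n)) [0..<2 * n]"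
      have "ts ! nat (j + int n) = f j" if "j \<in> {- int n..<int n}" for j
        using that by (simp add: ts_def nat_less_iff)
      then have "f \<in> C ts" "ts ! nat (i + int n) \<in> A" using f i by (auto simp: C_def window_cyl_def)
      then show "f \<in> (\<Union>ts\<in>{ts. ts ! nat (i + int n) \<in> A}. C ts)" by blast
    next
      fix f assume "f \<in> (\<Union>ts\<in>{ts. ts ! nat (i + int n) \<in> A}. C ts)"
      then show "f \<in> {f. f i \<in> A}" using i by (auto simp: C_def window_cyl_def)
    qed
    moreover have "C ts \<in> sigma_sets UNIV window_cyls" for ts
      by (rule sigma_sets.Basic) (auto simp: C_def window_cyls_def)
    moreover have "countable {ts :: 'a list. ts ! nat (i + int n) \<in> A}" by simp
    ultimately show ?thesis by (auto intro!: sigma_sets_UNION)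
  qed
  then show "sets (seq_space :: (int \<Rightarrow> 'a) measure) \<subseteq> sigma_sets UNIV window_cyls"
    unfolding gen by (intro sigma_sets_mono) auto
qed

lemma Int_stable_window_cyls: "Int_stable window_cyls"
proof -
  have *: "window_cyl (- int n) (int n) u \<inter> window_cyl (- int m) (int m) v \<in> window_cyls"
    if "n \<le> m" for n m and u v :: "int \<Rightarrow> 'a"
  proof (cases "\<forall>i\<in>{-int n..<int n}. u i = v i")
    case True
    have "window_cyl (- int n) (int n) u \<inter> window_cyl (- int m) (int m) v = window_cyl (- int m) (int m) v"
      using True that by (auto simp: window_cyl_def)
    then show ?thesis by (auto simp: window_cyls_def)
  next
    case False
    then have "window_cyl (- int n) (int n) u \<inter> window_cyl (- int m) (int m) v = {}"
      using that by (force simp: window_cyl_def)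
    then show ?thesis by (simp add: window_cyls_def)
  qed
  show ?thesis unfolding Int_stable_def
  proof (intro ballI)
    fix a b :: "(int \<Rightarrow> 'a) set" assume ab: "a \<in> window_cyls" "b \<in> window_cyls"
    show "a \<inter> b \<in> window_cyls"
    proof (cases "a = {} \<or> b = {}")
      case True
      then show ?thesis by (auto simp: window_cyls_def)
    next
      case False
      then obtain n u m v where "a = window_cyl (- int n) (int n) u" "b = window_cyl (- int m) (int m) v"
        using ab unfolding window_cyls_def by blast
      then show ?thesis using *[of n m u v] *[of m n v u] by (cases "n \<le> m") (auto simp: Int_commute)
    qed
  qed
qed

lemma measure_eq_windowI:
  fixes M N :: "(int \<Rightarrow> 'a::countable) measure"
  assumes "prob_space M" "sets M = sets seq_space" "sets N = sets seq_space"
    and eq: "\<And>n u. emeasure M (window_cyl (- int n) (int n) u) = emeasure N (window_cyl (- int n) (int n) u)"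
  shows "M = N"
proof (rule measure_eqI_generator_eq[OF Int_stable_window_cyls])
  interpret prob_space M by fact
  have "window_cyl (- int 0) (int 0) u = UNIV" for u :: "int \<Rightarrow> 'a" by (simp add: window_cyl_def)
  then have "UNIV \<in> (window_cyls :: (int \<Rightarrow> 'a) set set)" unfolding window_cyls_def by blast
  then show "range (\<lambda>_ :: nat. UNIV :: (int \<Rightarrow> 'a) set) \<subseteq> window_cyls" by auto
  show "emeasure M X = emeasure N X" if "X \<in> window_cyls" for X
    using that eq by (auto simp: window_cyls_def)
  show "sets M = sigma_sets UNIV window_cyls" "sets N = sigma_sets UNIV window_cyls"
    using assms sets_seq_space by metis+
qed (use assms(1) in \<open>auto simp: prob_space.finite_measure finite_measure.emeasure_finite\<close>)

lemma sets_PiM_pmf: "sets (Pi\<^sub>M UNIV (\<lambda>_. measure_pmf p)) = sets seq_space"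
  by (rule sets_PiM_cong) auto

lemma emeasure_PiM_pmf:
  assumes "finite W"
  shows "emeasure (Pi\<^sub>M UNIV (\<lambda>_ :: int. measure_pmf p)) {\<omega>. \<forall>i\<in>W. \<omega> i = u i} = ennreal (\<Prod>i\<in>W. pmf p (u i))"
proof -
  have "{\<omega>. \<forall>i\<in>W. \<omega> i = u i} = prod_emb UNIV (\<lambda>_. measure_pmf p) W (Pi\<^sub>E W (\<lambda>i. {u i}))"
    by (auto simp: prod_emb_def PiE_def extensional_def Pi_def)
  then have "emeasure (Pi\<^sub>M UNIV (\<lambda>_. measure_pmf p)) {\<omega>. \<forall>i\<in>W. \<omega> i = u i} = (\<Prod>i\<in>W. emeasure (measure_pmf p) {u i})"
    using assms by (simp add: emeasure_PiM_emb measure_pmf.prob_space_axioms)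
  then show ?thesis by (simp add: emeasure_pmf_single prod_ennreal)
qed

lemma prob_space_PiM_pmf: "prob_space (Pi\<^sub>M UNIV (\<lambda>_ :: int. measure_pmf p))"
  by (intro prob_space_PiM measure_pmf.prob_space_axioms)

text \<open>Serves \<open>PiM_pmf_indep_coordinate\<close>: after coordinate \<open>i\<close> is
  resampled, an event that does not see it, intersected with a condition on it, is a product event.
  Both factors thus live on the unsplit index set.\<close>

lemma PiM_pmf_resample:
  fixes p :: "'a::countable pmf" and i :: int
  shows "distr (Pi\<^sub>M UNIV (\<lambda>_. measure_pmf p) \<Otimes>\<^sub>M measure_pmf p) (Pi\<^sub>M UNIV (\<lambda>_. measure_pmf p)) (\<lambda>(\<omega>, x). fun_upd \<omega> i x)
    = Pi\<^sub>M UNIV (\<lambda>_. measure_pmf p)"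
    (is "distr (?B \<Otimes>\<^sub>M ?P) ?B ?f = ?B")
proof -
  interpret B: prob_space ?B by (rule prob_space_PiM_pmf)
  interpret BP: pair_prob_space ?B ?P ..
  have meas: "?f \<in> measurable (?B \<Otimes>\<^sub>M ?P) ?B"
    using measurable_add_dim[of i UNIV "\<lambda>_. measure_pmf p"] by simp
  show ?thesis
  proof (rule measure_eq_windowI)
    show "prob_space (distr (?B \<Otimes>\<^sub>M ?P) ?B ?f)" by (rule BP.prob_space_distr[OF meas])
    fix n :: nat and u :: "int \<Rightarrow> 'a"
    let ?W = "{- int n..<int n}"
    let ?C = "window_cyl (- int n) (int n) u"
    have C: "?C \<in> sets ?B" unfolding sets_PiM_pmf by (rule window_cyl_in_sets)
    have D: "{\<omega>. \<forall>j\<in>?W - {i}. \<omega> j = u j} \<in> sets ?B"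
      unfolding sets_PiM_pmf by (rule finite_cyl_in_sets) simp
    let ?X = "if i \<in> ?W then {u i} else UNIV"
    have "?f -` ?C \<inter> space (?B \<Otimes>\<^sub>M ?P) = {\<omega>. \<forall>j\<in>?W - {i}. \<omega> j = u j} \<times> ?X"
      by (auto simp: window_cyl_def space_pair_measure space_PiM split: if_splits)
    then have "emeasure (distr (?B \<Otimes>\<^sub>M ?P) ?B ?f) ?C =
        emeasure ?B {\<omega>. \<forall>j\<in>?W - {i}. \<omega> j = u j} * emeasure ?P ?X"
      using meas C D by (simp add: emeasure_distr measure_pmf.emeasure_pair_measure_Times)
    also have "\<dots> = ennreal (\<Prod>j\<in>?W - {i}. pmf p (u j)) * ennreal (if i \<in> ?W then pmf p (u i) else 1)"
      using measure_pmf.emeasure_space_1[of p] by (subst emeasure_PiM_pmf) (auto simp: emeasure_pmf_single)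
    also have "\<dots> = ennreal (\<Prod>j\<in>?W. pmf p (u j))"
    proof (cases "i \<in> ?W")
      case True
      then show ?thesis by (subst prod.remove[of ?W i]) (auto simp: ennreal_mult' prod_nonneg mult.commute)
    next
      case False
      then have "?W - {i} = ?W" by blast
      then show ?thesis by (simp only: False if_False) simp
    qed
    also have "\<dots> = emeasure ?B ?C" unfolding window_cyl_def by (subst emeasure_PiM_pmf) auto
    finally show "emeasure (distr (?B \<Otimes>\<^sub>M ?P) ?B ?f) ?C = emeasure ?B ?C" .
  qed (simp_all add: sets_PiM_pmf)
qed

lemma PiM_pmf_indep_coordinate:
  fixes p :: "'a::countable pmf" and i :: int
  assumes A: "A \<in> sets (Pi\<^sub>M UNIV (\<lambda>_. measure_pmf p))" and ins: "\<And>\<omega> x. fun_upd \<omega> i x \<in> A \<longleftrightarrow> \<omega> \<in> A"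
  shows "measure (Pi\<^sub>M UNIV (\<lambda>_. measure_pmf p)) {\<omega> \<in> A. \<omega> i = b} =
    measure (Pi\<^sub>M UNIV (\<lambda>_. measure_pmf p)) A * pmf p b"
    (is "measure ?B _ = _")
proof -
  let ?P = "measure_pmf p"
  let ?f = "\<lambda>(\<omega>, x). fun_upd \<omega> i x"
  interpret B: prob_space ?B by (rule prob_space_PiM_pmf)
  have meas: "?f \<in> measurable (?B \<Otimes>\<^sub>M ?P) ?B"
    using measurable_add_dim[of i UNIV "\<lambda>_. measure_pmf p"] by simp
  have "{\<omega> \<in> A. \<omega> i = b} = A \<inter> {\<omega>. \<omega> i \<in> {b}}" by auto
  then have S: "{\<omega> \<in> A. \<omega> i = b} \<in> sets ?B" using A coord_in_sets[of i "{b}"] by (simp add: sets_PiM_pmf)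
  have "emeasure ?B {\<omega> \<in> A. \<omega> i = b} = emeasure (distr (?B \<Otimes>\<^sub>M ?P) ?B ?f) {\<omega> \<in> A. \<omega> i = b}"
    by (simp add: PiM_pmf_resample)
  also have "\<dots> = emeasure (?B \<Otimes>\<^sub>M ?P) (?f -` {\<omega> \<in> A. \<omega> i = b} \<inter> space (?B \<Otimes>\<^sub>M ?P))"
    by (rule emeasure_distr[OF meas S])
  also have "?f -` {\<omega> \<in> A. \<omega> i = b} \<inter> space (?B \<Otimes>\<^sub>M ?P) = A \<times> {b}"
    by (auto simp: ins space_pair_measure space_PiM)
  also have "emeasure (?B \<Otimes>\<^sub>M ?P) (A \<times> {b}) = emeasure ?B A * emeasure ?P {b}"
    using A by (simp add: measure_pmf.emeasure_pair_measure_Times)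
  finally show ?thesis
    by (simp add: B.emeasure_eq_measure emeasure_pmf_single measure_nonneg flip: ennreal_mult)
qed

section \<open>The Bernoulli configuration and its density\<close>

locale ball_density =
  fixes lam :: real
  assumes lam: "0 \<le> lam" "lam < 1 / 2"
begin

abbreviation B :: "config measure" where
  "B \<equiv> bernoulli_config lam"

abbreviation ber :: "bool pmf" where
  "ber \<equiv> bernoulli_pmf lam"

lemma sets_B [measurable_cong]: "sets B = sets seq_space"
  by (simp add: bernoulli_config_def sets_PiM_pmf)

lemma space_B [simp]: "space B = UNIV"
  by (simp add: bernoulli_config_def space_PiM)

lemma prob_space_B: "prob_space B"
  unfolding bernoulli_config_def by (rule prob_space_PiM_pmf)

sublocale B: prob_space B by (rule prob_space_B)

lemma indep_coordinate:
  "A \<in> sets B \<Longrightarrow> (\<And>\<omega> x. fun_upd \<omega> i x \<in> A \<longleftrightarrow> \<omega> \<in> A) \<Longrightarrow>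
    B.prob {\<omega> \<in> A. \<omega> i = b} = B.prob A * pmf ber b"
  unfolding bernoulli_config_def by (rule PiM_pmf_indep_coordinate)

lemma emeasure_B_cyl: "finite W \<Longrightarrow> emeasure B {\<omega>. \<forall>i\<in>W. \<omega> i = u i} = ennreal (\<Prod>i\<in>W. pmf ber (u i))"
  unfolding bernoulli_config_def by (rule emeasure_PiM_pmf)

lemma shift_B: "distr B B (\<lambda>\<eta> z. \<eta> (z + a)) = B"
proof -
  have meas: "(\<lambda>\<eta> z. \<eta> (z + a)) \<in> measurable B B"
    unfolding measurable_cong_sets[OF sets_B sets_B] by (rule measurable_PiM_single') auto
  show ?thesis
  proof (rule measure_eq_windowI)
    show "prob_space (distr B B (\<lambda>\<eta> z. \<eta> (z + a)))" by (rule B.prob_space_distr[OF meas])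
    fix n :: nat and u :: "int \<Rightarrow> bool"
    let ?W = "{- int n..<int n}"
    have "(\<lambda>\<eta> z. \<eta> (z + a)) -` window_cyl (- int n) (int n) u \<inter> space B =
        {\<eta>. \<forall>j\<in>(\<lambda>z. z + a) ` ?W. \<eta> j = u (j - a)}"
      unfolding window_cyl_def by (simp del: image_add_atLeastLessThan' image_add_atLeastLessThan)
    then have "emeasure (distr B B (\<lambda>\<eta> z. \<eta> (z + a))) (window_cyl (- int n) (int n) u) =
        ennreal (\<Prod>j\<in>(\<lambda>z. z + a) ` ?W. pmf ber (u (j - a)))"
      using meas by (simp add: emeasure_distr sets_B window_cyl_in_sets emeasure_B_cyl)
    also have "\<dots> = ennreal (\<Prod>j\<in>?W. pmf ber (u j))"
      by (subst prod.reindex) (auto simp: inj_on_def)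
    also have "\<dots> = emeasure B (window_cyl (- int n) (int n) u)"
      by (simp add: window_cyl_def emeasure_B_cyl)
    finally show "emeasure (distr B B (\<lambda>\<eta> z. \<eta> (z + a))) (window_cyl (- int n) (int n) u) =
      emeasure B (window_cyl (- int n) (int n) u)" .
  qed (simp_all add: sets_B)
qed

lemma indep_vars_coordinates: "B.indep_vars (\<lambda>_. measure_pmf ber) (\<lambda>i \<eta>. \<eta> i) UNIV"
proof -
  interpret P: product_prob_space "\<lambda>_ :: int. measure_pmf ber" UNIV ..
  have d: "distr B (measure_pmf ber) (\<lambda>\<eta>. \<eta> i) = measure_pmf ber" for i
    unfolding bernoulli_config_def by (rule P.PiM_component) simp
  have m: "(\<lambda>\<eta>. \<eta> i) \<in> measurable B (measure_pmf ber)" for i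
    unfolding bernoulli_config_def by simp
  show ?thesis
    by (subst B.indep_vars_iff_distr_eq_PiM') (use m in \<open>simp_all add: d bernoulli_config_def[symmetric] restrict_UNIV distr_id2\<close>)
qed

text \<open>Hoeffding's inequality bounds the deviation probabilities by a geometric series, and
  Borel-Cantelli applies. Injectivity of \<open>f\<close> makes the sum run over distinct, hence
  independent, coordinates.\<close>

lemma slln:
  fixes f :: "nat \<Rightarrow> int"
  assumes f: "inj f"
  shows "AE \<eta> in B. (\<lambda>n. (\<Sum>i<n. of_bool (\<eta> (f i))) / real n) \<longlonglongrightarrow> lam"
proof -
  define X :: "int \<Rightarrow> config \<Rightarrow> real" where "X i \<eta> = of_bool (\<eta> i)" for i \<eta>
  have Xm [measurable]: "X i \<in> borel_measurable B" for i
  proof -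
    have "(\<lambda>\<eta>. \<eta> i) \<in> measurable B (count_space UNIV)"
      unfolding measurable_cong_sets[OF sets_B refl] by simp
    then show ?thesis unfolding X_def by measurable
  qed
  have EX: "B.expectation (X i) = lam" for i
  proof -
    have e: "X i = indicator {\<eta>. \<eta> i}" by (auto simp: X_def indicator_def)
    have "{\<eta>. \<eta> i} \<in> sets B" using coord_in_sets[of i "{True}"] by (simp add: sets_B)
    then have "B.expectation (X i) = B.prob {\<eta>. \<eta> i}" unfolding e by simp
    also have "\<dots> = lam"
      using indep_coordinate[of UNIV i True] lam B.prob_space sets.top[of B] by simp
    finally show ?thesis .
  qed
  have ind: "B.indep_vars (\<lambda>_. borel) X J" for J
    using B.indep_vars_subset[OF B.indep_vars_compose2[OF indep_vars_coordinates, of "\<lambda>_ b. of_bool b :: real" "\<lambda>_. borel"]]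
    by (auto simp: X_def[abs_def])
  define S where "S n \<eta> = (\<Sum>z\<in>f ` {..<n}. X z \<eta>)" for n \<eta>
  have conv: "AE \<eta> in B. \<forall>\<^sub>F n in sequentially. \<bar>S n \<eta> - real n * lam\<bar> < real n * e" if e: "e > 0" for e
  proof -
    define A where "A n = {\<eta> \<in> space B. \<bar>S (Suc n) \<eta> - real (Suc n) * lam\<bar> \<ge> real (Suc n) * e}" for n
    have [measurable]: "A n \<in> sets B" for n unfolding A_def S_def by measurable
    have bound: "B.prob (A n) \<le> 2 * exp (- 2 * e\<^sup>2) ^ Suc n" for n
    proof -
      interpret H: Hoeffding_ineq B "f ` {..<Suc n}" X "\<lambda>_. 0" "\<lambda>_. 1" "\<Sum>i\<in>f ` {..<Suc n}. B.expectation (X i)"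
        by unfold_locales (auto simp: ind X_def)
      have c: "card (f ` {..<Suc n}) = Suc n" using f by (simp add: card_image inj_on_subset)
      have "B.prob (A n) \<le> 2 * exp (- 2 * (real (Suc n) * e)\<^sup>2 / real (Suc n))"
        using H.Hoeffding_ineq_abs_ge[of "real (Suc n) * e"] e c unfolding A_def S_def EX by simp
      also have "- 2 * (real (Suc n) * e)\<^sup>2 / real (Suc n) = real (Suc n) * (- 2 * e\<^sup>2)"
        by (simp add: power2_eq_square field_simps)
      also have "exp \<dots> = exp (- 2 * e\<^sup>2) ^ Suc n" by (rule exp_of_nat_mult)
      finally show ?thesis .
    qed
    have "summable (\<lambda>n. 2 * exp (- 2 * e\<^sup>2) ^ Suc n)"
      using e by (intro summable_mult) (simp add: summable_geometric_iff summable_Suc_iff)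
    then have "summable (\<lambda>n. B.prob (A n))"
      by (rule summable_comparison_test') (use bound in auto)
    then have "AE \<eta> in B. \<forall>\<^sub>F n in sequentially. \<eta> \<in> space B - A n"
      by (intro borel_cantelli_AE1) (simp_all add: B.emeasure_eq_measure)
    then show ?thesis
    proof (rule AE_mp, intro AE_I2 impI)
      fix \<eta> assume "\<forall>\<^sub>F n in sequentially. \<eta> \<in> space B - A n"
      then have "\<forall>\<^sub>F n in sequentially. \<bar>S (Suc n) \<eta> - real (Suc n) * lam\<bar> < real (Suc n) * e"
        by eventually_elim (simp add: A_def)
      then show "\<forall>\<^sub>F n in sequentially. \<bar>S n \<eta> - real n * lam\<bar> < real n * e"
        unfolding eventually_sequentially_Suc[of "\<lambda>n. \<bar>S n \<eta> - real n * lam\<bar> < real n * e"] .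
    qed
  qed
  \<comment> \<open>Countably many tolerances are enough, and the union of their exceptional sets is
    null.\<close>
  have "AE \<eta> in B. \<forall>m. \<forall>\<^sub>F n in sequentially. \<bar>S n \<eta> - real n * lam\<bar> < real n * inverse (real (Suc m))"
    unfolding AE_all_countable using conv by simp
  then show ?thesis
  proof (rule AE_mp, intro AE_I2 impI)
    fix \<eta> assume *: "\<forall>m. \<forall>\<^sub>F n in sequentially. \<bar>S n \<eta> - real n * lam\<bar> < real n * inverse (real (Suc m))"
    have S: "S n \<eta> = (\<Sum>i<n. of_bool (\<eta> (f i)))" for n
      unfolding S_def X_def using inj_on_subset[OF f subset_UNIV] by (subst sum.reindex) auto
    show "(\<lambda>n. (\<Sum>i<n. of_bool (\<eta> (f i))) / real n) \<longlonglongrightarrow> lam"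
      unfolding S[symmetric]
    proof (rule tendstoI)
      fix e :: real assume "0 < e"
      then obtain m where m: "inverse (real (Suc m)) < e" using reals_Archimedean by blast
      show "\<forall>\<^sub>F n in sequentially. dist (S n \<eta> / real n) lam < e"
        using *[rule_format, of m] eventually_gt_at_top[of 0]
      proof eventually_elim
        case (elim n)
        have "dist (S n \<eta> / real n) lam = \<bar>S n \<eta> - real n * lam\<bar> / real n"
        proof -
          have "S n \<eta> / real n - lam = (S n \<eta> - real n * lam) / real n"
            using elim(2) by (simp add: field_simps)
          then show ?thesis by (simp add: dist_real_def)
        qed
        also have "\<dots> < inverse (real (Suc m))" using elim by (simp add: field_simps)
        finally show ?case using m by simp
      qed
    qed
  qed
qed

lemma AE_good: "AE \<eta> in B. \<eta> \<in> good_configs"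
proof -
  have "AE \<eta> in B. (\<lambda>n. (\<Sum>i<n. of_bool (\<eta> (int i))) / real n) \<longlonglongrightarrow> lam"
    by (rule slln) (simp add: inj_def)
  moreover have "AE \<eta> in B. (\<lambda>n. (\<Sum>i<n. of_bool (\<eta> (- int i))) / real n) \<longlonglongrightarrow> lam"
    by (rule slln) (simp add: inj_def)
  ultimately show ?thesis
  proof eventually_elim
    case (elim \<eta>)
    have tr: "(\<lambda>y. g y / real y) \<longlonglongrightarrow> lam" if "\<And>y. g y = (\<Sum>i<Suc y. of_bool (\<eta> (h i)))"
      "(\<lambda>n. (\<Sum>i<n. of_bool (\<eta> (h i))) / real n) \<longlonglongrightarrow> lam" for g :: "nat \<Rightarrow> real" and h
    proof -
      \<comment> \<open>The sums in \<open>density_configs\<close> have \<open>y + 1\<close> terms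
        but are divided by \<open>y\<close>; the ratio of the two tends to 1.\<close>
      have "(\<lambda>y. g y / real (Suc y) * (real (Suc y) / real y)) \<longlonglongrightarrow> lam * 1"
        using LIMSEQ_Suc[OF that(2)] LIMSEQ_Suc_n_over_n[where 'a=real] unfolding that(1)
        by (intro tendsto_mult) auto
      then show ?thesis
        by (simp del: of_nat_Suc)
    qed
    have "(\<Sum>z\<in>{0..int y}. of_bool (\<eta> z)) = (\<Sum>i<Suc y. of_bool (\<eta> (int i)) :: real)" for y
      by (rule sum.reindex_bij_witness[of _ int nat]) auto
    moreover have "(\<Sum>z\<in>{- int y..0}. of_bool (\<eta> z)) = (\<Sum>i<Suc y. of_bool (\<eta> (- int i)) :: real)" for y
      by (rule sum.reindex_bij_witness[of _ "\<lambda>i. - int i" "\<lambda>z. nat (- z)"]) auto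
    ultimately show ?case using tr[OF _ elim(1)] tr[OF _ elim(2)] lam
      unfolding good_configs_def density_configs_def by (intro UN_I[of lam]) auto
  qed
qed

end

section \<open>Invariance of the product measure\<close>

lemma walk_diff: "y \<le> z \<Longrightarrow> walk \<eta> z - walk \<eta> y = (\<Sum>j\<in>{y<..z}. 2 * of_bool (\<eta> j) - 1)"
proof (induction z rule: int_ge_induct)
  case (step z)
  have "{y<..z + 1} = insert (z + 1) {y<..z}" using step(1) by auto
  then show ?case using step walk_Suc[of \<eta> z] by simp
qed simp

lemma walk_diff_cong:
  assumes "\<And>j. j \<le> z \<Longrightarrow> \<eta> j = \<eta>' j" "y \<le> z"
  shows "walk \<eta> z - walk \<eta> y = walk \<eta>' z - walk \<eta>' y"
  unfolding walk_diff[OF assms(2)] by (rule sum.cong) (use assms(1) in auto)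

lemma walk_diff_shift:
  assumes "y \<le> z"
  shows "walk (\<lambda>z. \<eta> (z + a)) z - walk (\<lambda>z. \<eta> (z + a)) y = walk \<eta> (z + a) - walk \<eta> (y + a)"
proof -
  have "{y + a<..z + a} = (\<lambda>j. j + a) ` {y<..z}"
  proof (intro equalityI subsetI)
    fix t assume "t \<in> {y + a<..z + a}"
    then show "t \<in> (\<lambda>j. j + a) ` {y<..z}" by (intro image_eqI[of _ _ "t - a"]) auto
  qed auto
  then show ?thesis using assms by (simp add: walk_diff sum.reindex)
qed

text \<open>The load of the carrier after box \<open>z\<close>, as the largest increment of the walk up to \<open>z\<close>. Box \<open>z\<close> is
  a record iff it is empty and the load before it is 0.\<close>

definition has_load :: "config \<Rightarrow> int \<Rightarrow> nat \<Rightarrow> bool" where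
  "has_load \<eta> z w \<longleftrightarrow> (\<exists>y\<le>z. walk \<eta> z - walk \<eta> y = int w) \<and> (\<forall>y\<le>z. walk \<eta> z - walk \<eta> y \<le> int w)"

lemma has_load_unique: "has_load \<eta> z w \<Longrightarrow> has_load \<eta> z w' \<Longrightarrow> w = w'"
  unfolding has_load_def by (metis antisym of_nat_eq_iff)

lemma records_iff: "z \<in> records \<eta> \<longleftrightarrow> (\<forall>y<z. walk \<eta> z - walk \<eta> y < 0)"
  by (simp add: records_def)

lemma has_load_cong: "(\<And>j. j \<le> z \<Longrightarrow> \<eta> j = \<eta>' j) \<Longrightarrow> has_load \<eta> z w \<longleftrightarrow> has_load \<eta>' z w"
proof -
  assume "\<And>j. j \<le> z \<Longrightarrow> \<eta> j = \<eta>' j"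
  then have "walk \<eta> z - walk \<eta> y = walk \<eta>' z - walk \<eta>' y" if "y \<le> z" for y
    using walk_diff_cong that by blast
  then show ?thesis unfolding has_load_def by auto
qed

lemma records_cong: "(\<And>j. j \<le> z \<Longrightarrow> \<eta> j = \<eta>' j) \<Longrightarrow> z \<in> records \<eta> \<longleftrightarrow> z \<in> records \<eta>'"
  unfolding records_iff using walk_diff_cong[of z \<eta> \<eta>'] by simp

lemma has_load_shift: "has_load (\<lambda>z. \<eta> (z + a)) z w \<longleftrightarrow> has_load \<eta> (z + a) w"
proof -
  have "(\<exists>y\<le>z. walk \<eta> (z + a) - walk \<eta> (y + a) = int w) \<longleftrightarrow> (\<exists>y\<le>z + a. walk \<eta> (z + a) - walk \<eta> y = int w)"
    by (metis add_le_cancel_right diff_add_cancel)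
  moreover have "(\<forall>y\<le>z. walk \<eta> (z + a) - walk \<eta> (y + a) \<le> int w) \<longleftrightarrow> (\<forall>y\<le>z + a. walk \<eta> (z + a) - walk \<eta> y \<le> int w)"
    by (metis add_le_cancel_right diff_add_cancel)
  ultimately show ?thesis unfolding has_load_def using walk_diff_shift[of _ z \<eta> a] by auto
qed

text \<open>To the left of the record \<open>x\<close> at the height of \<open>z\<close> the walk is
  higher than at \<open>z\<close>, so its minimum up to \<open>z\<close> is attained between
  \<open>x\<close> and \<open>z\<close>.\<close>

lemma ex_load:
  assumes "\<forall>i. \<exists>z\<in>records \<eta>. walk \<eta> z = - i"
  shows "\<exists>w. has_load \<eta> z w"
proof -
  obtain x where x: "x \<in> records \<eta>" "walk \<eta> x = walk \<eta> z" using assms[rule_format, of "- walk \<eta> z"] by auto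
  have xz: "x \<le> z" using x unfolding records_def by force
  define m where "m = Min (walk \<eta> ` {x..z})"
  have "m \<in> walk \<eta> ` {x..z}" unfolding m_def using xz by (intro Min_in) auto
  then obtain y where y: "y \<in> {x..z}" "walk \<eta> y = m" by auto
  have le: "m \<le> walk \<eta> y'" if "y' \<le> z" for y'
  proof (cases "x \<le> y'")
    case True
    then show ?thesis unfolding m_def using that by (intro Min_le) auto
  next
    case False
    then have "walk \<eta> x < walk \<eta> y'" using x(1) by (simp add: records_def)
    moreover have "m \<le> walk \<eta> x" unfolding m_def using xz by (intro Min_le) auto
    ultimately show ?thesis by simp
  qed
  have "has_load \<eta> z (nat (walk \<eta> z - m))" unfolding has_load_def
  proof (intro conjI allI impI exI[of _ y])
    show "walk \<eta> z - walk \<eta> y' \<le> int (nat (walk \<eta> z - m))" if "y' \<le> z" for y' using le[OF that] le[of z] by simp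
  qed (use y le[of z] in auto)
  then show ?thesis ..
qed

text \<open>The truncated subtraction expresses that an empty carrier stays empty at an empty
  box.\<close>

lemma has_load_Suc:
  assumes "has_load \<eta> z w"
  shows "has_load \<eta> (z + 1) (if \<eta> (z + 1) then Suc w else w - 1)"
proof -
  obtain y0 where y0: "y0 \<le> z" "walk \<eta> z - walk \<eta> y0 = int w" and le: "\<And>y. y \<le> z \<Longrightarrow> walk \<eta> z - walk \<eta> y \<le> int w"
    using assms unfolding has_load_def by blast
  note W = walk_Suc[of \<eta> z]
  have split: "y \<le> z \<or> y = z + 1" if "y \<le> z + 1" for y using that by linarith
  show ?thesis
  proof (cases "\<eta> (z + 1) \<or> w \<noteq> 0")
    case True
    have "walk \<eta> (z + 1) - walk \<eta> y0 = int (if \<eta> (z + 1) then Suc w else w - 1)"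
      using True W y0(2) by auto
    moreover have "walk \<eta> (z + 1) - walk \<eta> y \<le> int (if \<eta> (z + 1) then Suc w else w - 1)" if "y \<le> z + 1" for y
      using split[OF that] le[of y] W True by auto
    moreover have "y0 \<le> z + 1" using y0(1) by simp
    ultimately show ?thesis unfolding has_load_def by blast
  next
    case False
    have "walk \<eta> (z + 1) - walk \<eta> y \<le> int 0" if "y \<le> z + 1" for y
      using split[OF that] le[of y] W False by auto
    then show ?thesis using False unfolding has_load_def by auto
  qed
qed

lemma record_Suc_iff:
  assumes "has_load \<eta> z w"
  shows "z + 1 \<in> records \<eta> \<longleftrightarrow> w = 0 \<and> \<not> \<eta> (z + 1)"
proof -
  obtain y0 where y0: "y0 \<le> z" "walk \<eta> z - walk \<eta> y0 = int w" and le: "\<And>y. y \<le> z \<Longrightarrow> walk \<eta> z - walk \<eta> y \<le> int w"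
    using assms unfolding has_load_def by blast
  note W = walk_Suc[of \<eta> z]
  show ?thesis
  proof
    assume r: "z + 1 \<in> records \<eta>"
    then have "walk \<eta> (z + 1) < walk \<eta> y0" using y0(1) by (simp add: records_def)
    then show "w = 0 \<and> \<not> \<eta> (z + 1)" using record_not_ball[OF r] W y0(2) by auto
  next
    assume w: "w = 0 \<and> \<not> \<eta> (z + 1)"
    show "z + 1 \<in> records \<eta>" unfolding records_iff
    proof (intro allI impI)
      fix y assume "y < z + 1"
      then show "walk \<eta> (z + 1) - walk \<eta> y < 0" using le[of y] W w by simp
    qed
  qed
qed

lemma bbs_cong: "(\<And>j. j \<le> z \<Longrightarrow> \<eta> j = \<eta>' j) \<Longrightarrow> bbs \<eta> z \<longleftrightarrow> bbs \<eta>' z"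
  unfolding bbs_def using records_cong[of z \<eta> \<eta>'] by simp

lemma finite_dependence_in_sets:
  fixes P :: "config \<Rightarrow> bool"
  assumes "finite W" "\<And>\<eta> \<eta>'. (\<forall>i\<in>W. \<eta> i = \<eta>' i) \<Longrightarrow> P \<eta> \<longleftrightarrow> P \<eta>'"
  shows "{\<eta>. P \<eta>} \<in> sets seq_space"
proof -
  have "{\<eta>. P \<eta>} = (\<Union>S\<in>{S \<in> Pow W. P (\<lambda>i. i \<in> S)}. {\<eta>. \<forall>i\<in>W. \<eta> i = (i \<in> S)})"
  proof (intro equalityI subsetI)
    fix \<eta> assume "\<eta> \<in> {\<eta>. P \<eta>}"
    then show "\<eta> \<in> (\<Union>S\<in>{S \<in> Pow W. P (\<lambda>i. i \<in> S)}. {\<eta>. \<forall>i\<in>W. \<eta> i = (i \<in> S)})"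
      using assms(2)[of \<eta> "\<lambda>i. i \<in> {i \<in> W. \<eta> i}"] by (intro UN_I[of "{i \<in> W. \<eta> i}"]) auto
  next
    fix \<eta> assume "\<eta> \<in> (\<Union>S\<in>{S \<in> Pow W. P (\<lambda>i. i \<in> S)}. {\<eta>. \<forall>i\<in>W. \<eta> i = (i \<in> S)})"
    then obtain S where "P (\<lambda>i. i \<in> S)" "\<forall>i\<in>W. \<eta> i = (i \<in> S)" by blast
    then show "\<eta> \<in> {\<eta>. P \<eta>}" using assms(2)[of \<eta> "\<lambda>i. i \<in> S"] by simp
  qed
  moreover have "\<dots> \<in> sets seq_space"
    by (rule sets.finite_UN) (use assms(1) in \<open>auto intro: finite_cyl_in_sets\<close>)
  ultimately show ?thesis by simp
qed

lemma measurable_countI: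
  fixes f :: "'a \<Rightarrow> 'b::countable"
  assumes "\<And>c. {x \<in> space M. f x = c} \<in> sets M"
  shows "f \<in> measurable M (count_space UNIV)"
  by (subst measurable_count_space_eq2_countable) (use assms in \<open>auto simp: vimage_def Collect_conj_eq[symmetric] Int_def conj_commute\<close>)

lemma measurable_walk [measurable]: "(\<lambda>\<eta>. walk \<eta> z) \<in> measurable seq_space (count_space UNIV)"
proof (rule measurable_countI)
  fix c
  have "walk \<eta> z = walk \<eta>' z" if "\<forall>i\<in>{0<..z} \<union> {z<..0}. \<eta> i = \<eta>' i" for \<eta> \<eta>'
    unfolding walk_def by (intro arg_cong2[where f = minus] sum.cong) (use that in auto)
  then have "{\<eta>. walk \<eta> z = c} \<in> sets seq_space"
    by (intro finite_dependence_in_sets[of "{0<..z} \<union> {z<..0}"]) auto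
  then show "{\<eta> \<in> space seq_space. walk \<eta> z = c} \<in> sets seq_space" by simp
qed

lemma measurable_coord [measurable]: "Measurable.pred seq_space (\<lambda>\<eta>. \<eta> z)"
  by simp

lemma measurable_records [measurable]: "Measurable.pred seq_space (\<lambda>\<eta>. z \<in> records \<eta>)"
  unfolding records_def mem_Collect_eq by measurable

lemma measurable_has_load [measurable]: "Measurable.pred seq_space (\<lambda>\<eta>. has_load \<eta> z w)"
  unfolding has_load_def by measurable

lemma measurable_bbs_coord [measurable]: "Measurable.pred seq_space (\<lambda>\<eta>. bbs \<eta> z)"
  unfolding bbs_def by measurable

section \<open>The stationary load and the output of the carrier\<close>

context ball_density
begin

lemma sets_B_I: "Measurable.pred seq_space P \<Longrightarrow> {\<eta>. P \<eta>} \<in> sets B"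
  by (simp add: pred_def sets_B)

lemma AE_records: "AE \<eta> in B. \<forall>i. \<exists>z\<in>records \<eta>. walk \<eta> z = - i"
  using AE_good by eventually_elim (rule good_configs_records)

lemma prob_eq_AE:
  assumes [measurable]: "Measurable.pred seq_space P" "Measurable.pred seq_space Q"
    and "\<And>\<eta>. \<forall>i. \<exists>z\<in>records \<eta>. walk \<eta> z = - i \<Longrightarrow> P \<eta> \<longleftrightarrow> Q \<eta>"
  shows "B.prob {\<eta>. P \<eta>} = B.prob {\<eta>. Q \<eta>}"
  using AE_records sets_B_I[OF assms(1)] sets_B_I[OF assms(2)] assms(3)
  by (intro B.finite_measure_eq_AE) auto

lemma prob_next:
  assumes "Measurable.pred seq_space P" "\<And>\<eta> \<eta>'. (\<And>j. j \<le> z \<Longrightarrow> \<eta> j = \<eta>' j) \<Longrightarrow> P \<eta> \<longleftrightarrow> P \<eta>'"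
  shows "B.prob {\<eta>. P \<eta> \<and> \<eta> (z + 1) = b} = B.prob {\<eta>. P \<eta>} * pmf ber b"
proof -
  have "B.prob {\<eta> \<in> {\<eta>. P \<eta>}. \<eta> (z + 1) = b} = B.prob {\<eta>. P \<eta>} * pmf ber b"
  proof (rule indep_coordinate)
    show "{\<eta>. P \<eta>} \<in> sets B" by (rule sets_B_I) (rule assms(1))
    show "fun_upd \<eta> (z + 1) x \<in> {\<eta>. P \<eta>} \<longleftrightarrow> \<eta> \<in> {\<eta>. P \<eta>}" for \<eta> x
      using assms(2)[of "fun_upd \<eta> (z + 1) x" \<eta>] by simp
  qed
  then show ?thesis by simp
qed

text \<open>Old load and input determine output and new load, and conversely: (0, empty) gives (no
  ball, 0), (\<open>w\<close>, ball) gives (no ball, \<open>Suc w\<close>), and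
  (\<open>Suc w\<close>, empty) gives (ball, \<open>w\<close>). So each event on the left is one
  past event together with the content of the next box.\<close>

lemma prob_load_step:
  assumes [measurable]: "Measurable.pred seq_space P"
    and past: "\<And>\<eta> \<eta>'. (\<And>j. j \<le> z \<Longrightarrow> \<eta> j = \<eta>' j) \<Longrightarrow> P \<eta> \<longleftrightarrow> P \<eta>'"
  shows "B.prob {\<eta>. (P \<eta> \<and> bbs \<eta> (z + 1) = False) \<and> has_load \<eta> (z + 1) 0} = B.prob {\<eta>. P \<eta> \<and> has_load \<eta> z 0} * (1 - lam)"
    and "B.prob {\<eta>. (P \<eta> \<and> bbs \<eta> (z + 1) = False) \<and> has_load \<eta> (z + 1) (Suc w)} = B.prob {\<eta>. P \<eta> \<and> has_load \<eta> z w} * lam"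
    and "B.prob {\<eta>. (P \<eta> \<and> bbs \<eta> (z + 1) = True) \<and> has_load \<eta> (z + 1) w} = B.prob {\<eta>. P \<eta> \<and> has_load \<eta> z (Suc w)} * (1 - lam)"
proof -
  have nx: "B.prob {\<eta>. (P \<eta> \<and> has_load \<eta> z v) \<and> \<eta> (z + 1) = b} = B.prob {\<eta>. P \<eta> \<and> has_load \<eta> z v} * pmf ber b" for v b
  proof (rule prob_next)
    show "(P \<eta> \<and> has_load \<eta> z v) = (P \<eta>' \<and> has_load \<eta>' z v)" if "\<And>j. j \<le> z \<Longrightarrow> \<eta> j = \<eta>' j" for \<eta> \<eta>'
      using past[OF that] has_load_cong[OF that] by simp
  qed measurable
  have key: "has_load \<eta> (z + 1) v \<longleftrightarrow> v = (if \<eta> (z + 1) then Suc u else u - 1)"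
    "bbs \<eta> (z + 1) \<longleftrightarrow> \<not> \<eta> (z + 1) \<and> u \<noteq> 0" "has_load \<eta> z v \<longleftrightarrow> v = u"
    if "has_load \<eta> z u" for \<eta> u v
  proof -
    show "has_load \<eta> (z + 1) v \<longleftrightarrow> v = (if \<eta> (z + 1) then Suc u else u - 1)"
      using has_load_Suc[OF that] has_load_unique by blast
    show "bbs \<eta> (z + 1) \<longleftrightarrow> \<not> \<eta> (z + 1) \<and> u \<noteq> 0"
      using record_Suc_iff[OF that] unfolding bbs_def by auto
    show "has_load \<eta> z v \<longleftrightarrow> v = u" using that has_load_unique by blast
  qed
  have "B.prob {\<eta>. (P \<eta> \<and> bbs \<eta> (z + 1) = False) \<and> has_load \<eta> (z + 1) 0} = B.prob {\<eta>. (P \<eta> \<and> has_load \<eta> z 0) \<and> \<eta> (z + 1) = False}"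
  proof (rule prob_eq_AE)
    fix \<eta> assume "\<forall>i. \<exists>z\<in>records \<eta>. walk \<eta> z = - i"
    then obtain u where u: "has_load \<eta> z u" using ex_load by blast
    show "((P \<eta> \<and> bbs \<eta> (z + 1) = False) \<and> has_load \<eta> (z + 1) 0) = ((P \<eta> \<and> has_load \<eta> z 0) \<and> \<eta> (z + 1) = False)"
      unfolding key[OF u] by auto
  qed measurable
  then show "B.prob {\<eta>. (P \<eta> \<and> bbs \<eta> (z + 1) = False) \<and> has_load \<eta> (z + 1) 0} = B.prob {\<eta>. P \<eta> \<and> has_load \<eta> z 0} * (1 - lam)"
    using nx[of 0 False] lam by simp
  have "B.prob {\<eta>. (P \<eta> \<and> bbs \<eta> (z + 1) = False) \<and> has_load \<eta> (z + 1) (Suc w)} = B.prob {\<eta>. (P \<eta> \<and> has_load \<eta> z w) \<and> \<eta> (z + 1) = True}"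
  proof (rule prob_eq_AE)
    fix \<eta> assume "\<forall>i. \<exists>z\<in>records \<eta>. walk \<eta> z = - i"
    then obtain u where u: "has_load \<eta> z u" using ex_load by blast
    show "((P \<eta> \<and> bbs \<eta> (z + 1) = False) \<and> has_load \<eta> (z + 1) (Suc w)) = ((P \<eta> \<and> has_load \<eta> z w) \<and> \<eta> (z + 1) = True)"
      unfolding key[OF u] by auto
  qed measurable
  then show "B.prob {\<eta>. (P \<eta> \<and> bbs \<eta> (z + 1) = False) \<and> has_load \<eta> (z + 1) (Suc w)} = B.prob {\<eta>. P \<eta> \<and> has_load \<eta> z w} * lam"
    using nx[of w True] lam by simp
  have "B.prob {\<eta>. (P \<eta> \<and> bbs \<eta> (z + 1) = True) \<and> has_load \<eta> (z + 1) w} = B.prob {\<eta>. (P \<eta> \<and> has_load \<eta> z (Suc w)) \<and> \<eta> (z + 1) = False}"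
  proof (rule prob_eq_AE)
    fix \<eta> assume "\<forall>i. \<exists>z\<in>records \<eta>. walk \<eta> z = - i"
    then obtain u where u: "has_load \<eta> z u" using ex_load by blast
    show "((P \<eta> \<and> bbs \<eta> (z + 1) = True) \<and> has_load \<eta> (z + 1) w) = ((P \<eta> \<and> has_load \<eta> z (Suc w)) \<and> \<eta> (z + 1) = False)"
      unfolding key[OF u] by auto
  qed measurable
  then show "B.prob {\<eta>. (P \<eta> \<and> bbs \<eta> (z + 1) = True) \<and> has_load \<eta> (z + 1) w} = B.prob {\<eta>. P \<eta> \<and> has_load \<eta> z (Suc w)} * (1 - lam)"
    using nx[of "Suc w" False] lam by simp
qed

lemma prob_load_sums:
  assumes [measurable]: "Measurable.pred seq_space P"
  shows "(\<lambda>w. B.prob {\<eta>. P \<eta> \<and> has_load \<eta> z w}) sums B.prob {\<eta>. P \<eta>}"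
proof -
  let ?A = "\<lambda>w. {\<eta>. P \<eta> \<and> has_load \<eta> z w}"
  have A: "?A w \<in> sets B" for w by (rule sets_B_I) measurable
  have "(\<lambda>w. B.prob (?A w)) sums B.prob (\<Union>w. ?A w)"
    by (rule B.finite_measure_UNION) (use A has_load_unique in \<open>auto simp: disjoint_family_on_def\<close>)
  moreover have "(\<Union>w. ?A w) = {\<eta>. P \<eta> \<and> (\<exists>w. has_load \<eta> z w)}" by auto
  moreover have "B.prob {\<eta>. P \<eta> \<and> (\<exists>w. has_load \<eta> z w)} = B.prob {\<eta>. P \<eta>}"
    by (rule prob_eq_AE) (use ex_load in \<open>auto\<close>)
  ultimately show ?thesis by simp
qed

definition load_prob :: "nat \<Rightarrow> real" where
  "load_prob w = B.prob {\<eta>. has_load \<eta> 0 w}"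

lemma prob_has_load: "B.prob {\<eta>. has_load \<eta> z w} = load_prob w"
proof -
  have meas: "(\<lambda>\<eta> x. \<eta> (x + z)) \<in> measurable B B"
    unfolding measurable_cong_sets[OF sets_B sets_B] by (rule measurable_PiM_single') auto
  have S: "{\<eta>. has_load \<eta> 0 w} \<in> sets B" by (rule sets_B_I) measurable
  have "B.prob {\<eta>. has_load \<eta> z w} = B.prob ((\<lambda>\<eta> x. \<eta> (x + z)) -` {\<eta>. has_load \<eta> 0 w} \<inter> space B)"
    using has_load_shift[of _ z 0 w] by (simp add: vimage_def)
  also have "\<dots> = measure (distr B B (\<lambda>\<eta> x. \<eta> (x + z))) {\<eta>. has_load \<eta> 0 w}"
    by (rule measure_distr[OF meas S, symmetric])
  finally show ?thesis by (simp add: shift_B load_prob_def)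
qed

text \<open>Stationarity links three neighbouring loads. For a nearest-neighbour chain on the
  natural numbers this forces zero net flow between \<open>w\<close> and \<open>Suc w\<close>, by
  induction from 0.\<close>

lemma load_prob_balance: "(1 - lam) * load_prob (Suc w) = lam * load_prob w"
proof -
  have M: "Measurable.pred seq_space (\<lambda>\<eta> :: config. True)" by simp
  note st = prob_load_step[OF M, of 0, simplified, unfolded prob_has_load]
  have tot: "load_prob w = B.prob {\<eta>. \<not> bbs \<eta> 1 \<and> has_load \<eta> 1 w} + B.prob {\<eta>. bbs \<eta> 1 \<and> has_load \<eta> 1 w}" for w
  proof -
    have "{\<eta>. \<not> bbs \<eta> 1 \<and> has_load \<eta> 1 w} \<in> sets B" "{\<eta>. bbs \<eta> 1 \<and> has_load \<eta> 1 w} \<in> sets B"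
      by (rule sets_B_I; measurable)+
    then have "B.prob ({\<eta>. \<not> bbs \<eta> 1 \<and> has_load \<eta> 1 w} \<union> {\<eta>. bbs \<eta> 1 \<and> has_load \<eta> 1 w}) =
      B.prob {\<eta>. \<not> bbs \<eta> 1 \<and> has_load \<eta> 1 w} + B.prob {\<eta>. bbs \<eta> 1 \<and> has_load \<eta> 1 w}"
      by (rule B.finite_measure_Union) auto
    moreover have "{\<eta>. \<not> bbs \<eta> 1 \<and> has_load \<eta> 1 w} \<union> {\<eta>. bbs \<eta> 1 \<and> has_load \<eta> 1 w} = {\<eta>. has_load \<eta> 1 w}" by auto
    ultimately show ?thesis using prob_has_load[of 1 w] by simp
  qed
  have rec: "load_prob 0 = load_prob 0 * (1 - lam) + load_prob 1 * (1 - lam)"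
    "load_prob (Suc w) = load_prob w * lam + load_prob (Suc (Suc w)) * (1 - lam)" for w
    using tot[of 0] tot[of "Suc w"] st by simp_all
  show ?thesis
  proof (induction w)
    case 0
    then show ?case using rec(1) by (simp add: algebra_simps)
  next
    case (Suc w)
    have "(1 - lam) * load_prob (Suc (Suc w)) = load_prob (Suc w) - lam * load_prob w"
      using rec(2)[of w] by (simp add: mult.commute)
    also have "\<dots> = load_prob (Suc w) - (1 - lam) * load_prob (Suc w)" using Suc by simp
    also have "\<dots> = lam * load_prob (Suc w)" by (simp add: algebra_simps)
    finally show ?case .
  qed
qed

lemma load_prob_sums: "load_prob sums 1"
proof -
  have "Measurable.pred seq_space (\<lambda>\<eta> :: config. True)" by simp
  then show ?thesis using prob_load_sums[of "\<lambda>_. True" 0] B.prob_space by (simp add: load_prob_def[abs_def])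
qed

text \<open>By the balance the load is geometric with ratio \<open>lam / (1 - lam)\<close>, which is
  below 1 because \<open>lam < 1 / 2\<close>.\<close>

lemma load_prob_0: "(1 - lam) * load_prob 0 = 1 - 2 * lam"
proof -
  define r where "r = lam / (1 - lam)"
  have r: "0 \<le> r" "r < 1" using lam by (auto simp: r_def field_simps)
  have "load_prob w = load_prob 0 * r ^ w" for w
  proof (induction w)
    case (Suc w)
    have "load_prob (Suc w) = r * load_prob w" using load_prob_balance[of w] lam by (simp add: r_def field_simps)
    then show ?case using Suc by simp
  qed simp
  then have "load_prob = (\<lambda>w. load_prob 0 * r ^ w)" by blast
  moreover have "(\<lambda>w. load_prob 0 * r ^ w) sums (load_prob 0 * (1 / (1 - r)))"
    using r by (intro sums_mult geometric_sums) auto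
  ultimately have "load_prob 0 * (1 / (1 - r)) = 1" using load_prob_sums sums_unique2 by metis
  moreover have "1 - r = (1 - 2 * lam) / (1 - lam)" using lam by (simp add: r_def field_simps)
  ultimately show ?thesis using lam by (simp add: field_simps)
qed

text \<open>A record is an empty box met by an empty carrier. The value is the normalization in
  \<open>palm\<close>.\<close>

lemma prob_record: "B.prob {\<eta>. z \<in> records \<eta>} = 1 - 2 * lam"
proof -
  have "B.prob {\<eta>. z \<in> records \<eta>} = B.prob {\<eta>. has_load \<eta> (z - 1) 0 \<and> \<eta> (z - 1 + 1) = False}"
  proof (rule prob_eq_AE)
    fix \<eta> assume "\<forall>i. \<exists>z\<in>records \<eta>. walk \<eta> z = - i"
    then obtain u where u: "has_load \<eta> (z - 1) u" using ex_load by blast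
    show "z \<in> records \<eta> \<longleftrightarrow> has_load \<eta> (z - 1) 0 \<and> \<eta> (z - 1 + 1) = False"
    proof -
      have "has_load \<eta> (z - 1) 0 \<longleftrightarrow> u = 0" using u has_load_unique by blast
      then show ?thesis using record_Suc_iff[OF u] by simp
    qed
  qed measurable
  also have "\<dots> = B.prob {\<eta>. has_load \<eta> (z - 1) 0} * pmf ber False"
  proof (rule prob_next)
    show "has_load \<eta> (z - 1) 0 = has_load \<eta>' (z - 1) 0" if "\<And>j. j \<le> z - 1 \<Longrightarrow> \<eta> j = \<eta>' j" for \<eta> \<eta>'
      using has_load_cong[OF that] .
  qed measurable
  also have "\<dots> = load_prob 0 * pmf ber False" by (simp only: prob_has_load)
  finally show ?thesis using load_prob_0 lam by (simp add: mult.commute)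
qed

text \<open>The output process together with the load satisfies the same recursion as the product of its two
  marginals, by detailed balance for the load.\<close>

lemma prob_bbs_load:
  "B.prob {\<eta>. (\<forall>i\<in>{1..m}. bbs \<eta> (a + int i) = u i) \<and> has_load \<eta> (a + int m) w} =
    load_prob w * (\<Prod>i\<in>{1..m}. pmf ber (u i))"
proof (induction m arbitrary: w)
  case 0
  then show ?case by (simp add: prob_has_load)
next
  case (Suc m)
  define P where "P \<eta> \<longleftrightarrow> (\<forall>i\<in>{1..m}. bbs \<eta> (a + int i) = u i)" for \<eta>
  have [measurable]: "Measurable.pred seq_space P" unfolding P_def by measurable
  have past: "P \<eta> \<longleftrightarrow> P \<eta>'" if "\<And>j. j \<le> a + int m \<Longrightarrow> \<eta> j = \<eta>' j" for \<eta> \<eta>'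
  proof -
    have "bbs \<eta> (a + int i) \<longleftrightarrow> bbs \<eta>' (a + int i)" if "i \<in> {1..m}" for i
      using \<open>i \<in> {1..m}\<close> \<open>\<And>j. j \<le> a + int m \<Longrightarrow> \<eta> j = \<eta>' j\<close> by (intro bbs_cong) auto
    then show ?thesis unfolding P_def by blast
  qed
  define c where "c = (\<Prod>i\<in>{1..m}. pmf ber (u i))"
  have IH: "B.prob {\<eta>. P \<eta> \<and> has_load \<eta> (a + int m) w} = load_prob w * c" for w
    using Suc unfolding P_def c_def by blast
  note st = prob_load_step[OF \<open>Measurable.pred seq_space P\<close>, of "a + int m", OF past, unfolded IH]
  have e: "(\<forall>i\<in>{1..Suc m}. bbs \<eta> (a + int i) = u i) \<and> has_load \<eta> (a + int (Suc m)) w \<longleftrightarrow>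
      (P \<eta> \<and> bbs \<eta> (a + int m + 1) = u (Suc m)) \<and> has_load \<eta> (a + int m + 1) w" for \<eta> w
    unfolding P_def by (auto simp: atLeastAtMostSuc_conv ac_simps)
  have "B.prob {\<eta>. (P \<eta> \<and> bbs \<eta> (a + int m + 1) = u (Suc m)) \<and> has_load \<eta> (a + int m + 1) w} =
      load_prob w * (c * pmf ber (u (Suc m)))"
  proof (cases "u (Suc m)")
    case True
    \<comment> \<open>An output ball comes from load \<open>Suc w\<close> and an empty box; detailed
      balance trades this for load \<open>w\<close> and the factor \<open>lam\<close> of a
      ball.\<close>
    have "load_prob (Suc w) * c * (1 - lam) = ((1 - lam) * load_prob (Suc w)) * c" by simp
    also have "\<dots> = load_prob w * (c * lam)" unfolding load_prob_balance by simp
    finally show ?thesis using st(3)[of w] lam True by simp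
  next
    case False
    show ?thesis
    proof (cases w)
      case 0
      then show ?thesis using st(1) lam False by simp
    next
      case (Suc w')
      have "load_prob w' * c * lam = (lam * load_prob w') * c" by simp
      also have "\<dots> = load_prob w * (c * (1 - lam))" unfolding Suc load_prob_balance[symmetric] by simp
      finally show ?thesis using st(2)[of w'] lam False Suc by simp
    qed
  qed
  then show ?case unfolding e by (simp add: c_def mult.commute)
qed

lemma prob_bbs: "B.prob {\<eta>. \<forall>i\<in>{1..m}. bbs \<eta> (a + int i) = u i} = (\<Prod>i\<in>{1..m}. pmf ber (u i))"
proof -
  have "Measurable.pred seq_space (\<lambda>\<eta>. \<forall>i\<in>{1..m}. bbs \<eta> (a + int i) = u i)" by measurable
  note s1 = prob_load_sums[OF this, of "a + int m", unfolded prob_bbs_load]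
  have "(\<lambda>w. load_prob w * (\<Prod>i\<in>{1..m}. pmf ber (u i))) sums (1 * (\<Prod>i\<in>{1..m}. pmf ber (u i)))"
    by (rule sums_mult2[OF load_prob_sums])
  then show ?thesis using s1 sums_unique2 by fastforce
qed

lemma bbs_invariant_B: "bbs_invariant B"
proof -
  have meas: "bbs \<in> measurable B B"
    unfolding measurable_cong_sets[OF sets_B sets_B] by (rule measurable_PiM_single') auto
  have "distr B B bbs = B"
  proof (rule measure_eq_windowI)
    show "prob_space (distr B B bbs)" by (rule B.prob_space_distr[OF meas])
    fix n :: nat and u :: "int \<Rightarrow> bool"
    \<comment> \<open>The indices in \<open>prob_bbs\<close> start at \<open>a + 1\<close>, which
      has to be the left end of the window.\<close>
    define a where "a = - int n - 1"
    have img: "{- int n..<int n} = (\<lambda>i. a + int i) ` {1..2 * n}"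
    proof (intro equalityI subsetI)
      fix z assume "z \<in> {- int n..<int n}"
      then show "z \<in> (\<lambda>i. a + int i) ` {1..2 * n}" by (intro image_eqI[of _ _ "nat (z - a)"]) (auto simp: a_def)
    qed (auto simp: a_def)
    have "emeasure (distr B B bbs) (window_cyl (- int n) (int n) u) = emeasure B (bbs -` window_cyl (- int n) (int n) u \<inter> space B)"
      by (rule emeasure_distr[OF meas]) (simp add: sets_B window_cyl_in_sets)
    also have "bbs -` window_cyl (- int n) (int n) u \<inter> space B = {\<eta>. \<forall>i\<in>{1..2 * n}. bbs \<eta> (a + int i) = u (a + int i)}"
      unfolding window_cyl_def img by auto
    also have "emeasure B \<dots> = ennreal (\<Prod>i\<in>{1..2 * n}. pmf ber (u (a + int i)))"
      unfolding B.emeasure_eq_measure prob_bbs ..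
    also have "\<dots> = ennreal (\<Prod>i\<in>{- int n..<int n}. pmf ber (u i))"
      unfolding img by (subst prod.reindex) (auto simp: inj_on_def)
    also have "\<dots> = emeasure B (window_cyl (- int n) (int n) u)"
      by (simp add: window_cyl_def emeasure_B_cyl)
    finally show "emeasure (distr B B bbs) (window_cyl (- int n) (int n) u) = emeasure B (window_cyl (- int n) (int n) u)" .
  qed (simp_all add: sets_B)
  then show ?thesis using meas by (simp add: bbs_invariant_def)
qed

end

section \<open>Measurability\<close>

lemma measurable_map_list:
  fixes f :: "'i \<Rightarrow> 'a \<Rightarrow> 'b::countable"
  assumes "\<And>z. z \<in> set zs \<Longrightarrow> f z \<in> measurable M (count_space UNIV)"
  shows "(\<lambda>x. map (\<lambda>z. f z x) zs) \<in> measurable M (count_space UNIV)"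
  using assms
proof (induction zs)
  case (Cons z zs)
  have "(\<lambda>x. (\<lambda>a l. a # l) (f z x) (map (\<lambda>z. f z x) zs)) \<in> measurable M (count_space UNIV)"
  proof (rule measurable_compose_countable[where f = "\<lambda>a x. a # map (\<lambda>z. f z x) zs" and g = "f z"])
    show "(\<lambda>x. a # map (\<lambda>z. f z x) zs) \<in> measurable M (count_space UNIV)" for a
      by (rule measurable_compose[OF Cons.IH]) (use Cons.prems in auto)
  qed (use Cons.prems in auto)
  then show ?case by simp
qed simp

lemma measurable_count2:
  fixes f :: "'a \<Rightarrow> 'b::countable"
  assumes "f \<in> measurable M (count_space UNIV)" "g \<in> measurable M (count_space UNIV)"
  shows "(\<lambda>x. h (f x) (g x)) \<in> measurable M (count_space UNIV)"
proof (rule measurable_compose_countable[OF _ assms(1), of "\<lambda>a x. h a (g x)"])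
  show "(\<lambda>x. h a (g x)) \<in> measurable M (count_space UNIV)" for a
    by (rule measurable_compose[OF assms(2)]) simp
qed

text \<open>\<open>LEAST\<close> has an unspecified but fixed value where no least point exists.
  Making it explicit gives measurability on the whole space, not only on regular
  configurations.\<close>

lemma rec_pos_eq_iff:
  "rec_pos \<eta> i = c \<longleftrightarrow> (walk \<eta> c = - i \<and> (\<forall>y. walk \<eta> y = - i \<longrightarrow> c \<le> y)) \<or>
     ((\<forall>x. \<not> (walk \<eta> x = - i \<and> (\<forall>y. walk \<eta> y = - i \<longrightarrow> x \<le> y))) \<and> c = (THE x. False))"
proof (cases "\<exists>x. walk \<eta> x = - i \<and> (\<forall>y. walk \<eta> y = - i \<longrightarrow> x \<le> y)")
  case True
  then obtain x where x: "walk \<eta> x = - i" "\<forall>y. walk \<eta> y = - i \<longrightarrow> x \<le> y" by blast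
  then have "rec_pos \<eta> i = x" unfolding rec_pos_def by (intro Least_equality) auto
  then show ?thesis using x True by (metis antisym)
next
  case False
  then have "(\<lambda>x. walk \<eta> x = - i \<and> (\<forall>y. walk \<eta> y = - i \<longrightarrow> x \<le> y)) = (\<lambda>x. False)"
    unfolding not_ex by (intro ext) (simp only:)
  then have "rec_pos \<eta> i = (THE x. False)" unfolding rec_pos_def Least_def by (rule arg_cong)
  then show ?thesis using False by auto
qed

lemma measurable_rec_pos [measurable]: "(\<lambda>\<eta>. rec_pos \<eta> i) \<in> measurable seq_space (count_space UNIV)"
proof (rule measurable_countI)
  fix c
  have "Measurable.pred seq_space (\<lambda>\<eta>. rec_pos \<eta> i = c)" unfolding rec_pos_eq_iff by measurable
  then show "{\<eta> \<in> space seq_space. rec_pos \<eta> i = c} \<in> sets seq_space" by (simp add: pred_def)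
qed

lemma measurable_excursion [measurable]: "(\<lambda>\<eta>. excursion \<eta> i) \<in> measurable seq_space (count_space UNIV)"
proof -
  define F where "F a b \<eta> = map (\<lambda>z. walk \<eta> (a + z) - walk \<eta> a) [0..2 * ((b - a - 1) div 2)]" for a b \<eta>
  have "(\<lambda>\<eta>. F a b \<eta>) \<in> measurable seq_space (count_space UNIV)" for a b
    unfolding F_def
    by (rule measurable_map_list[where f = "\<lambda>z \<eta>. walk \<eta> (a + z) - walk \<eta> a"]) measurable
  then have "(\<lambda>\<eta>. F a (rec_pos \<eta> (i + 1)) \<eta>) \<in> measurable seq_space (count_space UNIV)" for a
    by (rule measurable_compose_countable) (rule measurable_rec_pos)
  then have "(\<lambda>\<eta>. F (rec_pos \<eta> i) (rec_pos \<eta> (i + 1)) \<eta>) \<in> measurable seq_space (count_space UNIV)"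
    by (rule measurable_compose_countable) (rule measurable_rec_pos)
  then show ?thesis unfolding F_def excursion_def Let_def .
qed

lemma measurable_exc_word [measurable]: "(\<lambda>\<eta>. exc_word \<eta> i) \<in> measurable seq_space (count_space UNIV)"
proof -
  have "(\<lambda>\<eta> :: config. map \<eta> [a + 1..b - 1]) \<in> measurable seq_space (count_space UNIV)" for a b
    using measurable_map_list[of "[a + 1..b - 1]" "\<lambda>z (\<eta> :: config). \<eta> z" seq_space] by simp
  then have "(\<lambda>\<eta>. map \<eta> [a + 1..rec_pos \<eta> (i + 1) - 1]) \<in> measurable seq_space (count_space UNIV)" for a
    by (rule measurable_compose_countable) (rule measurable_rec_pos)
  then have "(\<lambda>\<eta>. map \<eta> [rec_pos \<eta> i + 1..rec_pos \<eta> (i + 1) - 1]) \<in> measurable seq_space (count_space UNIV)"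
    by (rule measurable_compose_countable) (rule measurable_rec_pos)
  then show ?thesis unfolding exc_word_def .
qed

lemma measurable_slots [measurable]: "Measurable.pred seq_space (\<lambda>\<eta>. z \<in> slots \<eta> k)"
proof -
  have "Measurable.pred seq_space (\<lambda>\<eta>. z \<in> (+) (rec_pos \<eta> i) ` exc_slots (excursion \<eta> i) k)" for i
    by (rule measurable_count2[OF measurable_rec_pos measurable_excursion,
      where h = "\<lambda>r e. z \<in> (+) r ` exc_slots e k"])
  then have "Measurable.pred seq_space (\<lambda>\<eta>. \<exists>i. z \<in> (+) (rec_pos \<eta> i) ` exc_slots (excursion \<eta> i) k)"
    by (intro pred_intros_countable)
  then show ?thesis by (simp add: slots_def)
qed

lemma measurable_solitons [measurable]: "Measurable.pred seq_space (\<lambda>\<eta>. \<gamma> \<in> solitons \<eta> k)"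
proof -
  have "Measurable.pred seq_space (\<lambda>\<eta>. \<gamma> \<in> (\<lambda>\<gamma>. (+) (rec_pos \<eta> i) ` \<gamma>) ` exc_solitons (excursion \<eta> i) k)" for i
    by (rule measurable_count2[OF measurable_rec_pos measurable_excursion,
      where h = "\<lambda>r e. \<gamma> \<in> (\<lambda>\<gamma>. (+) r ` \<gamma>) ` exc_solitons e k"])
  then have "Measurable.pred seq_space (\<lambda>\<eta>. \<exists>i. \<gamma> \<in> (\<lambda>\<gamma>. (+) (rec_pos \<eta> i) ` \<gamma>) ` exc_solitons (excursion \<eta> i) k)"
    by (intro pred_intros_countable)
  then show ?thesis by (simp add: solitons_def)
qed

definition enum_spec :: "int set \<Rightarrow> (int \<Rightarrow> int) \<Rightarrow> bool" where
  "enum_spec S s \<longleftrightarrow> strict_mono s \<and> range s = S \<and> s 0 = 0"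

lemma enum_spec_unique: "enum_spec S s \<Longrightarrow> enum_spec S s' \<Longrightarrow> s = s'"
  unfolding enum_spec_def by (rule strict_mono_same_range) auto

text \<open>Turns the existence of an enumeration, a quantifier over functions, into countably many
  conditions on membership, as measurability requires.\<close>

lemma ex_enum_spec:
  "(\<exists>s. enum_spec S s) \<longleftrightarrow> 0 \<in> S \<and> (\<forall>z. \<exists>y>z. y \<in> S) \<and> (\<forall>z. \<exists>y<z. y \<in> S)"
proof
  assume "\<exists>s. enum_spec S s"
  then obtain s :: "int \<Rightarrow> int" where s: "strict_mono s" "range s = S" "s 0 = 0"
    unfolding enum_spec_def by blast
  have "\<exists>y>z. y \<in> S" "\<exists>y<z. y \<in> S" for z
  proof -
    obtain i where i: "s i \<le> z" "z < s (i + 1)" using strict_mono_int_block[OF s(1), of z] by blast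
    have "s (i - 1) < s i" using s(1) by (simp add: strict_mono_def)
    then have "s (i - 1) < z" using i by simp
    moreover have "s (i - 1) \<in> S" "s (i + 1) \<in> S" using s(2) by blast+
    ultimately show "\<exists>y>z. y \<in> S" "\<exists>y<z. y \<in> S" using i by blast+
  qed
  moreover have "0 \<in> S" using s(2,3) by (metis rangeI)
  ultimately show "0 \<in> S \<and> (\<forall>z. \<exists>y>z. y \<in> S) \<and> (\<forall>z. \<exists>y<z. y \<in> S)" by blast
next
  assume S: "0 \<in> S \<and> (\<forall>z. \<exists>y>z. y \<in> S) \<and> (\<forall>z. \<exists>y<z. y \<in> S)"
  have "\<exists>y. least_in {y \<in> S. x < y} y" for x
  proof (rule ex_least_in)
    show "{y \<in> S. x < y} \<noteq> {}" using S by blast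
    show "bdd_below {y \<in> S. x < y}" by (rule bdd_belowI[of _ x]) auto
  qed
  then obtain nx where nx: "\<And>x. least_in {y \<in> S. x < y} (nx x)" by metis
  \<comment> \<open>The predecessor in \<open>S\<close> is a least element after reflection at
    0.\<close>
  have "\<exists>y. least_in {y. - y \<in> S \<and> - x < y} y" for x
  proof (rule ex_least_in)
    obtain y where "y < x" "y \<in> S" using S by blast
    then have "- y \<in> {y. - y \<in> S \<and> - x < y}" by simp
    then show "{y. - y \<in> S \<and> - x < y} \<noteq> {}" by blast
    show "bdd_below {y. - y \<in> S \<and> - x < y}" by (rule bdd_belowI[of _ "- x"]) auto
  qed
  then obtain pv where pv: "\<And>x. least_in {y. - y \<in> S \<and> - x < y} (pv x)" by metis
  define s where "s i = (if 0 \<le> i then (nx ^^ nat i) 0 else ((\<lambda>x. - pv x) ^^ nat (- i)) 0)" for i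
  have s0: "s 0 = 0" by (simp add: s_def)
  have up: "s (i + 1) = nx (s i)" if "0 \<le> i" for i
  proof -
    have "nat (i + 1) = Suc (nat i)" using that by simp
    then show ?thesis using that by (simp add: s_def)
  qed
  have dn: "s i = - pv (s (i + 1))" if "i < 0" for i
  proof -
    have "nat (- i) = Suc (nat (- (i + 1)))" using that by simp
    then show ?thesis using that by (cases "i + 1 = 0") (simp_all add: s_def)
  qed
  have inS: "s i \<in> S" for i
  proof (cases "0 \<le> i")
    case True
    then show ?thesis
    proof (induction i rule: int_ge_induct)
      case (step i)
      then show ?case using up[of i] nx[of "s i"] by (simp add: least_in_def)
    qed (simp add: s0 S)
  next
    case False
    then show ?thesis using dn[of i] pv[of "s (i + 1)"] by (simp add: least_in_def)
  qed
  have lt: "s i < s (i + 1) \<and> (\<forall>y\<in>S. s i < y \<longrightarrow> s (i + 1) \<le> y)" for i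
  proof (cases "0 \<le> i")
    case True
    then show ?thesis using up[of i] nx[of "s i"] by (auto simp: least_in_def)
  next
    case False
    have l: "least_in {y. - y \<in> S \<and> - s (i + 1) < y} (- s i)" using dn[of i] pv[of "s (i + 1)"] False by simp
    have "s (i + 1) \<le> y" if "y \<in> S" "s i < y" for y
    proof (rule ccontr)
      assume "\<not> s (i + 1) \<le> y"
      then have "- y \<in> {y. - y \<in> S \<and> - s (i + 1) < y}" using that by simp
      then have "- s i \<le> - y" using l unfolding least_in_def by blast
      then show False using that(2) by simp
    qed
    then show ?thesis using l by (auto simp: least_in_def)
  qed
  have sm: "strict_mono s" by (rule strict_mono_intI) (use lt in blast)
  have "S \<subseteq> range s"
  proof
    fix y assume y: "y \<in> S"
    obtain i where i: "s i \<le> y" "y < s (i + 1)" using strict_mono_int_block[OF sm, of y] by blast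
    then have "y = s i" using lt[of i] y by force
    then show "y \<in> range s" by blast
  qed
  then show "\<exists>s. enum_spec S s" using sm inS s0 by (auto simp: enum_spec_def)
qed

text \<open>The index of \<open>c\<close> is the signed number of elements of \<open>S\<close>
  between 0 and \<open>c\<close>. For fixed \<open>j\<close> and \<open>c\<close> this involves only
  finitely many memberships.\<close>

lemma enum_spec_eq_iff:
  assumes "enum_spec S s"
  shows "s j = c \<longleftrightarrow> c \<in> S \<and> (if 0 \<le> j then 0 \<le> c \<and> int (card {z \<in> {0..<c}. z \<in> S}) = j
     else c < 0 \<and> int (card {z \<in> {c..<0}. z \<in> S}) = - j)"
proof -
  have s: "strict_mono s" "range s = S" "s 0 = 0" using assms by (auto simp: enum_spec_def)
  have img: "{z \<in> {s a..<s b}. z \<in> S} = s ` {a..<b}" for a b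
    using s(2) strict_mono_less_eq[OF s(1)] strict_mono_less[OF s(1)] by fastforce
  have inj: "inj s" using s(1) by (rule strict_mono_imp_inj_on)
  have card: "card {z \<in> {s a..<s b}. z \<in> S} = nat (b - a)" for a b
    unfolding img by (subst card_image) (auto intro: inj_on_subset[OF inj])
  have sgn: "0 \<le> s i \<longleftrightarrow> 0 \<le> i" for i using strict_mono_less_eq[OF s(1), of 0 i] s(3) by simp
  have char: "if 0 \<le> i then 0 \<le> s i \<and> int (card {z \<in> {0..<s i}. z \<in> S}) = i
     else s i < 0 \<and> int (card {z \<in> {s i..<0}. z \<in> S}) = - i" for i
    using card[of 0 i] card[of i 0] s(3) sgn[of i] by auto
  show ?thesis
  proof
    assume "s j = c"
    then show "c \<in> S \<and> (if 0 \<le> j then 0 \<le> c \<and> int (card {z \<in> {0..<c}. z \<in> S}) = j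
     else c < 0 \<and> int (card {z \<in> {c..<0}. z \<in> S}) = - j)" using char[of j] s(2) by auto
  next
    assume h: "c \<in> S \<and> (if 0 \<le> j then 0 \<le> c \<and> int (card {z \<in> {0..<c}. z \<in> S}) = j
     else c < 0 \<and> int (card {z \<in> {c..<0}. z \<in> S}) = - j)"
    then obtain i where i: "c = s i" using s(2) by auto
    have "i = j" using h char[of i] sgn[of i] unfolding i by (auto split: if_splits)
    then show "s j = c" using i by simp
  qed
qed

lemma measurable_slot_pos [measurable]: "(\<lambda>\<eta>. slot_pos \<eta> k j) \<in> measurable seq_space (count_space UNIV)"
proof -
  define sp where "sp \<sigma> = (THE s. enum_spec {z. \<sigma> z} s)" for \<sigma> :: "int \<Rightarrow> bool"
  \<comment> \<open>The default value of the description when \<open>\<sigma>\<close> admits no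
    enumeration.\<close>
  define d where "d = (THE s :: int \<Rightarrow> int. False)"
  have val: "sp \<sigma> j = c \<longleftrightarrow>
     (if \<sigma> 0 \<and> (\<forall>z. \<exists>y>z. \<sigma> y) \<and> (\<forall>z. \<exists>y<z. \<sigma> y)
      then \<sigma> c \<and> (if 0 \<le> j then 0 \<le> c \<and> int (card {z \<in> {0..<c}. \<sigma> z}) = j
         else c < 0 \<and> int (card {z \<in> {c..<0}. \<sigma> z}) = - j)
      else d j = c)" for \<sigma> c
  proof (cases "\<exists>s. enum_spec {z. \<sigma> z} s")
    case True
    then obtain s where s: "enum_spec {z. \<sigma> z} s" by blast
    then have "sp \<sigma> = s" unfolding sp_def by (metis the_equality enum_spec_unique)
    then show ?thesis using enum_spec_eq_iff[OF s, of j c] True ex_enum_spec[of "{z. \<sigma> z}"] by auto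
  next
    case False
    then have "enum_spec {z. \<sigma> z} = (\<lambda>s. False)" unfolding not_ex by (intro ext) (simp only:)
    then have "sp \<sigma> = d" unfolding sp_def d_def by (rule arg_cong)
    then show ?thesis using False ex_enum_spec[of "{z. \<sigma> z}"] by auto
  qed
  have [measurable]: "Measurable.pred seq_space (\<lambda>\<sigma>. int (card {z \<in> {a..<b}. \<sigma> z}) = n)" for a b n
  proof -
    have "{\<sigma>. int (card {z \<in> {a..<b}. \<sigma> z}) = n} \<in> sets seq_space"
    proof (rule finite_dependence_in_sets[of "{a..<b}"])
      fix \<sigma> \<sigma>' :: "int \<Rightarrow> bool" assume "\<forall>i\<in>{a..<b}. \<sigma> i = \<sigma>' i"
      then have "{z \<in> {a..<b}. \<sigma> z} = {z \<in> {a..<b}. \<sigma>' z}" by blast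
      then show "(int (card {z \<in> {a..<b}. \<sigma> z}) = n) = (int (card {z \<in> {a..<b}. \<sigma>' z}) = n)" by simp
    qed simp
    then show ?thesis by (simp add: pred_def)
  qed
  have sp: "(\<lambda>\<sigma>. sp \<sigma> j) \<in> measurable seq_space (count_space UNIV)"
  proof (rule measurable_countI)
    fix c
    have "Measurable.pred seq_space (\<lambda>\<sigma>. sp \<sigma> j = c)" unfolding val by measurable
    then show "{\<sigma> \<in> space seq_space. sp \<sigma> j = c} \<in> sets seq_space" by (simp add: pred_def)
  qed
  have config_core: "(\<lambda>\<eta> z. z \<in> slots \<eta> k) \<in> measurable seq_space seq_space"
    by (rule measurable_PiM_single') (auto simp: measurable_slots)
  have "slot_pos \<eta> k j = sp (\<lambda>z. z \<in> slots \<eta> k) j" for \<eta>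
    by (simp add: slot_pos_def sp_def enum_spec_def)
  then show ?thesis using measurable_compose[OF config_core sp] by simp
qed

lemma measurable_component_coord [measurable]:
  "(\<lambda>\<eta>. component k \<eta> j) \<in> measurable seq_space (count_space UNIV)"
proof -
  define F where "F a b \<eta> = card {\<gamma> \<in> solitons \<eta> k. \<gamma> \<subseteq> {a<..<b}}" for a b :: int and \<eta>
  have "(\<lambda>\<eta>. F a b \<eta>) \<in> measurable seq_space (count_space UNIV)" for a b
  proof -
    \<comment> \<open>A bounded interval has finitely many subsets; listing them makes the
      cardinality a function of finitely many events.\<close>
    obtain gs where gs: "set gs = Pow {a<..<b}" "distinct gs"
      using finite_distinct_list[of "Pow {a<..<b}"] by auto
    have "{\<gamma> \<in> solitons \<eta> k. \<gamma> \<subseteq> {a<..<b}} = set (filter (\<lambda>\<gamma>. \<gamma> \<in> solitons \<eta> k) gs)" for \<eta>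
      using gs(1) by auto
    moreover have "card (set (filter (\<lambda>\<gamma>. \<gamma> \<in> solitons \<eta> k) gs)) = length (filter (\<lambda>\<gamma>. \<gamma> \<in> solitons \<eta> k) gs)" for \<eta>
      using gs(2) by (intro distinct_card) simp
    ultimately have F: "F a b = (\<lambda>\<eta>. length (filter (\<lambda>b. b) (map (\<lambda>\<gamma>. \<gamma> \<in> solitons \<eta> k) gs)))"
      unfolding F_def by (simp add: filter_map comp_def)
    have "(\<lambda>\<eta>. map (\<lambda>\<gamma>. \<gamma> \<in> solitons \<eta> k) gs) \<in> measurable seq_space (count_space UNIV)"
      by (rule measurable_map_list[where f = "\<lambda>\<gamma> \<eta>. \<gamma> \<in> solitons \<eta> k"]) (rule measurable_solitons)
    then show ?thesis unfolding F by (rule measurable_compose) simp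
  qed
  then have "(\<lambda>\<eta>. F a (slot_pos \<eta> k (j + 1)) \<eta>) \<in> measurable seq_space (count_space UNIV)" for a
    by (rule measurable_compose_countable) (rule measurable_slot_pos)
  then have "(\<lambda>\<eta>. F (slot_pos \<eta> k j) (slot_pos \<eta> k (j + 1)) \<eta>) \<in> measurable seq_space (count_space UNIV)"
    by (rule measurable_compose_countable) (rule measurable_slot_pos)
  then show ?thesis unfolding F_def component_def .
qed

lemma measurable_component [measurable]: "component k \<in> measurable seq_space seq_space"
  by (rule measurable_PiM_single') (auto simp: measurable_component_coord)

section \<open>The Palm measure and the law of finitely many excursions\<close>

context ball_density
begin

abbreviation P :: "config measure" where
  "P \<equiv> palm B"

lemma sets_P: "sets P = sets seq_space"
  by (simp add: palm_def sets_B)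

lemma expectation_ball: "B.expectation (\<lambda>\<eta>. of_bool (\<eta> 0)) = lam"
proof -
  have S: "{\<eta>. \<eta> 0} \<in> sets B" by (rule sets_B_I) measurable
  have "B.prob {\<eta> \<in> UNIV. \<eta> 0 = True} = B.prob UNIV * pmf ber True"
    by (rule indep_coordinate) (use sets.top[of B] in auto)
  then have "B.prob {\<eta>. \<eta> 0} = lam" using B.prob_space lam by simp
  moreover have "(\<lambda>\<eta>. of_bool (\<eta> 0)) = (indicator {\<eta>. \<eta> 0} :: config \<Rightarrow> real)" by (auto simp: indicator_def)
  ultimately show ?thesis using S by simp
qed

lemma emeasure_P:
  assumes [measurable]: "Measurable.pred seq_space Q"
  shows "emeasure P {\<eta>. Q \<eta>} = ennreal (B.prob {\<eta>. 0 \<in> records \<eta> \<and> Q \<eta>} / (1 - 2 * lam))"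
proof -
  have R: "{\<eta>. 0 \<in> records \<eta>} \<in> sets B" by (rule sets_B_I) measurable
  have Q: "{\<eta>. Q \<eta>} \<in> sets B" by (rule sets_B_I) measurable
  have RQ: "{\<eta>. 0 \<in> records \<eta> \<and> Q \<eta>} \<in> sets B" by (rule sets_B_I) measurable
  let ?c = "1 / (1 - 2 * lam)"
  have c: "0 \<le> ?c" using lam by simp
  have "(\<lambda>\<eta>. ennreal (indicator {\<eta>. 0 \<in> records \<eta>} \<eta> / (1 - 2 * lam))) \<in> borel_measurable B"
    using R by measurable
  then have "emeasure P {\<eta>. Q \<eta>} = (\<integral>\<^sup>+\<eta>. ennreal (indicator {\<eta>. 0 \<in> records \<eta>} \<eta> / (1 - 2 * lam)) * indicator {\<eta>. Q \<eta>} \<eta> \<partial>B)"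
    unfolding palm_def expectation_ball using Q by (rule emeasure_density)
  also have "\<dots> = (\<integral>\<^sup>+\<eta>. ennreal ?c * indicator {\<eta>. 0 \<in> records \<eta> \<and> Q \<eta>} \<eta> \<partial>B)"
    by (intro nn_integral_cong) (auto simp: indicator_def)
  also have "\<dots> = ennreal ?c * emeasure B {\<eta>. 0 \<in> records \<eta> \<and> Q \<eta>}"
    using RQ by (rule nn_integral_cmult_indicator)
  also have "\<dots> = ennreal (B.prob {\<eta>. 0 \<in> records \<eta> \<and> Q \<eta>} / (1 - 2 * lam))"
    using c by (simp add: B.emeasure_eq_measure flip: ennreal_mult)
  finally show ?thesis .
qed

lemma prob_space_P: "prob_space P"
proof
  have "emeasure P {\<eta>. True} = 1" using lam by (subst emeasure_P) (simp_all add: prob_record)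
  then show "emeasure P (space P) = 1" by (simp add: palm_def)
qed

sublocale P: prob_space P by (rule prob_space_P)

lemma AE_P_I: "AE \<eta> in B. Q \<eta> \<Longrightarrow> AE \<eta> in P. Q \<eta>"
  unfolding palm_def
proof (rule AE_density[THEN iffD2])
  have R: "{\<eta>. 0 \<in> records \<eta>} \<in> sets B" by (rule sets_B_I) measurable
  then show "(\<lambda>\<eta>. ennreal (indicator {\<eta>. 0 \<in> records \<eta>} \<eta> / (1 - 2 * B.expectation (\<lambda>\<eta>. of_bool (\<eta> 0))))) \<in> borel_measurable B"
    by measurable
qed auto

lemma AE_P_regular: "AE \<eta> in P. regular \<eta>"
proof -
  have R: "{\<eta>. 0 \<in> records \<eta>} \<in> sets B" by (rule sets_B_I) measurable
  have m: "(\<lambda>\<eta>. ennreal (indicator {\<eta>. 0 \<in> records \<eta>} \<eta> / (1 - 2 * B.expectation (\<lambda>\<eta>. of_bool (\<eta> 0))))) \<in> borel_measurable B"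
    using R by measurable
  have "AE \<eta> in P. 0 \<in> records \<eta>"
    unfolding palm_def by (subst AE_density[OF m]) (auto split: split_indicator_asm)
  moreover have "AE \<eta> in P. \<forall>i. \<exists>z\<in>records \<eta>. walk \<eta> z = - i" by (rule AE_P_I[OF AE_records])
  ultimately show ?thesis by eventually_elim (simp add: regular_def)
qed

lemma prob_block:
  assumes "Measurable.pred seq_space Q" "\<And>\<eta> \<eta>'. (\<And>j. j \<le> x \<Longrightarrow> \<eta> j = \<eta>' j) \<Longrightarrow> Q \<eta> \<longleftrightarrow> Q \<eta>'"
  shows "B.prob {\<eta>. Q \<eta> \<and> map \<eta> [x + 1..x + int (length v)] = v} = B.prob {\<eta>. Q \<eta>} * prod_list (map (pmf ber) v)"
  using assms
proof (induction v arbitrary: x Q)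
  case (Cons b v)
  note [measurable] = Cons.prems(1)
  have "[x + 1..x + int (length (b # v))] = (x + 1) # [x + 1 + 1..x + 1 + int (length v)]"
    by (subst upto_rec1) (simp_all add: ac_simps)
  then have "{\<eta>. Q \<eta> \<and> map \<eta> [x + 1..x + int (length (b # v))] = b # v} =
      {\<eta>. (Q \<eta> \<and> \<eta> (x + 1) = b) \<and> map \<eta> [x + 1 + 1..x + 1 + int (length v)] = v}" by auto
  moreover have "B.prob {\<eta>. (Q \<eta> \<and> \<eta> (x + 1) = b) \<and> map \<eta> [x + 1 + 1..x + 1 + int (length v)] = v} =
      B.prob {\<eta>. Q \<eta> \<and> \<eta> (x + 1) = b} * prod_list (map (pmf ber) v)"
  proof (rule Cons.IH)
    show "(Q \<eta> \<and> \<eta> (x + 1) = b) = (Q \<eta>' \<and> \<eta>' (x + 1) = b)" if "\<And>j. j \<le> x + 1 \<Longrightarrow> \<eta> j = \<eta>' j" for \<eta> \<eta>'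
      using Cons.prems(2)[of \<eta> \<eta>'] that by simp
  qed measurable
  moreover have "B.prob {\<eta>. Q \<eta> \<and> \<eta> (x + 1) = b} = B.prob {\<eta>. Q \<eta>} * pmf ber b"
    using Cons.prems by (rule prob_next)
  ultimately show ?case by (simp only: list.map prod_list.Cons mult.assoc)
next
  case Nil
  show ?case by simp
qed

definition word_prob :: "bool list \<Rightarrow> real" where
  "word_prob w = (if dyck 0 w then (1 - lam) * (lam * (1 - lam)) ^ (length w div 2) else 0)"

lemma prod_list_dyck:
  "dyck h w \<Longrightarrow> \<exists>t. length w = 2 * t + h \<and> prod_list (map (pmf ber) w) = lam ^ t * (1 - lam) ^ (t + h)"
proof (induction w arbitrary: h)
  case (Cons b w)
  show ?case
  proof (cases b)
    case True
    then obtain t where "length w = 2 * t + Suc h" "prod_list (map (pmf ber) w) = lam ^ t * (1 - lam) ^ (t + Suc h)"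
      using Cons.IH[of "Suc h"] Cons.prems by auto
    then show ?thesis using True lam by (intro exI[of _ "Suc t"]) simp
  next
    case False
    then obtain h' where h: "h = Suc h'" "dyck h' w" using Cons.prems by (cases h) auto
    then obtain t where "length w = 2 * t + h'" "prod_list (map (pmf ber) w) = lam ^ t * (1 - lam) ^ (t + h')"
      using Cons.IH by blast
    then show ?thesis using False lam h by (intro exI[of _ t]) simp
  qed
qed simp

lemma prod_list_block:
  assumes "dyck 0 w"
  shows "prod_list (map (pmf ber) (w @ [False])) = word_prob w"
proof -
  obtain t where "length w = 2 * t" "prod_list (map (pmf ber) w) = lam ^ t * (1 - lam) ^ t"
    using prod_list_dyck[OF assms] by auto
  then show ?thesis using lam assms by (simp add: word_prob_def power_mult_distrib)
qed

text \<open>By stationarity a record at the left end of the window has the same probability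
  \<open>1 - 2 * lam\<close> as one at 0, which cancels the Palm normalization. Each word with its
  closing record is then a block of fresh boxes.\<close>

lemma emeasure_P_words:
  assumes w: "\<And>i. dyck 0 (w i)"
  shows "emeasure P {\<eta>. \<forall>i\<in>{- int m..<int n}. exc_word \<eta> i = w i} = ennreal (\<Prod>i\<in>{- int m..<int n}. word_prob (w i))"
proof -
  define a where "a = offset (\<lambda>i. Suc (length (w i)))"
  have st: "a (i + 1) = a i + int (length (w i @ [False]))" for i unfolding a_def offset_step by simp
  \<comment> \<open>\<open>E k\<close> depends only on the boxes up to the end of the first
    \<open>k\<close> blocks, so the next block is independent of it.\<close>
  define E where "E k \<eta> \<longleftrightarrow> a (- int m) \<in> records \<eta> \<and>
      (\<forall>i\<in>{- int m..<- int m + int k}. map \<eta> [a i + 1..a (i + 1)] = w i @ [False])" for k \<eta>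
  have [measurable]: "Measurable.pred seq_space (E k)" for k
  proof -
    have "(\<lambda>\<eta> :: config. map \<eta> [a i + 1..a (i + 1)]) \<in> measurable seq_space (count_space UNIV)" for i
      using measurable_map_list[of "[a i + 1..a (i + 1)]" "\<lambda>z (\<eta> :: config). \<eta> z" seq_space] by simp
    note [measurable] = this
    show ?thesis unfolding E_def by measurable
  qed
  have mono: "a i \<le> a j" if "i \<le> j" for i j
    using strict_mono_offset[of "\<lambda>i. Suc (length (w i))"] that strict_mono_less_eq unfolding a_def by fastforce
  have past: "E k \<eta> = E k \<eta>'" if "\<And>j. j \<le> a (- int m + int k) \<Longrightarrow> \<eta> j = \<eta>' j" for k \<eta> \<eta>'
  proof -
    have "a (- int m) \<in> records \<eta> \<longleftrightarrow> a (- int m) \<in> records \<eta>'"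
      using that mono[of "- int m" "- int m + int k"] by (intro records_cong) auto
    moreover have "map \<eta> [a i + 1..a (i + 1)] = map \<eta>' [a i + 1..a (i + 1)]" if "i \<in> {- int m..<- int m + int k}" for i
      using \<open>\<And>j. j \<le> a (- int m + int k) \<Longrightarrow> \<eta> j = \<eta>' j\<close> mono[of "i + 1" "- int m + int k"] that by auto
    then have "(\<forall>i\<in>{- int m..<- int m + int k}. map \<eta> [a i + 1..a (i + 1)] = w i @ [False]) \<longleftrightarrow>
        (\<forall>i\<in>{- int m..<- int m + int k}. map \<eta>' [a i + 1..a (i + 1)] = w i @ [False])"
      by (intro ball_cong[OF refl]) (simp only:)
    ultimately show ?thesis unfolding E_def by blast
  qed
  have E: "B.prob {\<eta>. E k \<eta>} = (1 - 2 * lam) * (\<Prod>i\<in>{- int m..<- int m + int k}. word_prob (w i))" for k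
  proof (induction k)
    case 0
    then show ?case by (simp add: E_def prob_record)
  next
    case (Suc k)
    let ?i = "- int m + int k"
    have iv: "{- int m..<- int m + int (Suc k)} = insert ?i {- int m..<?i}" by auto
    have "{\<eta>. E (Suc k) \<eta>} = {\<eta>. E k \<eta> \<and> map \<eta> [a ?i + 1..a ?i + int (length (w ?i @ [False]))] = w ?i @ [False]}"
      unfolding st[symmetric] E_def iv by auto
    then have "B.prob {\<eta>. E (Suc k) \<eta>} = B.prob {\<eta>. E k \<eta>} * prod_list (map (pmf ber) (w ?i @ [False]))"
    proof (simp only:, intro prob_block)
      show "E k \<eta> = E k \<eta>'" if "\<And>j. j \<le> a ?i \<Longrightarrow> \<eta> j = \<eta>' j" for \<eta> \<eta>'
        using that by (rule past)
    qed measurable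
    then show ?case using Suc prod_list_block[OF w] unfolding iv by (simp add: mult.commute)
  qed
  have [measurable]: "Measurable.pred seq_space (\<lambda>\<eta>. \<forall>i\<in>{- int m..<int n}. exc_word \<eta> i = w i)" by measurable
  have "B.prob {\<eta>. 0 \<in> records \<eta> \<and> (\<forall>i\<in>{- int m..<int n}. exc_word \<eta> i = w i)} = B.prob {\<eta>. E (m + n) \<eta>}"
  proof (rule prob_eq_AE)
    fix \<eta> assume "\<forall>i. \<exists>z\<in>records \<eta>. walk \<eta> z = - i"
    from window_iff_blocks[OF w this, of m n]
    show "(0 \<in> records \<eta> \<and> (\<forall>i\<in>{- int m..<int n}. exc_word \<eta> i = w i)) = E (m + n) \<eta>"
      unfolding E_def a_def by simp
  qed measurable
  then show ?thesis using E[of "m + n"] lam by (subst emeasure_P) simp_all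
qed

end

section \<open>Factorization of the soliton weights\<close>

lemma pmf_replicate_pmf:
  "pmf (replicate_pmf n g) v = (if length v = n then prod_list (map (pmf g) v) else 0)"
proof (induction n arbitrary: v)
  case 0
  then show ?case by (cases v) auto
next
  case (Suc n)
  have e: "replicate_pmf (Suc n) g = map_pmf (\<lambda>(x, xs). x # xs) (pair_pmf g (replicate_pmf n g))"
    by (simp add: pair_pmf_def map_bind_pmf bind_assoc_pmf bind_return_pmf)
  show ?case
  proof (cases v)
    case Nil
    then have "v \<notin> set_pmf (replicate_pmf (Suc n) g)" by (auto simp: set_replicate_pmf)
    then show ?thesis using Nil by (simp add: set_pmf_iff del: replicate_pmf.simps)
  next
    case (Cons x xs)
    have "inj (\<lambda>(x :: 'a, xs). x # xs)" by (auto simp: inj_def)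
    then have "pmf (replicate_pmf (Suc n) g) v = pmf (pair_pmf g (replicate_pmf n g)) (x, xs)"
      unfolding e Cons using pmf_map_inj'[of "\<lambda>(x, xs). x # xs" _ "(x, xs)"] by simp
    then show ?thesis using Suc Cons by (simp add: pmf_pair)
  qed
qed

text \<open>No soliton is larger than the word is long, so finitely many factors give the whole
  product.\<close>

definition weight_word :: "(nat \<Rightarrow> real) \<Rightarrow> bool list \<Rightarrow> real" where
  "weight_word a w = (\<Prod>m<length w. a (Suc m) ^ word_solitons (Suc m) w)"

lemma weight_word_extend:
  assumes "dyck 0 w" "length w \<le> M"
  shows "weight_word a w = (\<Prod>m<M. a (Suc m) ^ word_solitons (Suc m) w)"
  unfolding weight_word_def
  by (rule prod.mono_neutral_left) (use assms word_solitons_eq_0 in auto)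

text \<open>The words of the excursions under \<^const>\<open>nu\<close>; here \<open>c\<close> is the inverse of the partition function.\<close>

definition soliton_law :: "(nat \<Rightarrow> real) \<Rightarrow> real \<Rightarrow> bool list pmf \<Rightarrow> bool" where
  "soliton_law a c p \<longleftrightarrow> 0 < c \<and> (\<forall>m\<ge>1. 0 \<le> a m) \<and>
     (\<forall>w. pmf p w = (if dyck 0 w then c * weight_word a w else 0))"

text \<open>Each letter of the shorter word is a 1-slot whose geometric count carries the
  normalization \<open>1 - a 1\<close>. An \<open>m\<close>-soliton of the shorter word has
  \<open>2 * m\<close> letters, and the division compensates for their factors.\<close>

definition next_param :: "(nat \<Rightarrow> real) \<Rightarrow> nat \<Rightarrow> real" where
  "next_param a m = a (Suc m) / (1 - a 1) ^ (2 * m)"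

abbreviation geom :: "real \<Rightarrow> nat pmf" where
  "geom x \<equiv> geometric_pmf (1 - x)"

lemma dyck_expand0:
  "dyck 0 u \<Longrightarrow> length v = Suc (length u) \<Longrightarrow> dyck 0 (expand False u v)"
  using dyck_expand[of v u False 0] by simp

lemma decode_expand0:
  assumes "length v = Suc (length u)"
  shows "wcore (expand False u v) = u" "wgaps (expand False u v) = v"
  using decode_expand[OF assms, of False] by simp_all

lemma expand_decode0: "dyck 0 w \<Longrightarrow> expand False (wcore w) (wgaps w) = w"
  using expand_decode[of False 0 w] by simp

lemma weight_word_expand:
  assumes u: "dyck 0 u" and v: "length v = Suc (length u)"
  shows "weight_word a (expand False u v) = a 1 ^ sum_list v * weight_word (\<lambda>m. a (Suc m)) u"
proof -
  let ?w = "expand False u v"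
  have w: "dyck 0 ?w" using dyck_expand0[OF u v] .
  define M where "M = length ?w + length u"
  have "weight_word a ?w = (\<Prod>m<Suc M. a (Suc m) ^ word_solitons (Suc m) ?w)"
    by (rule weight_word_extend[OF w]) (simp add: M_def)
  also have "\<dots> = a 1 ^ sum_list v * (\<Prod>m<M. a (Suc (Suc m)) ^ word_solitons (Suc m) u)"
    by (subst prod.lessThan_Suc_shift) (simp add: word_solitons_1 word_solitons_Suc_Suc decode_expand0[OF v])
  also have "(\<Prod>m<M. a (Suc (Suc m)) ^ word_solitons (Suc m) u) = weight_word (\<lambda>m. a (Suc m)) u"
    by (rule weight_word_extend[OF u, symmetric]) (simp add: M_def)
  finally show ?thesis .
qed

text \<open>\<open>length_word_solitons\<close> distributes the power of \<open>1 - a 1\<close> over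
  the solitons.\<close>

lemma weight_word_next_param:
  assumes "dyck 0 u" "a 1 < 1"
  shows "weight_word (next_param a) u * (1 - a 1) ^ length u = weight_word (\<lambda>m. a (Suc m)) u"
proof -
  have "length u = (\<Sum>m<length u. 2 * Suc m * word_solitons (Suc m) u)" by (rule length_word_solitons[OF assms(1) order_refl])
  then have "(1 - a 1) ^ length u = (\<Prod>m<length u. ((1 - a 1) ^ (2 * Suc m)) ^ word_solitons (Suc m) u)"
    by (metis (no_types, lifting) power_mult power_sum prod.cong)
  then have "weight_word (next_param a) u * (1 - a 1) ^ length u =
      (\<Prod>m<length u. (next_param a (Suc m) * (1 - a 1) ^ (2 * Suc m)) ^ word_solitons (Suc m) u)"
    by (simp only: weight_word_def prod.distrib[symmetric] power_mult_distrib)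
  then show ?thesis using assms(2) by (simp add: weight_word_def next_param_def)
qed

text \<open>Otherwise the words that consist of 1-solitons only would have infinite mass.\<close>

lemma soliton_law_first:
  assumes law: "soliton_law a c p"
  shows "0 \<le> a 1" "a 1 < 1"
proof -
  show a: "0 \<le> a 1" using law by (simp add: soliton_law_def)
  show "a 1 < 1"
  proof (rule ccontr)
    assume "\<not> a 1 < 1"
    then have ge: "1 \<le> a 1" by simp
    have c: "0 < c" using law by (simp add: soliton_law_def)
    have le: "real N * c \<le> 1" for N
    proof -
      have inj: "inj_on (\<lambda>n. expand False [] [n]) {..<N}"
        using decode_expand0(2)[of "[_]" "[]"] by (intro inj_onI) (metis length_Cons list.inject list.size(3))
      have "c \<le> pmf p (expand False [] [n])" for n
        using law weight_word_expand[of "[]" "[n]" a] dyck_expand0[of "[]" "[n]"] ge c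
        by (simp add: soliton_law_def weight_word_def)
      then have "(\<Sum>n<N. c) \<le> (\<Sum>n<N. pmf p (expand False [] [n]))" by (rule sum_mono)
      also have "\<dots> = measure p ((\<lambda>n. expand False [] [n]) ` {..<N})"
        using inj by (simp add: measure_measure_pmf_finite sum.reindex)
      also have "\<dots> \<le> 1" by (rule measure_pmf.prob_le_1)
      finally show ?thesis by simp
    qed
    obtain N where "1 / c < real N" using reals_Archimedean2 by blast
    then show False using le[of N] c by (simp add: field_simps)
  qed
qed

lemma prod_list_geom:
  assumes "0 \<le> x" "x < 1"
  shows "prod_list (map (pmf (geom x)) v) = x ^ sum_list v * (1 - x) ^ length v"
  using assms by (induction v) (auto simp: power_add)

text \<open>Given \<open>u\<close>, its \<open>length u + 1\<close> counts carry independent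
  geometric weights, and summing them out leaves the law of \<open>u\<close>. The one count beyond
  the letters of \<open>u\<close>, that of the record, turns \<open>c\<close> into
  \<open>c / (1 - a 1)\<close>.\<close>

lemma soliton_law_step:
  assumes law: "soliton_law a c p"
  shows "soliton_law (next_param a) (c / (1 - a 1)) (map_pmf wcore p)"
    and "\<And>u v. dyck 0 u \<Longrightarrow> length v = Suc (length u) \<Longrightarrow>
      pmf p (expand False u v) = pmf (map_pmf wcore p) u * prod_list (map (pmf (geom (a 1))) v)"
proof -
  note a1 = soliton_law_first[OF law]
  have c: "0 < c" "\<And>m. 1 \<le> m \<Longrightarrow> 0 \<le> a m" using law by (auto simp: soliton_law_def)
  define K where "K u = c / (1 - a 1) * weight_word (next_param a) u" for u
  have K0: "0 \<le> K u" for u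
  proof -
    have "0 \<le> weight_word (next_param a) u"
      unfolding weight_word_def next_param_def using c(2) a1 by (intro prod_nonneg) auto
    then show ?thesis using c(1) a1 by (simp add: K_def)
  qed
  have p: "pmf p (expand False u v) = K u * pmf (replicate_pmf (Suc (length u)) (geom (a 1))) v"
    if u: "dyck 0 u" and v: "length v = Suc (length u)" for u v
  proof -
    have "pmf p (expand False u v) = c * (a 1 ^ sum_list v * weight_word (\<lambda>m. a (Suc m)) u)"
      using law dyck_expand0[OF u v] weight_word_expand[OF u v] by (simp add: soliton_law_def)
    also have "\<dots> = c * (a 1 ^ sum_list v * (weight_word (next_param a) u * (1 - a 1) ^ length u))"
      using weight_word_next_param[of u a] u a1 by simp
    also have "\<dots> = K u * (a 1 ^ sum_list v * (1 - a 1) ^ length v)"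
      using a1 v by (simp add: K_def)
    finally show ?thesis using v prod_list_geom[OF a1] by (simp add: pmf_replicate_pmf del: replicate_pmf.simps)
  qed
  have pm: "pmf (map_pmf wcore p) u = K u" if u: "dyck 0 u" for u
  proof -
    let ?V = "{v :: nat list. length v = Suc (length u)}"
    have inj: "inj_on (expand False u) ?V" by (rule inj_onI) (metis decode_expand0(2) mem_Collect_eq)
    have sub: "expand False u ` ?V \<subseteq> wcore -` {u}" using decode_expand0(1) by auto
    \<comment> \<open>The law charges only Dyck words, so the part of the fibre over
      \<open>u\<close> that carries mass is parametrized by the counts.\<close>
    have supp: "w \<in> expand False u ` ?V" if "wcore w = u" "w \<in> set_pmf p" for w
    proof -
      have "dyck 0 w" using that(2) law by (auto simp: soliton_law_def set_pmf_iff split: if_splits)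
      then show ?thesis using expand_decode0[of w] that(1) length_gaps[of "\<lambda>b. b" False w]
        by (intro image_eqI[of _ _ "wgaps w"]) auto
    qed
    have "emeasure p (wcore -` {u}) = emeasure p (expand False u ` ?V)"
      using sub supp by (intro emeasure_eq_AE) (auto simp: AE_measure_pmf_iff)
    also have "\<dots> = (\<integral>\<^sup>+v. ennreal (pmf p (expand False u v)) \<partial>count_space ?V)"
      by (rule nn_integral_pmf'[OF inj, symmetric])
    also have "\<dots> = (\<integral>\<^sup>+v. ennreal (K u) * ennreal (pmf (replicate_pmf (Suc (length u)) (geom (a 1))) v) \<partial>count_space ?V)"
      using p[OF u] K0 by (intro nn_integral_cong) (simp add: ennreal_mult')
    also have "\<dots> = ennreal (K u) * emeasure (replicate_pmf (Suc (length u)) (geom (a 1))) ?V"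
      by (simp add: nn_integral_cmult nn_integral_pmf)
    also have "emeasure (replicate_pmf (Suc (length u)) (geom (a 1))) ?V = 1"
      by (rule measure_pmf.emeasure_eq_1_AE) (auto simp: AE_measure_pmf_iff set_replicate_pmf simp del: replicate_pmf.simps)
    finally have "ennreal (measure p (wcore -` {u})) = ennreal (K u)"
      by (simp add: measure_pmf.emeasure_eq_measure)
    then show ?thesis using K0 by (simp add: pmf_map)
  qed
  show "pmf p (expand False u v) = pmf (map_pmf wcore p) u * prod_list (map (pmf (geom (a 1))) v)"
    if "dyck 0 u" "length v = Suc (length u)" for u v
    using p[OF that] pm[OF that(1)] that(2) by (simp add: pmf_replicate_pmf del: replicate_pmf.simps)
  show "soliton_law (next_param a) (c / (1 - a 1)) (map_pmf wcore p)"
    unfolding soliton_law_def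
  proof (intro conjI allI impI)
    show "0 < c / (1 - a 1)" using c a1 by simp
    show "0 \<le> next_param a m" if "1 \<le> m" for m using c(2)[of "Suc m"] a1 by (simp add: next_param_def)
    fix w
    show "pmf (map_pmf wcore p) w = (if dyck 0 w then c / (1 - a 1) * weight_word (next_param a) w else 0)"
    proof (cases "dyck 0 w")
      case True
      then show ?thesis using pm[of w] by (simp add: K_def)
    next
      case False
      have "w \<notin> set_pmf (map_pmf wcore p)"
      proof
        assume "w \<in> set_pmf (map_pmf wcore p)"
        then obtain w' where "w' \<in> set_pmf p" "w = wcore w'" by auto
        then have "dyck 0 w'" using law by (auto simp: soliton_law_def set_pmf_iff split: if_splits)
        then show False using False \<open>w = wcore w'\<close> dyck_wcore by simp
      qed
      then have "pmf (map_pmf wcore p) w = 0" unfolding set_pmf_iff by simp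
      then show ?thesis using False by simp
    qed
  qed
qed

text \<open>In the product that defines \<open>q a (Suc k)\<close> the factor for
  \<open>j = 1\<close> is the denominator in \<open>next_param\<close>, and the others are those of
  \<open>q (next_param a) k\<close>. So \<open>q\<close> lists the geometric parameters of the
  successive rounds.\<close>

lemma q_next_param: "1 \<le> k \<Longrightarrow> q (next_param a) k = q a (Suc k)"
proof (induction k rule: less_induct)
  case (less k)
  have q1: "q a 1 = a 1" by (subst q.simps) simp
  have "(\<Prod>j\<in>{1..<Suc k}. (1 - q a j) ^ (2 * (Suc k - j))) =
      (1 - q a 1) ^ (2 * (Suc k - 1)) * (\<Prod>j\<in>{Suc 1..<Suc k}. (1 - q a j) ^ (2 * (Suc k - j)))"
    using less.prems by (intro prod.atLeast_Suc_lessThan) simp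
  also have "\<dots> = (1 - a 1) ^ (2 * k) * (\<Prod>j\<in>{1..<k}. (1 - q a (Suc j)) ^ (2 * (k - j)))"
    unfolding prod.shift_bounds_Suc_ivl q1 by simp
  also have "(\<Prod>j\<in>{1..<k}. (1 - q a (Suc j)) ^ (2 * (k - j))) = (\<Prod>j\<in>{1..<k}. (1 - q (next_param a) j) ^ (2 * (k - j)))"
    using less.IH by (intro prod.cong) auto
  finally have "q a (Suc k) = a (Suc k) / ((1 - a 1) ^ (2 * k) * (\<Prod>j\<in>{1..<k}. (1 - q (next_param a) j) ^ (2 * (k - j))))"
    by (subst q.simps) simp
  also have "\<dots> = q (next_param a) k"
    by (subst (2) q.simps) (simp add: next_param_def)
  finally show ?case by simp
qed

lemma q_funpow: "q a (Suc k) = (next_param ^^ k) a 1"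
proof (induction k arbitrary: a)
  case 0
  then show ?case by (subst q.simps) simp
next
  case (Suc k)
  then show ?case using q_next_param[of "Suc k" a] by (simp add: funpow_swap1)
qed

lemma soliton_law_funpow:
  "soliton_law a c p \<Longrightarrow> \<exists>c'. soliton_law ((next_param ^^ k) a) c' (map_pmf (wcore ^^ k) p)"
proof (induction k)
  case 0
  then show ?case by (auto simp: map_pmf_ident id_def)
next
  case (Suc k)
  then obtain c' where "soliton_law ((next_param ^^ k) a) c' (map_pmf (wcore ^^ k) p)" by blast
  from soliton_law_step(1)[OF this] show ?case by (auto simp: map_pmf_comp comp_def)
qed

lemma q_bounds: "soliton_law a c p \<Longrightarrow> 0 \<le> q a (Suc k) \<and> q a (Suc k) < 1"
  using soliton_law_funpow[of a c p k] soliton_law_first unfolding q_funpow by blast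

section \<open>Splitting a sequence of words into shorter words and counts\<close>

definition assemble :: "(int \<Rightarrow> bool list) \<times> (int \<Rightarrow> nat) \<Rightarrow> int \<Rightarrow> bool list" where
  "assemble uc i = (let l = (\<lambda>i. Suc (length (fst uc i)))
     in expand False (fst uc i) (map (snd uc) [offset l i..offset l (i + 1) - 1]))"

definition disassemble :: "(int \<Rightarrow> bool list) \<Rightarrow> (int \<Rightarrow> bool list) \<times> (int \<Rightarrow> nat)" where
  "disassemble w = (\<lambda>i. wcore (w i), concat_words (\<lambda>i. wgaps (w i)))"

lemma concat_words_blocks:
  assumes "\<And>i. 1 \<le> l i"
  shows "concat_words (\<lambda>i. map c [offset l i..offset l (i + 1) - 1]) = c"
proof
  fix j
  let ?V = "\<lambda>i. map c [offset l i..offset l (i + 1) - 1]"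
  have len: "length (?V i) = l i" for i by (simp add: offset_step)
  obtain i t where t: "t < l i" "j = offset l i + int t" using ex_block[of l j] assms by blast
  have "concat_words ?V (offset (\<lambda>i. length (?V i)) i + int t) = ?V i ! t"
  proof (rule concat_words_eq)
    show "?V i \<noteq> []" for i using len[of i] assms[of i] by fastforce
    show "t < length (?V i)" using t(1) len by simp
  qed
  then show "concat_words ?V j = c j" using t len by (simp add: offset_step nth_upto)
qed

lemma disassemble_assemble: "disassemble (assemble (u, c)) = (u, c)"
proof -
  define l where "l = (\<lambda>i. Suc (length (u i)))"
  have len: "length (map c [offset l i..offset l (i + 1) - 1]) = Suc (length (u i))" for i
    by (simp add: offset_step l_def)
  have a: "assemble (u, c) i = expand False (u i) (map c [offset l i..offset l (i + 1) - 1])" for i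
    by (simp add: assemble_def l_def Let_def)
  have "concat_words (\<lambda>i. map c [offset l i..offset l (i + 1) - 1]) = c" by (rule concat_words_blocks) (simp add: l_def)
  then show ?thesis unfolding disassemble_def a decode_expand0[OF len] by simp
qed

text \<open>The cutting points of \<open>c\<close> depend on the lengths in \<open>u\<close>. Once
  \<open>u\<close> agrees with the cores in the window, the cutting points there are the fixed
  numbers \<open>offset l i\<close>, so a window of words becomes a product of two windows.\<close>

lemma assemble_eq_iff:
  assumes w: "\<And>i. dyck 0 (w i)"
  defines "V \<equiv> (\<lambda>i. wgaps (w i))"
  defines "l \<equiv> (\<lambda>i. length (V i))"
  shows "(\<forall>i\<in>{- int n..<int n}. assemble (u, c) i = w i) \<longleftrightarrow>
     (\<forall>i\<in>{- int n..<int n}. u i = wcore (w i)) \<and> (\<forall>j\<in>{offset l (- int n)..<offset l (int n)}. c j = concat_words V j)"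
proof -
  define l' where "l' = (\<lambda>i. Suc (length (u i)))"
  have len: "length (map c [offset l' i..offset l' (i + 1) - 1]) = Suc (length (u i))" for i
    by (simp add: offset_step l'_def)
  have a: "assemble (u, c) i = expand False (u i) (map c [offset l' i..offset l' (i + 1) - 1])" for i
    by (simp add: assemble_def l'_def Let_def)
  have l: "l i = Suc (length (wcore (w i)))" for i by (simp add: l_def V_def length_gaps)
  have sm: "strict_mono (offset l)" by (rule strict_mono_offset) (simp add: l)
  have eq: "assemble (u, c) i = w i \<longleftrightarrow> u i = wcore (w i) \<and> map c [offset l' i..offset l' (i + 1) - 1] = V i" for i
    using decode_expand0[OF len, of i] expand_decode0[OF w, of i] unfolding a V_def by metis
  have V: "V i = map (concat_words V) [offset l i..offset l (i + 1) - 1]" for i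
  proof (rule nth_equalityI)
    show "length (V i) = length (map (concat_words V) [offset l i..offset l (i + 1) - 1])" by (simp add: offset_step l_def)
    fix t assume t: "t < length (V i)"
    then have "concat_words V (offset (\<lambda>i. length (V i)) i + int t) = V i ! t" by (intro concat_words_eq) (simp_all add: V_def)
    then show "V i ! t = map (concat_words V) [offset l i..offset l (i + 1) - 1] ! t"
      using t by (simp add: offset_step nth_upto l_def)
  qed
  show ?thesis
  proof (cases "\<forall>i\<in>{- int n..<int n}. u i = wcore (w i)")
    case False
    then show ?thesis using eq by blast
  next
    case True
    have o: "offset l' i = offset l i" if "i \<in> {- int n..int n}" for i
      by (rule offset_cong[OF _ _ _ that]) (use True in \<open>auto simp: l l'_def\<close>)
    have "(\<forall>i\<in>{- int n..<int n}. assemble (u, c) i = w i) \<longleftrightarrow>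
        (\<forall>i\<in>{- int n..<int n}. map c [offset l i..offset l (i + 1) - 1] = map (concat_words V) [offset l i..offset l (i + 1) - 1])"
    proof (rule ball_cong[OF refl])
      fix i assume i: "i \<in> {- int n..<int n}"
      then have "offset l' i = offset l i" "offset l' (i + 1) = offset l (i + 1)" using o[of i] o[of "i + 1"] by auto
      then show "(assemble (u, c) i = w i) = (map c [offset l i..offset l (i + 1) - 1] = map (concat_words V) [offset l i..offset l (i + 1) - 1])"
        using eq[of i] True i V[of i] by metis
    qed
    also have "\<dots> \<longleftrightarrow> (\<forall>i\<in>{- int n..<int n}. \<forall>j\<in>{offset l i..offset l (i + 1) - 1}. c j = concat_words V j)" by simp
    also have "\<dots> \<longleftrightarrow> (\<forall>j\<in>{offset l (- int n)..<offset l (int n)}. c j = concat_words V j)"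
    proof
      assume h: "\<forall>i\<in>{- int n..<int n}. \<forall>j\<in>{offset l i..offset l (i + 1) - 1}. c j = concat_words V j"
      show "\<forall>j\<in>{offset l (- int n)..<offset l (int n)}. c j = concat_words V j"
      proof
        fix j assume j: "j \<in> {offset l (- int n)..<offset l (int n)}"
        obtain i where i: "offset l i \<le> j" "j < offset l (i + 1)" using strict_mono_int_block[OF sm, of j] by blast
        have "offset l i < offset l (int n)" "offset l (- int n) < offset l (i + 1)" using i j by auto
        then have "i < int n" "- int n < i + 1" using strict_mono_less[OF sm] by blast+
        then show "c j = concat_words V j" using h i by simp
      qed
    next
      assume h: "\<forall>j\<in>{offset l (- int n)..<offset l (int n)}. c j = concat_words V j"
      show "\<forall>i\<in>{- int n..<int n}. \<forall>j\<in>{offset l i..offset l (i + 1) - 1}. c j = concat_words V j"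
      proof (intro ballI)
        fix i j assume i: "i \<in> {- int n..<int n}" and j: "j \<in> {offset l i..offset l (i + 1) - 1}"
        have "offset l (- int n) \<le> offset l i" "offset l (i + 1) \<le> offset l (int n)"
          using i by (auto simp: strict_mono_less_eq[OF sm])
        then show "c j = concat_words V j" using h j by auto
      qed
    qed
    finally show ?thesis using True by blast
  qed
qed

lemma prod_concat_words:
  fixes f :: "'a \<Rightarrow> real"
  assumes ne: "\<And>i. V i \<noteq> []"
  defines "l \<equiv> (\<lambda>i. length (V i))"
  shows "(\<Prod>j\<in>{offset l a..<offset l (a + int m)}. f (concat_words V j)) = (\<Prod>i\<in>{a..<a + int m}. prod_list (map f (V i)))"
proof (induction m)
  case (Suc m)
  let ?b = "a + int m"
  have sm: "strict_mono (offset l)"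
  proof (rule strict_mono_offset)
    show "1 \<le> l i" for i using ne[of i] by (cases "V i") (auto simp: l_def)
  qed
  define E where "E = offset l (a + int (Suc m))"
  have st: "E = offset l ?b + int (length (V ?b))" using offset_step[of l ?b] by (simp add: l_def E_def ac_simps)
  have le: "offset l a \<le> offset l ?b" by (simp add: strict_mono_less_eq[OF sm])
  have iv: "{offset l a..<E} = {offset l a..<offset l ?b} \<union> (\<lambda>t. offset l ?b + int t) ` {..<length (V ?b)}"
  proof (intro equalityI subsetI)
    fix j assume "j \<in> {offset l a..<E}"
    then show "j \<in> {offset l a..<offset l ?b} \<union> (\<lambda>t. offset l ?b + int t) ` {..<length (V ?b)}"
      unfolding st by (cases "j < offset l ?b") (auto intro!: image_eqI[of _ _ "nat (j - offset l ?b)"])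
  qed (use le in \<open>auto simp: st\<close>)
  have "(\<Prod>j\<in>(\<lambda>t. offset l ?b + int t) ` {..<length (V ?b)}. f (concat_words V j)) = (\<Prod>t<length (V ?b). f (concat_words V (offset l ?b + int t)))"
    by (subst prod.reindex) (auto simp: inj_on_def)
  also have "\<dots> = (\<Prod>t<length (V ?b). f (V ?b ! t))"
    using concat_words_eq[of V _ ?b] ne by (intro prod.cong) (auto simp: l_def)
  also have "\<dots> = prod_list (map f (V ?b))" by (simp add: prod.list_conv_set_nth atLeast0LessThan)
  finally have new: "(\<Prod>j\<in>(\<lambda>t. offset l ?b + int t) ` {..<length (V ?b)}. f (concat_words V j)) = prod_list (map f (V ?b))" .
  have "(\<Prod>j\<in>{offset l a..<E}. f (concat_words V j)) =
      (\<Prod>j\<in>{offset l a..<offset l ?b}. f (concat_words V j)) * prod_list (map f (V ?b))"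
    unfolding iv new[symmetric] by (rule prod.union_disjoint) auto
  moreover have "{a..<a + int (Suc m)} = insert ?b {a..<?b}" by auto
  ultimately show ?case using Suc unfolding E_def by (simp add: mult.commute)
qed simp

lemma measurable_offset:
  fixes g :: "'a::countable \<Rightarrow> nat"
  assumes f: "\<And>i. f i \<in> measurable M (count_space UNIV)"
  shows "(\<lambda>\<omega>. offset (\<lambda>i. g (f i \<omega>)) j) \<in> measurable M (count_space UNIV)"
proof -
  have s: "(\<Sum>y\<in>{a..<b}. int (h y)) = sum_list (map (\<lambda>y. int (h y)) [a..b - 1])" for a b and h :: "int \<Rightarrow> nat"
  proof -
    have "{a..<b} = set [a..b - 1]" by auto
    then show ?thesis by (simp add: sum_list_distinct_conv_sum_set)
  qed
  have "(\<lambda>\<omega>. map (\<lambda>y. f y \<omega>) zs) \<in> measurable M (count_space UNIV)" for zs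
    by (rule measurable_map_list) (rule f)
  note m = measurable_count2[OF this this, of "\<lambda>xs ys. sum_list (map (\<lambda>x. int (g x)) xs) - sum_list (map (\<lambda>x. int (g x)) ys)"]
  show ?thesis unfolding offset_def s using m[of "[0..j - 1]" "[j..0 - 1]"] by (simp add: comp_def)
qed

text \<open>Replaces the description in \<open>block_of\<close> by a countable disjunction, which is
  measurable.\<close>

lemma concat_words_eq_iff:
  assumes "\<And>i. V i \<noteq> []"
  shows "concat_words V j = x \<longleftrightarrow> (\<exists>i. offset (\<lambda>i. length (V i)) i \<le> j \<and> j < offset (\<lambda>i. length (V i)) (i + 1) \<and>
     V i ! nat (j - offset (\<lambda>i. length (V i)) i) = x)"
proof -
  let ?l = "\<lambda>i. length (V i)"
  have l: "1 \<le> ?l i" for i using assms[of i] by (cases "V i") auto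
  obtain i t where t: "t < length (V i)" "j = offset ?l i + int t" using ex_block_concat_words[of V j] assms by blast
  have i: "offset ?l i \<le> j" "j < offset ?l (i + 1)" using t by (auto simp: offset_step)
  have "concat_words V j = V i ! nat (j - offset ?l i)" using concat_words_eq[of V t i] assms t by simp
  note c = this
  have uniq: "i' = i" if "offset ?l i' \<le> j" "j < offset ?l (i' + 1)" for i'
    using block_of_eq[of ?l i' j, OF l that] block_of_eq[of ?l i j, OF l i] by simp
  show ?thesis
  proof
    assume "concat_words V j = x"
    then show "\<exists>i. offset ?l i \<le> j \<and> j < offset ?l (i + 1) \<and> V i ! nat (j - offset ?l i) = x"
      using i c by (intro exI[of _ i]) simp
  next
    assume "\<exists>i. offset ?l i \<le> j \<and> j < offset ?l (i + 1) \<and> V i ! nat (j - offset ?l i) = x"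
    then obtain i' where i': "offset ?l i' \<le> j" "j < offset ?l (i' + 1)" "V i' ! nat (j - offset ?l i') = x" by blast
    have "i' = i" using uniq i'(1,2) .
    then show "concat_words V j = x" using i'(3) c by simp
  qed
qed

lemma measurable_concat_words:
  fixes G :: "'a::countable \<Rightarrow> 'b::countable list"
  assumes ne: "\<And>x. G x \<noteq> []"
  shows "(\<lambda>\<omega>. concat_words (\<lambda>i. G (\<omega> i))) \<in> measurable seq_space seq_space"
proof (rule measurable_PiM_single')
  fix j :: int
  show "(\<lambda>\<omega>. concat_words (\<lambda>i. G (\<omega> i)) j) \<in> measurable seq_space (count_space UNIV)"
  proof (rule measurable_countI)
    fix x
    have [measurable]: "(\<lambda>\<omega>. offset (\<lambda>i. length (G (\<omega> i))) i) \<in> measurable seq_space (count_space UNIV)" for i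
      by (rule measurable_offset[where g = "\<lambda>a. length (G a)" and f = "\<lambda>i \<omega>. \<omega> i"]) simp
    have [measurable]: "Measurable.pred seq_space (\<lambda>\<omega>. G (\<omega> i) ! nat (j - offset (\<lambda>i. length (G (\<omega> i))) i) = x)" for i
      by (rule measurable_count2[where h = "\<lambda>a b. G a ! nat (j - b) = x" and f = "\<lambda>\<omega>. \<omega> i"]) measurable
    have "Measurable.pred seq_space (\<lambda>\<omega>. concat_words (\<lambda>i. G (\<omega> i)) j = x)"
      unfolding concat_words_eq_iff[of "\<lambda>i. G (_ i)", OF ne] by measurable
    then show "{\<omega> \<in> space seq_space. concat_words (\<lambda>i. G (\<omega> i)) j = x} \<in> sets seq_space" by (simp add: pred_def)
  qed
qed auto

lemma measurable_disassemble: "disassemble \<in> measurable seq_space (seq_space \<Otimes>\<^sub>M seq_space)"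
  unfolding disassemble_def
proof (rule measurable_Pair)
  show "(\<lambda>w i. wcore (w i)) \<in> measurable seq_space seq_space"
    by (rule measurable_PiM_single') auto
  show "(\<lambda>w. concat_words (\<lambda>i. wgaps (w i))) \<in> measurable seq_space seq_space"
    by (rule measurable_concat_words) simp
qed

lemma measurable_assemble: "assemble \<in> measurable (seq_space \<Otimes>\<^sub>M seq_space) seq_space"
proof (rule measurable_PiM_single')
  fix i :: int
  let ?M = "(seq_space :: (int \<Rightarrow> bool list) measure) \<Otimes>\<^sub>M (seq_space :: (int \<Rightarrow> nat) measure)"
  have fst: "(\<lambda>uc. fst uc z) \<in> measurable ?M (count_space UNIV)" for z
    by (rule measurable_compose[OF measurable_fst]) simp
  have snd: "(\<lambda>uc. snd uc z) \<in> measurable ?M (count_space UNIV)" for z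
    by (rule measurable_compose[OF measurable_snd]) simp
  have o: "(\<lambda>uc. offset (\<lambda>i. Suc (length (fst uc i))) j) \<in> measurable ?M (count_space UNIV)" for j
    by (rule measurable_offset[where g = "\<lambda>a. Suc (length a)" and f = "\<lambda>i uc. fst uc i", OF fst])
  have "(\<lambda>uc. map (snd uc) [a..b]) \<in> measurable ?M (count_space UNIV)" for a b
    using measurable_map_list[of "[a..b]" "\<lambda>z uc. snd uc z" ?M, OF snd] by simp
  then have "(\<lambda>uc. map (snd uc) [a..offset (\<lambda>i. Suc (length (fst uc i))) (i + 1) - 1]) \<in> measurable ?M (count_space UNIV)" for a
    using measurable_compose_countable[OF _ o, of "\<lambda>b uc. map (snd uc) [a..b - 1]"] by blast
  then have "(\<lambda>uc. map (snd uc) [offset (\<lambda>i. Suc (length (fst uc i))) i..offset (\<lambda>i. Suc (length (fst uc i))) (i + 1) - 1]) \<in> measurable ?M (count_space UNIV)"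
    using measurable_compose_countable[OF _ o, of "\<lambda>a uc. map (snd uc) [a..offset (\<lambda>i. Suc (length (fst uc i))) (i + 1) - 1]"] by blast
  from measurable_count2[OF fst this, of "expand False" i]
  show "(\<lambda>uc. assemble uc i) \<in> measurable ?M (count_space UNIV)" by (simp add: assemble_def Let_def)
qed auto

lemma emeasure_PiM_pmf_coord:
  fixes p :: "'a::countable pmf"
  shows "emeasure (Pi\<^sub>M UNIV (\<lambda>_ :: int. measure_pmf p)) {\<omega>. \<omega> i \<in> A} = emeasure (measure_pmf p) A"
proof -
  interpret P: product_prob_space "\<lambda>_ :: int. measure_pmf p" UNIV ..
  have "emeasure (measure_pmf p) A = emeasure (distr (Pi\<^sub>M UNIV (\<lambda>_ :: int. measure_pmf p)) (measure_pmf p) (\<lambda>\<omega>. \<omega> i)) A"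
    by (subst P.PiM_component) auto
  also have "\<dots> = emeasure (Pi\<^sub>M UNIV (\<lambda>_ :: int. measure_pmf p)) {\<omega>. \<omega> i \<in> A}"
    by (subst emeasure_distr) (auto simp: space_PiM vimage_def)
  finally show ?thesis by simp
qed

lemma sets_pair_PiM_pmf:
  "sets (Pi\<^sub>M UNIV (\<lambda>_. measure_pmf p) \<Otimes>\<^sub>M Pi\<^sub>M UNIV (\<lambda>_. measure_pmf p')) = sets (seq_space \<Otimes>\<^sub>M seq_space)"
  by (intro sets_pair_measure_cong sets_PiM_pmf)

lemma distr_assemble:
  assumes law: "soliton_law a c p" and g: "g = geom (a 1)"
  shows "distr (Pi\<^sub>M UNIV (\<lambda>_. measure_pmf (map_pmf wcore p)) \<Otimes>\<^sub>M Pi\<^sub>M UNIV (\<lambda>_. measure_pmf g)) seq_space assemble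
    = Pi\<^sub>M UNIV (\<lambda>_. measure_pmf p)"
    (is "distr (?U \<Otimes>\<^sub>M ?C) _ _ = _")
proof (rule measure_eq_windowI)
  interpret U: prob_space ?U by (rule prob_space_PiM_pmf)
  interpret C: prob_space ?C by (rule prob_space_PiM_pmf)
  interpret UC: pair_prob_space ?U ?C ..
  have meas: "assemble \<in> measurable (?U \<Otimes>\<^sub>M ?C) seq_space"
    using measurable_assemble unfolding measurable_cong_sets[OF sets_pair_PiM_pmf refl] .
  show "prob_space (distr (?U \<Otimes>\<^sub>M ?C) seq_space assemble)" by (rule UC.prob_space_distr[OF meas])
  have sp: "space (?U \<Otimes>\<^sub>M ?C) = UNIV" by (simp add: space_pair_measure space_PiM)
  fix n :: nat and w0 :: "int \<Rightarrow> bool list"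
  let ?W = "{- int n..<int n}"
  have L: "emeasure (distr (?U \<Otimes>\<^sub>M ?C) seq_space assemble) (window_cyl (- int n) (int n) w0) =
      emeasure (?U \<Otimes>\<^sub>M ?C) {uc. \<forall>i\<in>?W. assemble uc i = w0 i}"
  proof -
    have "assemble -` window_cyl (- int n) (int n) w0 \<inter> space (?U \<Otimes>\<^sub>M ?C) = {uc. \<forall>i\<in>?W. assemble uc i = w0 i}"
      unfolding sp window_cyl_def by auto
    then show ?thesis using emeasure_distr[OF meas window_cyl_in_sets, of "- int n" "int n" w0] by simp
  qed
  have R: "emeasure (Pi\<^sub>M UNIV (\<lambda>_. measure_pmf p)) (window_cyl (- int n) (int n) w0) = ennreal (\<Prod>i\<in>?W. pmf p (w0 i))"
    unfolding window_cyl_def by (rule emeasure_PiM_pmf) simp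
  show "emeasure (distr (?U \<Otimes>\<^sub>M ?C) seq_space assemble) (window_cyl (- int n) (int n) w0) =
      emeasure (Pi\<^sub>M UNIV (\<lambda>_. measure_pmf p)) (window_cyl (- int n) (int n) w0)"
  proof (cases "\<forall>i\<in>?W. dyck 0 (w0 i)")
    case True
    \<comment> \<open>\<open>assemble_eq_iff\<close> asks for Dyck words at all indices, so the
      sequence is continued by empty words outside the window.\<close>
    define w where "w i = (if i \<in> ?W then w0 i else [])" for i
    have w: "dyck 0 (w i)" for i using True by (simp add: w_def)
    define V where "V = (\<lambda>i. wgaps (w i))"
    define l where "l = (\<lambda>i. length (V i))"
    have ww: "w0 i = w i" if "i \<in> ?W" for i using that by (simp add: w_def)
    let ?A = "{u. \<forall>i\<in>?W. u i = wcore (w i)}" and ?B = "{c. \<forall>j\<in>{offset l (- int n)..<offset l (int n)}. c j = concat_words V j}"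
    have "{uc. \<forall>i\<in>?W. assemble uc i = w0 i} = ?A \<times> ?B"
    proof -
      have "(\<forall>i\<in>?W. assemble uc i = w0 i) \<longleftrightarrow> (\<forall>i\<in>?W. assemble uc i = w i)" for uc
        by (rule ball_cong[OF refl]) (simp add: ww)
      then have "(\<forall>i\<in>?W. assemble uc i = w0 i) \<longleftrightarrow> fst uc \<in> ?A \<and> snd uc \<in> ?B" for uc
        using assemble_eq_iff[of w n "fst uc" "snd uc", OF w] unfolding V_def l_def by simp
      then show ?thesis by auto
    qed
    moreover have "?A \<in> sets ?U" "?B \<in> sets ?C"
      unfolding sets_PiM_pmf by (rule finite_cyl_in_sets, simp)+
    ultimately have "emeasure (?U \<Otimes>\<^sub>M ?C) {uc. \<forall>i\<in>?W. assemble uc i = w0 i} = emeasure ?U ?A * emeasure ?C ?B"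
      by (simp add: C.emeasure_pair_measure_Times)
    also have "\<dots> = ennreal ((\<Prod>i\<in>?W. pmf (map_pmf wcore p) (wcore (w i))) * (\<Prod>j\<in>{offset l (- int n)..<offset l (int n)}. pmf g (concat_words V j)))"
      by (subst (1 2) emeasure_PiM_pmf) (auto simp: ennreal_mult prod_nonneg)
    also have "(\<Prod>j\<in>{offset l (- int n)..<offset l (int n)}. pmf g (concat_words V j)) = (\<Prod>i\<in>?W. prod_list (map (pmf g) (V i)))"
      using prod_concat_words[where V = V and a = "- int n" and m = "2 * n" and f = "pmf g"] unfolding l_def by (simp add: V_def)
    also have "(\<Prod>i\<in>?W. pmf (map_pmf wcore p) (wcore (w i))) * (\<Prod>i\<in>?W. prod_list (map (pmf g) (V i))) =
        (\<Prod>i\<in>?W. pmf p (w i))"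
      unfolding prod.distrib[symmetric]
    proof (rule prod.cong[OF refl])
      fix i
      show "pmf (map_pmf wcore p) (wcore (w i)) * prod_list (map (pmf g) (V i)) = pmf p (w i)"
        using soliton_law_step(2)[OF law, folded g, OF dyck_wcore[OF w[of i]], of "V i"] expand_decode0[OF w, of i]
        by (simp add: V_def length_gaps)
    qed
    also have "(\<Prod>i\<in>?W. pmf p (w i)) = (\<Prod>i\<in>?W. pmf p (w0 i))" by (rule prod.cong) (simp_all add: ww)
    finally show ?thesis unfolding L R .
  next
    case False
    then obtain i where i: "i \<in> ?W" "\<not> dyck 0 (w0 i)" by blast
    have "pmf p (w0 i) = 0" using law i(2) by (simp add: soliton_law_def)
    then have "(\<Prod>i\<in>?W. pmf p (w0 i)) = 0" using i(1) by (intro prod_zero) auto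
    \<comment> \<open>Expanding a Dyck word gives a Dyck word, so some \<open>u i\<close> would have
      to be a non-Dyck word, which has probability 0.\<close>
    moreover have "emeasure (?U \<Otimes>\<^sub>M ?C) {uc. \<forall>i\<in>?W. assemble uc i = w0 i} = 0"
    proof -
      have "{uc. \<forall>i\<in>?W. assemble uc i = w0 i} \<subseteq> {u. u i \<in> {u. \<not> dyck 0 u}} \<times> UNIV"
      proof
        fix uc assume uc: "uc \<in> {uc. \<forall>i\<in>?W. assemble uc i = w0 i}"
        have "\<not> dyck 0 (fst uc i)"
        proof
          assume "dyck 0 (fst uc i)"
          then have "dyck 0 (assemble uc i)" unfolding assemble_def Let_def
            by (rule dyck_expand0) (simp add: offset_step)
          then show False using uc i by simp
        qed
        then show "uc \<in> {u. u i \<in> {u. \<not> dyck 0 u}} \<times> UNIV" by (cases uc) auto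
      qed
      moreover have "{u. u i \<in> {u. \<not> dyck 0 u}} \<in> sets ?U" "UNIV \<in> sets ?C"
        using coord_in_sets[of i "{u. \<not> dyck 0 u}"] sets.top[of ?C] by (simp_all add: sets_PiM_pmf space_PiM)
      moreover have "emeasure ?U {u. u i \<in> {u. \<not> dyck 0 u}} = 0"
      proof -
        have "pmf (map_pmf wcore p) u = 0" if "\<not> dyck 0 u" for u
          using soliton_law_step(1)[OF law] that by (simp add: soliton_law_def)
        then have "set_pmf (map_pmf wcore p) \<inter> {u. \<not> dyck 0 u} = {}" by (auto simp: set_pmf_iff simp del: set_map_pmf)
        moreover have "emeasure (measure_pmf r) S = 0" if "set_pmf r \<inter> S = {}" for r :: "bool list pmf" and S
          using that by (simp add: measure_pmf.emeasure_eq_measure measure_pmf_zero_iff)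
        ultimately show ?thesis unfolding emeasure_PiM_pmf_coord by blast
      qed
      ultimately have "emeasure (?U \<Otimes>\<^sub>M ?C) {uc. \<forall>i\<in>?W. assemble uc i = w0 i} \<le> 0"
        using emeasure_mono[of "{uc. \<forall>i\<in>?W. assemble uc i = w0 i}" "{u. u i \<in> {u. \<not> dyck 0 u}} \<times> UNIV" "?U \<Otimes>\<^sub>M ?C"]
        by (simp add: C.emeasure_pair_measure_Times)
      then show ?thesis by simp
    qed
    ultimately show ?thesis unfolding L R by (simp only: ennreal_0)
  qed
qed (simp_all add: sets_PiM_pmf)

text \<open>Follows from the law of \<open>assemble\<close>, as \<open>disassemble\<close> inverts
  it; this avoids cylinders of \<open>disassemble\<close>, whose preimages have random cutting
  points.\<close>

lemma distr_disassemble: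
  assumes law: "soliton_law a c p"
  shows "distr (Pi\<^sub>M UNIV (\<lambda>_. measure_pmf p)) (seq_space \<Otimes>\<^sub>M seq_space) disassemble =
    Pi\<^sub>M UNIV (\<lambda>_. measure_pmf (map_pmf wcore p)) \<Otimes>\<^sub>M Pi\<^sub>M UNIV (\<lambda>_. measure_pmf (geom (a 1)))"
    (is "_ = ?U \<Otimes>\<^sub>M ?C")
proof -
  have meas: "assemble \<in> measurable (?U \<Otimes>\<^sub>M ?C) seq_space"
    using measurable_assemble unfolding measurable_cong_sets[OF sets_pair_PiM_pmf refl] .
  have "distr (Pi\<^sub>M UNIV (\<lambda>_. measure_pmf p)) (seq_space \<Otimes>\<^sub>M seq_space) disassemble =
      distr (distr (?U \<Otimes>\<^sub>M ?C) seq_space assemble) (seq_space \<Otimes>\<^sub>M seq_space) disassemble"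
    by (simp only: distr_assemble[OF law refl])
  also have "\<dots> = distr (?U \<Otimes>\<^sub>M ?C) (seq_space \<Otimes>\<^sub>M seq_space) (\<lambda>x. x)"
  proof -
    have "disassemble (assemble x) = x" for x by (cases x) (simp add: disassemble_assemble)
    then show ?thesis by (subst distr_distr[OF measurable_disassemble meas]) (simp add: comp_def)
  qed
  also have "\<dots> = ?U \<Otimes>\<^sub>M ?C" by (rule distr_id2) (rule sets_pair_PiM_pmf[symmetric])
  finally show ?thesis .
qed

section \<open>The joint law of the components of an i.i.d. sequence of words\<close>

definition components :: "nat \<Rightarrow> (int \<Rightarrow> bool list) \<Rightarrow> int \<Rightarrow> nat" where
  "components k w = concat_words (\<lambda>i. wgaps ((wcore ^^ k) (w i)))"

lemma measurable_components: "components k \<in> measurable seq_space seq_space"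
  using measurable_concat_words[of "\<lambda>w. wgaps ((wcore ^^ k) w)"] unfolding components_def[abs_def] by simp

lemma components_in_sets:
  assumes "\<And>k. A k \<in> sets seq_space"
  shows "{w. \<forall>k<n. components k w \<in> A k} \<in> sets seq_space"
proof -
  have "components k -` A k \<inter> space seq_space \<in> sets seq_space" for k
    by (rule measurable_sets[OF measurable_components assms])
  then have "{w. components k w \<in> A k} \<in> sets seq_space" for k by (simp add: vimage_def)
  then have "(\<Inter>k\<in>{..<n}. {w. components k w \<in> A k}) \<in> sets seq_space" if "n \<noteq> 0"
    using that by (intro sets.finite_INT) auto
  moreover have "(\<Inter>k\<in>{..<n}. {w. components k w \<in> A k}) = {w. \<forall>k<n. components k w \<in> A k}" by auto
  moreover have "(UNIV :: (int \<Rightarrow> bool list) set) \<in> sets seq_space" using sets.top[of seq_space] by simp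
  ultimately show ?thesis by (cases "n = 0") auto
qed

text \<open>One splitting separates \<open>components 0\<close>. The others are the components of
  the shorter words, which are independent of it and obey the law with
  \<open>next_param a\<close>.\<close>

lemma components_law:
  assumes "\<And>k. A k \<in> sets seq_space"
  shows "soliton_law a c p \<Longrightarrow> emeasure (Pi\<^sub>M UNIV (\<lambda>_. measure_pmf p)) {w. \<forall>k<n. components k w \<in> A k} =
    (\<Prod>k<n. emeasure (Pi\<^sub>M UNIV (\<lambda>_. measure_pmf (geom (q a (Suc k))))) (A k))"
  using assms
proof (induction n arbitrary: a c p A)
  case 0
  interpret prob_space "Pi\<^sub>M UNIV (\<lambda>_ :: int. measure_pmf p)" by (rule prob_space_PiM_pmf)
  show ?case using emeasure_space_1 by (simp add: space_PiM)
next
  case (Suc n)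
  note law = Suc.prems(1)
  let ?U = "Pi\<^sub>M UNIV (\<lambda>_ :: int. measure_pmf (map_pmf wcore p))"
  let ?C = "Pi\<^sub>M UNIV (\<lambda>_ :: int. measure_pmf (geom (a 1)))"
  interpret C: prob_space ?C by (rule prob_space_PiM_pmf)
  let ?E = "{w. \<forall>k<n. components k w \<in> A (Suc k)}"
  have E: "?E \<in> sets seq_space" by (rule components_in_sets) (rule Suc.prems(2))
  have "components (Suc k) w = components k (\<lambda>i. wcore (w i))" for k w
    by (simp add: components_def funpow_swap1)
  then have set_eq: "{w. \<forall>k<Suc n. components k w \<in> A k} = disassemble -` (?E \<times> A 0) \<inter> space (Pi\<^sub>M UNIV (\<lambda>_. measure_pmf p))"
    by (auto simp: disassemble_def All_less_Suc2 space_PiM components_def)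
  have meas: "disassemble \<in> measurable (Pi\<^sub>M UNIV (\<lambda>_. measure_pmf p)) (seq_space \<Otimes>\<^sub>M seq_space)"
    using measurable_disassemble unfolding measurable_cong_sets[OF sets_PiM_pmf refl] .
  have EA: "?E \<times> A 0 \<in> sets (seq_space \<Otimes>\<^sub>M seq_space)" using E Suc.prems(2) by auto
  have "emeasure (Pi\<^sub>M UNIV (\<lambda>_. measure_pmf p)) {w. \<forall>k<Suc n. components k w \<in> A k} =
      emeasure (distr (Pi\<^sub>M UNIV (\<lambda>_. measure_pmf p)) (seq_space \<Otimes>\<^sub>M seq_space) disassemble) (?E \<times> A 0)"
    unfolding set_eq by (rule emeasure_distr[OF meas EA, symmetric])
  also have "\<dots> = emeasure ?U ?E * emeasure ?C (A 0)"
    unfolding distr_disassemble[OF law] using E Suc.prems(2)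
    by (intro C.emeasure_pair_measure_Times) (simp_all add: sets_PiM_pmf)
  also have "emeasure ?U ?E = (\<Prod>k<n. emeasure (Pi\<^sub>M UNIV (\<lambda>_. measure_pmf (geom (q (next_param a) (Suc k))))) (A (Suc k)))"
    by (rule Suc.IH[OF soliton_law_step(1)[OF law]]) (rule Suc.prems(2))
  also have "\<dots> = (\<Prod>k<n. emeasure (Pi\<^sub>M UNIV (\<lambda>_. measure_pmf (geom (q a (Suc (Suc k)))))) (A (Suc k)))"
    by (simp add: q_next_param)
  also have "\<dots> * emeasure ?C (A 0) = (\<Prod>k<Suc n. emeasure (Pi\<^sub>M UNIV (\<lambda>_. measure_pmf (geom (q a (Suc k))))) (A k))"
    using q_funpow[of a 0] by (subst prod.lessThan_Suc_shift) (simp add: mult.commute)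
  finally show ?case .
qed

text \<open>Makes monotone convergence and change of variables available for the sums in
  \<open>Z\<close> and \<open>rho\<close>.\<close>

lemma infsum_eq_nn_integral:
  fixes f :: "'a::countable \<Rightarrow> ennreal"
  shows "infsum f A = (\<integral>\<^sup>+x. f x \<partial>count_space A)"
proof (rule antisym)
  have "sum f F \<le> (\<integral>\<^sup>+x. f x \<partial>count_space A)" if "finite F" "F \<subseteq> A" for F
  proof -
    have "sum f F = (\<integral>\<^sup>+x. f x \<partial>count_space F)" using that by (simp add: nn_integral_count_space_finite)
    also have "\<dots> \<le> (\<integral>\<^sup>+x. f x \<partial>count_space A)"
      using that(2) by (auto simp: nn_integral_count_space_indicator indicator_def intro!: nn_integral_mono)
    finally show ?thesis .
  qed
  then show "infsum f A \<le> (\<integral>\<^sup>+x. f x \<partial>count_space A)"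
    by (subst nonneg_infsum_complete) (auto intro!: SUP_least)
  define F where "F n = {x \<in> A. to_nat x < n}" for n
  have thin_blocks: "finite (F n)" for n
    by (rule finite_subset[of _ "from_nat ` {..<n}"]) (auto simp: F_def intro!: image_eqI[of _ _ "to_nat _"])
  have "(\<integral>\<^sup>+x. f x \<partial>count_space A) = (\<integral>\<^sup>+x. (SUP n. f x * indicator (F n) x) \<partial>count_space A)"
  proof (rule nn_integral_cong)
    fix x assume "x \<in> space (count_space A)"
    then have "f x * indicator (F (Suc (to_nat x))) x = f x" by (simp add: F_def)
    moreover have "f x * indicator (F n) x \<le> f x" for n by (simp add: indicator_def)
    ultimately show "f x = (SUP n. f x * indicator (F n) x)"
      by (intro antisym SUP_least) (metis SUP_upper UNIV_I)
  qed
  also have "\<dots> = (SUP n. (\<integral>\<^sup>+x. f x * indicator (F n) x \<partial>count_space A))"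
    by (rule nn_integral_monotone_convergence_SUP) (auto simp: incseq_def le_fun_def indicator_def F_def)
  also have "\<dots> \<le> infsum f A"
  proof (rule SUP_least)
    fix n
    have "(\<integral>\<^sup>+x. f x * indicator (F n) x \<partial>count_space A) = (\<integral>\<^sup>+x. f x \<partial>count_space (F n))"
      by (auto simp: nn_integral_count_space_indicator F_def indicator_def intro!: nn_integral_cong)
    also have "\<dots> = sum f (F n)" using thin_blocks by (rule nn_integral_count_space_finite)
    also have "\<dots> \<le> infsum f A"
      using thin_blocks by (subst nonneg_infsum_complete) (auto intro!: SUP_upper simp: F_def)
    finally show "(\<integral>\<^sup>+x. f x * indicator (F n) x \<partial>count_space A) \<le> infsum f A" .
  qed
  finally show "(\<integral>\<^sup>+x. f x \<partial>count_space A) \<le> infsum f A" .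
qed

section \<open>Excursions and components under the Palm measure\<close>

lemma (in prob_space) iid_of_distr_PiM:
  fixes p :: "'b::countable pmf" and X :: "'a \<Rightarrow> int \<Rightarrow> 'b"
  assumes X: "X \<in> measurable M seq_space" and d: "distr M seq_space X = Pi\<^sub>M UNIV (\<lambda>_. measure_pmf p)"
  shows "indep_vars (\<lambda>_. count_space UNIV) (\<lambda>j \<omega>. X \<omega> j) UNIV"
    and "distr M (count_space UNIV) (\<lambda>\<omega>. X \<omega> j) = measure_pmf p"
proof -
  interpret P: product_prob_space "\<lambda>_ :: int. measure_pmf p" UNIV ..
  have m: "(\<lambda>\<omega>. X \<omega> j) \<in> measurable M (count_space UNIV)" for j
    by (rule measurable_compose[OF X]) simp
  have dj: "distr M (count_space UNIV) (\<lambda>\<omega>. X \<omega> j) = measure_pmf p" for j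
  proof -
    have "distr M (count_space UNIV) (\<lambda>\<omega>. X \<omega> j) = distr (distr M seq_space X) (count_space UNIV) (\<lambda>x. x j)"
      using X by (subst distr_distr) (auto simp: comp_def)
    also have "\<dots> = distr (Pi\<^sub>M UNIV (\<lambda>_. measure_pmf p)) (measure_pmf p) (\<lambda>x. x j)"
      unfolding d by (rule distr_cong) auto
    also have "\<dots> = measure_pmf p" by (rule P.PiM_component) simp
    finally show ?thesis .
  qed
  show "distr M (count_space UNIV) (\<lambda>\<omega>. X \<omega> j) = measure_pmf p" by (rule dj)
  show "indep_vars (\<lambda>_. count_space UNIV) (\<lambda>j \<omega>. X \<omega> j) UNIV"
    by (subst indep_vars_iff_distr_eq_PiM') (simp_all add: m dj restrict_UNIV d)
qed

text \<open>Excursions agree with the paths of their words only almost surely, so independence has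
  to be transferred across a null set.\<close>

lemma (in prob_space) indep_vars_AE_cong:
  assumes X: "\<And>i. X i \<in> measurable M N" and Y: "\<And>i. Y i \<in> measurable M N"
    and ae: "AE \<omega> in M. \<forall>i. X i \<omega> = Y i \<omega>"
    and ind: "indep_vars (\<lambda>_. N) X (UNIV :: 'i set)"
  shows "indep_vars (\<lambda>_. N) Y (UNIV :: 'i set)"
proof -
  have "distr M N (X i) = distr M N (Y i)" for i
    using ae by (intro distr_cong_AE) (auto simp: X Y elim: eventually_mono)
  moreover have "distr M (Pi\<^sub>M UNIV (\<lambda>_. N)) (\<lambda>x. \<lambda>i\<in>UNIV. X i x) = distr M (Pi\<^sub>M UNIV (\<lambda>_. N)) (\<lambda>x. \<lambda>i\<in>UNIV. Y i x)"
    using ae by (intro distr_cong_AE measurable_restrict) (auto simp: X Y elim: eventually_mono)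
  ultimately show ?thesis using ind by (simp add: indep_vars_iff_distr_eq_PiM' X Y)
qed

context ball_density
begin

lemma word_prob_nonneg: "0 \<le> word_prob w"
  using lam by (simp add: word_prob_def)

lemma AE_P_dyck: "AE \<eta> in P. \<forall>i. dyck 0 (exc_word \<eta> i)"
  using AE_P_regular by eventually_elim (simp add: dyck_exc_word)

lemma emeasure_exc_word: "emeasure P {\<eta>. exc_word \<eta> 0 = w} = ennreal (word_prob w)"
proof (cases "dyck 0 w")
  case True
  have "{0..<1 :: int} = {0}" by auto
  then show ?thesis using emeasure_P_words[of "\<lambda>_. w" 0 1] True by simp
next
  case False
  have "AE \<eta> in P. \<not> exc_word \<eta> 0 = w" using AE_P_dyck False by (auto elim: eventually_mono)
  moreover have "{\<eta> \<in> space P. exc_word \<eta> 0 = w} \<in> sets P"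
    unfolding sets_P using measurable_sets[OF measurable_exc_word[of 0], of "{w}"]
    by (simp add: palm_def vimage_def)
  ultimately have "emeasure P {\<eta> \<in> space P. exc_word \<eta> 0 = w} = 0" by (simp add: AE_iff_measurable[OF _ refl])
  then show ?thesis using False by (simp add: palm_def word_prob_def)
qed

text \<open>The total mass is found without summing Catalan numbers: the values are the
  probabilities of a random word under the Palm measure. The partition function is obtained from
  this.\<close>

lemma nn_integral_word_prob: "(\<integral>\<^sup>+w. ennreal (word_prob w) \<partial>count_space UNIV) = 1"
proof -
  have m: "(\<lambda>\<eta>. exc_word \<eta> 0) \<in> measurable P (count_space UNIV)"
    unfolding measurable_cong_sets[OF sets_P refl] by measurable
  have "1 = emeasure (distr P (count_space UNIV) (\<lambda>\<eta>. exc_word \<eta> 0)) UNIV"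
    using m P.emeasure_space_1 by (simp add: emeasure_distr)
  also have "\<dots> = (\<integral>\<^sup>+w. emeasure (distr P (count_space UNIV) (\<lambda>\<eta>. exc_word \<eta> 0)) {w} \<partial>count_space UNIV)"
    by (rule emeasure_countable_singleton) auto
  also have "\<dots> = (\<integral>\<^sup>+w. ennreal (word_prob w) \<partial>count_space UNIV)"
    using m by (simp add: emeasure_distr emeasure_exc_word[symmetric] palm_def vimage_def)
  finally show ?thesis by simp
qed

definition word_pmf :: "bool list pmf" where
  "word_pmf = embed_pmf word_prob"

lemma pmf_word_pmf: "pmf word_pmf w = word_prob w"
  unfolding word_pmf_def by (rule pmf_embed_pmf[OF word_prob_nonneg nn_integral_word_prob])

abbreviation exc_words :: "config \<Rightarrow> int \<Rightarrow> bool list" where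
  "exc_words \<equiv> \<lambda>\<eta> i. exc_word \<eta> i"

lemma measurable_exc_words: "exc_words \<in> measurable P seq_space"
  unfolding measurable_cong_sets[OF sets_P refl] by (rule measurable_PiM_single') auto

lemma space_P: "space P = UNIV"
  by (simp add: palm_def)

lemma distr_exc_words: "distr P seq_space exc_words = Pi\<^sub>M UNIV (\<lambda>_. measure_pmf word_pmf)"
proof (rule measure_eq_windowI)
  show "prob_space (distr P seq_space exc_words)" by (rule P.prob_space_distr[OF measurable_exc_words])
  fix n :: nat and w0 :: "int \<Rightarrow> bool list"
  let ?W = "{- int n..<int n}"
  have L: "emeasure (distr P seq_space exc_words) (window_cyl (- int n) (int n) w0) = emeasure P {\<eta>. \<forall>i\<in>?W. exc_word \<eta> i = w0 i}"
    using emeasure_distr[OF measurable_exc_words window_cyl_in_sets, of "- int n" "int n" w0]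
    by (simp add: window_cyl_def vimage_def space_P)
  have R: "emeasure (Pi\<^sub>M UNIV (\<lambda>_. measure_pmf word_pmf)) (window_cyl (- int n) (int n) w0) = ennreal (\<Prod>i\<in>?W. word_prob (w0 i))"
    unfolding window_cyl_def by (subst emeasure_PiM_pmf) (simp_all add: pmf_word_pmf)
  show "emeasure (distr P seq_space exc_words) (window_cyl (- int n) (int n) w0) =
      emeasure (Pi\<^sub>M UNIV (\<lambda>_. measure_pmf word_pmf)) (window_cyl (- int n) (int n) w0)"
  proof (cases "\<forall>i\<in>?W. dyck 0 (w0 i)")
    case True
    define w where "w i = (if i \<in> ?W then w0 i else [])" for i
    have w: "dyck 0 (w i)" for i using True by (simp add: w_def)
    have ww: "w0 i = w i" if "i \<in> ?W" for i using that by (simp add: w_def)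
    have "(\<forall>i\<in>?W. exc_word \<eta> i = w0 i) \<longleftrightarrow> (\<forall>i\<in>?W. exc_word \<eta> i = w i)" for \<eta>
      by (rule ball_cong[OF refl]) (simp add: ww)
    moreover have "(\<Prod>i\<in>?W. word_prob (w0 i)) = (\<Prod>i\<in>?W. word_prob (w i))"
      by (rule prod.cong) (simp_all add: ww)
    ultimately show ?thesis unfolding L R using emeasure_P_words[of w n n, OF w] by simp
  next
    case False
    then obtain i where i: "i \<in> ?W" "\<not> dyck 0 (w0 i)" by blast
    have "word_prob (w0 i) = 0" using i(2) by (simp add: word_prob_def)
    then have "(\<Prod>i\<in>?W. word_prob (w0 i)) = 0" using i(1) by (intro prod_zero) auto
    moreover have "emeasure P {\<eta>. \<forall>i\<in>?W. exc_word \<eta> i = w0 i} = 0"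
    proof -
      have "AE \<eta> in P. \<not> (\<forall>i\<in>?W. exc_word \<eta> i = w0 i)"
        using AE_P_dyck by eventually_elim (use i in metis)
      moreover have "{\<eta>. \<forall>i\<in>?W. exc_word \<eta> i = w0 i} \<in> sets P"
        using measurable_sets[OF measurable_exc_words window_cyl_in_sets, of "- int n" "int n" w0]
        by (simp add: window_cyl_def vimage_def space_P)
      ultimately show ?thesis by (simp add: AE_iff_measurable[OF _ refl] space_P)
    qed
    ultimately show ?thesis unfolding L R by (simp only: ennreal_0)
  qed
qed (simp_all add: sets_PiM_pmf)

end

section \<open>The parameters that belong to the product measure, and the final assertions\<close>

locale soliton_density = ball_density +
  fixes alpha :: "nat \<Rightarrow> real"
  assumes alpha: "\<And>k. 1 \<le> k \<Longrightarrow> alpha k = (lam * (1 - lam)) ^ k"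
begin

lemma alpha_pos: "0 \<le> lam * (1 - lam)" "lam * (1 - lam) < 1"
proof -
  show "0 \<le> lam * (1 - lam)" using lam by simp
  have "lam * (1 - lam) \<le> lam * 1" using lam by (intro mult_left_mono) auto
  then show "lam * (1 - lam) < 1" using lam by simp
qed

text \<open>An \<open>m\<close>-soliton occupies \<open>2 * m\<close> boxes and has weight exponent
  \<open>m\<close>, so the exponents add up to half the length.\<close>

lemma weight_word_alpha:
  assumes "dyck 0 w"
  shows "weight_word alpha w = (lam * (1 - lam)) ^ (length w div 2)"
proof -
  have "length w = 2 * (\<Sum>m<length w. Suc m * word_solitons (Suc m) w)"
    using length_word_solitons[OF assms order_refl] by (simp add: sum_distrib_left mult.assoc)
  then have "length w div 2 = (\<Sum>m<length w. Suc m * word_solitons (Suc m) w)" by simp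
  then have "(lam * (1 - lam)) ^ (length w div 2) = (\<Prod>m<length w. (lam * (1 - lam)) ^ (Suc m * word_solitons (Suc m) w))"
    by (simp only: power_sum)
  also have "\<dots> = (\<Prod>m<length w. alpha (Suc m) ^ word_solitons (Suc m) w)"
    by (intro prod.cong refl) (simp only: power_mult alpha[of "Suc _", OF Suc_leI[OF zero_less_Suc, folded One_nat_def]])
  finally show ?thesis by (simp add: weight_word_def)
qed

lemma word_prob_weight: "dyck 0 w \<Longrightarrow> word_prob w = (1 - lam) * weight_word alpha w"
  by (simp add: word_prob_def weight_word_alpha)

lemma law_word_pmf: "soliton_law alpha (1 - lam) word_pmf"
  unfolding soliton_law_def
proof (intro conjI allI impI)
  show "0 < 1 - lam" using lam by simp
  show "0 \<le> alpha m" if "1 \<le> m" for m using alpha[OF that] alpha_pos by simp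
  show "pmf word_pmf w = (if dyck 0 w then (1 - lam) * weight_word alpha w else 0)" for w
    using word_prob_weight[of w] by (simp add: pmf_word_pmf word_prob_def)
qed

lemma weight_path:
  assumes "dyck 0 w"
  shows "weight alpha (path 0 w) = weight_word alpha w"
proof -
  have "weight alpha (path 0 w) = (\<Prod>k. alpha (Suc k) ^ word_solitons (Suc k) w)"
    by (simp add: weight_def exc_path(2)[OF assms])
  also have "\<dots> = weight_word alpha w"
    unfolding weight_word_def by (rule prodinf_finite) (use assms word_solitons_eq_0 in auto)
  finally show ?thesis .
qed

lemma nn_integral_excursions:
  "(\<integral>\<^sup>+e. f e \<partial>count_space excursions) = (\<integral>\<^sup>+w. f (path 0 w) \<partial>count_space {w. dyck 0 w})"
  by (rule nn_integral_bij_count_space[symmetric])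
    (auto simp: bij_betw_def excursions_eq intro: inj_on_subset[OF inj_path])

text \<open>The word probabilities are \<open>1 - lam\<close> times the weights and have total mass
  1.\<close>

lemma Z_alpha: "Z alpha = ennreal (1 / (1 - lam))"
proof -
  have "Z alpha = (\<integral>\<^sup>+w. ennreal (weight_word alpha w) \<partial>count_space {w. dyck 0 w})"
    unfolding Z_def infsum_eq_nn_integral nn_integral_excursions
    by (rule nn_integral_cong) (simp add: weight_path)
  also have "\<dots> = (\<integral>\<^sup>+w. ennreal (1 / (1 - lam)) * ennreal (word_prob w) \<partial>count_space {w. dyck 0 w})"
  proof (rule nn_integral_cong)
    fix w assume "w \<in> space (count_space {w. dyck 0 w})"
    then have "weight_word alpha w = (1 / (1 - lam)) * word_prob w"
      using lam by (simp add: word_prob_weight)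
    then show "ennreal (weight_word alpha w) = ennreal (1 / (1 - lam)) * ennreal (word_prob w)"
      using lam by (simp only: ennreal_mult word_prob_nonneg zero_le_divide_1_iff)
  qed
  also have "\<dots> = ennreal (1 / (1 - lam)) * (\<integral>\<^sup>+w. ennreal (word_prob w) \<partial>count_space {w. dyck 0 w})"
    by (rule nn_integral_cmult) simp
  also have "(\<integral>\<^sup>+w. ennreal (word_prob w) \<partial>count_space {w. dyck 0 w}) = (\<integral>\<^sup>+w. ennreal (word_prob w) \<partial>count_space UNIV)"
    by (auto simp: nn_integral_count_space_indicator word_prob_def indicator_def intro!: nn_integral_cong)
  finally show ?thesis by (simp add: nn_integral_word_prob)
qed

lemma nu_path:
  assumes "dyck 0 w"
  shows "nu alpha (path 0 w) = ennreal (word_prob w)"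
proof -
  have "path 0 w \<in> excursions" using assms by (auto simp: excursions_eq)
  moreover have "0 \<le> weight_word alpha w" using weight_word_alpha[OF assms] alpha_pos by simp
  ultimately show ?thesis
    using lam word_prob_weight[OF assms] by (simp add: nu_def Z_alpha weight_path[OF assms] divide_ennreal mult.commute)
qed

lemma alpha_params: "alpha \<in> params"
  using alpha alpha_pos by (auto simp: params_def Z_alpha power_le_one intro: power_Suc_less_one
      le_less_trans[OF power_decreasing[of 1]])

text \<open>The word probabilities of a larger density decay more slowly with the length and still
  have total mass 1, so they absorb the factor \<open>length w\<close>.\<close>

lemma word_length_sum_finite:
  "(\<integral>\<^sup>+w. ennreal (real (length w) * word_prob w) \<partial>count_space UNIV) < \<infinity>"
proof -
  \<comment> \<open>Halfway to \<open>1 / 2\<close>, so that \<open>lam'\<close> is an admissible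
    density and \<open>lam * (1 - lam)\<close> is strictly smaller than its value at
    \<open>lam'\<close>.\<close>
  define lam' where "lam' = (lam + 1 / 2) / 2"
  have lam': "lam < lam'" "lam' < 1 / 2" using lam by (auto simp: lam'_def)
  interpret L: ball_density lam' by standard (use lam lam' in auto)
  define x x' where "x = lam * (1 - lam)" and "x' = lam' * (1 - lam')"
  have "x' - x = (lam' - lam) * (1 - lam - lam')" by (simp add: x_def x'_def algebra_simps)
  moreover have "0 < (lam' - lam) * (1 - lam - lam')" using lam lam' by (intro mult_pos_pos) auto
  ultimately have xx: "0 \<le> x" "x < x'" using alpha_pos by (auto simp: x_def)
  define r where "r = x / x'"
  have r: "0 \<le> r" "r < 1" using xx by (auto simp: r_def)
  have "(\<lambda>n. real n * r ^ n) \<longlonglongrightarrow> 0" using r by (intro powser_times_n_limit_0) simp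
  then have "Bseq (\<lambda>n. real n * r ^ n)" using convergent_imp_Bseq convergentI by blast
  then obtain K where K: "0 < K" "\<And>n. norm (real n * r ^ n) \<le> K" by (auto elim: BseqE)
  have bound: "real (length w) * word_prob w \<le> 4 * K * L.word_prob w" for w
  proof (cases "dyck 0 w")
    case True
    then obtain n where n: "length w = 2 * n" using even_length_dyck by (auto elim: evenE)
    have "real n * x ^ n = (real n * r ^ n) * x' ^ n" using xx by (simp add: r_def power_divide)
    also have "\<dots> \<le> K * x' ^ n" using K(2)[of n] r xx by (intro mult_right_mono) auto
    finally have "real n * x ^ n \<le> K * x' ^ n" .
    then have "(2 * (1 - lam)) * (real n * x ^ n) \<le> (2 * (1 - lam)) * (K * x' ^ n)" using lam by (intro mult_left_mono) auto
    \<comment> \<open>Origin of the constant: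
      \<open>2 * (1 - lam) \<le> 2 \<le> 4 * (1 - lam')\<close>, since
      \<open>lam' < 1 / 2\<close>.\<close>
    also have "\<dots> \<le> (4 * (1 - lam')) * (K * x' ^ n)" using lam lam' K(1) xx by (intro mult_right_mono) auto
    finally have "2 * real n * ((1 - lam) * x ^ n) \<le> 4 * K * ((1 - lam') * x' ^ n)" by (simp only: mult_ac)
    then show ?thesis using True n by (simp add: word_prob_def L.word_prob_def x_def x'_def)
  qed (simp add: word_prob_def L.word_prob_def)
  have "(\<integral>\<^sup>+w. ennreal (real (length w) * word_prob w) \<partial>count_space UNIV) \<le>
      (\<integral>\<^sup>+w. ennreal (4 * K) * ennreal (L.word_prob w) \<partial>count_space UNIV)"
    using bound K(1) L.word_prob_nonneg by (intro nn_integral_mono) (simp add: ennreal_leI flip: ennreal_mult)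
  also have "\<dots> = ennreal (4 * K)" by (simp add: nn_integral_cmult L.nn_integral_word_prob)
  also have "\<dots> < \<infinity>" by simp
  finally show ?thesis .
qed

text \<open>The solitons fill the excursion, so exchanging sum and integral turns the series into
  the expected length.\<close>

lemma alpha_params_plus: "alpha \<in> params_plus"
proof -
  let ?D = "count_space {w. dyck 0 w}"
  have rho: "rho (Suc k) alpha = (\<integral>\<^sup>+w. ennreal (real (word_solitons (Suc k) w) * word_prob w) \<partial>?D)" for k
    unfolding rho_def infsum_eq_nn_integral nn_integral_excursions
    by (rule nn_integral_cong)
      (simp add: exc_path(2) nu_path word_prob_nonneg ennreal_mult ennreal_of_nat_eq_real_of_nat)
  have "(\<Sum>k. of_nat (2 * Suc k) * rho (Suc k) alpha) =
      (\<Sum>k. \<integral>\<^sup>+w. ennreal (real (2 * Suc k) * (real (word_solitons (Suc k) w) * word_prob w)) \<partial>?D)"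
    unfolding rho by (simp add: nn_integral_cmult[symmetric] ennreal_mult word_prob_nonneg ennreal_of_nat_eq_real_of_nat del: of_nat_mult of_nat_Suc)
  also have "\<dots> = (\<integral>\<^sup>+w. (\<Sum>k. ennreal (real (2 * Suc k) * (real (word_solitons (Suc k) w) * word_prob w))) \<partial>?D)"
    by (rule nn_integral_suminf[symmetric]) simp
  also have "\<dots> = (\<integral>\<^sup>+w. ennreal (real (length w) * word_prob w) \<partial>?D)"
  proof (rule nn_integral_cong)
    fix w assume "w \<in> space ?D"
    then have w: "dyck 0 w" by simp
    have "(\<Sum>k. ennreal (real (2 * Suc k) * (real (word_solitons (Suc k) w) * word_prob w))) =
        (\<Sum>k<length w. ennreal (real (2 * Suc k) * (real (word_solitons (Suc k) w) * word_prob w)))"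
      by (rule suminf_finite) (use word_solitons_eq_0[OF w] in auto)
    also have "\<dots> = ennreal (\<Sum>k<length w. real (2 * Suc k * word_solitons (Suc k) w) * word_prob w)"
      by (subst sum_ennreal) (auto simp only: word_prob_nonneg of_nat_mult mult.assoc of_nat_0_le_iff intro!: mult_nonneg_nonneg)
    also have "(\<Sum>k<length w. real (2 * Suc k * word_solitons (Suc k) w) * word_prob w) = real (length w) * word_prob w"
      unfolding sum_distrib_right[symmetric] of_nat_sum[symmetric] length_word_solitons[OF w order_refl, symmetric] ..
    finally show "(\<Sum>k. ennreal (real (2 * Suc k) * (real (word_solitons (Suc k) w) * word_prob w))) = ennreal (real (length w) * word_prob w)" .
  qed
  also have "\<dots> \<le> (\<integral>\<^sup>+w. ennreal (real (length w) * word_prob w) \<partial>count_space UNIV)"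
    by (auto simp: nn_integral_count_space_indicator indicator_def intro!: nn_integral_mono)
  also have "\<dots> < \<infinity>" by (rule word_length_sum_finite)
  finally show ?thesis using alpha_params by (simp add: params_plus_def)
qed

lemma excursion_eq: "AE \<eta> in P. \<forall>i. path 0 (exc_word \<eta> i) = excursion \<eta> i"
  using AE_P_regular by eventually_elim (simp add: excursion_regular)

lemma measurable_excursion_P: "(\<lambda>\<eta>. excursion \<eta> i) \<in> measurable P (count_space UNIV)"
  unfolding measurable_cong_sets[OF sets_P refl] by measurable

lemma measurable_exc_word_P: "(\<lambda>\<eta>. exc_word \<eta> i) \<in> measurable P (count_space UNIV)"
  unfolding measurable_cong_sets[OF sets_P refl] by measurable

lemma indep_excursions: "P.indep_vars (\<lambda>_. count_space UNIV) (\<lambda>i \<eta>. excursion \<eta> i) UNIV"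
proof (rule P.indep_vars_AE_cong[OF _ _ excursion_eq])
  show "P.indep_vars (\<lambda>_. count_space UNIV) (\<lambda>i \<eta>. path 0 (exc_word \<eta> i)) UNIV"
    using P.iid_of_distr_PiM(1)[OF measurable_exc_words distr_exc_words] by (rule P.indep_vars_compose2) simp
  show "(\<lambda>\<eta>. path 0 (exc_word \<eta> i)) \<in> measurable P (count_space UNIV)" for i
    by (rule measurable_compose[OF measurable_exc_word_P]) simp
qed (rule measurable_excursion_P)

lemma law_excursion: "distr P (count_space UNIV) (\<lambda>\<eta>. excursion \<eta> i) = exc_law alpha"
proof (rule measure_eqI_countable[of _ UNIV])
  fix e :: "int list"
  have "distr P (count_space UNIV) (\<lambda>\<eta>. excursion \<eta> i) = distr P (count_space UNIV) (\<lambda>\<eta>. path 0 (exc_word \<eta> i))"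
  proof (rule distr_cong_AE)
    show "AE \<eta> in P. excursion \<eta> i = path 0 (exc_word \<eta> i)" using excursion_eq by eventually_elim simp
  qed (auto intro: measurable_excursion_P measurable_compose[OF measurable_exc_word_P])
  also have "\<dots> = distr (distr P (count_space UNIV) (\<lambda>\<eta>. exc_word \<eta> i)) (count_space UNIV) (path 0)"
    by (subst distr_distr) (auto simp: comp_def measurable_exc_word_P)
  also have "\<dots> = measure_pmf (map_pmf (path 0) word_pmf)"
    unfolding P.iid_of_distr_PiM(2)[OF measurable_exc_words distr_exc_words] by (simp add: map_pmf_rep_eq)
  finally have "emeasure (distr P (count_space UNIV) (\<lambda>\<eta>. excursion \<eta> i)) {e} = ennreal (pmf (map_pmf (path 0) word_pmf) e)"
    by (simp add: emeasure_pmf_single)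
  also have "\<dots> = nu alpha e"
  proof (cases "e \<in> excursions")
    case True
    then obtain w where w: "e = path 0 w" "dyck 0 w" by (auto simp: excursions_eq)
    then show ?thesis using pmf_map_inj'[OF inj_path, of 0 word_pmf w] by (simp add: nu_path pmf_word_pmf)
  next
    case False
    have "e \<notin> set_pmf (map_pmf (path 0) word_pmf)"
    proof
      assume "e \<in> set_pmf (map_pmf (path 0) word_pmf)"
      then obtain w where w: "w \<in> set_pmf word_pmf" "e = path 0 w" by auto
      have "dyck 0 w" using w(1) by (auto simp: set_pmf_iff pmf_word_pmf word_prob_def split: if_splits)
      then show False using False w(2) by (auto simp: excursions_eq)
    qed
    then have "pmf (map_pmf (path 0) word_pmf) e = 0" unfolding set_pmf_iff by simp
    then show ?thesis using False by (simp add: nu_def)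
  qed
  also have "\<dots> = emeasure (exc_law alpha) {e}"
    unfolding exc_law_def point_measure_def by (simp add: emeasure_density)
  finally show "emeasure (distr P (count_space UNIV) (\<lambda>\<eta>. excursion \<eta> i)) {e} = emeasure (exc_law alpha) {e}" .
qed (auto simp: exc_law_def point_measure_def)

abbreviation comp_law :: "nat \<Rightarrow> (int \<Rightarrow> nat) measure" where
  "comp_law k \<equiv> Pi\<^sub>M UNIV (\<lambda>_. measure_pmf (geom (q alpha (Suc k))))"

lemma prob_space_comp_law: "prob_space (comp_law k)"
  by (rule prob_space_PiM_pmf)

lemma measurable_component_P: "component k \<in> measurable P seq_space"
  unfolding measurable_cong_sets[OF sets_P refl] by (rule measurable_component)

lemma component_event: "A \<in> sets seq_space \<Longrightarrow> {\<eta>. component k \<eta> \<in> A} \<in> sets P"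
  using measurable_sets[OF measurable_component_P] by (simp add: vimage_def space_P)

lemma component_eq: "AE \<eta> in P. \<forall>k. component (Suc k) \<eta> = components k (exc_words \<eta>)"
  using AE_P_regular by eventually_elim (simp add: component_regular components_def)

lemma emeasure_components:
  assumes A: "\<And>k. A k \<in> sets seq_space"
  shows "emeasure P {\<eta>. \<forall>k<n. component (Suc k) \<eta> \<in> A k} = (\<Prod>k<n. emeasure (comp_law k) (A k))"
proof -
  have C: "{w. \<forall>k<n. components k w \<in> A k} \<in> sets seq_space" by (rule components_in_sets[OF A])
  have S2: "{\<eta>. \<forall>k<n. components k (exc_words \<eta>) \<in> A k} \<in> sets P"
    using measurable_sets[OF measurable_exc_words C] by (simp add: vimage_def space_P)
  have S1: "{\<eta>. \<forall>k<n. component (Suc k) \<eta> \<in> A k} \<in> sets P"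
  proof -
    have "{\<eta>. \<forall>k<n. component (Suc k) \<eta> \<in> A k} = (\<Inter>k\<in>{..<n}. {\<eta>. component (Suc k) \<eta> \<in> A k})" by auto
    moreover have "(\<Inter>k\<in>{..<n}. {\<eta>. component (Suc k) \<eta> \<in> A k}) \<in> sets P" if "n \<noteq> 0"
      using that component_event[OF A] by (intro sets.finite_INT) auto
    ultimately show ?thesis using sets.top[of P] by (cases "n = 0") (auto simp: space_P)
  qed
  have "emeasure P {\<eta>. \<forall>k<n. component (Suc k) \<eta> \<in> A k} = emeasure P {\<eta>. \<forall>k<n. components k (exc_words \<eta>) \<in> A k}"
    using component_eq S1 S2 by (intro emeasure_eq_AE) (auto elim: eventually_mono)
  also have "\<dots> = emeasure (distr P seq_space exc_words) {w. \<forall>k<n. components k w \<in> A k}"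
    by (subst emeasure_distr[OF measurable_exc_words C]) (simp add: vimage_def space_P)
  also have "\<dots> = (\<Prod>k<n. emeasure (comp_law k) (A k))"
    unfolding distr_exc_words by (rule components_law[OF A law_word_pmf])
  finally show ?thesis .
qed

lemma emeasure_comp_law_UNIV: "emeasure (comp_law k) UNIV = 1"
  using prob_space.emeasure_space_1[OF prob_space_comp_law, of k] by (simp add: space_PiM)

lemma emeasure_component:
  assumes "A \<in> sets seq_space"
  shows "emeasure P {\<eta>. component (Suc k) \<eta> \<in> A} = emeasure (comp_law k) A"
proof -
  define A' where "A' j = (if j = k then A else UNIV)" for j
  have "UNIV \<in> sets (seq_space :: (int \<Rightarrow> nat) measure)" using sets.top[of seq_space] by simp
  then have A': "A' j \<in> sets seq_space" for j using assms by (simp add: A'_def)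
  have "{\<eta>. component (Suc k) \<eta> \<in> A} = {\<eta>. \<forall>j<Suc k. component (Suc j) \<eta> \<in> A' j}"
    by (auto simp: A'_def)
  then have "emeasure P {\<eta>. component (Suc k) \<eta> \<in> A} = (\<Prod>j<Suc k. emeasure (comp_law j) (A' j))"
    using emeasure_components[OF A', of "Suc k"] by simp
  also have "\<dots> = emeasure (comp_law k) A"
    by (simp add: A'_def emeasure_comp_law_UNIV)
  finally show ?thesis .
qed

lemma distr_component: "distr P seq_space (component (Suc k)) = comp_law k"
proof (rule measure_eqI)
  fix A assume "A \<in> sets (distr P seq_space (component (Suc k)))"
  then have A: "A \<in> sets seq_space" by simp
  then show "emeasure (distr P seq_space (component (Suc k))) A = emeasure (comp_law k) A"
    by (simp add: emeasure_distr[OF measurable_component_P] emeasure_component[symmetric] vimage_def space_P)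
qed (simp add: sets_PiM_pmf)

lemma indep_component_sets: "P.indep_sets (\<lambda>k. {component k -` A \<inter> space P |A. A \<in> sets seq_space}) {1..}"
proof (rule P.indep_setsI)
  show "{component k -` A \<inter> space P |A. A \<in> sets seq_space} \<subseteq> P.events" for k
    using measurable_sets[OF measurable_component_P] by blast
  fix E :: "nat \<Rightarrow> config set" and J :: "nat set"
  assume J: "J \<noteq> {}" "J \<subseteq> {1..}" "finite J" and E: "\<forall>j\<in>J. E j \<in> {component j -` A \<inter> space P |A. A \<in> sets seq_space}"
  then have "\<forall>j\<in>J. \<exists>A. E j = {\<eta>. component j \<eta> \<in> A} \<and> A \<in> sets seq_space"
    by (fastforce simp: space_P vimage_def)
  then obtain A where A: "\<And>j. j \<in> J \<Longrightarrow> E j = {\<eta>. component j \<eta> \<in> A j} \<and> A j \<in> sets seq_space" by metis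
  define n where "n = Suc (Max J)"
  \<comment> \<open>The joint law is known for initial segments; the finite index set is embedded in
    one, and the additional components are left unconstrained.\<close>
  define A' where "A' k = (if Suc k \<in> J then A (Suc k) else UNIV)" for k
  have "UNIV \<in> sets (seq_space :: (int \<Rightarrow> nat) measure)" using sets.top[of seq_space] by simp
  then have A': "A' k \<in> sets seq_space" for k using A by (simp add: A'_def)
  define I where "I = {k. k < n \<and> Suc k \<in> J}"
  have JI: "J = Suc ` I"
  proof (intro equalityI subsetI)
    fix j assume j: "j \<in> J"
    then obtain k where "j = Suc k" using J(2) by (cases j) auto
    moreover have "j \<le> Max J" using J(3) j by simp
    ultimately show "j \<in> Suc ` I" using j by (auto simp: I_def n_def)
  qed (auto simp: I_def)
  have "\<Inter> (E ` J) = {\<eta>. \<forall>k<n. component (Suc k) \<eta> \<in> A' k}"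
  proof -
    have "\<eta> \<in> \<Inter> (E ` J) \<longleftrightarrow> (\<forall>j\<in>J. component j \<eta> \<in> A j)" for \<eta>
      by (simp add: A)
    moreover have "(\<forall>j\<in>J. component j \<eta> \<in> A j) \<longleftrightarrow> (\<forall>k\<in>I. component (Suc k) \<eta> \<in> A (Suc k))" for \<eta>
      unfolding JI by blast
    moreover have "(\<forall>k\<in>I. component (Suc k) \<eta> \<in> A (Suc k)) \<longleftrightarrow> (\<forall>k<n. component (Suc k) \<eta> \<in> A' k)" for \<eta>
      by (auto simp: I_def A'_def)
    ultimately show ?thesis by (intro set_eqI) (simp only: mem_Collect_eq)
  qed
  then have "emeasure P (\<Inter> (E ` J)) = (\<Prod>k<n. emeasure (comp_law k) (A' k))"
    using emeasure_components[OF A'] by simp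
  also have "\<dots> = (\<Prod>k\<in>I. emeasure (comp_law k) (A' k))"
    by (rule prod.mono_neutral_right) (auto simp: I_def A'_def emeasure_comp_law_UNIV)
  also have "\<dots> = (\<Prod>k\<in>I. emeasure P (E (Suc k)))"
  proof (rule prod.cong[OF refl])
    fix k assume "k \<in> I"
    then have "Suc k \<in> J" by (simp add: I_def)
    then show "emeasure (comp_law k) (A' k) = emeasure P (E (Suc k))"
      using A[of "Suc k"] emeasure_component[of "A (Suc k)" k] by (simp add: A'_def)
  qed
  also have "\<dots> = (\<Prod>j\<in>J. emeasure P (E j))" unfolding JI by (subst prod.reindex) (auto simp: comp_def)
  finally show "P.prob (\<Inter> (E ` J)) = (\<Prod>j\<in>J. P.prob (E j))"
    by (simp add: P.emeasure_eq_measure prod_ennreal prod_nonneg)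
qed

lemma indep_components: "P.indep_vars (\<lambda>_. seq_space) component {1..}"
  by (rule P.indep_vars_def2[THEN iffD2]) (use indep_component_sets measurable_component_P in blast)

lemma corollary13_holds:
  "(AE \<eta> in B. \<eta> \<in> good_configs) \<and> prob_space P \<and> alpha \<in> params_plus \<and>
    P.indep_vars (\<lambda>_. count_space UNIV) (\<lambda>i \<eta>. excursion \<eta> i) UNIV \<and>
    (\<forall>i. distr P (count_space UNIV) (\<lambda>\<eta>. excursion \<eta> i) = exc_law alpha) \<and>
    P.indep_vars (\<lambda>_. seq_space) component {1..} \<and>
    (\<forall>k\<ge>1. 0 \<le> q alpha k \<and> q alpha k < 1 \<and>
      P.indep_vars (\<lambda>_. count_space UNIV) (\<lambda>j \<eta>. component k \<eta> j) UNIV \<and>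
      (\<forall>j. distr P (count_space UNIV) (\<lambda>\<eta>. component k \<eta> j) = measure_pmf (geom (q alpha k)))) \<and>
    bbs_invariant B"
proof (intro conjI allI impI)
  fix k :: nat assume "1 \<le> k"
  then obtain m where k: "k = Suc m" by (cases k) auto
  show "0 \<le> q alpha k" "q alpha k < 1" using q_bounds[OF law_word_pmf] k by auto
  note iid = P.iid_of_distr_PiM[OF measurable_component_P distr_component[of m]]
  show "P.indep_vars (\<lambda>_. count_space UNIV) (\<lambda>j \<eta>. component k \<eta> j) UNIV" unfolding k by (rule iid(1))
  show "distr P (count_space UNIV) (\<lambda>\<eta>. component k \<eta> j) = measure_pmf (geom (q alpha k))" for j
    unfolding k by (rule iid(2))
qed (rule AE_good prob_space_P alpha_params_plus indep_excursions law_excursion indep_components bbs_invariant_B)+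

end

theorem corollary13:
  fixes lam :: real and alpha :: "nat \<Rightarrow> real"
  assumes "0 \<le> lam" and "lam < 1 / 2"
    and "\<And>k. 1 \<le> k \<Longrightarrow> alpha k = (lam * (1 - lam)) ^ k"
  shows "(AE \<eta> in bernoulli_config lam. \<eta> \<in> good_configs) \<and>
    prob_space (palm (bernoulli_config lam)) \<and>
    alpha \<in> params_plus \<and>
    prob_space.indep_vars (palm (bernoulli_config lam)) (\<lambda>_. count_space UNIV)
      (\<lambda>i \<eta>. excursion \<eta> i) UNIV \<and>
    (\<forall>i. distr (palm (bernoulli_config lam)) (count_space UNIV) (\<lambda>\<eta>. excursion \<eta> i)
        = exc_law alpha) \<and>
    prob_space.indep_vars (palm (bernoulli_config lam))
      (\<lambda>_. Pi\<^sub>M UNIV (\<lambda>_::int. count_space UNIV)) component {1..} \<and>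
    (\<forall>k\<ge>1. 0 \<le> q alpha k \<and> q alpha k < 1 \<and>
      prob_space.indep_vars (palm (bernoulli_config lam)) (\<lambda>_. count_space UNIV)
        (\<lambda>j \<eta>. component k \<eta> j) UNIV \<and>
      (\<forall>j. distr (palm (bernoulli_config lam)) (count_space UNIV) (\<lambda>\<eta>. component k \<eta> j)
        = measure_pmf (geometric_pmf (1 - q alpha k)))) \<and>
    bbs_invariant (bernoulli_config lam)"
proof -
  interpret soliton_density lam alpha by standard (use assms in auto)
  show ?thesis by (rule corollary13_holds)
qed

end
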